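(* Suppose that, in addition to the standing assumptions listed in the context, the following hold: (1) $\Omega_1=\Omega_2=:\Omega_*$ (so that $d_1=d_2=:d_*$); (2) $\mu_2^{\mathrm d}\ll\lambda_*$, where $\lambda_*:=\lambda_1=\lambda_2$; (3) $c_{\mathrm d}(x_1,x_2)=h(x_1-x_2)$ with a function $h:\mathbb R^{d_*}\to\mathbb R$ that is strictly convex and even symmetric, i.e. $h(-\xi)=h(\xi)$ for all $\xi\in\mathbb R^{d_*}$; (4) $\mathcal J$ is upper semicontinuous with respect to weak-$*$ convergence in the first variable, i.e. if $\pi_n\rightharpoonup^*\pi$ in $\mathfrak M(\Omega)$, then $\limsup_{n\to\infty}\mathcal J(\pi_n,\mu_1)\le\mathcal J(\pi,\mu_1)$ for every $\mu_1\in\mathfrak M(\Omega_1)$; (5) the sequences $\gamma_n\searrow0$, $\delta_n\searrow 0$ of positive numbers satisfy $0<\delta_n\le\rho$ for all $n\in\mathbb N$ and $\gamma_n/\delta_n^{d}\to0$ as $n\to\infty$. Let $\{(\bar\pi_n,\bar\mu_1^n,\bar c_n)\}_{n\in\mathbb N}$ be a sequence such that $(\bar\pi_n,\bar\mu_1^n,\bar c_n)$ is a (globally optimal) solution of $(\mathrm{BK}_n)$ for every $n$. Then, up to subsequences, this sequence converges to an optimal solution of $(\mathrm{BK})$; that is, there are a subsequence (denoted by the same symbol) and an optimal solution $(\bar\pi,\bar\mu_1)$ of $(\mathrm{BK})$ such that $(\bar\pi_n,\bar\mu_1^n)\rightharpoonup^*(\bar\pi,\bar\mu_1)$ in $\mathfrak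 M(\Omega)\times\mathfrak M(\Omega_1)$ and $\bar c_n\to c_{\mathrm d}$ in $W^{1,p}(\Omega)$.
   Context: Domains. $d_1,d_2\in\mathbb N$; $\Omega_i\subset\mathbb R^{d_i}$ ($i=1,2$) are compact with non-empty interior; $\Omega:=\Omega_1\times\Omega_2$ coincides with the closure of its interior and has a Lipschitz boundary; $d:=d_1+d_2$. $\lambda_i$ and $\lambda=\lambda_1\otimes\lambda_2$ are the Lebesgue measures on $\Omega_i$ and $\Omega$; $|\Omega_i|:=\lambda_i(\Omega_i)$. $W^{1,p}(\Omega)$ denotes the Sobolev space on the interior of $\Omega$. Measures. For compact $X$, $\mathfrak M(X)$ is the space of signed regular Borel measures with the total variation norm, identified with the dual of $C(X)$; $\rightharpoonup^*$ denotes weak-$*$ convergence. $\mathfrak P(\Omega_i)$ is the set of probability measures in $\mathfrak M(\Omega_i)$. $P_i:\Omega_1\times\Omega_2\to\Omega_i$ is the coordinate projection, ${P_i}_\#\pi=\pi\circ P_i^{-1}$, and $\Pi(\mu_1,\mu_2):=\{\pi\in\mathfrak M(\Omega):{P_1}_\#\pi=\mu_1,\ {P_2}_\#\pi=\mu_2\}$ (elements need not be non-negative). A non-negative $L^2(\Omega)$-function is identified with the measure having it as Lebesgue density. Data. $\rho>0$ is fixed; $\mu_2^{\mathrm d}\in\mathfrak P(\Omega_2)$ satisfies $\mathrm{dist}(\mathrm{supp}(\mu_2^{\mathrm d}),\partial\Omega_2)\ge\rho$; $c_{\mathrm d}\in W^{1,p}(\Omega)$ with $p>d$ (with its continuous representative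 on $\Omega$). $\mathcal J:\mathfrak M(\Omega)\times\mathfrak M(\Omega_1)\to\mathbb R$ is lower semicontinuous with respect to weak-$*$ convergence and bounded on bounded sets, i.e. $\sup\{|\mathcal J(\pi,\mu_1)|:\|(\pi,\mu_1)\|\le M\}<\infty$ for every $M>0$. Bilevel problem $(\mathrm{BK})$: minimize $\mathcal J(\pi,\mu_1)$ over all $(\pi,\mu_1)$ with $\mu_1\in\mathfrak P(\Omega_1)$, $\mathrm{dist}(\mathrm{supp}(\mu_1),\partial\Omega_1)\ge\rho$, and $\pi\in\arg\min\{\int_\Omega c_{\mathrm d}\,d\varphi:\varphi\in\Pi(\mu_1,\mu_2^{\mathrm d}),\ \varphi\ge0\}$. It is assumed that $\rho$ is such that the feasible set of $(\mathrm{BK})$ is non-empty. Regularized lower level. For $\gamma>0$, $c\in L^2(\Omega)$ and $\lambda_i$-a.e. non-negative $\mu_i\in L^2(\Omega_i)$ with $\|\mu_1\|_{L^1(\Omega_1)}=\|\mu_2\|_{L^1(\Omega_2)}$, $\mathcal S_\gamma(c,\mu_1,\mu_2)\in L^2(\Omega)$ is the unique minimizer of $\int_\Omega c\,\pi\,d\lambda+\frac\gamma2\|\pi\|_{L^2(\Omega)}^2$ over all $\pi\in L^2(\Omega)$ with $\pi\ge0$ a.e., $\int_{\Omega_2}\pi(x_1,x_2)\,d\lambda_2(x_2)=\mu_1(x_1)$ for a.e. $x_1\in\Omega_1$, $\int_{\Omega_1}\pi(x_1,x_2)\,d\lambda_1(x_1)=\mu_2(x_2)$ for a.e. $x_2\in\Omega_2$.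 (Existence and uniqueness are known.) Smoothing. For $\delta>0$, $\mathcal T_i^\delta(\mu_i):=\varphi_i^\delta*\mu_i+\frac{\delta}{|\Omega_i|}\in L^2(\Omega_i)$ for $\mu_i\in\mathfrak M(\Omega_i)$, where $\varphi_i^\delta\in C_c^\infty(\mathbb R^{d_i})$ is the (symmetric, non-negative, rescaled) standard mollifier with $\|\varphi_i^\delta\|_{L^1}=1$ and support in $\overline{B(0,\delta)}$. Regularized bilevel problem $(\mathrm{BK}_\gamma^\delta)$, for $\gamma>0$, $\delta\in(0,\rho]$: minimize $\mathcal J_\gamma(\pi_\gamma,\mu_1,c):=\mathcal J(\pi_\gamma,\mu_1)+\frac1{p\gamma}\|c-c_{\mathrm d}\|_{W^{1,p}(\Omega)}^p$ over all $(\pi_\gamma,\mu_1,c)$ with $c\in W^{1,p}(\Omega)$, $\mu_1\in\mathfrak P(\Omega_1)$, $\mathrm{dist}(\mathrm{supp}(\mu_1),\partial\Omega_1)\ge\rho$, $\pi_\gamma=\mathcal S_\gamma(c,\mathcal T_1^\delta(\mu_1),\mathcal T_2^\delta(\mu_2^{\mathrm d}))$. $(\mathrm{BK}_n)$ denotes $(\mathrm{BK}_{\gamma_n}^{\delta_n})$. *)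

theory Defs
  imports "HOL-Analysis.Analysis"
begin

section \<open>Signed regular Borel measures\<close>

text \<open>
  A signed measure on \<open>X\<close> is a countably additive set function on the Borel sets of the ambient
  space that is concentrated on \<open>X\<close>. Its value on non-Borel sets is 0 by convention, so that equality
  of set functions is equality of measures. The last condition is regularity.
\<close>

type_synonym 'a smeas = "'a set \<Rightarrow> real"

definition variation :: "'a::topological_space smeas \<Rightarrow> 'a set \<Rightarrow> ennreal" where
  "variation \<nu> A =
     (SUP P \<in> {P. finite P \<and> disjoint P \<and> P \<subseteq> sets borel \<and> \<Union>P \<subseteq> A}. \<Sum>B\<in>P. ennreal \<bar>\<nu> B\<bar>)"

definition signed_measures :: "'a::topological_space set \<Rightarrow> 'a smeas set" where
  "signed_measures X = {\<nu>.
     (\<forall>A. A \<notin> sets borel \<longrightarrow> \<nu> A = 0) \<and>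
     (\<forall>A\<in>sets borel. \<nu> A = \<nu> (A \<inter> X)) \<and>
     (\<forall>A :: nat \<Rightarrow> 'a set. range A \<subseteq> sets borel \<longrightarrow> disjoint_family A \<longrightarrow>
        (\<lambda>n. \<nu> (A n)) sums \<nu> (\<Union>n. A n)) \<and>
     (\<forall>A\<in>sets borel. \<forall>e>0. \<exists>K U. compact K \<and> open U \<and> K \<subseteq> A \<and> A \<subseteq> U \<and>
        variation \<nu> (U - K) < ennreal e)}"

definition nonneg_smeas :: "'a smeas \<Rightarrow> bool" where
  "nonneg_smeas \<nu> \<longleftrightarrow> (\<forall>A. 0 \<le> \<nu> A)"

definition prob_measures :: "'a::topological_space set \<Rightarrow> 'a smeas set" where
  "prob_measures X = {\<nu> \<in> signed_measures X. nonneg_smeas \<nu> \<and> \<nu> X = 1}"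

definition supp :: "'a::topological_space smeas \<Rightarrow> 'a set" where
  "supp \<nu> = {x. \<forall>U. open U \<longrightarrow> x \<in> U \<longrightarrow> 0 < variation \<nu> U}"

text \<open>
  Jordan decomposition. Since \<open>ennreal\<close> maps negative reals to 0, \<open>pos_part \<nu>\<close> assigns to \<open>A\<close>
  the supremum of \<open>\<nu> B\<close> over the Borel sets \<open>B \<subseteq> A\<close>.
\<close>

definition pos_part :: "'a::topological_space smeas \<Rightarrow> 'a measure" where
  "pos_part \<nu> = measure_of UNIV (sets borel) (\<lambda>A. SUP B \<in> {B \<in> sets borel. B \<subseteq> A}. ennreal (\<nu> B))"

definition neg_part :: "'a::topological_space smeas \<Rightarrow> 'a measure" where
  "neg_part \<nu> = pos_part (\<lambda>A. - \<nu> A)"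

definition sm_integral :: "'a::topological_space set \<Rightarrow> 'a smeas \<Rightarrow> ('a \<Rightarrow> real) \<Rightarrow> real" where
  "sm_integral X \<nu> f = (LINT x:X|pos_part \<nu>. f x) - (LINT x:X|neg_part \<nu>. f x)"

definition weak_star_tendsto ::
  "'a::topological_space set \<Rightarrow> (nat \<Rightarrow> 'a smeas) \<Rightarrow> 'a smeas \<Rightarrow> bool" where
  "weak_star_tendsto X \<nu>s \<nu> \<longleftrightarrow>
     (\<forall>f. continuous_on X f \<longrightarrow> (\<lambda>n. sm_integral X (\<nu>s n) f) \<longlonglongrightarrow> sm_integral X \<nu> f)"

definition pushforward ::
  "'a set \<Rightarrow> ('a \<Rightarrow> 'b::topological_space) \<Rightarrow> 'a smeas \<Rightarrow> 'b smeas" where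
  "pushforward X f \<nu> A = (if A \<in> sets borel then \<nu> (f -` A \<inter> X) else 0)"

definition abs_cont_lebesgue :: "'a::euclidean_space set \<Rightarrow> 'a smeas \<Rightarrow> bool" where
  "abs_cont_lebesgue X \<nu> \<longleftrightarrow>
     (\<forall>A\<in>sets borel. A \<subseteq> X \<longrightarrow> emeasure (lebesgue_on X) A = 0 \<longrightarrow> \<nu> A = 0)"

text \<open>The identification of an integrable function on \<open>X\<close> with the measure it is the density of.\<close>

definition density_smeas :: "'a::euclidean_space set \<Rightarrow> ('a \<Rightarrow> real) \<Rightarrow> 'a smeas" where
  "density_smeas X f A = (if A \<in> sets borel then (LINT x:A|lebesgue_on X. f x) else 0)"

section \<open>Function spaces\<close>

text \<open>Elements of Lebesgue and Sobolev spaces are represented by functions; nothing below depends on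
  the choice of the representative.\<close>

definition Lp_on :: "real \<Rightarrow> 'a::euclidean_space set \<Rightarrow> ('a \<Rightarrow> real) \<Rightarrow> bool" where
  "Lp_on p S f \<longleftrightarrow> f \<in> borel_measurable (lebesgue_on S) \<and>
     integrable (lebesgue_on S) (\<lambda>x. \<bar>f x\<bar> powr p)"

primrec times_cont_diff :: "nat \<Rightarrow> ('a::euclidean_space \<Rightarrow> real) \<Rightarrow> bool" where
  "times_cont_diff 0 f \<longleftrightarrow> continuous_on UNIV f"
| "times_cont_diff (Suc k) f \<longleftrightarrow> (\<forall>x. f differentiable (at x)) \<and>
     (\<forall>b\<in>Basis. times_cont_diff k (\<lambda>x. frechet_derivative f (at x) b))"

definition test_function :: "'a::euclidean_space set \<Rightarrow> ('a \<Rightarrow> real) \<Rightarrow> bool" where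
  "test_function U \<phi> \<longleftrightarrow> (\<forall>k. times_cont_diff k \<phi>) \<and>
     compact (closure {x. \<phi> x \<noteq> 0}) \<and> closure {x. \<phi> x \<noteq> 0} \<subseteq> U"

definition locally_integrable :: "'a::euclidean_space set \<Rightarrow> ('a \<Rightarrow> real) \<Rightarrow> bool" where
  "locally_integrable U f \<longleftrightarrow> (\<forall>K. compact K \<longrightarrow> K \<subseteq> U \<longrightarrow> integrable (lebesgue_on K) f)"

definition weak_gradient ::
  "'a::euclidean_space set \<Rightarrow> ('a \<Rightarrow> real) \<Rightarrow> ('a \<Rightarrow> 'a) \<Rightarrow> bool" where
  "weak_gradient U u G \<longleftrightarrow> locally_integrable U u \<and>
     (\<forall>b\<in>Basis. locally_integrable U (\<lambda>x. G x \<bullet> b) \<and>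
        (\<forall>\<phi>. test_function U \<phi> \<longrightarrow>
           (LINT x|lebesgue_on U. u x * frechet_derivative \<phi> (at x) b)
             = - (LINT x|lebesgue_on U. (G x \<bullet> b) * \<phi> x)))"

definition sobolev_W1 :: "real \<Rightarrow> 'a::euclidean_space set \<Rightarrow> ('a \<Rightarrow> real) \<Rightarrow> bool" where
  "sobolev_W1 p U u \<longleftrightarrow> Lp_on p U u \<and>
     (\<exists>G. weak_gradient U u G \<and> (\<forall>b\<in>Basis. Lp_on p U (\<lambda>x. G x \<bullet> b)))"

text \<open>Weak gradients are unique almost everywhere, so the choice of \<open>G\<close> is immaterial.\<close>

definition W1_norm :: "real \<Rightarrow> 'a::euclidean_space set \<Rightarrow> ('a \<Rightarrow> real) \<Rightarrow> real" where
  "W1_norm p U u = (let G = (SOME G. weak_gradient U u G) in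
     ((LINT x|lebesgue_on U. \<bar>u x\<bar> powr p)
       + (\<Sum>b\<in>Basis. LINT x|lebesgue_on U. \<bar>G x \<bullet> b\<bar> powr p)) powr (1 / p))"

section \<open>Domains, convexity, mollifier\<close>

text \<open>
  Near every boundary point the closed set \<open>S\<close> is, in suitable orthonormal coordinates with last
  axis \<open>e\<close>, the set of points on or below the graph of a Lipschitz function \<open>g\<close> on the
  hyperplane orthogonal to \<open>e\<close>.
\<close>

definition lipschitz_boundary :: "'a::euclidean_space set \<Rightarrow> bool" where
  "lipschitz_boundary S \<longleftrightarrow> (\<forall>z\<in>frontier S. \<exists>r>0. \<exists>e g L. norm e = 1 \<and>
     L-lipschitz_on {y. y \<bullet> e = 0} g \<and>
     S \<inter> ball z r = {x \<in> ball z r. x \<bullet> e \<le> g (x - (x \<bullet> e) *\<^sub>R e)})"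

definition strictly_convex :: "('a::real_vector \<Rightarrow> real) \<Rightarrow> bool" where
  "strictly_convex h \<longleftrightarrow> (\<forall>x y t. x \<noteq> y \<longrightarrow> 0 < t \<longrightarrow> t < 1 \<longrightarrow>
     h ((1 - t) *\<^sub>R x + t *\<^sub>R y) < (1 - t) * h x + t * h y)"

definition bump :: "'a::euclidean_space \<Rightarrow> real" where
  "bump x = (if norm x < 1 then exp (- 1 / (1 - (norm x)\<^sup>2)) else 0)"

definition mollifier :: "real \<Rightarrow> 'a::euclidean_space \<Rightarrow> real" where
  "mollifier \<delta> x = bump (x /\<^sub>R \<delta>) / (\<delta> ^ DIM('a) * (LINT y|lebesgue. bump (y::'a)))"

definition smoothing ::
  "'a::euclidean_space set \<Rightarrow> real \<Rightarrow> 'a smeas \<Rightarrow> 'a \<Rightarrow> real" where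
  "smoothing X \<delta> \<mu> x = sm_integral X \<mu> (\<lambda>y. mollifier \<delta> (x - y)) + \<delta> / measure lebesgue X"

section \<open>The Kantorovich problem and its quadratic regularization\<close>

definition couplings ::
  "'a::euclidean_space set \<Rightarrow> 'b::euclidean_space set \<Rightarrow> 'a smeas \<Rightarrow> 'b smeas \<Rightarrow> ('a \<times> 'b) smeas set"
  where
  "couplings \<Omega>1 \<Omega>2 \<mu>1 \<mu>2 = {\<pi> \<in> signed_measures (\<Omega>1 \<times> \<Omega>2).
     pushforward (\<Omega>1 \<times> \<Omega>2) fst \<pi> = \<mu>1 \<and> pushforward (\<Omega>1 \<times> \<Omega>2) snd \<pi> = \<mu>2}"

definition kantorovich_solution ::
  "'a::euclidean_space set \<Rightarrow> 'b::euclidean_space set \<Rightarrow> ('a \<times> 'b \<Rightarrow> real) \<Rightarrow>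
    'a smeas \<Rightarrow> 'b smeas \<Rightarrow> ('a \<times> 'b) smeas \<Rightarrow> bool" where
  "kantorovich_solution \<Omega>1 \<Omega>2 c \<mu>1 \<mu>2 =
     is_arg_min (\<lambda>\<phi>. sm_integral (\<Omega>1 \<times> \<Omega>2) \<phi> c)
       (\<lambda>\<phi>. \<phi> \<in> couplings \<Omega>1 \<Omega>2 \<mu>1 \<mu>2 \<and> nonneg_smeas \<phi>)"

definition L2_couplings ::
  "'a::euclidean_space set \<Rightarrow> 'b::euclidean_space set \<Rightarrow> ('a \<Rightarrow> real) \<Rightarrow> ('b \<Rightarrow> real) \<Rightarrow>
    ('a \<times> 'b \<Rightarrow> real) set" where
  "L2_couplings \<Omega>1 \<Omega>2 m1 m2 = {\<pi>. Lp_on 2 (\<Omega>1 \<times> \<Omega>2) \<pi> \<and>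
     (AE z in lebesgue_on (\<Omega>1 \<times> \<Omega>2). 0 \<le> \<pi> z) \<and>
     (AE x1 in lebesgue_on \<Omega>1. (LINT x2|lebesgue_on \<Omega>2. \<pi> (x1, x2)) = m1 x1) \<and>
     (AE x2 in lebesgue_on \<Omega>2. (LINT x1|lebesgue_on \<Omega>1. \<pi> (x1, x2)) = m2 x2)}"

text \<open>\<open>reg_kantorovich_solution \<Omega>1 \<Omega>2 \<gamma> c m1 m2 \<pi>\<close> says that \<open>\<pi>\<close> represents the (almost everywhere
  unique) minimizer \<open>S\<^sub>\<gamma>(c, m1, m2)\<close>.\<close>

definition reg_kantorovich_solution ::
  "'a::euclidean_space set \<Rightarrow> 'b::euclidean_space set \<Rightarrow> real \<Rightarrow> ('a \<times> 'b \<Rightarrow> real) \<Rightarrow>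
    ('a \<Rightarrow> real) \<Rightarrow> ('b \<Rightarrow> real) \<Rightarrow> ('a \<times> 'b \<Rightarrow> real) \<Rightarrow> bool" where
  "reg_kantorovich_solution \<Omega>1 \<Omega>2 \<gamma> c m1 m2 =
     is_arg_min
       (\<lambda>\<pi>. (LINT z|lebesgue_on (\<Omega>1 \<times> \<Omega>2). c z * \<pi> z)
          + \<gamma> / 2 * (LINT z|lebesgue_on (\<Omega>1 \<times> \<Omega>2). (\<pi> z)\<^sup>2))
       (\<lambda>\<pi>. \<pi> \<in> L2_couplings \<Omega>1 \<Omega>2 m1 m2)"

section \<open>The bilevel problems\<close>

definition upper_level_set :: "'a::euclidean_space set \<Rightarrow> real \<Rightarrow> 'a smeas set" where
  "upper_level_set X \<rho> = {\<mu> \<in> prob_measures X. \<rho> \<le> setdist (supp \<mu>) (frontier X)}"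

definition BK_feasible ::
  "'a::euclidean_space set \<Rightarrow> 'b::euclidean_space set \<Rightarrow> real \<Rightarrow> ('a \<times> 'b \<Rightarrow> real) \<Rightarrow> 'b smeas \<Rightarrow>
    ('a \<times> 'b) smeas \<times> 'a smeas \<Rightarrow> bool" where
  "BK_feasible \<Omega>1 \<Omega>2 \<rho> cd \<mu>2d = (\<lambda>(\<pi>, \<mu>1).
     \<mu>1 \<in> upper_level_set \<Omega>1 \<rho> \<and> kantorovich_solution \<Omega>1 \<Omega>2 cd \<mu>1 \<mu>2d \<pi>)"

definition BK_solution ::
  "(('a::euclidean_space \<times> 'b::euclidean_space) smeas \<Rightarrow> 'a smeas \<Rightarrow> real) \<Rightarrow> 'a set \<Rightarrow> 'b set \<Rightarrow>
    real \<Rightarrow> ('a \<times> 'b \<Rightarrow> real) \<Rightarrow> 'b smeas \<Rightarrow> ('a \<times> 'b) smeas \<times> 'a smeas \<Rightarrow> bool" where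
  "BK_solution J \<Omega>1 \<Omega>2 \<rho> cd \<mu>2d =
     is_arg_min (\<lambda>(\<pi>, \<mu>1). J \<pi> \<mu>1) (BK_feasible \<Omega>1 \<Omega>2 \<rho> cd \<mu>2d)"

definition BK_reg_feasible ::
  "'a::euclidean_space set \<Rightarrow> 'b::euclidean_space set \<Rightarrow> real \<Rightarrow> real \<Rightarrow> 'b smeas \<Rightarrow> real \<Rightarrow> real \<Rightarrow>
    ('a \<times> 'b \<Rightarrow> real) \<times> 'a smeas \<times> ('a \<times> 'b \<Rightarrow> real) \<Rightarrow> bool" where
  "BK_reg_feasible \<Omega>1 \<Omega>2 \<rho> p \<mu>2d \<gamma> \<delta> = (\<lambda>(\<pi>, \<mu>1, c).
     sobolev_W1 p (interior (\<Omega>1 \<times> \<Omega>2)) c \<and>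
     \<mu>1 \<in> upper_level_set \<Omega>1 \<rho> \<and>
     reg_kantorovich_solution \<Omega>1 \<Omega>2 \<gamma> c (smoothing \<Omega>1 \<delta> \<mu>1) (smoothing \<Omega>2 \<delta> \<mu>2d) \<pi>)"

definition BK_reg_solution ::
  "(('a::euclidean_space \<times> 'b::euclidean_space) smeas \<Rightarrow> 'a smeas \<Rightarrow> real) \<Rightarrow> 'a set \<Rightarrow> 'b set \<Rightarrow>
    real \<Rightarrow> real \<Rightarrow> ('a \<times> 'b \<Rightarrow> real) \<Rightarrow> 'b smeas \<Rightarrow> real \<Rightarrow> real \<Rightarrow>
    ('a \<times> 'b \<Rightarrow> real) \<times> 'a smeas \<times> ('a \<times> 'b \<Rightarrow> real) \<Rightarrow> bool" where
  "BK_reg_solution J \<Omega>1 \<Omega>2 \<rho> p cd \<mu>2d \<gamma> \<delta> =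
     is_arg_min
       (\<lambda>(\<pi>, \<mu>1, c). J (density_smeas (\<Omega>1 \<times> \<Omega>2) \<pi>) \<mu>1
          + 1 / (p * \<gamma>) * W1_norm p (interior (\<Omega>1 \<times> \<Omega>2)) (\<lambda>z. c z - cd z) powr p)
       (BK_reg_feasible \<Omega>1 \<Omega>2 \<rho> p \<mu>2d \<gamma> \<delta>)"

text \<open>Semicontinuity along weak-* convergent sequences, and boundedness on norm-bounded sets.\<close>

definition weak_star_lsc ::
  "'a::topological_space set \<Rightarrow> 'b::topological_space set \<Rightarrow> ('a smeas \<Rightarrow> 'b smeas \<Rightarrow> real) \<Rightarrow> bool" where
  "weak_star_lsc X Y J \<longleftrightarrow>
     (\<forall>\<pi>s \<pi> \<mu>s \<mu>. range \<pi>s \<subseteq> signed_measures X \<longrightarrow> \<pi> \<in> signed_measures X \<longrightarrow>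
        range \<mu>s \<subseteq> signed_measures Y \<longrightarrow> \<mu> \<in> signed_measures Y \<longrightarrow>
        weak_star_tendsto X \<pi>s \<pi> \<longrightarrow> weak_star_tendsto Y \<mu>s \<mu> \<longrightarrow>
        ereal (J \<pi> \<mu>) \<le> liminf (\<lambda>n. ereal (J (\<pi>s n) (\<mu>s n))))"

definition weak_star_usc_fst ::
  "'a::topological_space set \<Rightarrow> 'b::topological_space set \<Rightarrow> ('a smeas \<Rightarrow> 'b smeas \<Rightarrow> real) \<Rightarrow> bool" where
  "weak_star_usc_fst X Y J \<longleftrightarrow>
     (\<forall>\<pi>s \<pi> \<mu>. range \<pi>s \<subseteq> signed_measures X \<longrightarrow> \<pi> \<in> signed_measures X \<longrightarrow>
        \<mu> \<in> signed_measures Y \<longrightarrow> weak_star_tendsto X \<pi>s \<pi> \<longrightarrow>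
        limsup (\<lambda>n. ereal (J (\<pi>s n) \<mu>)) \<le> ereal (J \<pi> \<mu>))"

definition bounded_on_bounded ::
  "'a::topological_space set \<Rightarrow> 'b::topological_space set \<Rightarrow> ('a smeas \<Rightarrow> 'b smeas \<Rightarrow> real) \<Rightarrow> bool" where
  "bounded_on_bounded X Y J \<longleftrightarrow>
     (\<forall>M>0. \<exists>B. \<forall>\<pi>\<in>signed_measures X. \<forall>\<mu>\<in>signed_measures Y.
        variation \<pi> X + variation \<mu> Y \<le> ennreal M \<longrightarrow> \<bar>J \<pi> \<mu>\<bar> \<le> B)"

end

theory Submission
 imports Defs "HOL-Probability.Probability"
begin

text \<open>
 The proof compares the given solutions with one competitor and passes to the limit on both sides.

 Let \<open>(\<pi>, \<mu>)\<close> be feasible for the bilevel problem. For every \<open>n\<close> the triple that consists of the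
 regularized optimal plan for the data \<open>(cd, \<mu>)\<close>, of \<open>\<mu>\<close> and of \<open>cd\<close> is feasible for the regularized
 bilevel problem and costs nothing in the penalty. Since \<open>J\<close> is bounded on bounded sets, optimality
 of the given solutions bounds the Sobolev distance of \<open>cn\<close> and \<open>cd\<close> by a multiple of \<open>\<gamma> powr (1 / p)\<close>,
 whence the convergence of the costs. By weak-* compactness (\<open>prob_measures_compact_subseq\<close>) a
 subsequence of plans and marginals converges. If limits of regularized plans are optimal for the
 limit marginals, the limit pair is feasible, and the competitors converge along a further
 subsequence to an optimal plan for \<open>\<mu>\<close> and \<open>\<mu>2d\<close>. The hypotheses on \<open>h\<close> and \<open>\<mu>2d\<close> make the
 optimal plan unique (\<open>optimal_coupling_unique\<close>), so that this limit is \<open>\<pi>\<close> itself. Lower semicontinuity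
 along the solutions and upper semicontinuity along the competitors give
 \<open>J (limit) \<le> J \<pi> \<mu>\<close>. This is \<open>solutions_converge\<close>.

 Three facts carry the argument.

 Stability (\<open>limit_of_minimizers\<close>). A coupling of the limit marginals has to be approximated by
 couplings of the mollified marginals whose squared norms are \<open>o(1 / \<gamma>)\<close>. A partition of unity cuts the
 product into small blocks; on each block the competitor is a multiple of the product of the
 mollified marginals with the mass that the given coupling puts there (\<open>block_competitor\<close>). The
 density is then at most a constant times that product, and its squared norm is of order
 \<open>\<delta> powr (- d)\<close>, which is where the coupling of \<open>\<gamma>\<close> and \<open>\<delta>\<close> enters. The error \<open>cn - cd\<close> in the cost is
 small uniformly in the interior by Morrey's inequality, and in the \<open>p\<close>-th mean up to the boundary;
 the mollified marginals have mass at most \<open>\<delta>\<close> near the boundary (\<open>cost_error_bound\<close>).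

 Morrey's inequality in the interior (\<open>interior_sobolev_bound\<close>). Averages of a Sobolev function against
 product kernels change by a controlled amount when the scale of the kernel is halved, because the
 difference of the two kernels is the derivative of a test function. For \<open>p\<close> above the dimension the
 changes are summable over the dyadic scales, and averages at small scales control the function
 almost everywhere.

 Uniqueness (\<open>optimal_coupling_unique\<close>). Supports of optimal couplings are monotone: exchanging the
 targets of two points does not lower the cost. For a strictly convex cost the targets
 that are reached from two different points form a Lebesgue null set, so almost every target
 determines its source and thereby the coupling.
\<close>

section \<open>Weak sequential compactness of probability measures on a compact set\<close>

text \<open>
 Binary digits code a point of a bounded set of a Euclidean space by one real number, from
 which it can be recovered continuously. This reduces weak compactness on the set to Helly's
 theorem on the line.
\<close>

definition bdigit :: "nat => real => real" where
 "bdigit j t = of_int (\<lfloor>2 ^ Suc j * t\<rfloor> - 2 * \<lfloor>2 ^ j * t\<rfloor>)"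

lemma bdigit_cases: "bdigit j t = 0 \<or> bdigit j t = 1"
proof -
 let ?a = "2 ^ j * t"
 have "\<lfloor>2 ^ Suc j * t\<rfloor> = \<lfloor>2 * ?a\<rfloor>" by (simp add: algebra_simps)
 moreover have "\<lfloor>2 * ?a\<rfloor> = 2 * \<lfloor>?a\<rfloor> \<or> \<lfloor>2 * ?a\<rfloor> = 2 * \<lfloor>?a\<rfloor> + 1" by linarith
 ultimately show ?thesis unfolding bdigit_def by auto
qed

lemma bdigit_measurable [measurable]: "bdigit j \<in> borel_measurable borel"
 unfolding bdigit_def by measurable

lemma bdigit_sums:
 assumes "0 \<le> t" "t < 1"
 shows "(\<lambda>j. bdigit j t / 2 ^ Suc j) sums t"
proof -
 have part: "(\<Sum>j<n. bdigit j t / 2 ^ Suc j) = of_int \<lfloor>2 ^ n * t\<rfloor> / 2 ^ n" for n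
 proof (induction n)
  case 0
  have "\<lfloor>t\<rfloor> = 0" using assms by linarith
  then show ?case by simp
 next
  case (Suc n)
  then show ?case by (simp add: bdigit_def field_simps)
 qed
 have "(\<lambda>n. of_int \<lfloor>2 ^ n * t\<rfloor> / 2 ^ n) \<longlonglongrightarrow> t"
 proof (rule tendsto_sandwich[where f="\<lambda>n. t - (1/2) ^ n" and h="\<lambda>n. t"])
  show "\<forall>\<^sub>F n in sequentially. t - (1/2) ^ n \<le> of_int \<lfloor>2 ^ n * t\<rfloor> / 2 ^ n"
  proof (rule always_eventually, rule allI)
   fix n :: nat
   have "2 ^ n * t - 1 \<le> of_int \<lfloor>2 ^ n * t\<rfloor>" by linarith
   then have "(2 ^ n * t - 1) / 2 ^ n \<le> of_int \<lfloor>2 ^ n * t\<rfloor> / 2 ^ n" by (rule divide_right_mono) simp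
   then show "t - (1/2) ^ n \<le> of_int \<lfloor>2 ^ n * t\<rfloor> / 2 ^ n"
    by (simp add: diff_divide_distrib power_one_over)
  qed
  show "\<forall>\<^sub>F n in sequentially. of_int \<lfloor>2 ^ n * t\<rfloor> / 2 ^ n \<le> t"
  proof (rule always_eventually, rule allI)
   fix n :: nat
   have "of_int \<lfloor>2 ^ n * t\<rfloor> \<le> 2 ^ n * t" by linarith
   then show "of_int \<lfloor>2 ^ n * t\<rfloor> / 2 ^ n \<le> t" by (simp add: divide_le_eq mult.commute)
  qed
  have "(\<lambda>n. t - (1/2::real) ^ n) \<longlonglongrightarrow> t - 0"
   by (intro tendsto_intros LIMSEQ_power_zero) auto
  then show "(\<lambda>n. t - (1/2) ^ n) \<longlonglongrightarrow> t" by simp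
 qed simp
 then show ?thesis unfolding sums_def part .
qed

text \<open>
 A continuous function of period 1 that is 0 on \<open>[0, 1/12]\<close> and 1 on \<open>[1/4,
 1/3]\<close> up to integer shifts: it reads a digit in base 4.
\<close>

definition detect :: "real => real" where
 "detect t = max 0 (min 1 ((sin (2 * pi * t) - 1 / 2) / (sqrt 3 / 2 - 1 / 2)))"

lemma sqrt3_gt1: "sqrt 3 > (1::real)"
 by (simp add: real_less_rsqrt)

lemma detect_range: "0 \<le> detect t" "detect t \<le> 1"
 unfolding detect_def by auto

lemma detect_cont [continuous_intros]: "continuous_on S detect"
 unfolding detect_def using sqrt3_gt1 by (intro continuous_intros) auto

lemma detect_zero:
 assumes "0 \<le> \<tau>" "\<tau> \<le> 1 / 12" shows "detect (of_int N + \<tau>) = 0"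
proof -
 have "sin (2 * pi * (of_int N + \<tau>)) = sin (2 * pi * \<tau> + of_int N * (2 * pi))"
  by (simp add: algebra_simps)
 also have "\<dots> = sin (2 * pi * \<tau>)"
  using sin_cos_eq_iff[of "2 * pi * \<tau> + of_int N * (2 * pi)" "2 * pi * \<tau>"]
  by (metis mult.commute mult.left_commute sin_cos_eq_iff)
 also have "\<dots> \<le> sin (pi / 6)"
  using assms by (intro sin_monotone_2pi_le) (auto intro: order_trans[of _ 0] simp: field_simps)
 finally have "sin (2 * pi * (of_int N + \<tau>)) - 1/2 \<le> 0" by (simp add: sin_30)
 then have "(sin (2 * pi * (of_int N + \<tau>)) - 1 / 2) / (sqrt 3 / 2 - 1 / 2) \<le> 0"
  using sqrt3_gt1 by (intro divide_nonpos_pos) auto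
 then show ?thesis unfolding detect_def by simp
qed

lemma detect_one:
 assumes "1 / 4 \<le> \<tau>" "\<tau> \<le> 1 / 3" shows "detect (of_int N + \<tau>) = 1"
proof -
 have "sin (2 * pi * (of_int N + \<tau>)) = sin (2 * pi * \<tau> + of_int N * (2 * pi))"
  by (simp add: algebra_simps)
 also have "\<dots> = sin (2 * pi * \<tau>)"
  by (metis mult.commute mult.left_commute sin_cos_eq_iff)
 also have "\<dots> = sin (pi - 2 * pi * \<tau>)" by simp
 also have "\<dots> \<ge> sin (pi / 3)"
  using assms by (intro sin_monotone_2pi_le) (auto simp: field_simps)
 finally have "sin (2 * pi * (of_int N + \<tau>)) \<ge> sqrt 3 / 2" by (simp add: sin_60)
 then have "(sin (2 * pi * (of_int N + \<tau>)) - 1 / 2) / (sqrt 3 / 2 - 1 / 2) \<ge> 1"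
  using sqrt3_gt1 by (simp add: le_divide_eq)
 then show ?thesis unfolding detect_def by simp
qed

text \<open>
 Digits 0 and 1 in base 4 leave gaps, and the remainder after \<open>k\<close> digits stays in
 one of the two intervals on which \<open>detect\<close> is constant.
\<close>

lemma detect_code:
 fixes d :: "nat => real"
 assumes d: "\<And>k. d k = 0 \<or> d k = 1"
 shows "summable (\<lambda>k. d k / 4 ^ Suc k)" "detect (4 ^ k * (\<Sum>k. d k / 4 ^ Suc k)) = d k"
  "0 \<le> (\<Sum>k. d k / 4 ^ Suc k)" "(\<Sum>k. d k / 4 ^ Suc k) \<le> 1/3"
proof -
 have g: "(\<lambda>k. 1 / 4 ^ Suc k) sums (1/3::real)"
  using sums_mult[OF geometric_sums[of "1/4::real"], of "1/4"] by (simp add: power_one_over)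
 have d01: "0 \<le> d k" "d k \<le> 1" for k using d[of k] by auto
 have bnd: "summable (\<lambda>k. d (k + n) / 4 ^ Suc k) \<and> 0 \<le> (\<Sum>k. d (k + n) / 4 ^ Suc k) \<and>
   (\<Sum>k. d (k + n) / 4 ^ Suc k) \<le> 1/3" for n
 proof -
  have s: "summable (\<lambda>k. d (k + n) / 4 ^ Suc k)"
   by (rule summable_comparison_test'[OF sums_summable[OF g], of 0])
    (use d01 in \<open>auto simp: divide_right_mono\<close>)
  have "(\<Sum>k. d (k + n) / 4 ^ Suc k) \<le> (\<Sum>k. 1 / 4 ^ Suc k)"
   by (rule suminf_le[OF _ s sums_summable[OF g]]) (use d01 in \<open>auto simp: divide_right_mono\<close>)
  then show ?thesis using s sums_unique[OF g] suminf_nonneg[OF s] d01 by auto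
 qed
 show s0: "summable (\<lambda>k. d k / 4 ^ Suc k)" and "0 \<le> (\<Sum>k. d k / 4 ^ Suc k)" "(\<Sum>k. d k / 4 ^ Suc k) \<le> 1/3"
  using bnd[of 0] by auto
 define \<tau> where "\<tau> = (\<Sum>i. d (i + k) / 4 ^ Suc i)"
 have \<tau>: "\<tau> = d k / 4 + (1/4) * (\<Sum>i. d (i + Suc k) / 4 ^ Suc i)"
 proof -
  have "\<tau> = d (0 + k) / 4 ^ Suc 0 + (\<Sum>i. d (Suc i + k) / 4 ^ Suc (Suc i))"
   unfolding \<tau>_def using suminf_split_head[OF conjunct1[OF bnd[of k]]] by simp
  also have "(\<Sum>i. d (Suc i + k) / 4 ^ Suc (Suc i)) = (1/4) * (\<Sum>i. d (i + Suc k) / 4 ^ Suc i)"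
   using suminf_mult[OF conjunct1[OF bnd[of "Suc k"]], of "1/4"] by simp
  finally show ?thesis by simp
 qed
 have "\<exists>N::int. 4 ^ k * (\<Sum>i<k. d i / 4 ^ Suc i) = of_int N"
 proof (induction k)
  case 0 then show ?case by (auto intro: exI[of _ 0])
 next
  case (Suc k)
  then obtain N :: int where N: "4 ^ k * (\<Sum>i<k. d i / 4 ^ Suc i) = of_int N" by blast
  obtain e :: int where e: "d k = of_int e" using d[of k] by (metis of_int_0 of_int_1)
  have "4 ^ Suc k * (\<Sum>i<Suc k. d i / 4 ^ Suc i) = 4 * (4 ^ k * (\<Sum>i<k. d i / 4 ^ Suc i)) + d k"
   by (simp add: algebra_simps)
  also have "\<dots> = of_int (4 * N + e)" unfolding N e by simp
  finally show ?case by blast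
 qed
 then obtain N :: int where N: "4 ^ k * (\<Sum>i<k. d i / 4 ^ Suc i) = of_int N" by blast
 have "(\<Sum>k. d k / 4 ^ Suc k) = (\<Sum>i. d (i + k) / 4 ^ Suc (i + k)) + (\<Sum>i<k. d i / 4 ^ Suc i)"
  by (rule suminf_split_initial_segment[OF s0])
 also have "(\<Sum>i. d (i + k) / 4 ^ Suc (i + k)) = (1 / 4 ^ k) * \<tau>"
  unfolding \<tau>_def using suminf_mult[OF conjunct1[OF bnd[of k]], of "1/4^k"]
  by (simp add: power_add mult_ac)
 finally have eq: "4 ^ k * (\<Sum>k. d k / 4 ^ Suc k) = of_int N + \<tau>"
  using N by (simp add: algebra_simps)
 show "detect (4 ^ k * (\<Sum>k. d k / 4 ^ Suc k)) = d k"
  using d[of k]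
 proof
  assume "d k = 0"
  then show ?thesis unfolding eq using \<tau> bnd[of "Suc k"] by (subst detect_zero) auto
 next
  assume "d k = 1"
  then show ?thesis unfolding eq using \<tau> bnd[of "Suc k"] by (subst detect_one) auto
 qed
qed

text \<open>
 The coordinates are expanded in binary, their digits are interleaved and read in base 4. The
 code is only measurable, but the decoding is a uniformly convergent series of continuous
 functions.
\<close>

lemma compact_code:
 fixes X :: "'a::euclidean_space set"
 assumes "bounded X"
 obtains s :: "'a => real" and q :: "real => 'a"
 where "s \<in> borel_measurable borel" "continuous_on UNIV q"
  "\<And>x. 0 \<le> s x \<and> s x \<le> 1/3" "\<And>x. x \<in> X ==> q (s x) = x"
proof -
 obtain R where R: "R > 0" "\<And>x. x \<in> X ==> norm x < R"
  using assms unfolding bounded_pos by (metis add.commute le_add_same_cancel2 less_add_one order_le_less_trans zero_less_one add_pos_pos)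
 obtain bs :: "'a list" where bs: "set bs = Basis" "distinct bs"
  using finite_distinct_list[OF finite_Basis] by blast
 define m where "m = length bs"
 have m: "m > 0" unfolding m_def using bs(1) nonempty_Basis by fastforce
 define co where "co b x = (x \<bullet> b + R) / (2 * R)" for b x :: 'a
 define d where "d x k = bdigit (k div m) (co (bs ! (k mod m)) x)" for x k
 define s where "s x = (\<Sum>k. d x k / 4 ^ Suc k)" for x
 define F where "F i c = (\<Sum>j. detect (4 ^ (j * m + i) * c) / 2 ^ Suc j)" for i c
 define q where "q c = (\<Sum>i<m. (2 * R * F i c - R) *\<^sub>R (bs ! i))" for c
 have d01: "d x k = 0 \<or> d x k = 1" for x k unfolding d_def by (rule bdigit_cases)
 have co_meas [measurable]: "co b \<in> borel_measurable borel" for b unfolding co_def by measurable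
 have [measurable]: "(\<lambda>x. d x k) \<in> borel_measurable borel" for k unfolding d_def by measurable
 have s_meas: "s \<in> borel_measurable borel" unfolding s_def by measurable
 have g: "summable (\<lambda>k. 1 / 2 ^ Suc k :: real)"
  using summable_mult[OF summable_geometric[of "1/2::real"], of "1/2"] by (simp add: power_one_over)
 have Fcont: "continuous_on UNIV (F i)" for i
 proof -
  have "uniform_limit UNIV (\<lambda>n c. \<Sum>j<n. detect (4 ^ (j * m + i) * c) / 2 ^ Suc j) (F i) sequentially"
   unfolding F_def
   by (rule Weierstrass_m_test[OF _ g]) (use detect_range in \<open>auto simp: divide_right_mono\<close>)
  then show ?thesis
   by (rule uniform_limit_theorem[rotated])
    (auto intro!: always_eventually continuous_intros continuous_on_compose2[OF detect_cont])
 qed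
 have qcont: "continuous_on UNIV q" unfolding q_def
  by (intro continuous_intros continuous_on_compose2[OF Fcont]) auto
 have "q (s x) = x" if x: "x \<in> X" for x
 proof -
  have F: "F i (s x) = co (bs ! i) x" if i: "i < m" for i
  proof -
   have "detect (4 ^ (j * m + i) * s x) = bdigit j (co (bs ! i) x)" for j
    unfolding s_def detect_code(2)[OF d01] unfolding d_def using i by simp
   then have F: "F i (s x) = (\<Sum>j. bdigit j (co (bs ! i) x) / 2 ^ Suc j)" unfolding F_def by simp
   have "bs ! i \<in> Basis" using bs(1) i m_def nth_mem by blast
   then have "\<bar>x \<bullet> (bs ! i)\<bar> < R" using R(2)[OF x] Basis_le_norm le_less_trans by blast
   then have "0 \<le> co (bs ! i) x" "co (bs ! i) x < 1" using R(1) unfolding co_def by (auto simp: field_simps)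
   then show ?thesis unfolding F using sums_unique[OF bdigit_sums] by metis
  qed
  have "q (s x) = (\<Sum>i<m. (x \<bullet> (bs ! i)) *\<^sub>R (bs ! i))"
   unfolding q_def using R(1) F by (intro sum.cong) (auto simp: co_def)
  also have "\<dots> = (\<Sum>b\<in>Basis. (x \<bullet> b) *\<^sub>R b)"
   by (rule sum.reindex_bij_betw[where h="\<lambda>i. bs ! i"])
    (use bs m_def bij_betw_nth[of bs "{..<m}" Basis] in auto)
  finally show ?thesis by (simp add: euclidean_representation)
 qed
 moreover have "0 \<le> s x \<and> s x \<le> 1/3" for x
  unfolding s_def using detect_code(3)[of "d x"] detect_code(4)[of "d x"] d01 by simp
 ultimately show ?thesis using that s_meas qcont by blast
qed

text \<open>
 The codes of the measures live in a bounded interval, hence are tight, and a subsequence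
 converges weakly on the line. The decoding is continuous, so images under it converge weakly;
 they are the original measures.
\<close>

lemma prob_measures_compact_subseq:
 fixes X :: "'a::euclidean_space set" and M :: "nat => 'a measure"
 assumes X: "compact X" and P: "\<And>n. prob_space (M n)" and S: "\<And>n. sets (M n) = sets borel"
  and AE: "\<And>n. AE x in M n. x \<in> X"
 obtains r N where "strict_mono r" "prob_space N" "sets N = sets borel" "AE x in N. x \<in> X"
  "\<And>f::'a => real. continuous_on X f ==>
    (\<lambda>n. \<integral>x. indicator X x * f x \<partial>M (r n)) \<longlonglongrightarrow> (\<integral>x. indicator X x * f x \<partial>N)"
proof -
 have Xb [measurable]: "X \<in> sets borel" using X by (simp add: borel_compact)
 have Xne: "X \<noteq> {}"
 proof
  assume "X = {}"
  then have "AE x in M 0. False" using AE[of 0] by simp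
  then show False using prob_space.AE_const[OF P[of 0]] by simp
 qed
 obtain s :: "'a => real" and q :: "real => 'a"
 where s [measurable]: "s \<in> borel_measurable borel" and q: "continuous_on UNIV q"
  and s01: "\<And>x. 0 \<le> s x \<and> s x \<le> 1/3" and qs: "\<And>x. x \<in> X ==> q (s x) = x"
  using compact_code[OF compact_imp_bounded[OF X]] by metis
 have qm [measurable]: "q \<in> borel_measurable borel" using q by (rule borel_measurable_continuous_onI)
 have sM: "s \<in> measurable (M n) borel" for n using s S measurable_cong_sets by blast
 define M' where "M' n = distr (M n) borel s" for n
 have rd: "real_distribution (M' n)" for n
  unfolding M'_def real_distribution_def real_distribution_axioms_def
  using prob_space.prob_space_distr[OF P sM] by auto
 have "tight M'"
  unfolding tight_def
 proof (intro conjI allI impI)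
  fix e :: real assume e: "e > 0"
  have "measure (M' n) {-1<..1} = 1" for n
  proof -
   have "measure (M' n) {-1<..1} = measure (M n) (s -` {-1<..1} \<inter> space (M n))"
    unfolding M'_def by (rule measure_distr[OF sM]) simp
   also have "s -` {-1<..1} \<inter> space (M n) = space (M n)"
   proof -
    have "s x \<in> {-1<..1}" for x using s01[of x] by auto
    then show ?thesis by auto
   qed
   finally show ?thesis using prob_space.prob_space[OF P] by simp
  qed
  then show "\<exists>a b. a < b \<and> (\<forall>n. 1 - e < measure (M' n) {a<..b})"
   using e by (intro exI[of _ "-1"] exI[of _ 1]) auto
 qed (rule rd)
 then obtain r N' where r: "strict_mono (r :: nat => nat)" and N': "real_distribution N'"
  and wc: "weak_conv_m (M' \<circ> id \<circ> r) N'"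
  using tight_imp_convergent_subsubsequence[of M' id] strict_mono_id by (metis id_def)
 interpret N': real_distribution N' by (rule N')
 define N where "N = distr N' borel q"
 have PN: "prob_space N" unfolding N_def by (rule N'.prob_space_distr) simp
 have SN: "sets N = sets borel" unfolding N_def by simp
 have conv: "(\<lambda>n. \<integral>x. g x \<partial>M (r n)) \<longlonglongrightarrow> (\<integral>x. g x \<partial>N)"
  if g: "continuous_on UNIV g" and B: "\<And>x. \<bar>g x\<bar> \<le> B" for g :: "'a => real" and B
 proof -
  have gm [measurable]: "g \<in> borel_measurable borel" using g by (rule borel_measurable_continuous_onI)
  have "(\<lambda>n. \<integral>t. g (q t) \<partial>M' (r n)) \<longlonglongrightarrow> (\<integral>t. g (q t) \<partial>N')"
  proof (rule weak_conv_imp_integral_bdd_continuous_conv[where B=B])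
   show "weak_conv_m (\<lambda>n. M' (r n)) N'" using wc by (simp add: comp_def)
   show "isCont (\<lambda>t. g (q t)) x" for x
    using continuous_on_compose2[OF g q] by (simp add: continuous_on_eq_continuous_at)
  qed (use rd N' B in auto)
  moreover have "(\<integral>t. g (q t) \<partial>M' n) = (\<integral>x. g x \<partial>M n)" for n
  proof -
   have "(\<integral>t. g (q t) \<partial>M' n) = (\<integral>x. g (q (s x)) \<partial>M n)"
    unfolding M'_def by (rule integral_distr[OF sM]) simp
   also have "\<dots> = (\<integral>x. g x \<partial>M n)"
    by (rule integral_cong_AE) (use AE[of n] qs in \<open>auto simp: measurable_cong_sets[OF S refl]\<close>)
   finally show ?thesis .
  qed
  moreover have "(\<integral>t. g (q t) \<partial>N') = (\<integral>x. g x \<partial>N)"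
   unfolding N_def by (rule integral_distr[symmetric]) auto
  ultimately show ?thesis by simp
 qed
 have AEN: "AE x in N. x \<in> X"
 proof -
  define g where "g x = min 1 (infdist x X)" for x
  have gc: "continuous_on UNIV g" unfolding g_def by (intro continuous_intros)
  have gm [measurable]: "g \<in> borel_measurable borel" using gc by (rule borel_measurable_continuous_onI)
  have g0: "0 \<le> g x" "\<bar>g x\<bar> \<le> 1" for x unfolding g_def using infdist_nonneg[of x X] by auto
  have gX: "g x = 0" if "x \<in> X" for x using that by (simp add: g_def)
  have "(\<integral>x. g x \<partial>M n) = (\<integral>x. 0 \<partial>M n)" for n
   by (rule integral_cong_AE) (use AE[of n] gX in \<open>auto simp: measurable_cong_sets[OF S refl]\<close>)
  then have "(\<lambda>n. 0) \<longlonglongrightarrow> (\<integral>x. g x \<partial>N)" using conv[OF gc g0(2)] by simp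
  then have "(\<integral>x. g x \<partial>N) = 0" using LIMSEQ_unique[OF tendsto_const] by metis
  moreover have "integrable N g"
   using finite_measure.integrable_const_bound[OF prob_space.finite_measure[OF PN], of g 1] g0
   by (auto simp: measurable_cong_sets[OF SN refl])
  ultimately have "AE x in N. g x = 0" using integral_nonneg_eq_0_iff_AE[of N g] g0 by simp
  then show ?thesis
  proof (rule AE_mp, intro AE_I2 impI)
   fix x assume "g x = 0"
   then have "infdist x X = 0" unfolding g_def by (auto simp: min_def split: if_splits)
   then show "x \<in> X" using in_closed_iff_infdist_zero[OF compact_imp_closed[OF X] Xne] by blast
  qed
 qed
 show ?thesis
 proof (rule that[OF r PN SN AEN])
  fix f :: "'a => real" assume f: "continuous_on X f"
  obtain B where B: "\<And>x. x \<in> X ==> norm (f x) \<le> B"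
   using compact_imp_bounded[OF compact_continuous_image[OF f X]] unfolding bounded_iff by blast
  then have B0: "0 \<le> B" using Xne norm_ge_zero order_trans by blast
  obtain g where g: "continuous_on UNIV g" "\<And>x. x \<in> X ==> g x = f x" "\<And>x. x \<in> UNIV ==> norm (g x) \<le> B"
   using Tietze[OF f, of UNIV B] X B B0 compact_imp_closed by auto
  have gm [measurable]: "g \<in> borel_measurable borel" using g(1) by (rule borel_measurable_continuous_onI)
  have eq: "(\<integral>x. indicator X x * f x \<partial>Q) = (\<integral>x. g x \<partial>Q)" if "AE x in Q. x \<in> X" "sets Q = sets borel" for Q
  proof -
   have "(\<integral>x. indicator X x * f x \<partial>Q) = (\<integral>x. indicator X x * g x \<partial>Q)"
    by (rule Bochner_Integration.integral_cong) (auto simp: indicator_def g(2))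
   also have "\<dots> = (\<integral>x. g x \<partial>Q)"
    by (rule integral_cong_AE) (use that in \<open>auto simp: measurable_cong_sets[OF that(2) refl]\<close>)
   finally show ?thesis .
  qed
  show "(\<lambda>n. \<integral>x. indicator X x * f x \<partial>M (r n)) \<longlonglongrightarrow> (\<integral>x. indicator X x * f x \<partial>N)"
   unfolding eq[OF AE S] eq[OF AEN SN] by (rule conv[OF g(1)]) (use g(3) in auto)
 qed
qed

section \<open>Null sets and supports\<close>

text \<open>
 Infinitely many disjoint translates of a set in a bounded region leave no room for positive
 measure.
\<close>

lemma disjoint_translates_null:
 fixes A :: "'a::euclidean_space set"
 assumes A: "compact A" and w: "\<And>y t. y \<in> A ==> 0 < t ==> t \<le> 1 ==> y + t *\<^sub>R w \<notin> A"
 shows "A \<in> null_sets lborel"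
proof -
 obtain R where R: "\<And>y. y \<in> A ==> norm y \<le> R" using compact_imp_bounded[OF A] unfolding bounded_iff by blast
 define s where "s n = 1 / real (Suc n)" for n
 define T where "T n = (+) (s n *\<^sub>R w) ` A" for n
 have Am: "A \<in> lmeasurable" using A by (rule lmeasurable_compact)
 have Tm: "T n \<in> lmeasurable" "measure lebesgue (T n) = measure lebesgue A" for n
  unfolding T_def using Am by (auto simp: measurable_translation measure_translation)
 have s01: "0 < s n" "s n \<le> 1" for n unfolding s_def by auto
 have sdis: "m \<noteq> n ==> s m \<noteq> s n" for m n unfolding s_def by auto
 have disj: "T m \<inter> T n = {}" if "m \<noteq> n" for m n
 proof -
  have aux: "False" if "s i < s j" "y \<in> A" "z \<in> A" "s i *\<^sub>R w + y = s j *\<^sub>R w + z" for i j y z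
  proof -
   have "y = z + (s j - s i) *\<^sub>R w" using that(4) by (simp add: algebra_simps)
   moreover have "z + (s j - s i) *\<^sub>R w \<notin> A" using that s01[of j] s01[of i] by (intro w) auto
   ultimately show False using that by simp
  qed
  show ?thesis
  proof (rule ccontr)
   assume "T m \<inter> T n \<noteq> {}"
   then obtain y z where yz: "y \<in> A" "z \<in> A" "s m *\<^sub>R w + y = s n *\<^sub>R w + z" unfolding T_def by auto
   show False using aux[of m n y z] aux[of n m z y] yz sdis[OF that] by (auto simp: not_less_iff_gr_or_eq neq_iff)
  qed
 qed
 have "real N * measure lebesgue A \<le> measure lebesgue (cball (0::'a) (R + norm w))" for N
 proof -
  have "measure lebesgue (\<Union>n<N. T n) = (\<Sum>n<N. measure lebesgue (T n))"
  proof (rule measure_finite_Union)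
   show "T ` {..<N} \<subseteq> sets lebesgue" using Tm(1) fmeasurableD by blast
   show "disjoint_family_on T {..<N}" unfolding disjoint_family_on_def using disj by blast
   show "emeasure lebesgue (T i) \<noteq> \<infinity>" if "i \<in> {..<N}" for i using fmeasurableD2[OF Tm(1)] by simp
  qed simp
  then have "real N * measure lebesgue A = measure lebesgue (\<Union>n<N. T n)" using Tm(2) by simp
  also have "\<dots> \<le> measure lebesgue (cball (0::'a) (R + norm w))"
  proof (rule measure_mono_fmeasurable)
   show "(\<Union>n<N. T n) \<subseteq> cball 0 (R + norm w)"
   proof clarify
    fix n x assume "x \<in> T n"
    then obtain y where y: "y \<in> A" "x = s n *\<^sub>R w + y" unfolding T_def by auto
    have "norm (s n *\<^sub>R w) \<le> norm w" using s01[of n] by (simp add: mult_left_le_one_le)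
    then show "x \<in> cball 0 (R + norm w)" using norm_triangle_ineq[of "s n *\<^sub>R w" y] R[OF y(1)] y(2) by simp
   qed
  qed (use Tm in auto)
  finally show ?thesis .
 qed
 then have "\<not> 0 < measure lebesgue A"
  using reals_Archimedean3[of "measure lebesgue A"] by (meson not_le)
 then have "measure lebesgue A = 0" using measure_nonneg[of lebesgue A] by linarith
 then have "emeasure lebesgue A = 0" using emeasure_eq_measure2[OF Am] by simp
 moreover have "A \<in> sets lborel" using A by (simp add: borel_compact)
 ultimately show ?thesis by (simp add: null_sets_def)
qed

definition msupp :: "'a::topological_space measure => 'a set" where
 "msupp M = {z. \<forall>U. open U \<longrightarrow> z \<in> U \<longrightarrow> 0 < emeasure M U}"

lemma msupp_compl:
 fixes M :: "'a::second_countable_topology measure"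
 assumes "sets M = sets borel"
 shows "closed (msupp M)" "AE z in M. z \<in> msupp M"
proof -
 obtain B :: "'a set set" where B: "countable B" "topological_basis B" using ex_countable_basis by blast
 have eq: "- msupp M = \<Union>{U \<in> B. emeasure M U = 0}"
 proof (intro subset_antisym subsetI)
  fix z assume "z \<in> - msupp M"
  then obtain U where U: "open U" "z \<in> U" "emeasure M U = 0" unfolding msupp_def by (auto simp: zero_less_iff_neq_zero)
  obtain V where V: "V \<in> B" "z \<in> V" "V \<subseteq> U" using topological_basisE[OF B(2) U(1,2)] by blast
  have "emeasure M V = 0" using emeasure_mono[OF V(3), of M] U assms by (simp add: le_zero_eq)
  then show "z \<in> \<Union>{U \<in> B. emeasure M U = 0}" using V by blast
 next
  fix z assume "z \<in> \<Union>{U \<in> B. emeasure M U = 0}"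
  then show "z \<in> - msupp M" unfolding msupp_def using topological_basis_open[OF B(2)] by (force simp: zero_less_iff_neq_zero)
 qed
 have op: "open U" if "U \<in> B" for U using topological_basis_open[OF B(2) that] .
 show "closed (msupp M)" unfolding closed_def eq using op by blast
 have "(\<Union>U\<in>{U \<in> B. emeasure M U = 0}. U) \<in> null_sets M"
  by (rule null_sets_UN') (use B op assms in \<open>auto simp: null_sets_def\<close>)
 then have "- msupp M \<in> null_sets M" unfolding eq by simp
 from AE_not_in[OF this] show "AE z in M. z \<in> msupp M" by simp
qed

lemma msupp_subset:
 assumes "sets M = sets borel" "closed X" "AE z in M. z \<in> X"
 shows "msupp M \<subseteq> X"
proof (rule ccontr)
 assume "\<not> msupp M \<subseteq> X"
 then obtain z where z: "z \<in> msupp M" "z \<in> - X" by auto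
 have "emeasure M (- X) = 0"
  using assms by (subst AE_iff_measurable[symmetric, where P="\<lambda>z. z \<in> X"])
   (auto dest: sets_eq_imp_space_eq)
 then show False using z assms(2) unfolding msupp_def by (auto simp: closed_def)
qed

section \<open>Couplings and their improvement by exchanging targets\<close>

definition is_coupling ::
 "('a::euclidean_space \<times> 'b::euclidean_space) measure => 'a measure => 'b measure => bool" where
 "is_coupling M A B \<longleftrightarrow> sets M = sets borel \<and> distr M borel fst = A \<and> distr M borel snd = B"

definition optimal_coupling where
 "optimal_coupling c M A B \<longleftrightarrow> is_coupling M A B \<and>
   (\<forall>M'. is_coupling M' A B \<longrightarrow> (\<integral>z. c z \<partial>M) \<le> (\<integral>z. (c z :: real) \<partial>M'))"

lemma fst_borel [measurable]: "fst \<in> borel_measurable (borel :: ('a::second_countable_topology \<times> 'b::second_countable_topology) measure)"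
 and snd_borel [measurable]: "snd \<in> borel_measurable (borel :: ('a::second_countable_topology \<times> 'b::second_countable_topology) measure)"
 unfolding borel_prod[symmetric] by simp_all

lemma measurable_borel_sets: "sets M = sets borel ==> f \<in> borel_measurable borel ==> f \<in> borel_measurable M"
 using measurable_cong_sets by blast

lemma distr_eqI_integral:
 assumes N: "finite_measure N" "sets N = sets borel" and M: "finite_measure M" and g: "g \<in> borel_measurable M"
  and eq: "\<And>S. S \<in> sets borel ==> (\<integral>z. indicat_real S (g z) \<partial>M) = measure N S"
 shows "distr M borel g = N"
proof (rule measure_eqI)
 fix S assume "S \<in> sets (distr M borel g)"
 then have S: "S \<in> sets borel" by simp
 have s: "g -` S \<inter> space M \<in> sets M" using g S by simp
 have "measure M (g -` S \<inter> space M) = (\<integral>z. indicat_real (g -` S \<inter> space M) z \<partial>M)"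
  using s by simp
 also have "\<dots> = (\<integral>z. indicat_real S (g z) \<partial>M)"
  by (rule Bochner_Integration.integral_cong) (auto simp: indicator_def)
 finally show "emeasure (distr M borel g) S = emeasure N S"
  using eq[OF S] g S by (simp add: emeasure_distr finite_measure.emeasure_eq_measure[OF M] finite_measure.emeasure_eq_measure[OF N(1)])
qed (simp add: N)

lemma integrable_bounded_borel:
 fixes f :: "'a::topological_space => real"
 assumes "finite_measure M" "sets M = sets borel" "f \<in> borel_measurable borel" "\<And>x. \<bar>f x\<bar> \<le> B"
 shows "integrable M f"
 using assms by (intro finite_measure.integrable_const_bound[where B=B]) (auto intro: measurable_borel_sets)

text \<open>
 Draw two transport pairs independently, one from each coupling, exchange their targets whenever the
 first pair lies in \<open>U1 \<times> V1\<close> and the second in \<open>U2 \<times> V2\<close>, and keep one of the two resulting pairs by a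
 fair coin. The exchange does not change the unordered pair of targets, so the marginals survive the
 averaging, while the cost drops on a set of positive measure.
\<close>

lemma swap_improves:
 fixes c :: "'a::euclidean_space \<times> 'b::euclidean_space => real"
 assumes M: "prob_space M1" "is_coupling M1 A B" "prob_space M2" "is_coupling M2 A B" and c: "c \<in> borel_measurable borel" "\<And>z. \<bar>c z\<bar> \<le> K"
  and U: "U1 \<in> sets borel" "V1 \<in> sets borel" "U2 \<in> sets borel" "V2 \<in> sets borel"
  and pos: "0 < measure M1 (U1 \<times> V1)" "0 < measure M2 (U2 \<times> V2)"
  and b: "\<And>z. z \<in> U1 \<times> V1 ==> b1 \<le> c z" "\<And>z. z \<in> U2 \<times> V2 ==> b2 \<le> c z"
   "\<And>z. z \<in> U1 \<times> V2 ==> c z \<le> b3" "\<And>z. z \<in> U2 \<times> V1 ==> c z \<le> b4"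
  and less: "b3 + b4 < b1 + b2"
 shows "\<exists>M'. is_coupling M' A B \<and> 2 * (\<integral>z. c z \<partial>M') < (\<integral>z. c z \<partial>M1) + (\<integral>z. c z \<partial>M2)"
proof -
 interpret M1: prob_space M1 by fact
 interpret M2: prob_space M2 by fact
 interpret Q: pair_prob_space M1 M2 ..
 let ?Q = "M1 \<Otimes>\<^sub>M M2" and ?coin = "measure_pmf (bernoulli_pmf (1/2))"
 interpret coin: prob_space ?coin by (rule prob_space_measure_pmf)
 interpret R: pair_prob_space ?Q ?coin ..
 have S: "sets M1 = sets borel" "sets M2 = sets borel" and d: "distr M1 borel fst = A" "distr M1 borel snd = B" "distr M2 borel fst = A" "distr M2 borel snd = B"
  using M unfolding is_coupling_def by auto
 have SQ: "sets ?Q = sets borel" using sets_pair_measure_cong[OF S] unfolding borel_prod .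
 define W where "W = (U1 \<times> V1) \<times> (U2 \<times> V2)"
 have WQ: "W \<in> sets ?Q" "U1 \<times> V1 \<in> sets M1" "U2 \<times> V2 \<in> sets M2"
  unfolding W_def S borel_prod[symmetric] SQ using U by auto
 then have W [measurable]: "W \<in> sets borel" using SQ by simp
 define p q where "p z = (fst (fst z), if z \<in> W then snd (snd z) else snd (fst z))" and "q z = (fst (snd z), if z \<in> W then snd (fst z) else snd (snd z))" for z
 have pq [measurable]: "p \<in> borel_measurable borel" "q \<in> borel_measurable borel" unfolding p_def q_def by measurable
 define T where "T y = (if snd y then p (fst y) else q (fst y))" for y
 have pQ: "p \<in> borel_measurable ?Q" "q \<in> borel_measurable ?Q" using pq by (auto intro: measurable_borel_sets[OF SQ])
 have Tm: "T \<in> measurable (?Q \<Otimes>\<^sub>M ?coin) borel" unfolding T_def using pQ by measurable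
 define M' where "M' = distr (?Q \<Otimes>\<^sub>M ?coin) borel T"
 interpret M': prob_space M' unfolding M'_def by (rule R.P.prob_space_distr[OF Tm])
 have form: "2 * (\<integral>z. f z \<partial>M') = (\<integral>z. f (p z) + f (q z) \<partial>?Q)" if f: "f \<in> borel_measurable borel" "\<And>z. \<bar>f z\<bar> \<le> k" for f :: "'a \<times> 'b => real" and k
 proof -
  have "integrable (?Q \<Otimes>\<^sub>M ?coin) (\<lambda>y. f (T y))"
   by (rule R.P.integrable_const_bound[where B=k]) (use f measurable_compose[OF Tm f(1)] in auto)
  from R.integral_fst'[OF this] have "(\<integral>y. f (T y) \<partial>(?Q \<Otimes>\<^sub>M ?coin)) = (\<integral>z. (f (p z) + f (q z)) / 2 \<partial>?Q)"
   unfolding T_def by (simp add: add_divide_distrib)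
  then show ?thesis unfolding M'_def using integral_distr[OF Tm f(1)] by simp
 qed
 have add: "integrable ?Q (\<lambda>z. f (fst z) + f (snd z))" "(\<integral>z. f (fst z) + f (snd z) \<partial>?Q) = (\<integral>z. f z \<partial>M1) + (\<integral>z. f z \<partial>M2)"
  if f: "f \<in> borel_measurable borel" "\<And>z. \<bar>f z\<bar> \<le> k" for f :: "'a \<times> 'b => real" and k
 proof -
  have i: "integrable ?Q (\<lambda>z. f (fst z))" "integrable ?Q (\<lambda>z. f (snd z))"
   by (rule Q.P.integrable_const_bound[where B=k]; use f in \<open>auto intro!: measurable_borel_sets[OF SQ]\<close>)+
  then show "integrable ?Q (\<lambda>z. f (fst z) + f (snd z))" by simp
  show "(\<integral>z. f (fst z) + f (snd z) \<partial>?Q) = (\<integral>z. f z \<partial>M1) + (\<integral>z. f z \<partial>M2)"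
   using i Q.integral_fst'[OF i(1)] Q.integral_fst'[OF i(2)] by (simp add: M1.prob_space M2.prob_space)
 qed
 have mf: "fst \<in> borel_measurable N" "snd \<in> borel_measurable N" if "sets N = sets borel" for N :: "('a \<times> 'b) measure"
  unfolding measurable_cong_sets[OF that refl] by (rule fst_borel, rule snd_borel)
 have SM': "sets M' = sets borel" unfolding M'_def by simp
 have fin: "finite_measure A" "finite_measure B" using M1.finite_measure_distr[OF mf(1)[OF S(1)]] M1.finite_measure_distr[OF mf(2)[OF S(1)]] d by auto
 have "distr M' borel fst = A"
 proof (rule distr_eqI_integral[OF fin(1) _ M'.finite_measure_axioms mf(1)[OF SM']])
  fix E :: "'a set" assume E: "E \<in> sets borel"
  let ?f = "\<lambda>z :: 'a \<times> 'b. indicat_real E (fst z)"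
  have f: "?f \<in> borel_measurable borel" "\<And>z. \<bar>?f z\<bar> \<le> 1" using E by auto
  have "(\<integral>z. ?f z \<partial>M1) = measure A E" "(\<integral>z. ?f z \<partial>M2) = measure A E"
   using integral_distr[OF mf(1)[OF S(1)], of "indicat_real E"] integral_distr[OF mf(1)[OF S(2)], of "indicat_real E"] E d by auto
  then show "(\<integral>z. ?f z \<partial>M') = measure A E" using form[OF f] add(2)[OF f] unfolding p_def q_def by simp
 qed (use d in auto)
 moreover have "distr M' borel snd = B"
 proof (rule distr_eqI_integral[OF fin(2) _ M'.finite_measure_axioms mf(2)[OF SM']])
  fix E :: "'b set" assume E: "E \<in> sets borel"
  let ?f = "\<lambda>z :: 'a \<times> 'b. indicat_real E (snd z)"
  have f: "?f \<in> borel_measurable borel" "\<And>z. \<bar>?f z\<bar> \<le> 1" using E by auto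
  have "(\<integral>z. ?f z \<partial>M1) = measure B E" "(\<integral>z. ?f z \<partial>M2) = measure B E"
   using integral_distr[OF mf(2)[OF S(1)], of "indicat_real E"] integral_distr[OF mf(2)[OF S(2)], of "indicat_real E"] E d by auto
  moreover have "(\<lambda>z. ?f (p z) + ?f (q z)) = (\<lambda>z. ?f (fst z) + ?f (snd z))" unfolding p_def q_def by auto
  ultimately show "(\<integral>z. ?f z \<partial>M') = measure B E" using form[OF f] add(2)[OF f] by simp
 qed (use d in auto)
 moreover have "2 * (\<integral>z. c z \<partial>M') < (\<integral>z. c z \<partial>M1) + (\<integral>z. c z \<partial>M2)"
 proof -
  let ?D = "b1 + b2 - b3 - b4"
  have iW: "integrable ?Q (\<lambda>z. ?D * indicat_real W z)"
   by (rule Q.P.integrable_const_bound[where B="\<bar>?D\<bar>"]) (use WQ in \<open>auto simp: indicator_def\<close>)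
  have "c (p z) + c (q z) \<le> c (fst z) + c (snd z) - ?D * indicat_real W z" for z
  proof (cases "z \<in> W")
   case True
   then show ?thesis using b(1)[of "fst z"] b(2)[of "snd z"] b(3)[of "p z"] b(4)[of "q z"] unfolding p_def q_def W_def by auto
  qed (simp add: p_def q_def)
  moreover have cb: "\<bar>c (p z) + c (q z)\<bar> \<le> K + K" for z using c(2)[of "p z"] c(2)[of "q z"] by linarith
  have "integrable ?Q (\<lambda>z. c (p z) + c (q z))"
   by (rule Q.P.integrable_const_bound[where B="K + K"])
    (use cb measurable_compose[OF pQ(1) c(1)] measurable_compose[OF pQ(2) c(1)] in auto)
  ultimately have "(\<integral>z. c (p z) + c (q z) \<partial>?Q) \<le> (\<integral>z. c (fst z) + c (snd z) - ?D * indicat_real W z \<partial>?Q)"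
   using add(1)[OF c] iW by (intro integral_mono) auto
  also have "\<dots> = (\<integral>z. c z \<partial>M1) + (\<integral>z. c z \<partial>M2) - ?D * measure ?Q W"
   using add[OF c] iW WQ by simp
  also have "measure ?Q W = measure M1 (U1 \<times> V1) * measure M2 (U2 \<times> V2)"
   unfolding W_def using WQ by (simp add: measure_def M2.emeasure_pair_measure_Times enn2real_mult)
  finally show ?thesis using form[OF c] less mult_pos_pos[of ?D, OF _ mult_pos_pos[OF pos]] by simp
 qed
 ultimately show ?thesis unfolding is_coupling_def using SM' by blast
qed

section \<open>Uniqueness of optimal couplings for strictly convex costs\<close>

lemma strictly_convex_convex_on:
 assumes "strictly_convex h" shows "convex_on UNIV h"
proof (rule convex_onI)
 fix t x y :: _ assume t: "0 < t" "t < (1::real)"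
 show "h ((1 - t) *\<^sub>R x + t *\<^sub>R y) \<le> (1 - t) * h x + t * h y"
 proof (cases "x = y")
  case True
  then show ?thesis by (simp add: algebra_simps flip: scaleR_add_left)
 next
  case False
  then show ?thesis using assms t unfolding strictly_convex_def by (meson less_imp_le)
 qed
qed simp

text \<open>
 Otherwise the strict inequality would hold on neighbourhoods of the two points, which have
 positive measure, and \<open>swap_improves\<close> would beat the optimal value. Two different
 optimal couplings are allowed, so that the union of their supports is monotone.
\<close>

lemma optimal_support_monotone:
 fixes c :: "'a::euclidean_space \<times> 'b::euclidean_space => real"
 assumes M: "prob_space M1" "prob_space M2" and opt: "optimal_coupling c M1 A B" "optimal_coupling c M2 A B"
  and c: "continuous_on UNIV c" "\<And>z. \<bar>c z\<bar> \<le> C"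
  and z: "(x1, y1) \<in> msupp M1" "(x2, y2) \<in> msupp M2"
 shows "c (x1, y1) + c (x2, y2) \<le> c (x1, y2) + c (x2, y1)"
proof (rule ccontr)
 assume "\<not> ?thesis"
 then have D: "0 < c (x1, y1) + c (x2, y2) - c (x1, y2) - c (x2, y1)" (is "0 < ?D") by simp
 define e where "e = ?D / 5"
 have e: "0 < e" using D unfolding e_def by simp
 have co: "is_coupling M1 A B" "is_coupling M2 A B" using opt unfolding optimal_coupling_def by auto
 have nb: "\<exists>U V. open U \<and> open V \<and> x \<in> U \<and> y \<in> V \<and> (\<forall>z\<in>U \<times> V. \<bar>c z - c (x, y)\<bar> < e)" for x y
 proof -
  have "open (c -` ball (c (x, y)) e)" using c(1) open_vimage by blast
  moreover have "(x, y) \<in> c -` ball (c (x, y)) e" using e by simp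
  ultimately obtain U V where "open U" "open V" "x \<in> U" "y \<in> V" "U \<times> V \<subseteq> c -` ball (c (x, y)) e"
   by (rule open_prod_elim) auto
  then show ?thesis by (intro exI[of _ U] exI[of _ V]) (auto simp: dist_real_def abs_minus_commute subset_iff)
 qed
 obtain U11 V11 where n11: "open U11" "open V11" "x1 \<in> U11" "y1 \<in> V11" "\<And>z. z \<in> U11 \<times> V11 ==> \<bar>c z - c (x1, y1)\<bar> < e" using nb[of x1 y1] by blast
 obtain U22 V22 where n22: "open U22" "open V22" "x2 \<in> U22" "y2 \<in> V22" "\<And>z. z \<in> U22 \<times> V22 ==> \<bar>c z - c (x2, y2)\<bar> < e" using nb[of x2 y2] by blast
 obtain U12 V12 where n12: "open U12" "open V12" "x1 \<in> U12" "y2 \<in> V12" "\<And>z. z \<in> U12 \<times> V12 ==> \<bar>c z - c (x1, y2)\<bar> < e" using nb[of x1 y2] by blast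
 obtain U21 V21 where n21: "open U21" "open V21" "x2 \<in> U21" "y1 \<in> V21" "\<And>z. z \<in> U21 \<times> V21 ==> \<bar>c z - c (x2, y1)\<bar> < e" using nb[of x2 y1] by blast
 define U1 V1 U2 V2 where "U1 = U11 \<inter> U12" and "V1 = V11 \<inter> V21" and "U2 = U22 \<inter> U21" and "V2 = V22 \<inter> V12"
 have op: "open U1" "open V1" "open U2" "open V2" unfolding U1_def V1_def U2_def V2_def using n11 n22 n12 n21 by auto
 have "0 < emeasure M1 (U1 \<times> V1)" "0 < emeasure M2 (U2 \<times> V2)"
  using z op n11 n22 n12 n21 unfolding msupp_def U1_def V1_def U2_def V2_def by (auto simp: open_Times)
 then have pos: "0 < measure M1 (U1 \<times> V1)" "0 < measure M2 (U2 \<times> V2)"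
  using finite_measure.emeasure_eq_measure[OF prob_space.finite_measure[OF M(1)]] finite_measure.emeasure_eq_measure[OF prob_space.finite_measure[OF M(2)]] by auto
 have "\<exists>M'. is_coupling M' A B \<and> 2 * (\<integral>z. c z \<partial>M') < (\<integral>z. c z \<partial>M1) + (\<integral>z. c z \<partial>M2)"
 proof (rule swap_improves[OF M(1) co(1) M(2) co(2) _ c(2) _ _ _ _ pos])
  show "c \<in> borel_measurable borel" using c(1) by (rule borel_measurable_continuous_onI)
  show "c (x1, y1) - e \<le> c z" if "z \<in> U1 \<times> V1" for z
   using n11(5)[of z] that unfolding U1_def V1_def by (auto simp: abs_less_iff)
  show "c (x2, y2) - e \<le> c z" if "z \<in> U2 \<times> V2" for z
   using n22(5)[of z] that unfolding U2_def V2_def by (auto simp: abs_less_iff)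
  show "c z \<le> c (x1, y2) + e" if "z \<in> U1 \<times> V2" for z
   using n12(5)[of z] that unfolding U1_def V2_def by (auto simp: abs_less_iff)
  show "c z \<le> c (x2, y1) + e" if "z \<in> U2 \<times> V1" for z
   using n21(5)[of z] that unfolding U2_def V1_def by (auto simp: abs_less_iff)
  show "c (x1, y2) + e + (c (x2, y1) + e) < c (x1, y1) - e + (c (x2, y2) - e)"
  proof -
   have "5 * e = c (x1, y1) + c (x2, y2) - c (x1, y2) - c (x2, y1)" unfolding e_def by simp
   then show ?thesis using e by linarith
  qed
 qed (use op in auto)
 then obtain M' where "is_coupling M' A B" "2 * (\<integral>z. c z \<partial>M') < (\<integral>z. c z \<partial>M1) + (\<integral>z. c z \<partial>M2)" by blast
 moreover from this(1) have "(\<integral>z. c z \<partial>M1) \<le> (\<integral>z. c z \<partial>M')" "(\<integral>z. c z \<partial>M2) \<le> (\<integral>z. c z \<partial>M')"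
  using opt unfolding optimal_coupling_def by blast+
 ultimately show False by linarith
qed

text \<open>
 If \<open>y\<close> is reached from \<open>x \<noteq> x'\<close>, strict convexity at the
 midpoint yields a vector \<open>w\<close> and a gap between \<open>h (x - y - w) - h (x -
 y)\<close> and \<open>h (x' - y) - h (x' - y + w)\<close>. The targets that share the vector
 and the gap form a set that is disjoint from its translates along \<open>w\<close>, since
 monotonicity together with convexity along \<open>w\<close> would close the gap. Countably
 many vectors and rational gaps exhaust all targets.
\<close>

lemma multivalued_null:
 fixes h :: "'a::euclidean_space => real"
 assumes h: "strictly_convex h" and \<Gamma>: "compact \<Gamma>"
  and mono: "\<And>x1 y1 x2 y2. (x1, y1) \<in> \<Gamma> ==> (x2, y2) \<in> \<Gamma> ==>
   h (x1 - y1) + h (x2 - y2) \<le> h (x1 - y2) + h (x2 - y1)"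
 obtains N where "N \<in> null_sets lborel" "\<And>x x' y. (x, y) \<in> \<Gamma> ==> (x', y) \<in> \<Gamma> ==> y \<notin> N ==> x = x'"
proof -
 have hc: "convex_on UNIV h" using strictly_convex_convex_on[OF h] .
 have hcont: "continuous_on UNIV h" using convex_on_continuous[OF open_UNIV hc] .
 define K where "K = (\<lambda>(p, q). (fst p, fst q, snd p)) ` ((\<Gamma> \<times> \<Gamma>) \<inter> {(p, q). snd p = snd q})"
 have Kc: "compact K" unfolding K_def
 proof (rule compact_continuous_image)
  have "closed {pq :: ('a \<times> 'a) \<times> ('a \<times> 'a). snd (fst pq) = snd (snd pq)}" by (intro closed_Collect_eq continuous_intros)
  then show "compact ((\<Gamma> \<times> \<Gamma>) \<inter> {(p, q). snd p = snd q})"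
   using compact_Times[OF \<Gamma> \<Gamma>] by (intro compact_Int_closed) (auto simp: case_prod_beta')
 qed (auto intro!: continuous_intros simp: case_prod_beta')
 have K: "(x, x', y) \<in> K \<longleftrightarrow> (x, y) \<in> \<Gamma> \<and> (x', y) \<in> \<Gamma>" for x x' y
  unfolding K_def by (force simp: image_iff)
 obtain D :: "'a set" where D: "countable D" "\<And>X. open X ==> X \<noteq> {} ==> \<exists>d\<in>D. d \<in> X"
  using countable_dense_setE by blast
 define G where "G w r1 r2 = K \<inter> {(x, x', y). h (x - y - w) - h (x - y) \<le> r1 \<and> r2 \<le> h (x' - y) - h (x' - y + w)}" for w r1 r2
 define A where "A w r1 r2 = (snd \<circ> snd) ` G w r1 r2" for w r1 r2
 have Ac: "compact (A w r1 r2)" for w r1 r2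
 proof -
  have "closed {(x, x', y). h (x - y - w) - h (x - y) \<le> r1 \<and> r2 \<le> h (x' - y) - h (x' - y + w)}"
   unfolding case_prod_beta'
   by (intro closed_Collect_conj closed_Collect_le continuous_intros continuous_on_compose2[OF hcont]) auto
  then have "compact (G w r1 r2)" unfolding G_def using Kc by (rule compact_Int_closed[rotated])
  then show ?thesis unfolding A_def by (intro compact_continuous_image) (auto intro!: continuous_intros simp: comp_def)
 qed
 have An: "A w r1 r2 \<in> null_sets lborel" if r: "r1 < r2" for w r1 r2
 proof (rule disjoint_translates_null[OF Ac])
  fix y t assume y: "y \<in> A w r1 r2" and t: "0 < t" "t \<le> (1::real)"
  show "y + t *\<^sub>R w \<notin> A w r1 r2"
  proof
   assume "y + t *\<^sub>R w \<in> A w r1 r2"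
   then obtain x' where x': "(x', y + t *\<^sub>R w) \<in> \<Gamma>" "r2 \<le> h (x' - (y + t *\<^sub>R w)) - h (x' - (y + t *\<^sub>R w) + w)"
    unfolding A_def G_def using K by auto
   obtain x where x: "(x, y) \<in> \<Gamma>" "h (x - y - w) - h (x - y) \<le> r1"
    using y unfolding A_def G_def using K by auto
   define z z' where "z = x - y" and "z' = x' - (y + t *\<^sub>R w)"
   have e1: "x - (y + t *\<^sub>R w) = (1 - t) *\<^sub>R z + t *\<^sub>R (z - w)" "x' - y = (1 - t) *\<^sub>R z' + t *\<^sub>R (z' + w)"
    unfolding z_def z'_def by (simp_all add: algebra_simps)
   have "h (x - (y + t *\<^sub>R w)) \<le> (1 - t) * h z + t * h (z - w)"
    unfolding e1(1) using t by (intro convex_onD[OF hc]) auto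
   moreover have "h (x' - y) \<le> (1 - t) * h z' + t * h (z' + w)"
    unfolding e1(2) using t by (intro convex_onD[OF hc]) auto
   moreover have "h z + h z' \<le> h (x - (y + t *\<^sub>R w)) + h (x' - y)"
    using mono[OF x(1) x'(1)] unfolding z_def z'_def .
   ultimately have "0 \<le> t * (h (z - w) - h z) + t * (h (z' + w) - h z')" by (simp add: algebra_simps)
   also have "\<dots> = t * ((h (z - w) - h z) + (h (z' + w) - h z'))" by (simp add: distrib_left)
   finally have "0 \<le> (h (z - w) - h z) + (h (z' + w) - h z')" using t(1) by (simp add: zero_le_mult_iff)
   moreover have "h (z - w) - h z \<le> r1" "r2 \<le> h z' - h (z' + w)" using x(2) x'(2) unfolding z_def z'_def by auto
   ultimately show False using r by linarith
  qed
 qed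
 define N where "N = (\<Union>(w, r1, r2) \<in> D \<times> {(r1, r2). r1 \<in> \<rat> \<and> r2 \<in> \<rat> \<and> r1 < r2}. A w r1 r2)"
 have "countable (D \<times> {(r1, r2). r1 \<in> \<rat> \<and> r2 \<in> \<rat> \<and> r1 < (r2::real)})"
  by (intro countable_SIGMA D(1) countable_subset[OF _ countable_SIGMA[OF countable_rat countable_rat]]) auto
 then have Nn: "N \<in> null_sets lborel" unfolding N_def
  by (intro null_sets_UN') (auto intro: An)
 show ?thesis
 proof (rule that[OF Nn], rule ccontr)
  fix x x' y assume x: "(x, y) \<in> \<Gamma>" "(x', y) \<in> \<Gamma>" "y \<notin> N" "x \<noteq> x'"
  define z z' where "z = x - y" and "z' = x' - y"
  have zz: "z \<noteq> z'" using x unfolding z_def z'_def by simp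
  \<comment> \<open>contains half of \<open>z - z'\<close> and is open, so it meets the countable dense set \<open>D\<close>\<close>
  define W where "W = {w. h (z - w) - h z < h z' - h (z' + w)}"
  have "open W" unfolding W_def
   by (intro open_Collect_less continuous_intros continuous_on_compose2[OF hcont]) auto
  moreover have "(1/2) *\<^sub>R (z - z') \<in> W"
  proof -
   have "h ((1 - 1/2) *\<^sub>R z + (1/2) *\<^sub>R z') < (1 - 1/2) * h z + (1/2) * h z'"
    using h[unfolded strictly_convex_def, rule_format, OF zz, of "1/2"] by simp
   moreover have "z - (1/2) *\<^sub>R (z - z') = (1 - 1/2) *\<^sub>R z + (1/2) *\<^sub>R z'" "z' + (1/2) *\<^sub>R (z - z') = (1 - 1/2) *\<^sub>R z + (1/2) *\<^sub>R z'"
    by (simp_all add: algebra_simps) (simp_all flip: scaleR_add_left)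
   ultimately show ?thesis unfolding W_def by simp
  qed
  ultimately obtain w where w: "w \<in> D" "h (z - w) - h z < h z' - h (z' + w)" using D(2)[of W] unfolding W_def by blast
  obtain r1 where r1: "r1 \<in> \<rat>" "h (z - w) - h z < r1" "r1 < h z' - h (z' + w)" using Rats_dense_in_real[OF w(2)] by blast
  obtain r2 where r2: "r2 \<in> \<rat>" "r1 < r2" "r2 < h z' - h (z' + w)" using Rats_dense_in_real[OF r1(3)] by blast
  have "(x, x', y) \<in> G w r1 r2" using r1 r2 x K unfolding G_def z_def z'_def by auto
  then have "y \<in> A w r1 r2" unfolding A_def by force
  then have "y \<in> N" unfolding N_def using w r1 r2 by blast
  then show False using x by simp
 qed
qed

text \<open>
 Outside a null set of targets the union of the two supports is a graph over the second factor.
 So each coupling gives a closed set \<open>F\<close> the mass that \<open>B\<close> gives to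
 the targets of \<open>F\<close>.
\<close>

theorem optimal_coupling_unique:
 fixes c :: "'a::euclidean_space \<times> 'a => real" and h :: "'a => real"
 assumes X: "compact X" "compact Y" and A: "prob_space A" "AE x in A. x \<in> X" and B: "prob_space B" "AE y in B. y \<in> Y"
  and c: "continuous_on UNIV c" "\<And>z. \<bar>c z\<bar> \<le> C" "\<And>x y. x \<in> X ==> y \<in> Y ==> c (x, y) = h (x - y)"
  and h: "strictly_convex h"
  and ac: "\<And>N. N \<in> null_sets lborel ==> emeasure B N = 0"
  and opt: "optimal_coupling c M1 A B" "optimal_coupling c M2 A B"
 shows "M1 = M2"
proof -
 have S: "sets M1 = sets borel" "sets M2 = sets borel" and d: "distr M1 borel fst = A" "distr M2 borel fst = A"
   "distr M1 borel snd = B" "distr M2 borel snd = B"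
  using opt unfolding optimal_coupling_def is_coupling_def by auto
 have SB: "sets A = sets borel" "sets B = sets borel" using d by auto
 have mf: "fst \<in> borel_measurable M" "snd \<in> borel_measurable M" if "sets M = sets borel" for M :: "('a \<times> 'a) measure"
  unfolding measurable_cong_sets[OF that refl] by (rule fst_borel, rule snd_borel)
 have P: "prob_space M1" "prob_space M2"
  using prob_space_distrD[OF mf(1)[OF S(1)]] prob_space_distrD[OF mf(1)[OF S(2)]] A(1) unfolding d by auto
 have AEXY: "AE z in M. z \<in> X \<times> Y" if "sets M = sets borel" "distr M borel fst = A" "distr M borel snd = B" for M
 proof -
  have "AE x in distr M borel fst. x \<in> X" "AE y in distr M borel snd. y \<in> Y"
   unfolding that(2,3) using A B by auto
  moreover have "{x \<in> space borel. x \<in> X} \<in> sets borel" "{x \<in> space borel. x \<in> Y} \<in> sets borel"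
   using X by (auto simp: borel_compact)
  ultimately have "AE z in M. fst z \<in> X" "AE z in M. snd z \<in> Y"
   using AE_distr_iff[OF mf(1)[OF that(1)]] AE_distr_iff[OF mf(2)[OF that(1)]] by auto
  then show ?thesis by eventually_elim (auto simp: mem_Times_iff)
 qed
 define \<Gamma> where "\<Gamma> = msupp M1 \<union> msupp M2"
 have cl: "closed (X \<times> Y)" using X by (simp add: compact_Times compact_imp_closed)
 have \<Gamma>sub: "\<Gamma> \<subseteq> X \<times> Y" unfolding \<Gamma>_def
  using msupp_subset[OF S(1) cl AEXY[OF S(1) d(1,3)]] msupp_subset[OF S(2) cl AEXY[OF S(2) d(2,4)]] by simp
 have \<Gamma>cl: "closed \<Gamma>" unfolding \<Gamma>_def by (intro closed_Un msupp_compl(1) S)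
 have AE\<Gamma>: "AE z in M1. z \<in> \<Gamma>" "AE z in M2. z \<in> \<Gamma>"
  using msupp_compl(2)[OF S(1)] msupp_compl(2)[OF S(2)] unfolding \<Gamma>_def by (auto elim!: eventually_mono)
 have \<Gamma>c: "compact \<Gamma>" using compact_Int_closed[OF compact_Times[OF X] \<Gamma>cl] \<Gamma>sub by (simp add: Int_absorb1)
 obtain N where N: "N \<in> null_sets lborel" "\<And>x x' y. (x, y) \<in> \<Gamma> ==> (x', y) \<in> \<Gamma> ==> y \<notin> N ==> x = x'"
 proof (rule multivalued_null[OF h \<Gamma>c])
  fix x1 y1 x2 y2 assume a: "(x1, y1) \<in> \<Gamma>" "(x2, y2) \<in> \<Gamma>"
  then show "h (x1 - y1) + h (x2 - y2) \<le> h (x1 - y2) + h (x2 - y1)"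
   using optimal_support_monotone[OF P(1) P(1) opt(1) opt(1) c(1,2), of x1 y1 x2 y2] optimal_support_monotone[OF P(1) P(2) opt c(1,2), of x1 y1 x2 y2]
    optimal_support_monotone[OF P(2) P(1) opt(2) opt(1) c(1,2), of x1 y1 x2 y2] optimal_support_monotone[OF P(2) P(2) opt(2) opt(2) c(1,2), of x1 y1 x2 y2]
    \<Gamma>sub c(3) unfolding \<Gamma>_def by (auto simp: subset_iff)
 qed blast
 have Nb: "N \<in> sets borel" using N(1) by auto
 have key: "emeasure M' F = emeasure B (snd ` (F \<inter> \<Gamma>))"
  if F: "closed F" and M': "sets M' = sets borel" "distr M' borel snd = B" and AEG: "AE z in M'. z \<in> \<Gamma>" for M' F
 proof -
  have "AE y in B. y \<notin> N" using ac[OF N(1)] Nb SB by (intro AE_not_in) (auto simp: null_sets_def)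
  then have AEN: "AE z in M'. snd z \<notin> N"
   using AE_distr_iff[OF mf(2)[OF M'(1)], of "\<lambda>y. y \<notin> N"] Nb unfolding M'(2) by (auto simp: pred_def)
  define T where "T = snd ` (F \<inter> \<Gamma>)"
  have Tc: "compact T" unfolding T_def using F \<Gamma>c by (intro compact_continuous_image) (auto intro!: continuous_intros simp: closed_Int_compact)
  have Tb: "T \<in> sets borel" using Tc by (rule borel_compact)
  have sT: "snd -` T \<in> sets M'" using measurable_sets[OF mf(2)[OF M'(1)] Tb] sets_eq_imp_space_eq[OF M'(1)] by simp
  have "emeasure M' F = emeasure M' (snd -` T)"
  proof (rule emeasure_eq_AE)
   show "AE z in M'. (z \<in> F) = (z \<in> snd -` T)"
    using AEN AEG
   proof eventually_elim
    case (elim z)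
    obtain x y where z: "z = (x, y)" by (cases z)
    show ?case
    proof
     assume "z \<in> F" then show "z \<in> snd -` T" using elim unfolding T_def by auto
    next
     assume "z \<in> snd -` T"
     then obtain x' where "(x', y) \<in> F" "(x', y) \<in> \<Gamma>" unfolding T_def z by force
     then show "z \<in> F" using N(2)[of x y x'] elim z by auto
    qed
   qed
  qed (use F M' sT in auto)
  also have "\<dots> = emeasure (distr M' borel snd) T"
   using Tb mf(2)[OF M'(1)] sets_eq_imp_space_eq[OF M'(1)] by (subst emeasure_distr) auto
  finally show ?thesis unfolding M'(2) T_def .
 qed
 show ?thesis
 proof (rule measure_eqI_generator_eq[where E="Collect closed" and \<Omega>=UNIV and A="\<lambda>_. UNIV"])
  show "Int_stable (Collect (closed :: ('a \<times> 'a) set => bool))" by (auto simp: Int_stable_def)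
  show "emeasure M1 F = emeasure M2 F" if "F \<in> Collect closed" for F
   using key[of F M1] key[of F M2] that S d AE\<Gamma> by auto
  show "sets M1 = sigma_sets UNIV (Collect closed)" "sets M2 = sigma_sets UNIV (Collect closed)"
   using S unfolding borel_eq_closed by auto
  show "emeasure M1 UNIV \<noteq> \<infinity>"
   using prob_space.emeasure_space_1[OF P(1)] sets_eq_imp_space_eq[OF S(1)] by simp
 qed auto
qed

section \<open>Signed measures and their Jordan parts\<close>

definition smeas_of :: "'a::topological_space measure => 'a smeas" where
 "smeas_of M A = (if A \<in> sets borel then measure M A else 0)"

lemma signed_measuresD:
 assumes "\<nu> \<in> signed_measures X"
 shows "\<And>A. A \<notin> sets borel ==> \<nu> A = 0" "\<And>A. A \<in> sets borel ==> \<nu> A = \<nu> (A \<inter> X)"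
  "\<And>A :: nat => _ set. range A \<subseteq> sets borel ==> disjoint_family A ==> (\<lambda>n. \<nu> (A n)) sums \<nu> (\<Union>n. A n)"
proof -
 note c = assms[unfolded signed_measures_def mem_Collect_eq]
 show "\<And>A. A \<notin> sets borel ==> \<nu> A = 0" by (rule c[THEN conjunct1, rule_format])
 show "\<And>A. A \<in> sets borel ==> \<nu> A = \<nu> (A \<inter> X)" by (rule c[THEN conjunct2, THEN conjunct1, rule_format])
 show "\<And>A :: nat => _ set. range A \<subseteq> sets borel ==> disjoint_family A ==> (\<lambda>n. \<nu> (A n)) sums \<nu> (\<Union>n. A n)"
  by (rule c[THEN conjunct2, THEN conjunct2, THEN conjunct1, rule_format])
qed

text \<open>
 For a non-negative set function the supremum over subsets is attained at the set itself.
\<close>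

lemma pos_part_eq:
 fixes \<nu> :: "'a::topological_space smeas"
 assumes \<nu>: "\<nu> \<in> signed_measures X" "nonneg_smeas \<nu>" and X: "X \<in> sets borel"
 shows "sets (pos_part \<nu>) = sets borel" "\<And>A. A \<in> sets borel ==> emeasure (pos_part \<nu>) A = ennreal (\<nu> A)"
  "finite_measure (pos_part \<nu>)" "AE x in pos_part \<nu>. x \<in> X" "smeas_of (pos_part \<nu>) = \<nu>"
  "\<And>A. A \<in> sets borel ==> emeasure (neg_part \<nu>) A = 0"
proof -
 have nn: "0 \<le> \<nu> A" for A using \<nu>(2) unfolding nonneg_smeas_def by blast
 have ca: "(\<lambda>n. \<nu> (A n)) sums \<nu> (\<Union>n. A n)" if "range A \<subseteq> sets borel" "disjoint_family A" for A :: "nat => 'a set"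
  by (rule signed_measuresD(3)[OF \<nu>(1) that])
 have zero: "\<nu> {} = 0"
 proof -
  have "(\<lambda>n::nat. \<nu> {}) sums \<nu> {}" using ca[of "\<lambda>_. {}"] by (simp add: disjoint_family_on_def)
  then have "summable (\<lambda>n::nat. \<nu> {})" by (rule sums_summable)
  then show ?thesis by (simp add: summable_const_iff)
 qed
 define N where "N = measure_of UNIV (sets borel) (\<lambda>A. ennreal (\<nu> A))"
 have N: "emeasure N A = ennreal (\<nu> A)" if "A \<in> sets borel" for A
  unfolding N_def
 proof (rule emeasure_measure_of_sigma)
  show "sigma_algebra UNIV (sets (borel :: 'a measure))" using sets.sigma_algebra_axioms[of "borel :: 'a measure"] by simp
  show "positive (sets borel) (\<lambda>A. ennreal (\<nu> A))" by (simp add: positive_def zero)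
  show "countably_additive (sets borel) (\<lambda>A. ennreal (\<nu> A))"
  proof (rule countably_additiveI)
   fix A :: "nat => 'a set" assume A: "range A \<subseteq> sets borel" "disjoint_family A"
   show "(\<Sum>i. ennreal (\<nu> (A i))) = ennreal (\<nu> (\<Union>i. A i))"
    using suminf_ennreal_eq[OF nn ca[OF A]] by simp
  qed
 qed fact
 have SN: "sets N = sets borel" unfolding N_def using sets.sigma_sets_eq[of "borel :: 'a measure"] by simp
 have mono: "\<nu> B \<le> \<nu> A" if "B \<in> sets borel" "A \<in> sets borel" "B \<subseteq> A" for A B
 proof -
  have "ennreal (\<nu> B) \<le> ennreal (\<nu> A)" using emeasure_mono[OF that(3), of N] N that SN by simp
  then show ?thesis using nn by (simp add: ennreal_le_iff)
 qed
 have s1: "(SUP B \<in> {B \<in> sets borel. B \<subseteq> A}. ennreal (\<nu> B)) = ennreal (\<nu> A)" if "A \<in> sets borel" for A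
  by (rule antisym) (use that mono in \<open>auto intro!: SUP_least SUP_upper ennreal_leI\<close>)
 have PN: "pos_part \<nu> = N"
  unfolding pos_part_def N_def by (rule measure_of_eq) (use s1 sets.sigma_sets_eq[of "borel :: 'a measure"] in auto)
 have XX: "\<nu> A = \<nu> (A \<inter> X)" if "A \<in> sets borel" for A by (rule signed_measuresD(2)[OF \<nu>(1) that])
 show S: "sets (pos_part \<nu>) = sets borel" unfolding PN by (rule SN)
 show E: "emeasure (pos_part \<nu>) A = ennreal (\<nu> A)" if "A \<in> sets borel" for A unfolding PN using N[OF that] .
 have sp: "space (pos_part \<nu>) = UNIV" using sets_eq_imp_space_eq[OF S] by simp
 show "finite_measure (pos_part \<nu>)" by (rule finite_measureI) (simp add: E sp)
 have "emeasure (pos_part \<nu>) (- X) = 0" using E[of "- X"] XX[of "- X"] X zero by auto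
 then have "- X \<in> null_sets (pos_part \<nu>)" using X S by (auto simp: null_sets_def)
 from AE_not_in[OF this] show "AE x in pos_part \<nu>. x \<in> X" by simp
 show "smeas_of (pos_part \<nu>) = \<nu>"
 proof
  fix A show "smeas_of (pos_part \<nu>) A = \<nu> A"
   using E[of A] nn signed_measuresD(1)[OF \<nu>(1), of A] unfolding smeas_of_def measure_def by auto
 qed
 fix A :: "'a set" assume A: "A \<in> sets borel"
 have "(SUP B \<in> {B \<in> sets borel. B \<subseteq> A}. ennreal (- \<nu> B)) = 0" for A
  using nn by (auto simp: SUP_eq_const ennreal_neg intro!: antisym SUP_least)
 then have "neg_part \<nu> = measure_of UNIV (sets borel) (\<lambda>_. 0)" unfolding neg_part_def pos_part_def by simp
 then show "emeasure (neg_part \<nu>) A = 0" by (simp add: emeasure_sigma)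
qed

lemma sm_integral_eq:
 fixes \<nu> :: "'a::topological_space smeas"
 assumes \<nu>: "\<nu> \<in> signed_measures X" "nonneg_smeas \<nu>" and X: "X \<in> sets borel"
 shows "sm_integral X \<nu> f = (\<integral>x. indicator X x * f x \<partial>pos_part \<nu>)"
proof -
 have S: "sets (neg_part \<nu>) = sets borel" unfolding neg_part_def pos_part_def using sets.sigma_sets_eq[of "borel :: 'a measure"] by simp
 have "space (neg_part \<nu>) \<in> null_sets (neg_part \<nu>)" using pos_part_eq(6)[OF assms] S
  by (auto simp: null_sets_def)
 then have "AE x in neg_part \<nu>. indicator X x *\<^sub>R f x = 0" by (rule AE_I') auto
 then have "(LINT x:X|neg_part \<nu>. f x) = 0" unfolding set_lebesgue_integral_def by (rule integral_eq_zero_AE)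
 then show ?thesis unfolding sm_integral_def set_lebesgue_integral_def by simp
qed

lemma variation_eq:
 fixes \<nu> :: "'a::topological_space smeas"
 assumes \<nu>: "\<And>A. A \<in> sets borel ==> ennreal (\<nu> A) = emeasure M A" and nn: "\<And>A. 0 \<le> \<nu> A" and M: "sets M = sets borel" and A: "A \<in> sets borel"
 shows "variation \<nu> A = emeasure M A"
 unfolding variation_def
proof (rule antisym)
 show "(SUP P\<in>{P. finite P \<and> disjoint P \<and> P \<subseteq> sets borel \<and> \<Union> P \<subseteq> A}. \<Sum>B\<in>P. ennreal \<bar>\<nu> B\<bar>) \<le> emeasure M A"
 proof (rule SUP_least, clarify)
  fix P :: "'a set set" assume P: "finite P" "disjoint P" "P \<subseteq> sets borel" "\<Union> P \<subseteq> A"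
  have "(\<Sum>B\<in>P. ennreal \<bar>\<nu> B\<bar>) = (\<Sum>B\<in>P. emeasure M B)" using P(3) \<nu> nn by (intro sum.cong) auto
  also have "\<dots> = emeasure M (\<Union>B\<in>P. B)"
   using P M by (intro sum_emeasure) (auto simp: disjoint_def disjoint_family_on_def)
  also have "\<dots> \<le> emeasure M A" using P(4) A M by (intro emeasure_mono) auto
  finally show "(\<Sum>B\<in>P. ennreal \<bar>\<nu> B\<bar>) \<le> emeasure M A" .
 qed
 have "emeasure M A = (\<Sum>B\<in>{A}. ennreal \<bar>\<nu> B\<bar>)" using \<nu>[OF A] nn by simp
 also have "\<dots> \<le> (SUP P\<in>{P. finite P \<and> disjoint P \<and> P \<subseteq> sets borel \<and> \<Union> P \<subseteq> A}. \<Sum>B\<in>P. ennreal \<bar>\<nu> B\<bar>)"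
  using A by (intro SUP_upper) (auto simp: disjoint_def)
 finally show "emeasure M A \<le> (SUP P\<in>{P. finite P \<and> disjoint P \<and> P \<subseteq> sets borel \<and> \<Union> P \<subseteq> A}. \<Sum>B\<in>P. ennreal \<bar>\<nu> B\<bar>)" .
qed

lemma smeas_of:
 fixes M :: "'a::{second_countable_topology, complete_space} measure"
 assumes M: "finite_measure M" "sets M = sets borel" and X: "X \<in> sets borel" "AE x in M. x \<in> X"
 shows "smeas_of M \<in> signed_measures X" "nonneg_smeas (smeas_of M)" "pos_part (smeas_of M) = M"
  "\<And>A. A \<in> sets borel ==> variation (smeas_of M) A = emeasure M A"
proof -
 interpret finite_measure M by fact
 have nn: "0 \<le> smeas_of M A" for A unfolding smeas_of_def by simp
 have e: "ennreal (smeas_of M A) = emeasure M A" if "A \<in> sets borel" for A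
  unfolding smeas_of_def using that by (simp add: emeasure_eq_measure)
 show var: "variation (smeas_of M) A = emeasure M A" if "A \<in> sets borel" for A
  by (rule variation_eq[OF e nn M(2) that])
 show nonneg: "nonneg_smeas (smeas_of M)" unfolding nonneg_smeas_def using nn by blast
 have sp: "space M = UNIV" using sets_eq_imp_space_eq[OF M(2)] by simp
 show sm: "smeas_of M \<in> signed_measures X"
  unfolding signed_measures_def
 proof (intro CollectI conjI allI ballI impI)
  fix A :: "'a set" assume "A \<notin> sets borel" then show "smeas_of M A = 0" unfolding smeas_of_def by simp
 next
  fix A :: "'a set" assume A: "A \<in> sets borel"
  have "emeasure M A = emeasure M (A \<inter> X)"
   by (rule emeasure_eq_AE) (use X A M in \<open>auto elim!: eventually_mono\<close>)
  then show "smeas_of M A = smeas_of M (A \<inter> X)" using A X unfolding smeas_of_def measure_def by auto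
 next
  fix A :: "nat => 'a set" assume A: "range A \<subseteq> sets borel" "disjoint_family A"
  then have "(\<lambda>n. measure M (A n)) sums measure M (\<Union>n. A n)" using M by (intro finite_measure_UNION) auto
  moreover have "A n \<in> sets borel" "(\<Union>n. A n) \<in> sets borel" for n using A by auto
  ultimately show "(\<lambda>n. smeas_of M (A n)) sums smeas_of M (\<Union>n. A n)" unfolding smeas_of_def by simp
 next
  fix A :: "'a set" and e :: real assume A: "A \<in> sets borel" and e: "0 < e"
  have fin: "emeasure M (space M) \<noteq> \<infinity>" by simp
  have e2: "0 < ennreal (e / 2)" using e by simp
  have "\<exists>K. K \<subseteq> A \<and> compact K \<and> emeasure M A < emeasure M K + ennreal (e / 2)"
  proof (rule ccontr)
   assume "\<not> ?thesis"
   then have *: "emeasure M K + ennreal (e / 2) \<le> emeasure M A" if "K \<subseteq> A" "compact K" for K using that by (meson not_le)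
   have "emeasure M K \<le> ennreal (measure M A - e / 2)" if "K \<subseteq> A" "compact K" for K
   proof -
    have "measure M K + e / 2 \<le> measure M A" using *[OF that] e by (simp add: emeasure_eq_measure flip: ennreal_plus)
    then show ?thesis by (simp add: emeasure_eq_measure ennreal_leI)
   qed
   then have "emeasure M A \<le> ennreal (measure M A - e / 2)"
    unfolding inner_regular[OF M(2) fin A] by (intro SUP_least) auto
   then have "measure M A \<le> measure M A - e / 2 \<or> measure M A \<le> 0"
    by (cases "measure M A - e / 2 \<ge> 0") (auto simp: emeasure_eq_measure ennreal_le_iff ennreal_neg)
   then have "measure M A = 0" using e measure_nonneg[of M A] by linarith
   then show False using *[of "{}"] e by (simp add: emeasure_eq_measure)
  qed
  then obtain K where K: "K \<subseteq> A" "compact K" "emeasure M A < emeasure M K + ennreal (e / 2)" by blast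
  have "emeasure M A < emeasure M A + ennreal (e / 2)" using e by (simp add: emeasure_eq_measure ennreal_less_iff flip: ennreal_plus)
  then obtain U where U: "A \<subseteq> U" "open U" "emeasure M U < emeasure M A + ennreal (e / 2)"
   unfolding outer_regular[OF M(2) fin A] INF_less_iff by auto
  have mK: "measure M A < measure M K + e / 2" "measure M U < measure M A + e / 2"
   using K(3) U(3) e by (auto simp: emeasure_eq_measure ennreal_less_iff simp flip: ennreal_plus)
  have KU: "K \<in> sets borel" "U \<in> sets borel" using K U borel_compact by auto
  have "measure M (U - K) = measure M U - measure M K"
   using KU K U M by (intro finite_measure_Diff) auto
  then have "measure M (U - K) < e" using mK by linarith
  then have "variation (smeas_of M) (U - K) < ennreal e" using var[of "U - K"] KU by (simp add: emeasure_eq_measure ennreal_less_iff)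
  then show "\<exists>K U. compact K \<and> open U \<and> K \<subseteq> A \<and> A \<subseteq> U \<and> variation (smeas_of M) (U - K) < ennreal e" using K U by blast
 qed
 show "pos_part (smeas_of M) = M"
  by (rule measure_eqI) (use pos_part_eq(1,2)[OF sm nonneg X(1)] e M in auto)
qed

text \<open>
 In the signed sense only the part on \<open>X \<times> Y\<close> is projected; since the
 measure is concentrated there, the projections are the image measures of its Jordan part.
\<close>

lemma coupling_dictionary:
 fixes X Y :: "'a::euclidean_space set"
 assumes XY: "compact X" "compact Y" and \<mu>: "\<mu> \<in> prob_measures X" "\<nu> \<in> prob_measures Y"
 shows "\<pi> \<in> couplings X Y \<mu> \<nu> ==> nonneg_smeas \<pi> ==> is_coupling (pos_part \<pi>) (pos_part \<mu>) (pos_part \<nu>)"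
  "is_coupling M (pos_part \<mu>) (pos_part \<nu>) ==> smeas_of M \<in> couplings X Y \<mu> \<nu>"
  "is_coupling M (pos_part \<mu>) (pos_part \<nu>) ==> prob_space M \<and> sets M = sets borel \<and> (AE z in M. z \<in> X \<times> Y)"
  "prob_space (pos_part \<mu>)" "prob_space (pos_part \<nu>)"
proof -
 have Xb: "X \<in> sets borel" "Y \<in> sets borel" using XY by (auto simp: borel_compact)
 have XYb: "X \<times> Y \<in> sets borel" using compact_Times[OF XY] by (rule borel_compact)
 have m: "\<mu> \<in> signed_measures X" "nonneg_smeas \<mu>" "\<mu> X = 1" "\<nu> \<in> signed_measures Y" "nonneg_smeas \<nu>" "\<nu> Y = 1"
  using \<mu> unfolding prob_measures_def by auto
 note p\<mu> = pos_part_eq[OF m(1,2) Xb(1)] and p\<nu> = pos_part_eq[OF m(4,5) Xb(2)]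
 have uni: "\<mu> UNIV = 1" "\<nu> UNIV = 1" using m(3,6) signed_measuresD(2)[OF m(1), of UNIV] signed_measuresD(2)[OF m(4), of UNIV] by auto
 show pr: "prob_space (pos_part \<mu>)" "prob_space (pos_part \<nu>)"
  using p\<mu>(2)[of UNIV] p\<nu>(2)[of UNIV] sets_eq_imp_space_eq[OF p\<mu>(1)] sets_eq_imp_space_eq[OF p\<nu>(1)] uni
  by (auto intro!: prob_spaceI)
 have mf: "fst \<in> measurable M borel" "snd \<in> measurable M borel" if "sets M = sets borel" for M :: "('a \<times> 'a) measure"
  unfolding measurable_cong_sets[OF that refl] by (rule fst_borel, rule snd_borel)
 { assume \<pi>: "\<pi> \<in> couplings X Y \<mu> \<nu>" "nonneg_smeas \<pi>"
  have \<pi>s: "\<pi> \<in> signed_measures (X \<times> Y)" and pf: "pushforward (X \<times> Y) fst \<pi> = \<mu>" "pushforward (X \<times> Y) snd \<pi> = \<nu>"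
   using \<pi> unfolding couplings_def by auto
  note p\<pi> = pos_part_eq[OF \<pi>s \<pi>(2) XYb]
  have sp: "space (pos_part \<pi>) = UNIV" using sets_eq_imp_space_eq[OF p\<pi>(1)] by simp
  have gen: "distr (pos_part \<pi>) borel pj = pos_part \<eta>"
   if pf: "pushforward (X \<times> Y) pj \<pi> = \<eta>" and pjm: "pj \<in> measurable borel borel" and \<eta>: "sets (pos_part \<eta>) = sets borel" "\<And>A. A \<in> sets borel ==> emeasure (pos_part \<eta>) A = ennreal (\<eta> A)"
   for pj :: "'a \<times> 'a => 'a" and \<eta>
  proof (rule measure_eqI)
   fix A assume "A \<in> sets (distr (pos_part \<pi>) borel pj)"
   then have A: "A \<in> sets borel" by simp
   have pA: "pj -` A \<in> sets borel" using measurable_sets[OF pjm A] by simp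
   have "emeasure (distr (pos_part \<pi>) borel pj) A = emeasure (pos_part \<pi>) (pj -` A)"
    using A pjm sp measurable_cong_sets[OF p\<pi>(1) refl] by (subst emeasure_distr) auto
   also have "\<dots> = ennreal (\<pi> (pj -` A))" using p\<pi>(2)[OF pA] .
   also have "\<pi> (pj -` A) = \<pi> (pj -` A \<inter> (X \<times> Y))" by (rule signed_measuresD(2)[OF \<pi>s pA])
   also have "\<dots> = \<eta> A" using fun_cong[OF pf, of A] A unfolding pushforward_def by simp
   finally show "emeasure (distr (pos_part \<pi>) borel pj) A = emeasure (pos_part \<eta>) A" using \<eta>(2)[OF A] by simp
  qed (use \<eta> in simp)
  show "is_coupling (pos_part \<pi>) (pos_part \<mu>) (pos_part \<nu>)"
   unfolding is_coupling_def using gen[OF pf(1) _ p\<mu>(1,2)] gen[OF pf(2) _ p\<nu>(1,2)] p\<pi>(1) by auto }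
 { assume M: "is_coupling M (pos_part \<mu>) (pos_part \<nu>)"
  then have S: "sets M = sets borel" and d: "distr M borel fst = pos_part \<mu>" "distr M borel snd = pos_part \<nu>"
   unfolding is_coupling_def by auto
  have PM: "prob_space M" using prob_space_distrD[OF mf(1)[OF S]] pr d by auto
  have "AE x in distr M borel fst. x \<in> X" "AE y in distr M borel snd. y \<in> Y"
   unfolding d using p\<mu>(4) p\<nu>(4) by auto
  moreover have "{x \<in> space borel. x \<in> X} \<in> sets borel" "{x \<in> space borel. x \<in> Y} \<in> sets borel" using Xb by auto
  ultimately have "AE z in M. fst z \<in> X" "AE z in M. snd z \<in> Y"
   using AE_distr_iff[OF mf(1)[OF S]] AE_distr_iff[OF mf(2)[OF S]] by auto
  then have AE: "AE z in M. z \<in> X \<times> Y" by eventually_elim (auto simp: mem_Times_iff)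
  then show "prob_space M \<and> sets M = sets borel \<and> (AE z in M. z \<in> X \<times> Y)" using PM S by blast
  note sm = smeas_of[OF prob_space.finite_measure[OF PM] S XYb AE]
  have sp: "space M = UNIV" using sets_eq_imp_space_eq[OF S] by simp
  have gen: "pushforward (X \<times> Y) pj (smeas_of M) = \<eta>"
   if d: "distr M borel pj = pos_part \<eta>" and pjm: "pj \<in> measurable borel borel" and \<eta>: "smeas_of (pos_part \<eta>) = \<eta>"
   for pj :: "'a \<times> 'a => 'a" and \<eta>
  proof
   fix A :: "'a set"
   show "pushforward (X \<times> Y) pj (smeas_of M) A = \<eta> A"
   proof (cases "A \<in> sets borel")
    case True
    have pA: "pj -` A \<in> sets borel" using measurable_sets[OF pjm True] by simp
    have "pushforward (X \<times> Y) pj (smeas_of M) A = smeas_of M (pj -` A \<inter> (X \<times> Y))" unfolding pushforward_def using True by simp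
    also have "\<dots> = smeas_of M (pj -` A)" by (rule signed_measuresD(2)[OF sm(1) pA, symmetric])
    also have "\<dots> = measure M (pj -` A)" unfolding smeas_of_def using pA by simp
    also have "\<dots> = measure (distr M borel pj) A" using True pjm sp measurable_cong_sets[OF S refl] by (subst measure_distr) auto
    also have "\<dots> = smeas_of (pos_part \<eta>) A" unfolding d smeas_of_def using True by simp
    finally show ?thesis unfolding \<eta> .
   next
    case False
    then show ?thesis using fun_cong[OF \<eta>, of A] by (simp add: pushforward_def smeas_of_def)
   qed
  qed
  show "smeas_of M \<in> couplings X Y \<mu> \<nu>"
   unfolding couplings_def using sm(1) gen[OF d(1) _ p\<mu>(5)] gen[OF d(2) _ p\<nu>(5)] by auto }
qed

lemma kantorovich_dictionary:
 fixes X Y :: "'a::euclidean_space set" and c c' :: "'a \<times> 'a => real"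
 assumes XY: "compact X" "compact Y" and \<mu>: "\<mu> \<in> prob_measures X" "\<nu> \<in> prob_measures Y"
  and c': "c' \<in> borel_measurable borel" "\<And>z. z \<in> X \<times> Y ==> c' z = c z"
 shows "kantorovich_solution X Y c \<mu> \<nu> \<pi> \<longleftrightarrow>
  (\<exists>M. \<pi> = smeas_of M \<and> optimal_coupling c' M (pos_part \<mu>) (pos_part \<nu>))"
proof -
 have XYb: "X \<times> Y \<in> sets borel" using compact_Times[OF XY] by (rule borel_compact)
 note D = coupling_dictionary[OF XY \<mu>]
 have cost: "sm_integral (X \<times> Y) (smeas_of M) c = (\<integral>z. c' z \<partial>M)" if M: "is_coupling M (pos_part \<mu>) (pos_part \<nu>)" for M
 proof -
  note DM = D(3)[OF M]
  have S: "sets M = sets borel" using DM by blast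
  note sm = smeas_of[OF _ S XYb, OF prob_space.finite_measure]
  have "sm_integral (X \<times> Y) (smeas_of M) c = (\<integral>z. indicator (X \<times> Y) z * c z \<partial>M)"
   using sm_integral_eq[OF sm(1,2) XYb] sm(3) DM by auto
  also have "\<dots> = (\<integral>z. indicator (X \<times> Y) z * c' z \<partial>M)" using c'(2) by (intro Bochner_Integration.integral_cong) (auto simp: indicator_def)
  also have "\<dots> = (\<integral>z. c' z \<partial>M)"
  proof (rule integral_cong_AE)
   have "(\<lambda>z. indicat_real (X \<times> Y) z * c' z) \<in> borel_measurable borel" using c'(1) XYb by measurable
   then show "(\<lambda>z. indicat_real (X \<times> Y) z * c' z) \<in> borel_measurable M" by (rule measurable_borel_sets[OF S])
   show "c' \<in> borel_measurable M" by (rule measurable_borel_sets[OF S c'(1)])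
   have "AE z in M. z \<in> X \<times> Y" using DM by blast
   then show "AE z in M. indicat_real (X \<times> Y) z * c' z = c' z" by eventually_elim simp
  qed
  finally show ?thesis .
 qed
 have pp: "pos_part (smeas_of M) = M" "nonneg_smeas (smeas_of M)" if "is_coupling M (pos_part \<mu>) (pos_part \<nu>)" for M
  using smeas_of[OF prob_space.finite_measure _ XYb, of M] D(3)[OF that] by auto
 have recover: "\<phi> = smeas_of (pos_part \<phi>)" if "\<phi> \<in> couplings X Y \<mu> \<nu>" "nonneg_smeas \<phi>" for \<phi>
  using pos_part_eq(5)[OF _ that(2) XYb] that(1) unfolding couplings_def by auto
 show ?thesis
 proof
  assume K: "kantorovich_solution X Y c \<mu> \<nu> \<pi>"
  then have \<pi>: "\<pi> \<in> couplings X Y \<mu> \<nu>" "nonneg_smeas \<pi>"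
   and opt: "\<And>\<phi>. \<phi> \<in> couplings X Y \<mu> \<nu> ==> nonneg_smeas \<phi> ==> \<not> sm_integral (X \<times> Y) \<phi> c < sm_integral (X \<times> Y) \<pi> c"
   unfolding kantorovich_solution_def is_arg_min_def by auto
  have ic: "is_coupling (pos_part \<pi>) (pos_part \<mu>) (pos_part \<nu>)" using D(1) \<pi> by blast
  have "optimal_coupling c' (pos_part \<pi>) (pos_part \<mu>) (pos_part \<nu>)"
   unfolding optimal_coupling_def
  proof (intro conjI allI impI ic)
   fix M' assume M': "is_coupling M' (pos_part \<mu>) (pos_part \<nu>)"
   show "(\<integral>z. c' z \<partial>pos_part \<pi>) \<le> (\<integral>z. c' z \<partial>M')"
    using opt[OF D(2)[OF M'] pp(2)[OF M']] cost[OF M'] cost[OF ic] recover[OF \<pi>] by simp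
  qed
  then show "\<exists>M. \<pi> = smeas_of M \<and> optimal_coupling c' M (pos_part \<mu>) (pos_part \<nu>)" using recover[OF \<pi>] by blast
 next
  assume "\<exists>M. \<pi> = smeas_of M \<and> optimal_coupling c' M (pos_part \<mu>) (pos_part \<nu>)"
  then obtain M where M: "\<pi> = smeas_of M" "is_coupling M (pos_part \<mu>) (pos_part \<nu>)"
   and opt: "\<And>M'. is_coupling M' (pos_part \<mu>) (pos_part \<nu>) ==> (\<integral>z. c' z \<partial>M) \<le> (\<integral>z. c' z \<partial>M')" unfolding optimal_coupling_def by auto
  show "kantorovich_solution X Y c \<mu> \<nu> \<pi>"
   unfolding kantorovich_solution_def is_arg_min_def
  proof (intro conjI notI)
   show "\<pi> \<in> couplings X Y \<mu> \<nu>" "nonneg_smeas \<pi>" unfolding M(1) using D(2)[OF M(2)] pp(2)[OF M(2)] by auto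
   assume "\<exists>\<phi>. (\<phi> \<in> couplings X Y \<mu> \<nu> \<and> nonneg_smeas \<phi>) \<and> sm_integral (X \<times> Y) \<phi> c < sm_integral (X \<times> Y) \<pi> c"
   then obtain \<phi> where \<phi>: "\<phi> \<in> couplings X Y \<mu> \<nu>" "nonneg_smeas \<phi>" "sm_integral (X \<times> Y) \<phi> c < sm_integral (X \<times> Y) \<pi> c" by blast
   have ic: "is_coupling (pos_part \<phi>) (pos_part \<mu>) (pos_part \<nu>)" using D(1) \<phi> by blast
   show False using opt[OF ic] \<phi>(3) cost[OF ic] cost[OF M(2)] recover[OF \<phi>(1,2)] M(1) by simp
  qed
 qed
qed

section \<open>Smooth product functions as test functions\<close>

primrec cont_diff :: "nat => (real => real) => bool" where
 "cont_diff 0 g \<longleftrightarrow> continuous_on UNIV g"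
| "cont_diff (Suc k) g \<longleftrightarrow> (\<exists>g'. (\<forall>x. (g has_real_derivative g' x) (at x)) \<and> cont_diff k g')"

definition smooth :: "(real => real) => bool" where
 "smooth g \<longleftrightarrow> (\<forall>k. cont_diff k g)"

lemma cont_diff_Suc: "cont_diff (Suc k) g ==> cont_diff k g"
proof (induction k arbitrary: g)
 case 0
 then show ?case by (auto intro: continuous_at_imp_continuous_on DERIV_isCont)
next
 case (Suc k)
 then obtain g' where g': "\<forall>x. (g has_real_derivative g' x) (at x)" "cont_diff (Suc k) g'" by (auto simp del: cont_diff.simps(1))
 then show ?case using Suc.IH[OF g'(2)] by auto
qed

lemma cont_diff_add: "cont_diff k f ==> cont_diff k g ==> cont_diff k (\<lambda>x. f x + g x)"
proof (induction k arbitrary: f g)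
 case (Suc k)
 obtain f' g' where "\<forall>x. (f has_real_derivative f' x) (at x)" "cont_diff k f'"
   "\<forall>x. (g has_real_derivative g' x) (at x)" "cont_diff k g'" using Suc.prems by auto
 then show ?case using Suc.IH by (auto intro!: exI[of _ "\<lambda>x. f' x + g' x"] derivative_eq_intros)
qed (auto intro!: continuous_intros)

lemma cont_diff_mult: "cont_diff k f ==> cont_diff k g ==> cont_diff k (\<lambda>x. f x * g x)"
proof (induction k arbitrary: f g)
 case (Suc k)
 obtain f' g' where fg: "\<forall>x. (f has_real_derivative f' x) (at x)" "cont_diff k f'"
   "\<forall>x. (g has_real_derivative g' x) (at x)" "cont_diff k g'" using Suc.prems by auto
 have "cont_diff k (\<lambda>x. f' x * g x + f x * g' x)"
  using fg Suc.IH cont_diff_Suc[OF Suc.prems(1)] cont_diff_Suc[OF Suc.prems(2)] by (intro cont_diff_add) auto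
 then show ?case using fg by (auto intro!: exI[of _ "\<lambda>x. f' x * g x + f x * g' x"] derivative_eq_intros)
qed (auto intro!: continuous_intros)

lemma cont_diff_const: "cont_diff k (\<lambda>_. c)"
proof (induction k arbitrary: c)
 case (Suc k)
 then show ?case by (auto intro!: exI[of _ "\<lambda>_. 0"])
qed auto

lemma cont_diff_affine: "cont_diff k g ==> cont_diff k (\<lambda>x. g (a * x + b))"
proof (induction k arbitrary: g)
 case 0
 then show ?case by (auto intro!: continuous_on_compose2[of UNIV g] continuous_intros)
next
 case (Suc k)
 then obtain g' where g': "\<And>x. (g has_real_derivative g' x) (at x)" "cont_diff k g'" by auto
 have "((\<lambda>x. g (a * x + b)) has_real_derivative g' (a * x + b) * a) (at x)" for x
  by (rule DERIV_chain2[OF g'(1)]) (auto intro!: derivative_eq_intros)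
 moreover have "cont_diff k (\<lambda>x. g' (a * x + b) * a)" using Suc.IH[OF g'(2)] by (intro cont_diff_mult cont_diff_const)
 ultimately show ?case unfolding cont_diff.simps by (intro exI[of _ "\<lambda>x. g' (a * x + b) * a"]) blast
qed

lemma smooth_mult: "smooth f ==> smooth g ==> smooth (\<lambda>x. f x * g x)"
 and smooth_add: "smooth f ==> smooth g ==> smooth (\<lambda>x. f x + g x)"
 and smooth_const: "smooth (\<lambda>_. c)"
 and smooth_affine: "smooth g ==> smooth (\<lambda>x. g (a * x + b))"
 unfolding smooth_def using cont_diff_mult cont_diff_add cont_diff_const cont_diff_affine by auto

lemma smooth_antiderivative:
 assumes "\<And>x. (f has_real_derivative g x) (at x)" "smooth g" shows "smooth f"
 unfolding smooth_def
proof
 fix k show "cont_diff k f"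
 proof (cases k)
  case 0
  then show ?thesis using assms(1) by (auto intro: continuous_at_imp_continuous_on DERIV_isCont)
 next
  case (Suc j)
  have "cont_diff j g" using assms(2) unfolding smooth_def by blast
  then show ?thesis unfolding Suc cont_diff.simps using assms(1) by (intro exI[of _ g]) blast
 qed
qed

lemma smooth_deriv:
 assumes "smooth g"
 shows "(g has_real_derivative deriv g x) (at x)" "smooth (deriv g)"
proof -
 have *: "\<exists>g'. (\<forall>x. (g has_real_derivative g' x) (at x)) \<and> cont_diff k g'" for k
  using assms cont_diff.simps(2) unfolding smooth_def by blast
 then show d: "(g has_real_derivative deriv g x) (at x)" using DERIV_imp_deriv by metis
 have "cont_diff k (deriv g)" for k
 proof -
  obtain g' where g': "\<forall>x. (g has_real_derivative g' x) (at x)" "cont_diff k g'" using * by blast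
  then have "deriv g = g'" by (auto intro!: DERIV_imp_deriv)
  then show ?thesis using g' by simp
 qed
 then show "smooth (deriv g)" unfolding smooth_def by blast
qed

lemma smooth_continuous: "smooth g ==> continuous_on UNIV g"
 unfolding smooth_def using cont_diff.simps(1) by blast

lemma poly_div_exp_tendsto_0: "((\<lambda>u. poly q u / exp u) \<longlongrightarrow> (0::real)) at_top"
proof -
 have "((\<lambda>u. \<Sum>i\<le>degree q. coeff q i * (u ^ i / exp u)) \<longlongrightarrow> (\<Sum>i\<le>degree q. coeff q i * 0)) at_top"
  by (intro tendsto_sum tendsto_mult tendsto_const tendsto_power_div_exp_0)
 then show ?thesis by (simp add: poly_altdef sum_divide_distrib)
qed

text \<open>
 The functions \<open>q (1 / t) exp (- 1 / t)\<close> with polynomials \<open>q\<close> are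
 closed under differentiation, which gives their smoothness without a formula for the
 derivatives.
\<close>

definition flat :: "real poly => real => real" where
 "flat q t = (if t > 0 then poly q (1 / t) * exp (- (1 / t)) else 0)"

lemma flat_deriv: "(flat q has_real_derivative flat ([:0, 0, 1:] * (q - pderiv q)) t) (at t)"
proof (cases t "0::real" rule: linorder_cases)
 case less
 have "((\<lambda>_. 0) has_real_derivative 0) (at t)" by simp
 then have "(flat q has_real_derivative 0) (at t)"
  by (rule has_field_derivative_transform_within_open[where S="{..<0}"]) (use less in \<open>auto simp: flat_def\<close>)
 then show ?thesis using less by (simp add: flat_def)
next
 case greater
 have "((\<lambda>t. poly q (1 / t) * exp (- (1 / t))) has_real_derivative
   poly (pderiv q) (1 / t) * (- 1 / t ^ 2) * exp (- (1 / t)) + poly q (1 / t) * (exp (- (1 / t)) * (1 / t ^ 2))) (at t)"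
  using greater
  by (auto intro!: derivative_eq_intros DERIV_chain2[OF poly_DERIV] simp: power2_eq_square divide_simps)
 also have "poly (pderiv q) (1 / t) * (- 1 / t ^ 2) * exp (- (1 / t)) + poly q (1 / t) * (exp (- (1 / t)) * (1 / t ^ 2))
   = flat ([:0, 0, 1:] * (q - pderiv q)) t"
  using greater by (simp add: flat_def field_simps power2_eq_square)
 finally show ?thesis
  by (rule has_field_derivative_transform_within_open[where S="{0<..}"]) (use greater in \<open>auto simp: flat_def\<close>)
next
 case equal
 have "((\<lambda>h. flat q h / h) \<longlongrightarrow> 0) (at_right 0)"
 proof -
  have "((\<lambda>h. poly ([:0, 1:] * q) (inverse h) / exp (inverse h)) \<longlongrightarrow> 0) (at_right (0::real))"
   by (rule filterlim_compose[OF poly_div_exp_tendsto_0 filterlim_inverse_at_top_right])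
  moreover have "\<forall>\<^sub>F h in at_right 0. poly ([:0, 1:] * q) (inverse h) / exp (inverse h) = flat q h / h"
   by (rule eventually_at_right_less[THEN eventually_mono]) (auto simp: flat_def exp_minus field_simps)
  ultimately show ?thesis using tendsto_cong by fastforce
 qed
 moreover have "((\<lambda>h. flat q h / h) \<longlongrightarrow> 0) (at_left 0)"
  by (rule tendsto_eventually, rule eventually_at_leftI[of "-1"]) (auto simp: flat_def)
 ultimately have "((\<lambda>h. flat q h / h) \<longlongrightarrow> 0) (at 0)" by (simp add: filterlim_at_split)
 then show ?thesis unfolding equal DERIV_def by (simp add: flat_def)
qed

lemma smooth_flat: "smooth (flat q)"
proof -
 have "cont_diff k (flat q)" for k
 proof (induction k arbitrary: q)
  case 0
  show ?case using flat_deriv by (auto intro: continuous_at_imp_continuous_on DERIV_isCont)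
 next
  case (Suc k)
  then show ?case using flat_deriv by (auto simp del: mult_pCons_left)
 qed
 then show ?thesis unfolding smooth_def by blast
qed

text \<open>
 A bump and its antiderivative, which climbs from 0 to 1 across the bump.
\<close>

lemma smooth_step_exists:
 obtains A \<zeta> :: "real => real" and Z where "smooth A" "smooth \<zeta>" "\<And>t. (A has_real_derivative \<zeta> t) (at t)"
  "\<And>t. 0 \<le> \<zeta> t" "\<And>t. \<zeta> t \<le> Z" "\<And>t. \<bar>t\<bar> \<ge> 1 ==> \<zeta> t = 0" "\<And>t. \<bar>t\<bar> < 1 ==> 0 < \<zeta> t"
  "\<And>t. t \<le> -1 ==> A t = 0" "\<And>t. t \<ge> 1 ==> A t = 1" "\<And>t. 0 \<le> A t \<and> A t \<le> 1"
proof -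
 define z where "z t = flat 1 (1 * t + 1) * flat 1 ((-1) * t + 1)" for t
 have zs: "smooth z" unfolding z_def by (intro smooth_mult smooth_affine smooth_flat)
 have z0: "0 \<le> z t" "z t \<le> 1" for t
  unfolding z_def flat_def by (auto simp: mult_le_one)
 have zz: "\<bar>t\<bar> \<ge> 1 ==> z t = 0" "\<bar>t\<bar> < 1 ==> 0 < z t" for t
  unfolding z_def flat_def by auto
 have "\<exists>F. \<forall>x::real. -\<infinity> < ereal x \<longrightarrow> ereal x < \<infinity> \<longrightarrow> (F has_vector_derivative z x) (at x)"
  using smooth_continuous[OF zs] by (intro einterval_antiderivative) (auto simp: continuous_on_eq_continuous_at)
 then obtain F where F: "\<And>x. (F has_real_derivative z x) (at x)"
  by (auto simp: has_real_derivative_iff_has_vector_derivative)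
 have mono: "x \<le> y ==> F x \<le> F y" for x y
  using DERIV_nonneg_imp_nondecreasing[of x y F] F z0 by blast
 have cl: "F t = F (-1)" if "t \<le> -1" for t
 proof (cases "t = -1")
  case False
  then have "t < -1" using that by simp
  then obtain c where "c < -1" "F (-1) - F t = (-1 - t) * z c" using MVT2[of t "-1" F z] F by auto
  then show ?thesis using zz(1)[of c] by auto
 qed auto
 have cr: "F t = F 1" if "t \<ge> 1" for t
 proof (cases "t = 1")
  case False
  then have "t > 1" using that by simp
  then obtain c where "c > 1" "F t - F 1 = (t - 1) * z c" using MVT2[of 1 t F z] F by auto
  then show ?thesis using zz(1)[of c] by auto
 qed auto
 obtain c where "-1 < c" "c < 1" "F 1 - F (-1) = (1 - (-1)) * z c" using MVT2[of "-1" 1 F z] F by auto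
 then have pos: "0 < F 1 - F (-1)" using zz(2)[of c] by auto
 define D where "D = F 1 - F (-1)"
 define A where "A t = (1 / D) * F t + (- F (-1) / D)" for t
 define \<zeta> where "\<zeta> t = (1 / D) * z t" for t
 have D: "D > 0" using pos D_def by simp
 have dA: "(A has_real_derivative \<zeta> t) (at t)" for t
  unfolding A_def \<zeta>_def by (rule derivative_eq_intros F refl | simp)+
 have \<zeta>s: "smooth \<zeta>" unfolding \<zeta>_def by (intro smooth_mult smooth_const zs)
 have b1: "F (-1) \<le> F t" for t
 proof (cases "t \<le> -1")
  case True then show ?thesis using cl[OF True] by (rule_tac eq_refl, rule_tac sym)
 next
  case False then show ?thesis by (intro mono) linarith
 qed
 have b2: "F t \<le> F 1" for t
 proof (cases "t \<ge> 1")
  case True then show ?thesis using cr[OF True] by (rule_tac eq_refl)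
 next
  case False then show ?thesis by (intro mono) linarith
 qed
 note b = b1 b2
 show ?thesis
 proof (rule that[of A \<zeta> "1 / D"])
  show "smooth A" by (rule smooth_antiderivative[OF dA \<zeta>s])
  have A: "A t = (F t - F (-1)) / D" for t unfolding A_def by (simp add: diff_divide_distrib)
  show "0 \<le> A t \<and> A t \<le> 1" for t
   unfolding A using b1[of t] b2[of t] D by (simp add: divide_le_eq) (simp add: D_def)
  show "t \<ge> 1 ==> A t = 1" for t unfolding A using cr[of t] D by (simp add: D_def)
  show "t \<le> -1 ==> A t = 0" for t unfolding A using cl[of t] by simp
  show "\<zeta> t \<le> 1 / D" for t unfolding \<zeta>_def using z0(2)[of t] D by (auto simp: field_simps)
 qed (use \<zeta>s dA z0 zz D in \<open>auto simp: \<zeta>_def\<close>)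
qed

text \<open>
 Products of functions of one coordinate: their partial derivatives are again of this form, so
 smoothness is a matter of one variable.
\<close>

definition tensor :: "('a::euclidean_space => real => real) => 'a => real" where
 "tensor g y = (\<Prod>b\<in>Basis. g b (y \<bullet> b))"

lemma tensor_derivative:
 assumes "\<And>b. b \<in> Basis ==> smooth (g b)"
 shows "tensor g differentiable (at x)"
  "b \<in> Basis ==> frechet_derivative (tensor g) (at x) b = tensor (g(b := deriv (g b))) x"
proof -
 have 1: "((\<lambda>y. g i (y \<bullet> i)) has_derivative (\<lambda>v. deriv (g i) (x \<bullet> i) * (v \<bullet> i))) (at x)" if "i \<in> Basis" for i
 proof -
  have "(g i has_derivative (*) (deriv (g i) (x \<bullet> i))) (at (x \<bullet> i))"
   using smooth_deriv(1)[OF assms[OF that]] by (simp add: has_field_derivative_def)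
  moreover have "((\<lambda>y. y \<bullet> i) has_derivative (\<lambda>v. v \<bullet> i)) (at x)" by (auto intro!: derivative_eq_intros)
  ultimately show ?thesis using has_derivative_compose by blast
 qed
 have D: "(tensor g has_derivative (\<lambda>v. \<Sum>i\<in>Basis. (deriv (g i) (x \<bullet> i) * (v \<bullet> i)) * (\<Prod>j\<in>Basis - {i}. g j (x \<bullet> j)))) (at x)"
  unfolding tensor_def by (rule has_derivative_prod) (rule 1)
 show "tensor g differentiable (at x)" using D by (rule differentiableI)
 assume b: "b \<in> Basis"
 have "frechet_derivative (tensor g) (at x) b = (\<Sum>i\<in>Basis. (deriv (g i) (x \<bullet> i) * (b \<bullet> i)) * (\<Prod>j\<in>Basis - {i}. g j (x \<bullet> j)))"
  by (rule fun_cong[OF frechet_derivative_at[OF D, symmetric]])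
 also have "\<dots> = (\<Sum>i\<in>Basis. if i = b then deriv (g b) (x \<bullet> b) * (\<Prod>j\<in>Basis - {b}. g j (x \<bullet> j)) else 0)"
  using b by (intro sum.cong) (auto simp: inner_Basis)
 also have "\<dots> = deriv (g b) (x \<bullet> b) * (\<Prod>j\<in>Basis - {b}. g j (x \<bullet> j))" using b by simp
 also have "\<dots> = tensor (g(b := deriv (g b))) x"
  unfolding tensor_def using b by (subst prod.remove[OF finite_Basis b]) (auto intro!: prod.cong)
 finally show "frechet_derivative (tensor g) (at x) b = tensor (g(b := deriv (g b))) x" .
qed

lemma tensor_continuous:
 assumes "\<And>b. b \<in> Basis ==> continuous_on UNIV (g b)" shows "continuous_on UNIV (tensor g)"
 unfolding tensor_def
 by (intro continuous_on_prod continuous_on_compose2[OF assms]) (auto intro!: continuous_intros)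

lemma tensor_times_cont_diff:
 assumes "\<And>b. b \<in> Basis ==> smooth (g b)"
 shows "times_cont_diff k (tensor g)"
 using assms
proof (induction k arbitrary: g)
 case 0
 then show ?case by (simp add: tensor_continuous smooth_continuous)
next
 case (Suc k)
 have "times_cont_diff k (\<lambda>x. frechet_derivative (tensor g) (at x) b)" if b: "b \<in> Basis" for b
 proof -
  have "(\<lambda>x. frechet_derivative (tensor g) (at x) b) = tensor (g(b := deriv (g b)))"
   using tensor_derivative(2)[OF Suc.prems b] by auto
  moreover have "times_cont_diff k (tensor (g(b := deriv (g b))))"
   by (rule Suc.IH) (use Suc.prems smooth_deriv(2) b in auto)
  ultimately show ?thesis by simp
 qed
 then show ?case using tensor_derivative(1)[of g, OF Suc.prems] by simp
qed

lemma tensor_test_function: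
 assumes "\<And>b. b \<in> Basis ==> smooth (g b)" "\<And>b t. b \<in> Basis ==> \<bar>t - x \<bullet> b\<bar> > s ==> g b t = 0"
  and "cbox (x - s *\<^sub>R One) (x + s *\<^sub>R One) \<subseteq> U"
 shows "test_function U (tensor g)"
proof -
 have sub: "{y. tensor g y \<noteq> 0} \<subseteq> cbox (x - s *\<^sub>R One) (x + s *\<^sub>R One)"
 proof
  fix y assume y: "y \<in> {y. tensor g y \<noteq> 0}"
  have "\<bar>y \<bullet> b - x \<bullet> b\<bar> \<le> s" if b: "b \<in> Basis" for b
  proof (rule ccontr)
   assume "\<not> ?thesis"
   then have "g b (y \<bullet> b) = 0" using assms(2)[OF b] by auto
   then show False using y b by (auto simp: tensor_def)
  qed
  then show "y \<in> cbox (x - s *\<^sub>R One) (x + s *\<^sub>R One)"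
   by (force simp: mem_box algebra_simps abs_le_iff)
 qed
 then have cl: "closure {y. tensor g y \<noteq> 0} \<subseteq> cbox (x - s *\<^sub>R One) (x + s *\<^sub>R One)"
  by (rule closure_minimal) (rule closed_cbox)
 moreover have "compact (closure {y. tensor g y \<noteq> 0})"
  using cl by (meson bounded_cbox bounded_subset closed_closure compact_eq_bounded_closed)
 ultimately show ?thesis unfolding test_function_def using tensor_times_cont_diff[of g, OF assms(1)] assms(3) by blast
qed

section \<open>Averages against product kernels\<close>

lemma local_mult_integrable:
 fixes f \<phi> :: "'a::euclidean_space => real"
 assumes f: "integrable (lebesgue_on K) f" and K: "compact K" "K \<subseteq> U" and U: "open U"
  and \<phi>: "continuous_on UNIV \<phi>" "\<And>y. \<bar>\<phi> y\<bar> \<le> B" "\<And>y. y \<notin> K ==> \<phi> y = 0"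
 shows "integrable (lebesgue_on U) (\<lambda>y. f y * \<phi> y)"
  "\<bar>LINT y|lebesgue_on U. f y * \<phi> y\<bar> \<le> B * (LINT y|lebesgue_on K. \<bar>f y\<bar>)"
proof -
 have Km: "K \<in> sets lebesgue" and Um: "U \<in> sets lebesgue" using K U by (auto simp: borel_compact)
 have \<phi>m: "\<phi> \<in> borel_measurable lebesgue"
  using borel_measurable_continuous_onI[OF \<phi>(1)] by (intro measurable_completion) simp
 have B0: "0 \<le> B" using \<phi>(2)[of 0] by linarith
 have fK: "integrable lebesgue (\<lambda>y. indicat_real K y * f y)"
  using f Km by (simp add: integrable_restrict_space)
 have fK': "integrable lebesgue (\<lambda>y. indicat_real K y * \<bar>f y\<bar>)"
  using integrable_abs[OF fK] by (simp add: abs_mult)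
 have prod: "integrable lebesgue (\<lambda>y. \<phi> y * (indicat_real K y * f y))"
 proof (rule Bochner_Integration.integrable_bound[where f="\<lambda>y. B * (indicat_real K y * f y)"])
  show "integrable lebesgue (\<lambda>y. B * (indicat_real K y * f y))" using fK by simp
  show "(\<lambda>y. \<phi> y * (indicat_real K y * f y)) \<in> borel_measurable lebesgue"
   using \<phi>m borel_measurable_integrable[OF fK] by (rule borel_measurable_times)
  have "\<bar>\<phi> y\<bar> * c \<le> \<bar>B\<bar> * c" if "c \<ge> 0" for y c
   using \<phi>(2)[of y] that by (intro mult_right_mono) auto
  then show "AE y in lebesgue. norm (\<phi> y * (indicat_real K y * f y)) \<le> norm (B * (indicat_real K y * f y))"
   by (intro AE_I2) (simp add: abs_mult)
 qed
 have eq: "(\<lambda>y. indicat_real U y *\<^sub>R (f y * \<phi> y)) = (\<lambda>y. \<phi> y * (indicat_real K y * f y))"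
  using K(2) \<phi>(3) by (auto simp: indicator_def fun_eq_iff)
 show "integrable (lebesgue_on U) (\<lambda>y. f y * \<phi> y)"
  using prod Um by (simp add: integrable_restrict_space eq[simplified])
 have "(LINT y|lebesgue_on U. f y * \<phi> y) = (LINT y|lebesgue. \<phi> y * (indicat_real K y * f y))"
  using Um by (simp add: integral_restrict_space eq[simplified])
 also have "\<bar>\<dots>\<bar> \<le> (LINT y|lebesgue. \<bar>\<phi> y * (indicat_real K y * f y)\<bar>)" by (rule integral_abs_bound)
 also have "\<dots> \<le> (LINT y|lebesgue. B * (indicat_real K y * \<bar>f y\<bar>))"
 proof (rule integral_mono)
  show "integrable lebesgue (\<lambda>y. \<bar>\<phi> y * (indicat_real K y * f y)\<bar>)" using prod by (rule integrable_abs)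
  show "integrable lebesgue (\<lambda>y. B * (indicat_real K y * \<bar>f y\<bar>))" using fK' by simp
  show "\<bar>\<phi> y * (indicat_real K y * f y)\<bar> \<le> B * (indicat_real K y * \<bar>f y\<bar>)" for y
   using \<phi>(2)[of y] by (simp add: abs_mult mult_right_mono)
 qed
 also have "\<dots> = B * (LINT y|lebesgue_on K. \<bar>f y\<bar>)" using Km by (simp add: integral_restrict_space)
 finally show "\<bar>LINT y|lebesgue_on U. f y * \<phi> y\<bar> \<le> B * (LINT y|lebesgue_on K. \<bar>f y\<bar>)" .
qed

text \<open>
 Trades the first power for the \<open>p\<close>-th with a free scale \<open>\<tau>\<close>;
 choosing \<open>\<tau>\<close> replaces an application of Hoelder's inequality.
\<close>

lemma abs_le_young:
 fixes a \<tau> p :: real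
 assumes "0 \<le> a" "0 < \<tau>" "1 \<le> p" shows "a \<le> \<tau> + a powr p * \<tau> powr (1 - p)"
proof (cases "a \<le> \<tau>")
 case True
 have "0 \<le> a powr p * \<tau> powr (1 - p)" by simp
 then show ?thesis using True by linarith
next
 case False
 then have "a powr (1 - p) \<le> \<tau> powr (1 - p)" using assms by (intro powr_mono2') auto
 then have "a powr p * a powr (1 - p) \<le> a powr p * \<tau> powr (1 - p)" by (intro mult_left_mono) auto
 moreover have "a powr p * a powr (1 - p) = a" using False assms by (simp flip: powr_add)
 ultimately show ?thesis using assms by linarith
qed

lemma Lp_integrable_compact:
 fixes f :: "'a::euclidean_space => real"
 assumes f: "Lp_on p U f" and K: "compact K" "K \<subseteq> U" and U: "open U" and p: "1 \<le> p" and \<tau>: "0 < \<tau>"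
 shows "integrable (lebesgue_on K) f"
  "(LINT y|lebesgue_on K. \<bar>f y\<bar>) \<le> \<tau> * measure lebesgue K + \<tau> powr (1 - p) * (LINT y|lebesgue_on U. \<bar>f y\<bar> powr p)"
proof -
 have Km: "K \<in> sets lebesgue" and Um: "U \<in> sets lebesgue" using K U by (auto simp: borel_compact)
 have fin: "emeasure lebesgue K < \<infinity>" using lmeasurable_compact[OF K(1)] by (auto simp: fmeasurable_def)
 have fm: "f \<in> borel_measurable (lebesgue_on K)"
  using f K(2) measurable_restrict_mono unfolding Lp_on_def by blast
 have pi: "integrable lebesgue (\<lambda>y. indicator U y * \<bar>f y\<bar> powr p)"
  using f Um unfolding Lp_on_def by (simp add: integrable_restrict_space)
 have "integrable lebesgue (\<lambda>y. indicator K y * (indicator U y * \<bar>f y\<bar> powr p))"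
  using integrable_mult_indicator[OF Km pi] by simp
 moreover have "(\<lambda>y. indicat_real K y * (indicator U y * \<bar>f y\<bar> powr p)) = (\<lambda>y. indicator K y * \<bar>f y\<bar> powr p)"
  using K(2) by (auto simp: indicator_def fun_eq_iff)
 ultimately have pK: "integrable (lebesgue_on K) (\<lambda>y. \<bar>f y\<bar> powr p)"
  using Km by (simp add: integrable_restrict_space)
 have cK: "integrable (lebesgue_on K) (\<lambda>y. c::real)" for c
  using fin Km by (intro finite_measure.integrable_const finite_measure_lebesgue_on) (auto simp: fmeasurable_def)
 have bd: "integrable (lebesgue_on K) (\<lambda>y. \<tau> + \<bar>f y\<bar> powr p * \<tau> powr (1 - p))"
  using pK cK by simp
 have le: "\<bar>f y\<bar> \<le> \<tau> + \<bar>f y\<bar> powr p * \<tau> powr (1 - p)" for y using abs_le_young[of "\<bar>f y\<bar>" \<tau> p] \<tau> p by simp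
 have nn: "0 \<le> \<tau> + \<bar>f y\<bar> powr p * \<tau> powr (1 - p)" for y using \<tau> by simp
 show i: "integrable (lebesgue_on K) f"
  by (rule Bochner_Integration.integrable_bound[OF bd fm]) (use le nn in \<open>auto\<close>)
 have "(LINT y|lebesgue_on K. \<bar>f y\<bar>) \<le> (LINT y|lebesgue_on K. \<tau> + \<bar>f y\<bar> powr p * \<tau> powr (1 - p))"
  using i bd le by (intro integral_mono) auto
 also have "\<dots> = \<tau> * measure lebesgue K + \<tau> powr (1 - p) * (LINT y|lebesgue_on K. \<bar>f y\<bar> powr p)"
  using pK cK Km by (simp add: measure_restrict_space mult.commute)
 also have "(LINT y|lebesgue_on K. \<bar>f y\<bar> powr p) \<le> (LINT y|lebesgue_on U. \<bar>f y\<bar> powr p)"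
 proof -
  have "(LINT y|lebesgue. indicator K y * \<bar>f y\<bar> powr p) \<le> (LINT y|lebesgue. indicator U y * \<bar>f y\<bar> powr p)"
   using pi pK Km K(2) by (intro integral_mono) (auto simp: integrable_restrict_space indicator_def)
  then show ?thesis using Km Um by (simp add: integral_restrict_space)
 qed
 finally show "(LINT y|lebesgue_on K. \<bar>f y\<bar>) \<le> \<tau> * measure lebesgue K + \<tau> powr (1 - p) * (LINT y|lebesgue_on U. \<bar>f y\<bar> powr p)"
  by (simp add: mult_left_mono)
qed

abbreviation cube :: "'a::euclidean_space => real => 'a set" where
 "cube x s \<equiv> cbox (x - s *\<^sub>R One) (x + s *\<^sub>R One)"

lemma mem_cube: "y \<in> cube x s \<longleftrightarrow> (\<forall>b\<in>Basis. \<bar>y \<bullet> b - x \<bullet> b\<bar> \<le> s)"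
 by (force simp: mem_box algebra_simps abs_le_iff)

lemma measure_cube: "0 \<le> s ==> measure lebesgue (cube (x::'a::euclidean_space) s) = (2 * s) ^ DIM('a)"
 by (simp add: content_cbox_if box_eq_empty algebra_simps not_less)

text \<open>
 A bump \<open>\<zeta>\<close> on \<open>[-1, 1]\<close> of mass 1 together with its
 antiderivative \<open>A\<close>.
\<close>

locale kernel_profile =
 fixes A \<zeta> :: "real => real" and Z :: real
 assumes A_smooth: "smooth A" and \<zeta>_smooth: "smooth \<zeta>" and A_deriv: "\<And>t. (A has_real_derivative \<zeta> t) (at t)"
  and \<zeta>_nonneg: "\<And>t. 0 \<le> \<zeta> t" and \<zeta>_le: "\<And>t. \<zeta> t \<le> Z" and \<zeta>_zero: "\<And>t. \<bar>t\<bar> \<ge> 1 ==> \<zeta> t = 0"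
  and \<zeta>_pos: "\<And>t. \<bar>t\<bar> < 1 ==> 0 < \<zeta> t" and A_left: "\<And>t. t \<le> -1 ==> A t = 0" and A_right: "\<And>t. t \<ge> 1 ==> A t = 1"
  and A_range: "\<And>t. 0 \<le> A t \<and> A t \<le> 1"
begin

definition ker :: "real => real => real => real" where "ker s x t = \<zeta> ((t - x) / s) / s"
text \<open>
 An antiderivative of the difference of the kernels of width \<open>s\<close> and \<open>s /
 2\<close>. Both kernels have the same mass, so it vanishes outside the wider one, which makes
 it admissible in the definition of the weak gradient.
\<close>

definition edge :: "real => real => real => real" where "edge s x t = A ((t - x) / s) - A (2 * (t - x) / s)"
definition kern :: "('a::euclidean_space => real) => 'a => 'a => real" where
 "kern \<sigma> x = tensor (\<lambda>b. ker (\<sigma> b) (x \<bullet> b))"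

lemma Z_pos: "0 < Z" using \<zeta>_pos[of 0] \<zeta>_le[of 0] by simp

lemma ker_smooth: "smooth (ker s x)"
proof -
 have "smooth (\<lambda>t. (1 / s) * \<zeta> ((1 / s) * t + (- x / s)))"
  by (intro smooth_mult smooth_const smooth_affine \<zeta>_smooth)
 moreover have "(\<lambda>t. (1 / s) * \<zeta> ((1 / s) * t + (- x / s))) = ker s x"
  unfolding ker_def by (simp add: diff_divide_distrib fun_eq_iff)
 ultimately show ?thesis by simp
qed

lemma ker_bounds: "0 < s ==> 0 \<le> ker s x t" "0 < s ==> ker s x t \<le> Z / s"
 "0 < s ==> \<bar>t - x\<bar> > s ==> ker s x t = 0"
 unfolding ker_def using \<zeta>_nonneg \<zeta>_le by (auto simp: divide_right_mono intro!: \<zeta>_zero)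

lemma edge_smooth: "smooth (edge s x)"
proof -
 have "smooth (\<lambda>t. A ((1 / s) * t + (- x / s)) + (-1) * A ((2 / s) * t + (- 2 * x / s)))"
  by (intro smooth_add smooth_mult smooth_const smooth_affine A_smooth)
 moreover have "(\<lambda>t. A ((1 / s) * t + (- x / s)) + (-1) * A ((2 / s) * t + (- 2 * x / s))) = edge s x"
  unfolding edge_def by (simp add: diff_divide_distrib fun_eq_iff right_diff_distrib)
 ultimately show ?thesis by simp
qed

lemma edge_bounds: "\<bar>edge s x t\<bar> \<le> 1" "0 < s ==> \<bar>t - x\<bar> > s ==> edge s x t = 0"
proof -
 show "\<bar>edge s x t\<bar> \<le> 1"
  unfolding edge_def using A_range[of "(t - x) / s"] A_range[of "2 * (t - x) / s"] by linarith
 assume s: "0 < s" "\<bar>t - x\<bar> > s"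
 show "edge s x t = 0"
 proof (cases "t - x > 0")
  case True
  then have "(t - x) / s \<ge> 1" "2 * (t - x) / s \<ge> 1" using s by auto
  then show ?thesis unfolding edge_def using A_right by auto
 next
  case False
  then have "(t - x) / s \<le> -1" "2 * (t - x) / s \<le> -1" using s by (auto simp: divide_le_eq)
  then show ?thesis unfolding edge_def using A_left by auto
 qed
qed

lemma deriv_edge: "0 < s ==> deriv (edge s x) = (\<lambda>t. ker s x t - ker (s / 2) x t)"
proof
 fix t assume s: "0 < s"
 have 1: "((\<lambda>t. A ((t - x) / s)) has_real_derivative \<zeta> ((t - x) / s) * (1 / s)) (at t)"
  by (rule DERIV_chain2[OF A_deriv]) (use s in \<open>auto intro!: derivative_eq_intros\<close>)
 have 2: "((\<lambda>t. A (2 * (t - x) / s)) has_real_derivative \<zeta> (2 * (t - x) / s) * (2 / s)) (at t)"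
  by (rule DERIV_chain2[OF A_deriv]) (use s in \<open>auto intro!: derivative_eq_intros\<close>)
 have "(edge s x has_real_derivative \<zeta> ((t - x) / s) * (1 / s) - \<zeta> (2 * (t - x) / s) * (2 / s)) (at t)"
  unfolding edge_def by (rule DERIV_diff[OF 1 2])
 then have "deriv (edge s x) t = \<zeta> ((t - x) / s) * (1 / s) - \<zeta> (2 * (t - x) / s) * (2 / s)" by (rule DERIV_imp_deriv)
 also have "2 * (t - x) / s = (t - x) / (s / 2)" by simp
 finally show "deriv (edge s x) t = ker s x t - ker (s / 2) x t" unfolding ker_def by simp
qed

lemma tensor_support_bound:
 fixes x :: "'a::euclidean_space"
 assumes g: "\<And>b. b \<in> Basis ==> smooth (g b)" "\<And>b t. b \<in> Basis ==> \<bar>t - x \<bullet> b\<bar> > s ==> g b t = 0"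
  and B: "\<And>b t. b \<in> Basis ==> \<bar>g b t\<bar> \<le> B b"
 shows "continuous_on UNIV (tensor g)" "\<And>y. \<bar>tensor g y\<bar> \<le> (\<Prod>b\<in>Basis. B b)" "\<And>y. y \<notin> cube x s ==> tensor g y = 0"
proof -
 show "continuous_on UNIV (tensor g)" using g(1) by (intro tensor_continuous smooth_continuous)
 show "\<bar>tensor g y\<bar> \<le> (\<Prod>b\<in>Basis. B b)" for y
  unfolding tensor_def abs_prod using B by (intro prod_mono) auto
 fix y assume "y \<notin> cube x s"
 then obtain b where b: "b \<in> Basis" "\<bar>y \<bullet> b - x \<bullet> b\<bar> > s" unfolding mem_cube by force
 then show "tensor g y = 0" unfolding tensor_def using g(2)[OF b(1)] by (intro prod_zero) auto
qed

lemma kern_bound: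
 fixes x :: "'a::euclidean_space"
 assumes "\<And>b. b \<in> Basis ==> 0 < \<sigma> b \<and> \<sigma> b \<le> s" "\<And>b. b \<in> Basis ==> r \<le> \<sigma> b" "0 < r"
 shows "continuous_on UNIV (kern \<sigma> x)" "\<And>y. \<bar>kern \<sigma> x y\<bar> \<le> (Z / r) ^ DIM('a)" "\<And>y. y \<notin> cube x s ==> kern \<sigma> x y = 0"
proof -
 have 1: "\<bar>ker (\<sigma> b) (x \<bullet> b) t\<bar> \<le> Z / r" if b: "b \<in> Basis" for b t
 proof -
  have "Z / \<sigma> b \<le> Z / r" using assms(2)[OF b] assms(3) Z_pos by (intro divide_left_mono) auto
  then show ?thesis using ker_bounds(1,2)[of "\<sigma> b" "x \<bullet> b" t] assms(1)[OF b] by auto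
 qed
 have 2: "ker (\<sigma> b) (x \<bullet> b) t = 0" if "b \<in> Basis" "\<bar>t - x \<bullet> b\<bar> > s" for b t
  using ker_bounds(3)[of "\<sigma> b" t "x \<bullet> b"] assms(1)[OF that(1)] that(2) by auto
 note tensor_support_bound[where g="\<lambda>b. ker (\<sigma> b) (x \<bullet> b)" and x=x and s=s and B="\<lambda>_. Z / r", OF ker_smooth 2 1]
 then show "continuous_on UNIV (kern \<sigma> x)" "\<And>y. \<bar>kern \<sigma> x y\<bar> \<le> (Z / r) ^ DIM('a)" "\<And>y. y \<notin> cube x s ==> kern \<sigma> x y = 0"
  unfolding kern_def by auto
qed

text \<open>
 Replacing one factor of the kernel by the factor of half the width changes the average by the
 integral of \<open>u\<close> against a partial derivative of a test function, which
 integration by parts turns into an integral of the weak gradient.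
\<close>

lemma halve_coordinate:
 fixes x :: "'a::euclidean_space"
 assumes U: "open U" and wg: "weak_gradient U u G" and sub: "cube x s \<subseteq> U" and s: "0 < s"
  and \<sigma>: "\<And>b. b \<in> Basis ==> \<sigma> b = s \<or> \<sigma> b = s / 2" and b: "b \<in> Basis" "\<sigma> b = s"
 shows "\<bar>(LINT y|lebesgue_on U. u y * kern \<sigma> x y) - (LINT y|lebesgue_on U. u y * kern (\<sigma>(b := s / 2)) x y)\<bar>
   \<le> (2 * Z / s) ^ (DIM('a) - 1) * (LINT y|lebesgue_on (cube x s). \<bar>G y \<bullet> b\<bar>)"
proof -
 let ?\<sigma> = "\<sigma>(b := s / 2)"
 define g where "g = (\<lambda>b'. ker (\<sigma> b') (x \<bullet> b'))(b := edge s (x \<bullet> b))"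
 have li: "integrable (lebesgue_on (cube x s)) u" "integrable (lebesgue_on (cube x s)) (\<lambda>y. G y \<bullet> b)"
  using wg sub b(1) unfolding weak_gradient_def locally_integrable_def by (auto intro: compact_cbox)
 have \<sigma>b: "0 < \<sigma> b' \<and> \<sigma> b' \<le> s" "s / 2 \<le> \<sigma> b'" "0 < ?\<sigma> b' \<and> ?\<sigma> b' \<le> s" "s / 2 \<le> ?\<sigma> b'" if "b' \<in> Basis" for b'
  using \<sigma>[OF that] s by auto
 have s2: "0 < s / 2" using s by simp
 note k1 = kern_bound[OF \<sigma>b(1,2) s2, where x=x] and k2 = kern_bound[OF \<sigma>b(3,4) s2, where x=x]
 have i1: "integrable (lebesgue_on U) (\<lambda>y. u y * kern \<sigma> x y)"
  by (rule local_mult_integrable[OF li(1) compact_cbox sub U k1(1) k1(2) k1(3)])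
 have i2: "integrable (lebesgue_on U) (\<lambda>y. u y * kern ?\<sigma> x y)"
  by (rule local_mult_integrable[OF li(1) compact_cbox sub U k2(1) k2(2) k2(3)])
 have gs: "smooth (g b')" for b' unfolding g_def using ker_smooth edge_smooth by auto
 have g0: "g b' t = 0" if "b' \<in> Basis" "\<bar>t - x \<bullet> b'\<bar> > s" for b' t
  unfolding g_def using edge_bounds(2)[OF s] ker_bounds(3)[of "\<sigma> b'" t "x \<bullet> b'"] \<sigma>b(1)[OF that(1)] that by auto
 have gB: "\<bar>g b' t\<bar> \<le> (if b' = b then 1 else 2 * Z / s)" if "b' \<in> Basis" for b' t
 proof (cases "b' = b")
  case True then show ?thesis unfolding g_def using edge_bounds(1) by simp
 next
  case False
  have "Z / \<sigma> b' \<le> Z / (s / 2)" using \<sigma>b(2)[OF that] s Z_pos by (intro divide_left_mono) auto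
  then show ?thesis unfolding g_def using False ker_bounds(1,2)[of "\<sigma> b'" "x \<bullet> b'" t] \<sigma>b(1)[OF that] by (simp add: mult.commute)
 qed
 note tg = tensor_support_bound[where g=g and x=x and s=s and B="\<lambda>b'. if b' = b then 1 else 2 * Z / s", OF gs g0 gB]
 have B: "(\<Prod>b'\<in>Basis. if b' = b then 1 else 2 * Z / s) = (2 * Z / s) ^ (DIM('a) - 1)"
  using b(1) by (subst prod.remove[OF finite_Basis b(1)]) simp
 have tf: "test_function U (tensor g)" by (rule tensor_test_function[where g=g and x=x and s=s, OF gs g0 sub])
 have fd: "frechet_derivative (tensor g) (at y) b = kern \<sigma> x y - kern ?\<sigma> x y" for y
 proof -
  have "frechet_derivative (tensor g) (at y) b = tensor (g(b := deriv (g b))) y"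
   by (rule tensor_derivative(2)[OF gs b(1)])
  also have "\<dots> = (ker s (x \<bullet> b) (y \<bullet> b) - ker (s / 2) (x \<bullet> b) (y \<bullet> b)) * (\<Prod>b'\<in>Basis - {b}. ker (\<sigma> b') (x \<bullet> b') (y \<bullet> b'))"
   unfolding tensor_def using deriv_edge[OF s]
   by (subst prod.remove[OF finite_Basis b(1)]) (auto simp: g_def intro!: prod.cong)
  also have "\<dots> = kern \<sigma> x y - kern ?\<sigma> x y"
  proof -
   have "kern \<sigma> x y = ker s (x \<bullet> b) (y \<bullet> b) * (\<Prod>b'\<in>Basis - {b}. ker (\<sigma> b') (x \<bullet> b') (y \<bullet> b'))"
    unfolding kern_def tensor_def using b(2) by (subst prod.remove[OF finite_Basis b(1)]) simp
   moreover have "kern ?\<sigma> x y = ker (s / 2) (x \<bullet> b) (y \<bullet> b) * (\<Prod>b'\<in>Basis - {b}. ker (\<sigma> b') (x \<bullet> b') (y \<bullet> b'))"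
    unfolding kern_def tensor_def by (subst prod.remove[OF finite_Basis b(1)]) (auto intro!: prod.cong)
   ultimately show ?thesis by (simp add: left_diff_distrib)
  qed
  finally show ?thesis .
 qed
 have "(LINT y|lebesgue_on U. u y * frechet_derivative (tensor g) (at y) b)
   = - (LINT y|lebesgue_on U. (G y \<bullet> b) * tensor g y)"
  using wg b(1) tf unfolding weak_gradient_def by blast
 then have "(LINT y|lebesgue_on U. u y * kern \<sigma> x y) - (LINT y|lebesgue_on U. u y * kern ?\<sigma> x y)
   = - (LINT y|lebesgue_on U. (G y \<bullet> b) * tensor g y)"
  unfolding fd right_diff_distrib using i1 i2 by simp
 moreover have "\<bar>LINT y|lebesgue_on U. (G y \<bullet> b) * tensor g y\<bar> \<le> (2 * Z / s) ^ (DIM('a) - 1) * (LINT y|lebesgue_on (cube x s). \<bar>G y \<bullet> b\<bar>)"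
  using local_mult_integrable(2)[OF li(2) compact_cbox sub U tg(1) tg(2) tg(3)] unfolding B .
 ultimately show ?thesis by simp
qed

end

section \<open>Morrey bounds for the averages\<close>

lemma (in pair_sigma_finite) integrable_times:
 fixes f g :: "_ => real"
 assumes f: "integrable M1 f" and g: "integrable M2 g"
 shows "integrable (M1 \<Otimes>\<^sub>M M2) (\<lambda>z. f (fst z) * g (snd z))"
proof (rule Fubini_integrable)
 note [measurable] = borel_measurable_integrable[OF f] borel_measurable_integrable[OF g]
 show "(\<lambda>z. f (fst z) * g (snd z)) \<in> borel_measurable (M1 \<Otimes>\<^sub>M M2)" by measurable
 show "integrable M1 (\<lambda>x. \<integral>y. norm (f (fst (x, y)) * g (snd (x, y))) \<partial>M2)"
  using integrable_norm[OF f] by (simp add: abs_mult)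
 show "AE x in M1. integrable M2 (\<lambda>y. f (fst (x, y)) * g (snd (x, y)))" using g by simp
qed

lemma integrable_bounded_support:
 fixes g :: "'a::euclidean_space => real"
 assumes "g \<in> borel_measurable borel" "\<And>x. \<bar>g x\<bar> \<le> B" "\<And>x. x \<notin> K ==> g x = 0" "bounded K"
 shows "integrable lborel g"
proof -
 obtain a b where K: "K \<subseteq> cbox a b" using bounded_subset_cbox_symmetric[OF assms(4)] by blast
 have "integrable lborel (\<lambda>x. indicat_real (cbox a b) x *\<^sub>R B)"
  using emeasure_bounded_finite[OF bounded_cbox, of a b]
  by (intro integrable_scaleR_left integrable_real_indicator) (auto simp: less_top)
 then show ?thesis
 proof (rule Bochner_Integration.integrable_bound)
  show "AE x in lborel. norm (g x) \<le> norm (indicat_real (cbox a b) x *\<^sub>R B)"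
   using assms(2,3) K by (intro AE_I2) (auto simp: indicator_def subset_iff intro: order_trans[OF _ abs_ge_self])
 qed (use assms in simp)
qed

context kernel_profile
begin

text \<open>
 The coordinates are halved one after the other.
\<close>

lemma halve_scale:
 fixes x :: "'a::euclidean_space"
 assumes U: "open U" and wg: "weak_gradient U u G" and sub: "cube x s \<subseteq> U" and s: "0 < s"
  and D: "\<And>b. b \<in> Basis ==> (LINT y|lebesgue_on (cube x s). \<bar>G y \<bullet> b\<bar>) \<le> D"
 shows "\<bar>(LINT y|lebesgue_on U. u y * kern (\<lambda>_. s) x y) - (LINT y|lebesgue_on U. u y * kern (\<lambda>_. s / 2) x y)\<bar>
   \<le> real DIM('a) * ((2 * Z / s) ^ (DIM('a) - 1) * D)"
proof -
 define I where "I \<sigma> = (LINT y|lebesgue_on U. u y * kern \<sigma> x y)" for \<sigma>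
 let ?K = "(2 * Z / s) ^ (DIM('a) - 1) * D"
 have "\<bar>I (\<lambda>_. s) - I (\<lambda>b. if b \<in> B then s / 2 else s)\<bar> \<le> real (card B) * ?K" if "finite B" "B \<subseteq> Basis" for B
  using that
 proof (induction B rule: finite_induct)
  case (insert c B)
  let ?\<sigma> = "\<lambda>b. if b \<in> B then s / 2 else s"
  have eq: "(\<lambda>b. if b \<in> insert c B then s / 2 else s) = ?\<sigma>(c := s / 2)" by auto
  have "\<bar>I ?\<sigma> - I (?\<sigma>(c := s / 2))\<bar> \<le> (2 * Z / s) ^ (DIM('a) - 1) * (LINT y|lebesgue_on (cube x s). \<bar>G y \<bullet> c\<bar>)"
   unfolding I_def by (rule halve_coordinate[OF U wg sub s]) (use insert in auto)
  also have "\<dots> \<le> ?K" using D[of c] insert.prems Z_pos s by (intro mult_left_mono) auto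
  finally show ?case using insert unfolding eq by (simp add: algebra_simps)
 qed simp
 from this[of Basis] have "\<bar>I (\<lambda>_. s) - I (\<lambda>b. if b \<in> Basis then s / 2 else s)\<bar> \<le> real DIM('a) * ?K" by simp
 moreover have "kern (\<lambda>b. if b \<in> Basis then s / 2 else s) x = kern (\<lambda>_. s / 2) x"
  unfolding kern_def tensor_def by (auto intro!: prod.cong)
 ultimately show ?thesis unfolding I_def by simp
qed

text \<open>
 The change at scale \<open>r / 2 ^ k\<close> is an average of the gradient over a cube of that
 size times its width, which the \<open>p\<close>-th mean bounds by a power of the scale. The
 exponent is positive exactly because \<open>p\<close> exceeds the dimension, and the geometric
 series converges.
\<close>

lemma morrey_averages:
 fixes p r :: real
 assumes p: "real DIM('a::euclidean_space) < p" and r: "0 < r"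
 obtains C where "0 \<le> C" "\<And>U (u::'a => real) G W x k. open U ==> weak_gradient U u G ==> Lp_on p U u ==>
   (\<And>b. b \<in> Basis ==> Lp_on p U (\<lambda>y. G y \<bullet> b)) ==> 0 < W ==>
   (LINT y|lebesgue_on U. \<bar>u y\<bar> powr p) \<le> W powr p ==>
   (\<And>b. b \<in> Basis ==> (LINT y|lebesgue_on U. \<bar>G y \<bullet> b\<bar> powr p) \<le> W powr p) ==>
   cube x r \<subseteq> U ==> \<bar>LINT y|lebesgue_on U. u y * kern (\<lambda>_. r / 2 ^ k) x y\<bar> \<le> C * W"
proof -
 let ?m = "DIM('a)"
 define \<alpha> where "\<alpha> = 1 - real ?m / p"
 define \<theta> where "\<theta> = 2 powr (- \<alpha>)"
 define C1 where "C1 = real ?m * (2 * Z) ^ (?m - 1) * (2 ^ ?m + 1)"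
 define C where "C = (Z / r) ^ ?m * ((2 * r) ^ ?m + 1) + C1 * r powr \<alpha> / (1 - \<theta>)"
 have m1: "1 \<le> ?m" using DIM_positive[where 'a='a] by linarith
 have p1: "1 \<le> p" "0 < p" using p m1 by linarith+
 have \<alpha>: "0 < \<alpha>" unfolding \<alpha>_def using p p1 by (simp add: divide_less_eq)
 have \<theta>: "0 < \<theta>" "\<theta> < 1" unfolding \<theta>_def using powr_less_mono[of "- \<alpha>" 0 2] \<alpha> by auto
 have C1: "0 \<le> C1" unfolding C1_def using Z_pos by simp
 show ?thesis
 proof (rule that[of C])
  show "0 \<le> C" unfolding C_def using C1 \<theta> Z_pos r by simp
  fix U and u :: "'a => real" and G W x k
  assume U: "open U" and wg: "weak_gradient U u G" and Lu: "Lp_on p U u"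
   and LG: "\<And>b. b \<in> Basis ==> Lp_on p U (\<lambda>y. G y \<bullet> b)" and W: "0 < W"
   and nu: "(LINT y|lebesgue_on U. \<bar>u y\<bar> powr p) \<le> W powr p"
   and nG: "\<And>b. b \<in> Basis ==> (LINT y|lebesgue_on U. \<bar>G y \<bullet> b\<bar> powr p) \<le> W powr p"
   and sub: "cube x r \<subseteq> U"
  define I where "I s = (LINT y|lebesgue_on U. u y * kern (\<lambda>_. s) x y)" for s
  have step: "\<bar>I s - I (s / 2)\<bar> \<le> C1 * W * s powr \<alpha>" if s: "0 < s" "s \<le> r" for s
  proof -
   have sub': "cube x s \<subseteq> U" using sub s mem_cube[of _ x] by (meson order_trans subset_iff)
   define \<tau> where "\<tau> = W * s powr (- (real ?m / p))"
   have \<tau>: "0 < \<tau>" unfolding \<tau>_def using W s by simp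
   define D where "D = \<tau> * (2 * s) ^ ?m + \<tau> powr (1 - p) * W powr p"
   have D: "(LINT y|lebesgue_on (cube x s). \<bar>G y \<bullet> b\<bar>) \<le> D" if b: "b \<in> Basis" for b
   proof -
    have "(LINT y|lebesgue_on (cube x s). \<bar>G y \<bullet> b\<bar>) \<le> \<tau> * measure lebesgue (cube x s) + \<tau> powr (1 - p) * (LINT y|lebesgue_on U. \<bar>G y \<bullet> b\<bar> powr p)"
     by (rule Lp_integrable_compact(2)[OF LG[OF b] compact_cbox sub' U p1(1) \<tau>])
    also have "\<dots> \<le> D" unfolding D_def using measure_cube[of s x] s nG[OF b] by (simp add: mult_left_mono)
    finally show ?thesis .
   qed
   have e1: "\<tau> powr (1 - p) * W powr p = W * s powr (real ?m - real ?m / p)"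
   proof -
    have "\<tau> powr (1 - p) = W powr (1 - p) * s powr (- (real ?m / p) * (1 - p))"
     unfolding \<tau>_def using W s by (simp add: powr_mult powr_powr)
    moreover have "- (real ?m / p) * (1 - p) = real ?m - real ?m / p" using p1 by (simp add: field_simps)
    moreover have "W powr (1 - p) * W powr p = W" using W by (simp flip: powr_add)
    ultimately show ?thesis by (simp add: mult_ac)
   qed
   have e2: "\<tau> * (2 * s) ^ ?m = 2 ^ ?m * (W * s powr (real ?m - real ?m / p))"
   proof -
    have "(2 * s) ^ ?m = 2 ^ ?m * s powr real ?m" using s by (simp add: power_mult_distrib powr_realpow)
    moreover have "s powr (- (real ?m / p)) * s powr real ?m = s powr (real ?m - real ?m / p)" by (simp flip: powr_add)
    ultimately show ?thesis unfolding \<tau>_def by (simp add: mult_ac)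
   qed
   have D': "D = (2 ^ ?m + 1) * (W * s powr (real ?m - real ?m / p))" unfolding D_def e1 e2 by (simp add: algebra_simps)
   have "\<bar>I s - I (s / 2)\<bar> \<le> real ?m * ((2 * Z / s) ^ (?m - 1) * D)"
    unfolding I_def by (rule halve_scale[OF U wg sub' s(1) D])
   also have "(2 * Z / s) ^ (?m - 1) = (2 * Z) ^ (?m - 1) * s powr (- (real ?m - 1))"
   proof -
    have "s powr (- (real ?m - 1)) = inverse (s ^ (?m - 1))"
     using s m1 powr_realpow[of s "?m - 1"] by (simp add: powr_minus of_nat_diff del: minus_diff_eq)
    then show ?thesis unfolding power_divide[of "2 * Z" s] by (simp only: divide_inverse)
   qed
   also have "real ?m * ((2 * Z) ^ (?m - 1) * s powr (- (real ?m - 1)) * D) = C1 * W * (s powr (- (real ?m - 1)) * s powr (real ?m - real ?m / p))"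
    unfolding D' C1_def by (simp add: mult_ac)
   also have "s powr (- (real ?m - 1)) * s powr (real ?m - real ?m / p) = s powr \<alpha>"
    unfolding \<alpha>_def by (simp flip: powr_add)
   finally show ?thesis .
  qed
  have tel: "\<bar>I r - I (r / 2 ^ k)\<bar> \<le> (\<Sum>j<k. C1 * W * (r / 2 ^ j) powr \<alpha>)"
  proof (induction k)
   case (Suc k)
   have "\<bar>I (r / 2 ^ k) - I (r / 2 ^ k / 2)\<bar> \<le> C1 * W * (r / 2 ^ k) powr \<alpha>"
    by (rule step) (use r in \<open>auto simp: divide_le_eq\<close>)
   then show ?case using Suc by (simp add: mult.commute)
  qed simp
  have th: "(r / 2 ^ j) powr \<alpha> = r powr \<alpha> * \<theta> ^ j" for j
  proof -
   have "\<theta> ^ j = \<theta> powr real j" using \<theta> by (simp add: powr_realpow)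
   also have "\<dots> = 2 powr (- (real j * \<alpha>))" unfolding \<theta>_def powr_powr by (simp add: mult.commute)
   also have "\<dots> = inverse ((2 powr real j) powr \<alpha>)" unfolding powr_powr powr_minus ..
   also have "(2::real) powr real j = 2 ^ j" by (simp add: powr_realpow)
   finally have e: "\<theta> ^ j = inverse ((2 ^ j) powr \<alpha>)" .
   have "(r / 2 ^ j) powr \<alpha> = r powr \<alpha> / (2 ^ j) powr \<alpha>" by (rule powr_divide)
   also have "\<dots> = r powr \<alpha> * inverse ((2 ^ j) powr \<alpha>)" by (rule divide_inverse)
   finally show ?thesis by (simp only: e)
  qed
  have "(\<Sum>j<k. C1 * W * (r / 2 ^ j) powr \<alpha>) = C1 * W * r powr \<alpha> * (\<Sum>j<k. \<theta> ^ j)"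
   unfolding th by (simp add: sum_distrib_left mult_ac)
  also have "\<dots> \<le> C1 * W * r powr \<alpha> * (1 / (1 - \<theta>))"
  proof (rule mult_left_mono)
   have "(\<Sum>j<k. \<theta> ^ j) \<le> (\<Sum>j. \<theta> ^ j)" using \<theta> by (intro sum_le_suminf) (auto intro!: summable_geometric)
   then show "(\<Sum>j<k. \<theta> ^ j) \<le> 1 / (1 - \<theta>)" using \<theta> by (simp add: suminf_geometric)
  qed (use C1 W in simp)
  finally have d: "\<bar>I r - I (r / 2 ^ k)\<bar> \<le> C1 * r powr \<alpha> / (1 - \<theta>) * W" using tel by (simp add: mult_ac)
  have Ir: "\<bar>I r\<bar> \<le> (Z / r) ^ ?m * ((2 * r) ^ ?m + 1) * W"
  proof -
   have s: "0 < r \<and> r \<le> r" "r \<le> r" using r by auto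
   have li: "integrable (lebesgue_on (cube x r)) u" by (rule Lp_integrable_compact(1)[OF Lu compact_cbox sub U p1(1) W])
   have "\<bar>I r\<bar> \<le> (Z / r) ^ ?m * (LINT y|lebesgue_on (cube x r). \<bar>u y\<bar>)" unfolding I_def
    by (rule local_mult_integrable(2)[OF li compact_cbox sub U])
     (use kern_bound[where \<sigma>="\<lambda>_. r" and s=r and r=r and x=x, OF s r] in auto)
   also have "(LINT y|lebesgue_on (cube x r). \<bar>u y\<bar>) \<le> W * measure lebesgue (cube x r) + W powr (1 - p) * (LINT y|lebesgue_on U. \<bar>u y\<bar> powr p)"
    by (rule Lp_integrable_compact(2)[OF Lu compact_cbox sub U p1(1) W])
   also have "\<dots> \<le> W * (2 * r) ^ ?m + W powr (1 - p) * W powr p"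
    using measure_cube[of r x] r nu by (simp add: mult_left_mono)
   also have "\<dots> = ((2 * r) ^ ?m + 1) * W" using W by (simp add: algebra_simps flip: powr_add)
   finally show ?thesis using Z_pos r by (simp add: mult_left_mono mult.assoc)
  qed
  show "\<bar>LINT y|lebesgue_on U. u y * kern (\<lambda>_. r / 2 ^ k) x y\<bar> \<le> C * W"
   using d Ir unfolding I_def C_def distrib_right by linarith
 qed
qed

definition kmass :: "'a::euclidean_space itself => real" where
 "kmass _ = (LBINT z. kern (\<lambda>_. 1) (0::'a) z)"

lemma kern_scale: "0 < s ==> kern (\<lambda>_. s) (x::'a::euclidean_space) y = kern (\<lambda>_. 1) 0 ((1 / s) *\<^sub>R (y - x)) / s ^ DIM('a)"
 unfolding kern_def tensor_def ker_def by (simp add: inner_diff_left prod_dividef)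

lemma kern1:
 "continuous_on UNIV (kern (\<lambda>_. 1) (0::'a::euclidean_space))" "\<And>z. 0 \<le> kern (\<lambda>_. 1) (0::'a) z"
 "\<And>z. kern (\<lambda>_. 1) (0::'a) z \<le> Z ^ DIM('a)" "\<And>z. z \<notin> cube (0::'a) 1 ==> kern (\<lambda>_. 1) 0 z = 0"
proof -
 note k = kern_bound[where \<sigma>="\<lambda>_. 1" and s=1 and r=1 and x="0::'a"]
 show "continuous_on UNIV (kern (\<lambda>_. 1) (0::'a))" "\<And>z. z \<notin> cube (0::'a) 1 ==> kern (\<lambda>_. 1) 0 z = 0" using k by auto
 show nn: "0 \<le> kern (\<lambda>_. 1) (0::'a) z" for z unfolding kern_def tensor_def by (intro prod_nonneg) (auto intro: ker_bounds)
 show "kern (\<lambda>_. 1) (0::'a) z \<le> Z ^ DIM('a)" for z using k(2)[of z] nn[of z] by simp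
qed

lemma kmass_pos: "0 < kmass TYPE('a::euclidean_space)"
proof -
 let ?k = "kern (\<lambda>_. 1) (0::'a)"
 have m: "?k \<in> borel_measurable borel" using kern1(1) by (rule borel_measurable_continuous_onI)
 have i: "integrable lborel ?k"
  by (rule integrable_bounded_support[OF m, of "Z ^ DIM('a)" "cube 0 1"]) (use kern1[where 'a='a] in auto)
 have pos: "0 < ?k z" if "z \<in> box (- One) One" for z
  unfolding kern_def tensor_def ker_def using that
  by (intro prod_pos) (auto simp: mem_box abs_less_iff intro!: \<zeta>_pos)
 have "0 \<le> kmass TYPE('a)" unfolding kmass_def using kern1(2) by (intro integral_nonneg_AE) auto
 moreover have "kmass TYPE('a) \<noteq> 0"
 proof
  assume "kmass TYPE('a) = 0"
  moreover have "AE z in lborel. 0 \<le> ?k z" by (intro AE_I2 kern1(2))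
  ultimately have "AE z in lborel. ?k z = 0" unfolding kmass_def using integral_nonneg_eq_0_iff_AE[OF i] by blast
  then have "AE z in lborel. z \<notin> box (- One) (One::'a)" by eventually_elim (use pos in force)
  then have "emeasure lborel (box (- One) (One::'a)) = 0"
   by (subst (asm) AE_iff_measurable[OF _ refl]) auto
  moreover have "emeasure lborel (box (- One) (One::'a)) = ennreal (\<Prod>b\<in>(Basis::'a set). 2)"
  proof -
   have "(\<Prod>b\<in>Basis. (One - - One :: 'a) \<bullet> b) = (\<Prod>b\<in>(Basis::'a set). 2)"
    by (rule prod.cong) (auto simp: inner_add_left)
   then show ?thesis by (subst emeasure_lborel_box) auto
  qed
  ultimately show False by simp
 qed
 ultimately show ?thesis by simp
qed

lemma kern_integral_center:
 fixes y :: "'a::euclidean_space"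
 assumes s: "0 < s"
 shows "(LBINT x. kern (\<lambda>_. s) x y) = kmass TYPE('a)"
proof -
 have m: "(\<lambda>z. kern (\<lambda>_. 1) (0::'a) z) \<in> borel_measurable borel" using kern1(1) by (rule borel_measurable_continuous_onI)
 have mk: "(\<lambda>x. kern (\<lambda>_. s) x y) \<in> borel_measurable borel" unfolding kern_scale[OF s] using m by measurable
 have "(LBINT x. kern (\<lambda>_. s) x y) =
   (\<integral>x. kern (\<lambda>_. s) x y \<partial>density (distr lborel borel (\<lambda>z. y + (- s) *\<^sub>R z)) (\<lambda>_. ennreal (\<bar>- s\<bar> ^ DIM('a))))"
  using lborel_affine[of "- s" y] s by simp
 also have "\<dots> = (\<integral>x. (\<bar>- s\<bar> ^ DIM('a)) *\<^sub>R kern (\<lambda>_. s) x y \<partial>distr lborel borel (\<lambda>z. y + (- s) *\<^sub>R z))"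
  using mk by (intro integral_density) auto
 also have "\<dots> = (LBINT z. (\<bar>- s\<bar> ^ DIM('a)) *\<^sub>R kern (\<lambda>_. s) (y + (- s) *\<^sub>R z) y)"
  using mk by (intro integral_distr) auto
 also have "\<dots> = (LBINT z. kern (\<lambda>_. 1) (0::'a) z)"
  unfolding kern_scale[OF s] using s by (intro Bochner_Integration.integral_cong) auto
 finally show ?thesis unfolding kmass_def .
qed

text \<open>
 Integrating the averages against a Lipschitz function \<open>g\<close> and moving the kernel
 onto \<open>g\<close> recovers the integral of \<open>f g\<close> up to an error proportional
 to the scale.
\<close>

lemma lipschitz_test:
 fixes f g :: "'a::euclidean_space => real"
 assumes f: "integrable lborel f" and r: "0 < r"
  and g: "g \<in> borel_measurable borel" "\<And>x. 0 \<le> g x" "\<And>x. g x \<le> 1" "\<And>x y. \<bar>g x - g y\<bar> \<le> L * dist x y"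
  and K: "bounded K" "\<And>x. x \<notin> K ==> g x = 0"
  and bd: "\<And>x k. x \<in> K ==> (LBINT y. f y * kern (\<lambda>_. r / 2 ^ k) x y) \<le> M"
 shows "kmass TYPE('a) * (LBINT y. f y * g y) \<le> M * (LBINT x. g x)"
proof -
 let ?c = "kmass TYPE('a)"
 have gi: "integrable lborel g" by (rule integrable_bounded_support[OF g(1) _ K(2) K(1), of 1]) (use g in auto)
 have fm [measurable]: "f \<in> borel_measurable borel" using borel_measurable_integrable[OF f] by simp
 note [measurable] = g(1)
 have km [measurable]: "(\<lambda>z. kern (\<lambda>_. 1) (0::'a) z) \<in> borel_measurable borel" using kern1(1) by (rule borel_measurable_continuous_onI)
 have L: "0 \<le> L"
 proof -
  obtain b :: 'a where "b \<in> Basis" using nonempty_Basis by blast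
  then show ?thesis using g(4)[of b 0] abs_ge_zero[of "g b - g 0"] by (simp add: dist_norm norm_Basis)
 qed
 have est: "?c * (LBINT y. f y * g y) - (LBINT y. \<bar>f y\<bar>) * (L * (real DIM('a) * s) * ?c) \<le> M * (LBINT x. g x)"
  if s: "s = r / 2 ^ k" for s k
 proof -
  have s0: "0 < s" using r s by simp
  define \<kappa> where "\<kappa> x y = kern (\<lambda>_. s) (x::'a) y" for x y
  have \<kappa>0: "0 \<le> \<kappa> x y" "\<kappa> x y \<le> (Z / s) ^ DIM('a)" for x y
   unfolding \<kappa>_def kern_scale[OF s0] using kern1(2,3)[where 'a='a] s0 by (auto simp: power_divide divide_right_mono)
  have \<kappa>m [measurable]: "(\<lambda>z. \<kappa> (fst z) (snd z)) \<in> borel_measurable (borel \<Otimes>\<^sub>M borel)"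
   "\<And>x. \<kappa> x \<in> borel_measurable borel" "\<And>y. (\<lambda>x. \<kappa> x y) \<in> borel_measurable borel"
   unfolding \<kappa>_def kern_scale[OF s0] by measurable
  have near: "dist x y \<le> real DIM('a) * s" if "\<kappa> x y \<noteq> 0" for x y
  proof -
   have "(1 / s) *\<^sub>R (y - x) \<in> cube (0::'a) 1" using kern1(4) that unfolding \<kappa>_def kern_scale[OF s0] by force
   then have "\<bar>(y - x) \<bullet> b\<bar> \<le> s" if "b \<in> Basis" for b using that s0 unfolding mem_cube by (auto simp: abs_mult divide_le_eq)
   then have "(\<Sum>b\<in>Basis. \<bar>(y - x) \<bullet> b\<bar>) \<le> (\<Sum>b\<in>(Basis::'a set). s)" by (rule sum_mono)
   then show ?thesis using norm_le_l1[of "y - x"] by (simp add: dist_norm norm_minus_commute)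
  qed
  have \<kappa>i: "integrable lborel (\<lambda>x. \<kappa> x y)" for y
   by (rule integrable_bounded_support[of _ "(Z / s) ^ DIM('a)" "cball y (real DIM('a) * s)"])
    (use \<kappa>0 near in \<open>force simp: dist_commute\<close>)+
  have fi: "integrable lborel (\<lambda>y. f y * \<kappa> x y)" for x
   by (rule Bochner_Integration.integrable_bound[where f="\<lambda>y. (Z / s) ^ DIM('a) * f y"])
    (use f \<kappa>0 Z_pos s0 in \<open>auto simp: abs_mult mult.commute intro!: mult_left_mono\<close>)
  have int2: "integrable (lborel \<Otimes>\<^sub>M lborel) (\<lambda>z. g (fst z) * (f (snd z) * \<kappa> (fst z) (snd z)))"
  proof (rule Bochner_Integration.integrable_bound[where f="\<lambda>z. (Z / s) ^ DIM('a) * (g (fst z) * f (snd z))"])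
   show "integrable (lborel \<Otimes>\<^sub>M lborel) (\<lambda>z. (Z / s) ^ DIM('a) * (g (fst z) * f (snd z)))"
    using lborel_pair.integrable_times[OF gi f] by simp
   show "AE z in lborel \<Otimes>\<^sub>M lborel. norm (g (fst z) * (f (snd z) * \<kappa> (fst z) (snd z))) \<le> norm ((Z / s) ^ DIM('a) * (g (fst z) * f (snd z)))"
   proof (rule AE_I2)
    fix z :: "'a \<times> 'a"
    have "\<bar>g (fst z) * f (snd z)\<bar> * \<kappa> (fst z) (snd z) \<le> \<bar>g (fst z) * f (snd z)\<bar> * (Z / s) ^ DIM('a)"
     using \<kappa>0 by (intro mult_left_mono) auto
    then show "norm (g (fst z) * (f (snd z) * \<kappa> (fst z) (snd z))) \<le> norm ((Z / s) ^ DIM('a) * (g (fst z) * f (snd z)))"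
     using \<kappa>0(1)[of "fst z" "snd z"] Z_pos s0 by (simp add: abs_mult mult_ac)
   qed
  qed measurable
  have fub: "(LBINT x. g x * (LBINT y. f y * \<kappa> x y)) = (LBINT y. f y * (LBINT x. g x * \<kappa> x y))"
  proof -
   have "(LBINT y. (LBINT x. g x * (f y * \<kappa> x y))) = (LBINT x. (LBINT y. g x * (f y * \<kappa> x y)))"
    by (rule lborel_pair.Fubini_integral) (use int2 in \<open>simp add: case_prod_beta'\<close>)
   moreover have "(\<lambda>y. (LBINT x. g x * (f y * \<kappa> x y))) = (\<lambda>y. f y * (LBINT x. g x * \<kappa> x y))"
    by (simp add: mult.left_commute)
   ultimately show ?thesis by simp
  qed
  have gk: "integrable lborel (\<lambda>x. g x * \<kappa> x y)" for y
   by (rule Bochner_Integration.integrable_bound[OF \<kappa>i[of y]]) (use \<kappa>0 g in \<open>auto simp: abs_mult mult_left_le_one_le\<close>)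
  have dev: "\<bar>(LBINT x. g x * \<kappa> x y) - ?c * g y\<bar> \<le> L * (real DIM('a) * s) * ?c" for y
  proof -
   have "(LBINT x. g x * \<kappa> x y) - ?c * g y = (LBINT x. g x * \<kappa> x y - g y * \<kappa> x y)"
    using gk \<kappa>i kern_integral_center[OF s0, of y] by (simp add: \<kappa>_def mult.commute)
   also have "\<bar>\<dots>\<bar> \<le> (LBINT x. \<bar>g x * \<kappa> x y - g y * \<kappa> x y\<bar>)" by (rule integral_abs_bound)
   also have "\<dots> \<le> (LBINT x. L * (real DIM('a) * s) * \<kappa> x y)"
   proof (rule integral_mono)
    show "\<bar>g x * \<kappa> x y - g y * \<kappa> x y\<bar> \<le> L * (real DIM('a) * s) * \<kappa> x y" for x
    proof (cases "\<kappa> x y = 0")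
     case False
     have "\<bar>g x - g y\<bar> \<le> L * (real DIM('a) * s)"
      using g(4)[of x y] near[OF False] L by (meson mult_left_mono order_trans)
     then show ?thesis using \<kappa>0(1)[of x y] by (simp add: abs_mult mult_right_mono flip: left_diff_distrib)
    qed simp
   qed (use gk \<kappa>i in auto)
   also have "\<dots> = L * (real DIM('a) * s) * ?c" using kern_integral_center[OF s0, of y] by (simp add: \<kappa>_def)
   finally show ?thesis .
  qed
  have im: "integrable lborel (\<lambda>y. f y * (LBINT x. g x * \<kappa> x y))"
  proof -
   have "integrable lborel (\<lambda>y. \<integral>x. g x * (f y * \<kappa> x y) \<partial>lborel)"
    using lborel_pair.integrable_snd[of "\<lambda>x y. g x * (f y * \<kappa> x y)"] int2 by (simp add: case_prod_beta')
   then show ?thesis by (simp add: mult.left_commute)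
  qed
  have fg: "integrable lborel (\<lambda>y. f y * g y)"
   by (rule Bochner_Integration.integrable_bound[OF f]) (use g in \<open>auto simp: abs_mult mult_right_le_one_le\<close>)
  define E where "E = L * (real DIM('a) * s) * ?c"
  have lin: "integrable lborel (\<lambda>y. ?c * (f y * g y) - \<bar>f y\<bar> * E)"
   using fg integrable_abs[OF f] by (intro Bochner_Integration.integrable_diff integrable_mult_right integrable_mult_left)
  have "?c * (LBINT y. f y * g y) - (LBINT y. \<bar>f y\<bar>) * E = (LBINT y. ?c * (f y * g y) - \<bar>f y\<bar> * E)"
   using fg integrable_abs[OF f] by (subst Bochner_Integration.integral_diff) auto
  also have "\<dots> \<le> (LBINT y. f y * (LBINT x. g x * \<kappa> x y))"
  proof (rule integral_mono[OF lin im])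
   fix y
   have "f y * (?c * g y - (LBINT x. g x * \<kappa> x y)) \<le> \<bar>f y * (?c * g y - (LBINT x. g x * \<kappa> x y))\<bar>"
    by (rule abs_ge_self)
   also have "\<dots> = \<bar>f y\<bar> * \<bar>?c * g y - (LBINT x. g x * \<kappa> x y)\<bar>" by (rule abs_mult)
   also have "\<dots> \<le> \<bar>f y\<bar> * E"
    using dev[of y] unfolding E_def by (intro mult_left_mono) (auto simp: abs_minus_commute)
   finally show "?c * (f y * g y) - \<bar>f y\<bar> * E \<le> f y * (LBINT x. g x * \<kappa> x y)"
    by (simp add: right_diff_distrib mult.left_commute)
  qed
  also have "\<dots> = (LBINT x. g x * (LBINT y. f y * \<kappa> x y))" by (rule fub[symmetric])
  also have "\<dots> \<le> (LBINT x. g x * M)"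
  proof (rule integral_mono)
   have "integrable lborel (\<lambda>x. \<integral>y. g x * (f y * \<kappa> x y) \<partial>lborel)"
    using lborel_pair.integrable_fst[of "\<lambda>x y. g x * (f y * \<kappa> x y)"] int2 by (simp add: case_prod_beta')
   then show "integrable lborel (\<lambda>x. g x * (LBINT y. f y * \<kappa> x y))" by simp
   show "g x * (LBINT y. f y * \<kappa> x y) \<le> g x * M" for x
    using bd[of x k] K(2)[of x] g(2)[of x] unfolding \<kappa>_def s by (cases "x \<in> K") (auto intro: mult_left_mono)
  qed (use gi in simp)
  also have "\<dots> = M * (LBINT x. g x)" by (simp add: mult.commute)
  finally show ?thesis unfolding E_def .
 qed
 have "(\<lambda>k. ?c * (LBINT y. f y * g y) - (LBINT y. \<bar>f y\<bar>) * (L * (real DIM('a) * (r * (1/2) ^ k)) * ?c)) \<longlonglongrightarrow>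
   ?c * (LBINT y. f y * g y) - (LBINT y. \<bar>f y\<bar>) * (L * (real DIM('a) * (r * 0)) * ?c)"
  by (intro tendsto_intros LIMSEQ_power_zero) simp
 then have lim: "(\<lambda>k. ?c * (LBINT y. f y * g y) - (LBINT y. \<bar>f y\<bar>) * (L * (real DIM('a) * (r * (1/2) ^ k)) * ?c)) \<longlonglongrightarrow>
   ?c * (LBINT y. f y * g y)" by simp
 have "r * (1/2) ^ k = r / 2 ^ k" for k by (simp add: power_one_over)
 then show ?thesis
  by (intro LIMSEQ_le_const2[OF lim] exI[of _ 0] allI impI est)
qed

end

section \<open>From averages to the interior Sobolev bound\<close>

lemma compact_neighbourhood:
 fixes C :: "'a::euclidean_space set"
 assumes "compact C" "open U" "C \<subseteq> U" "C \<noteq> {}"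
 obtains r L where "0 < r" "compact L" "L \<subseteq> U" "\<And>x. infdist x C \<le> r ==> cube x r \<subseteq> L"
proof -
 obtain e where e: "0 < e" "(\<Union>x\<in>C. cball x e) \<subseteq> U"
  using compact_subset_open_imp_cball_epsilon_subset[OF assms(1-3)] by metis
 define L where "L = {x. infdist x C \<le> e}"
 define r where "r = e / (real DIM('a) + 1)"
 have Lc: "compact L" unfolding L_def using compact_infdist_le[OF assms(4,1) e(1)] .
 have LU: "L \<subseteq> U"
 proof
  fix x assume x: "x \<in> L"
  obtain y where "y \<in> C" "infdist x C = dist x y"
   using infdist_attains_inf[OF compact_imp_closed[OF assms(1)] assms(4)] by metis
  then have "x \<in> cball y e" using x unfolding L_def by (simp add: dist_commute)
  then show "x \<in> U" using e(2) \<open>y \<in> C\<close> by blast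
 qed
 have "cube x r \<subseteq> L" if x: "infdist x C \<le> r" for x
 proof
  fix y assume "y \<in> cube x r"
  then have "(\<Sum>b\<in>Basis. \<bar>(y - x) \<bullet> b\<bar>) \<le> (\<Sum>b\<in>(Basis::'a set). r)"
   unfolding mem_cube by (intro sum_mono) (simp add: inner_diff_left)
  then have "dist y x \<le> real DIM('a) * r" using norm_le_l1[of "y - x"] by (simp add: dist_norm)
  then have "infdist y C \<le> r + real DIM('a) * r" using infdist_triangle[of y C x] x by linarith
  also have "\<dots> = (real DIM('a) + 1) * r" by (simp add: algebra_simps)
  also have "\<dots> = e" unfolding r_def by simp
  finally show "y \<in> L" unfolding L_def by simp
 qed
 moreover have "0 < r" unfolding r_def using e by simp
 ultimately show ?thesis using that Lc LU by blast
qed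

context kernel_profile
begin

text \<open>
 The indicator of a compact set is a limit of Lipschitz functions, so the inequality between
 integrals against Lipschitz functions extends to compact sets, and by regularity it holds
 almost everywhere.
\<close>

lemma ae_le_of_averages:
 fixes f :: "'a::euclidean_space => real"
 assumes f: "integrable lborel f" and r: "0 < r" "0 < r0" and C: "compact C" "C \<noteq> {}"
  and bd: "\<And>x k. infdist x C \<le> r0 ==> (LBINT y. f y * kern (\<lambda>_. r / 2 ^ k) x y) \<le> M"
 shows "AE x in lborel. x \<in> C \<longrightarrow> kmass TYPE('a) * f x \<le> M"
proof -
 let ?c = "kmass TYPE('a)"
 have fm [measurable]: "f \<in> borel_measurable borel" using borel_measurable_integrable[OF f] by simp
 have Cb [measurable]: "C \<in> sets borel" using C borel_compact by blast
 define E where "E = {x \<in> C. M < ?c * f x}"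
 have Eb: "E \<in> sets borel" unfolding E_def by measurable
 have bE: "bounded E" unfolding E_def using C compact_imp_bounded bounded_subset by (metis (no_types, lifting) mem_Collect_eq subsetI)
 have Elm: "E \<in> lmeasurable" using Eb bE by (intro bounded_set_imp_lmeasurable) auto
 have "emeasure lebesgue E = 0"
 proof (rule ccontr)
  assume "emeasure lebesgue E \<noteq> 0"
  then have Epos: "0 < measure lebesgue E" using Elm emeasure_eq_measure2[OF Elm] measure_nonneg[of lebesgue E] by (metis ennreal_0 less_eq_real_def)
  obtain T where T: "closed T" "T \<subseteq> E" "E - T \<in> lmeasurable" "emeasure lebesgue (E - T) < ennreal (measure lebesgue E)"
   using sets_lebesgue_inner_closed[OF fmeasurableD[OF Elm] Epos] by metis
  have Tne: "T \<noteq> {}" using T(4) emeasure_eq_measure2[OF Elm] by auto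
  have Tc: "compact T" using T bE by (meson bounded_subset compact_eq_bounded_closed)
  have Tb [measurable]: "T \<in> sets borel" using Tc borel_compact by blast
  have Tpos: "emeasure lborel T \<noteq> 0"
  proof
   assume "emeasure lborel T = 0"
   then have "T \<in> null_sets lebesgue" using Tb null_sets_completionI[of T lborel] by (auto simp: null_sets_def)
   then have "emeasure lebesgue (E - T) = emeasure lebesgue E"
    using emeasure_Diff_null_set fmeasurableD[OF Elm] by blast
   then show False using T(4) emeasure_eq_measure2[OF Elm] by simp
  qed
  define g where "g n x = max 0 (1 - (real (Suc n) / r0) * infdist x T)" for n x
  define K where "K = {x. infdist x T \<le> r0}"
  have Kc: "compact K" unfolding K_def using compact_infdist_le[OF Tne Tc r(2)] .
  have gc: "continuous_on UNIV (g n)" for n unfolding g_def by (intro continuous_intros)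
  have gm [measurable]: "g n \<in> borel_measurable borel" for n using gc by (rule borel_measurable_continuous_onI)
  have g01: "0 \<le> g n x" "g n x \<le> 1" for n x unfolding g_def using r infdist_nonneg[of x T] by auto
  have gL: "\<bar>g n x - g n y\<bar> \<le> (real (Suc n) / r0) * dist x y" for n x y
  proof -
   have gen: "\<bar>max 0 (1 - a) - max 0 (1 - b)\<bar> \<le> \<bar>a - b\<bar>" for a b :: real by linarith
   have "\<bar>g n x - g n y\<bar> \<le> \<bar>(real (Suc n) / r0) * infdist x T - (real (Suc n) / r0) * infdist y T\<bar>"
    unfolding g_def using gen by blast
   also have "\<dots> = (real (Suc n) / r0) * \<bar>infdist x T - infdist y T\<bar>"
    unfolding right_diff_distrib[symmetric] abs_mult using r by simp
   also have "\<dots> \<le> (real (Suc n) / r0) * dist x y"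
    using r infdist_triangle_abs[of x T y] by (intro mult_left_mono) auto
   finally show ?thesis .
  qed
  have gK: "g n x = 0" if "x \<notin> K" for n x
  proof -
   have "1 \<le> (real (Suc n) / r0) * r0" using r by simp
   also have "\<dots> \<le> (real (Suc n) / r0) * infdist x T" using that r unfolding K_def by (intro mult_left_mono) auto
   finally show ?thesis unfolding g_def by simp
  qed
  have ineq: "?c * (LBINT y. f y * g n y) \<le> M * (LBINT x. g n x)" for n
  proof (rule lipschitz_test[OF f r(1) gm g01 gL compact_imp_bounded[OF Kc] gK])
   fix x k assume x: "x \<in> K"
   have "infdist x C \<le> infdist x T" using T(2) Tne unfolding E_def by (intro infdist_mono) auto
   then show "(LBINT y. f y * kern (\<lambda>_. r / 2 ^ k) x y) \<le> M" using x bd unfolding K_def by force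
  qed
  have lim: "(\<lambda>n. g n x) \<longlonglongrightarrow> indicat_real T x" for x
  proof (cases "x \<in> T")
   case True then show ?thesis unfolding g_def by simp
  next
   case False
   then have d: "0 < infdist x T" using infdist_pos_not_in_closed[OF T(1) Tne] by blast
   obtain N where N: "r0 / infdist x T < real N" using reals_Archimedean2 by blast
   have "g n x = 0" if "n \<ge> N" for n
   proof -
    have "r0 / infdist x T \<le> real (Suc n)" using N that by linarith
    then have "1 \<le> (real (Suc n) / r0) * infdist x T" using d r by (simp add: field_simps)
    then show ?thesis unfolding g_def by simp
   qed
   then have "\<forall>\<^sub>F n in sequentially. g n x = indicat_real T x" using False by (intro eventually_sequentiallyI[of N]) auto
   then show ?thesis by (rule tendsto_eventually)
  qed
  have Kb [measurable]: "K \<in> sets borel" using Kc borel_compact by blast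
  have Ki: "integrable lborel (indicat_real K)"
   by (rule integrable_bounded_support[of _ 1 K]) (use Kc in \<open>auto intro: compact_imp_bounded\<close>)
  have l1: "(\<lambda>n. \<integral>x. g n x \<partial>lborel) \<longlonglongrightarrow> (LBINT x. indicat_real T x)"
   by (rule integral_dominated_convergence[where w="indicat_real K"])
    (use lim g01 gK Ki in \<open>auto simp: indicator_def\<close>)
  have l2: "(\<lambda>n. \<integral>x. f x * g n x \<partial>lborel) \<longlonglongrightarrow> (LBINT x. f x * indicat_real T x)"
   by (rule integral_dominated_convergence[where w="\<lambda>x. \<bar>f x\<bar>"])
    (use lim g01 f in \<open>auto simp: abs_mult mult_right_le_one_le intro!: tendsto_mult AE_I2\<close>)
  have le: "?c * (LBINT x. f x * indicat_real T x) \<le> M * (LBINT x. indicat_real T x)"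
   by (rule LIMSEQ_le[OF tendsto_mult[OF tendsto_const l2] tendsto_mult[OF tendsto_const l1]]) (use ineq in auto)
  have i1: "integrable lborel (\<lambda>x. f x * indicat_real T x)"
   using integrable_mult_indicator[where A=T and M=lborel and f=f] f Tb by (simp add: mult.commute)
  have i2: "integrable lborel (indicat_real T)"
   by (rule integrable_bounded_support[of _ 1 T]) (use Tc in \<open>auto intro: compact_imp_bounded\<close>)
  define w where "w x = indicat_real T x * (?c * f x - M)" for x
  have weq: "w = (\<lambda>x. ?c * (f x * indicat_real T x) - M * indicat_real T x)" unfolding w_def by (auto simp: algebra_simps)
  have wi: "integrable lborel w" unfolding weq using i1 i2 by auto
  have w0: "0 \<le> w x" for x unfolding w_def using T(2) E_def by (auto simp: indicator_def)
  have "(LBINT x. w x) \<le> 0" unfolding weq using i1 i2 le by simp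
  then have "(LBINT x. w x) = 0" using Bochner_Integration.integral_nonneg[where M=lborel and f=w] w0 by (intro antisym) auto
  moreover have "AE x in lborel. 0 \<le> w x" using w0 by simp
  ultimately have "AE x in lborel. w x = 0" using integral_nonneg_eq_0_iff_AE[OF wi] by blast
  then have "AE x in lborel. x \<notin> T"
  proof eventually_elim
   case (elim x)
   then show ?case unfolding w_def using T(2) E_def by (auto simp: indicator_def)
  qed
  then have "emeasure lborel T = 0" by (subst (asm) AE_iff_measurable[OF _ refl]) auto
  then show False using Tpos by simp
 qed
 then have "E \<in> null_sets lborel" using Eb by (simp add: null_sets_def)
 then have "AE x in lborel. x \<notin> E" by (rule AE_not_in)
 then show ?thesis by eventually_elim (auto simp: E_def)
qed

lemma local_ae_bound:
 fixes u :: "'a::euclidean_space => real"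
 assumes U: "open U" and C: "compact C" "C \<noteq> {}" and r: "0 < r"
  and L: "compact L" "L \<subseteq> U" "\<And>x. infdist x C \<le> r ==> cube x r \<subseteq> L"
  and u: "integrable (lebesgue_on L) u"
  and bd: "\<And>x k. infdist x C \<le> r ==> \<bar>LINT y|lebesgue_on U. u y * kern (\<lambda>_. r / 2 ^ k) x y\<bar> \<le> M"
 shows "AE x in lebesgue. x \<in> C \<longrightarrow> kmass TYPE('a) * \<bar>u x\<bar> \<le> M"
proof -
 have Lm: "L \<in> sets lebesgue" and Um: "U \<in> sets lebesgue" using L U by (auto simp: borel_compact)
 have Li: "integrable lebesgue (\<lambda>y. indicat_real L y * u y)" using u Lm by (simp add: integrable_restrict_space)
 obtain f where f: "f \<in> borel_measurable lborel" "AE x in lborel. indicat_real L x * u x = f x"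
  using completion_ex_borel_measurable_real[OF borel_measurable_integrable[OF Li]] by blast
 have fL: "AE x in lebesgue. indicat_real L x * u x = f x" using f(2) by (rule AE_completion)
 have fm: "f \<in> borel_measurable lebesgue" using f(1) by (rule measurable_completion)
 have "integrable lebesgue f" using Li integrable_cong_AE[OF borel_measurable_integrable[OF Li] fm fL] by simp
 then have fi: "integrable lborel f" using f(1) by (simp add: integrable_completion)
 have avg: "(LBINT y. f y * kern (\<lambda>_. r / 2 ^ k) x y) = (LINT y|lebesgue_on U. u y * kern (\<lambda>_. r / 2 ^ k) x y)"
  if x: "infdist x C \<le> r" for x k
 proof -
  let ?k = "kern (\<lambda>_. r / 2 ^ k) x"
  have s: "0 < r / 2 ^ k \<and> r / 2 ^ k \<le> r" "0 < r / 2 ^ k" using r by (auto simp: divide_le_eq)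
  note k = kern_bound[where \<sigma>="\<lambda>_. r / 2 ^ k" and s=r and r="r / 2 ^ k" and x=x, OF s(1) order_refl s(2)]
  have kz: "?k y = 0" if "y \<notin> L" for y using k(3) L(3)[OF x] that by blast
  have km: "?k \<in> borel_measurable borel" using k(1) by (rule borel_measurable_continuous_onI)
  have kml: "?k \<in> borel_measurable lebesgue" using km by (intro measurable_completion) simp
  have "(LINT y|lebesgue_on U. u y * ?k y) = (LINT y|lebesgue. (indicat_real L y * u y) * ?k y)"
   using Um by (simp add: integral_restrict_space) (rule Bochner_Integration.integral_cong, use kz L(2) in \<open>auto simp: indicator_def\<close>)
  also have "\<dots> = (LINT y|lebesgue. f y * ?k y)"
   by (rule integral_cong_AE) (use fL borel_measurable_integrable[OF Li] fm kml in \<open>auto intro!: borel_measurable_times elim!: eventually_mono\<close>)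
  also have "\<dots> = (LBINT y. f y * ?k y)" using f(1) km by (intro integral_completion) auto
  finally show ?thesis by simp
 qed
 have "AE x in lborel. x \<in> C \<longrightarrow> kmass TYPE('a) * f x \<le> M"
  by (rule ae_le_of_averages[OF fi r r C]) (use avg bd in \<open>auto simp: abs_le_iff\<close>)
 moreover have "AE x in lborel. x \<in> C \<longrightarrow> kmass TYPE('a) * (- f x) \<le> M"
  by (rule ae_le_of_averages[where f="\<lambda>x. - f x", OF _ r r C]) (use fi avg bd in \<open>auto simp: abs_le_iff\<close>)
 ultimately have "AE x in lborel. x \<in> C \<longrightarrow> kmass TYPE('a) * \<bar>f x\<bar> \<le> M"
  by eventually_elim (auto simp: abs_if)
 then have "AE x in lebesgue. x \<in> C \<longrightarrow> kmass TYPE('a) * \<bar>f x\<bar> \<le> M" by (rule AE_completion)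
 with fL show ?thesis
 proof eventually_elim
  case (elim x)
  show ?case
  proof
   assume x: "x \<in> C"
   have "x \<in> cube x r" unfolding mem_cube using r by simp
   then have "x \<in> L" using L(3)[of x] x r by auto
   then show "kmass TYPE('a) * \<bar>u x\<bar> \<le> M" using elim x by simp
  qed
 qed
qed

end

lemma test_function_props:
 fixes \<phi> :: "'a::euclidean_space => real"
 assumes "test_function U \<phi>" "b \<in> Basis"
 obtains K B where "compact K" "K \<subseteq> U" "continuous_on UNIV \<phi>" "\<And>y. \<bar>\<phi> y\<bar> \<le> B" "\<And>y. y \<notin> K ==> \<phi> y = 0"
  "continuous_on UNIV (\<lambda>x. frechet_derivative \<phi> (at x) b)" "\<And>y. \<bar>frechet_derivative \<phi> (at y) b\<bar> \<le> B"
  "\<And>y. y \<notin> K ==> frechet_derivative \<phi> (at y) b = 0"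
proof -
 define K where "K = closure {x. \<phi> x \<noteq> 0}"
 have K: "compact K" "K \<subseteq> U" using assms unfolding test_function_def K_def by auto
 have t: "times_cont_diff k \<phi>" for k using assms unfolding test_function_def by auto
 have c1: "continuous_on UNIV \<phi>" using t[of 0] by simp
 have c2: "continuous_on UNIV (\<lambda>x. frechet_derivative \<phi> (at x) b)" using t[of "Suc 0"] assms(2) by simp
 have z1: "\<phi> y = 0" if "y \<notin> K" for y
 proof (rule ccontr)
  assume "\<phi> y \<noteq> 0"
  then have "y \<in> K" unfolding K_def by (intro subsetD[OF closure_subset]) simp
  then show False using that by simp
 qed
 have z2: "frechet_derivative \<phi> (at y) b = 0" if y: "y \<notin> K" for y
 proof -
  have "((\<lambda>_. 0) has_derivative (\<lambda>_. 0)) (at y)" by simp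
  then have "(\<phi> has_derivative (\<lambda>_. 0)) (at y)"
   by (rule has_derivative_transform_within_open[where s="- K"])
    (use y z1 K(1) in \<open>auto simp: compact_imp_closed open_Compl\<close>)
  from fun_cong[OF frechet_derivative_at[OF this], of b] show ?thesis by simp
 qed
 have bdd: "\<exists>B. \<forall>y. \<bar>\<psi> y\<bar> \<le> B" if "continuous_on UNIV \<psi>" "\<And>y. y \<notin> K ==> \<psi> y = 0" for \<psi> :: "'a => real"
 proof -
  have "bounded (\<psi> ` K)" using K that by (intro compact_imp_bounded compact_continuous_image) (auto intro: continuous_on_subset)
  then obtain B where "\<forall>y\<in>K. \<bar>\<psi> y\<bar> \<le> B" unfolding bounded_iff by auto
  have "\<bar>\<psi> y\<bar> \<le> max B 0" for y
  proof (cases "y \<in> K")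
   case True then show ?thesis using \<open>\<forall>y\<in>K. \<bar>\<psi> y\<bar> \<le> B\<close> by fastforce
  next
   case False then show ?thesis using that(2)[OF False] by simp
  qed
  then show ?thesis by blast
 qed
 obtain B1 where B1: "\<And>y. \<bar>\<phi> y\<bar> \<le> B1" using bdd[OF c1 z1] by blast
 obtain B2 where B2: "\<And>y. \<bar>frechet_derivative \<phi> (at y) b\<bar> \<le> B2" using bdd[OF c2 z2] by blast
 show ?thesis
  by (rule that[of K "max B1 B2", OF K c1 _ z1 c2 _ z2]) (use B1 B2 in \<open>auto simp: le_max_iff_disj\<close>)
qed

lemma weak_gradient_diff:
 fixes u v :: "'a::euclidean_space => real"
 assumes U: "open U" and u: "weak_gradient U u G" and v: "weak_gradient U v H"
 shows "weak_gradient U (\<lambda>x. u x - v x) (\<lambda>x. G x - H x)"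
proof -
 have "(LINT x|lebesgue_on U. (u x - v x) * frechet_derivative \<phi> (at x) b) = - (LINT x|lebesgue_on U. ((G x - H x) \<bullet> b) * \<phi> x)"
  if b: "b \<in> Basis" and \<phi>: "test_function U \<phi>" for b \<phi>
 proof -
  obtain K B where K: "compact K" "K \<subseteq> U" and p: "continuous_on UNIV \<phi>" "\<And>y. \<bar>\<phi> y\<bar> \<le> B" "\<And>y. y \<notin> K ==> \<phi> y = 0"
   and q: "continuous_on UNIV (\<lambda>x. frechet_derivative \<phi> (at x) b)" "\<And>y. \<bar>frechet_derivative \<phi> (at y) b\<bar> \<le> B"
  "\<And>y. y \<notin> K ==> frechet_derivative \<phi> (at y) b = 0" by (rule test_function_props[OF \<phi> b]) blast
  have li: "integrable (lebesgue_on K) u" "integrable (lebesgue_on K) v"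
   "integrable (lebesgue_on K) (\<lambda>x. G x \<bullet> b)" "integrable (lebesgue_on K) (\<lambda>x. H x \<bullet> b)"
   using u v K b unfolding weak_gradient_def locally_integrable_def by auto
  have i: "integrable (lebesgue_on U) (\<lambda>x. u x * frechet_derivative \<phi> (at x) b)" "integrable (lebesgue_on U) (\<lambda>x. v x * frechet_derivative \<phi> (at x) b)"
   "integrable (lebesgue_on U) (\<lambda>x. (G x \<bullet> b) * \<phi> x)" "integrable (lebesgue_on U) (\<lambda>x. (H x \<bullet> b) * \<phi> x)"
   by (rule local_mult_integrable(1)[OF _ K U], rule li, (rule p q, assumption?)+)+
  have "(LINT x|lebesgue_on U. u x * frechet_derivative \<phi> (at x) b) = - (LINT x|lebesgue_on U. (G x \<bullet> b) * \<phi> x)"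
   "(LINT x|lebesgue_on U. v x * frechet_derivative \<phi> (at x) b) = - (LINT x|lebesgue_on U. (H x \<bullet> b) * \<phi> x)"
   using u v b \<phi> unfolding weak_gradient_def by auto
  then show ?thesis using i by (simp add: left_diff_distrib inner_diff_left)
 qed
 moreover have "locally_integrable U (\<lambda>x. u x - v x)" "\<And>b. b \<in> Basis ==> locally_integrable U (\<lambda>x. (G x - H x) \<bullet> b)"
  using u v unfolding weak_gradient_def locally_integrable_def by (auto simp: inner_diff_left)
 ultimately show ?thesis unfolding weak_gradient_def by blast
qed

text \<open>
 The difference of two weak gradients has vanishing averages, hence vanishes by the same
 argument that bounds functions by their averages.
\<close>

lemma weak_gradient_unique:
 fixes u :: "'a::euclidean_space => real"
 assumes U: "open U" and wg: "weak_gradient U u G" "weak_gradient U u H" and b: "b \<in> Basis"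
 shows "AE x in lebesgue_on U. G x \<bullet> b = H x \<bullet> b"
proof -
 obtain A \<zeta> Z where "kernel_profile A \<zeta> Z"
  using smooth_step_exists kernel_profile.intro by metis
 then interpret kernel_profile A \<zeta> Z .
 define D where "D x = (G x - H x) \<bullet> b" for x
 have wd: "weak_gradient U (\<lambda>x. u x - u x) (\<lambda>x. G x - H x)" by (rule weak_gradient_diff[OF U wg])
 have D0: "(LINT y|lebesgue_on U. D y * \<phi> y) = 0" if "test_function U \<phi>" for \<phi>
  using wd b that unfolding weak_gradient_def D_def by simp
 have loc: "AE x in lebesgue. x \<in> C \<longrightarrow> D x = 0" if C: "compact C" "C \<subseteq> U" for C
 proof (cases "C = {}")
  case False
  obtain r L where r: "0 < r" and L: "compact L" "L \<subseteq> U" "\<And>x. infdist x C \<le> r ==> cube x r \<subseteq> L"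
   using compact_neighbourhood[OF C(1) U C(2) False] by metis
  have uL: "integrable (lebesgue_on L) D" using wd b L unfolding weak_gradient_def locally_integrable_def D_def by blast
  have "AE x in lebesgue. x \<in> C \<longrightarrow> kmass TYPE('a) * \<bar>D x\<bar> \<le> 0"
  proof (rule local_ae_bound[OF U C(1) False r L(1,2) L(3) uL])
   fix x k assume x: "infdist x C \<le> r"
   have s: "0 < r / 2 ^ k" "r / 2 ^ k \<le> r" using r by (auto simp: divide_le_eq)
   have "test_function U (kern (\<lambda>_. r / 2 ^ k) x)" unfolding kern_def
    by (rule tensor_test_function[where x=x and s=r]) (use ker_smooth ker_bounds(3)[OF s(1)] s(2) subset_trans[OF L(3)[OF x] L(2)] in \<open>auto\<close>)
   then show "\<bar>LINT y|lebesgue_on U. D y * kern (\<lambda>_. r / 2 ^ k) x y\<bar> \<le> 0" using D0 by simp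
  qed
  then show ?thesis
   by eventually_elim (use kmass_pos[where 'a='a] in \<open>auto simp: mult_le_0_iff\<close>)
 qed simp
 obtain C :: "nat => 'a set" where C: "\<And>n. compact (C n)" "\<And>n. C n \<subseteq> U" "\<Union>(range C) = U"
  by (rule open_Union_compact_subsets[OF U]) (rule that; assumption)
 have "AE x in lebesgue. \<forall>n. x \<in> C n \<longrightarrow> D x = 0" using loc[OF C(1,2)] unfolding AE_all_countable by blast
 then have "AE x in lebesgue. x \<in> U \<longrightarrow> D x = 0" by eventually_elim (use C(3) in blast)
 then show ?thesis using U by (subst AE_restrict_space_iff) (auto simp: D_def inner_diff_left elim!: eventually_mono)
qed

lemma Lp_on_diff:
 assumes p: "1 \<le> p" and f: "Lp_on p S f" and g: "Lp_on p S g"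
 shows "Lp_on p S (\<lambda>x. f x - g x)"
proof -
 have m: "f \<in> borel_measurable (lebesgue_on S)" "g \<in> borel_measurable (lebesgue_on S)" using f g unfolding Lp_on_def by auto
 have b: "\<bar>f x - g x\<bar> powr p \<le> 2 powr p * (\<bar>f x\<bar> powr p + \<bar>g x\<bar> powr p)" for x
 proof -
  have "\<bar>f x - g x\<bar> powr p \<le> (2 * max \<bar>f x\<bar> \<bar>g x\<bar>) powr p" using p by (intro powr_mono2) auto
  also have "\<dots> = 2 powr p * (max \<bar>f x\<bar> \<bar>g x\<bar>) powr p" by (simp add: powr_mult)
  also have "(max \<bar>f x\<bar> \<bar>g x\<bar>) powr p \<le> \<bar>f x\<bar> powr p + \<bar>g x\<bar> powr p" by (auto simp: max_def)
  finally show ?thesis by simp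
 qed
 have "integrable (lebesgue_on S) (\<lambda>x. 2 powr p * (\<bar>f x\<bar> powr p + \<bar>g x\<bar> powr p))"
  using f g unfolding Lp_on_def by auto
 then have "integrable (lebesgue_on S) (\<lambda>x. \<bar>f x - g x\<bar> powr p)"
  by (rule Bochner_Integration.integrable_bound) (use m b in \<open>auto\<close>)
 then show ?thesis unfolding Lp_on_def using m by auto
qed

lemma sobolev_W1_diff:
 assumes "open U" "1 \<le> p" "sobolev_W1 p U u" "sobolev_W1 p U v"
 shows "sobolev_W1 p U (\<lambda>x. u x - v x)"
proof -
 obtain G H where "weak_gradient U u G" "weak_gradient U v H" "\<forall>b\<in>Basis. Lp_on p U (\<lambda>x. G x \<bullet> b)" "\<forall>b\<in>Basis. Lp_on p U (\<lambda>x. H x \<bullet> b)"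
  using assms unfolding sobolev_W1_def by auto
 note GH = this
 have "Lp_on p U (\<lambda>x. (G x - H x) \<bullet> b)" if "b \<in> Basis" for b
  using Lp_on_diff[OF assms(2), of U "\<lambda>x. G x \<bullet> b" "\<lambda>x. H x \<bullet> b"] GH that by (simp add: inner_diff_left)
 moreover have "Lp_on p U (\<lambda>x. u x - v x)" using assms Lp_on_diff unfolding sobolev_W1_def by blast
 ultimately show ?thesis using weak_gradient_diff[OF assms(1) GH(1,2)] unfolding sobolev_W1_def by blast
qed

lemma W1_norm_powr:
 fixes u :: "'a::euclidean_space => real"
 assumes U: "open U" and p: "0 < p" and wg: "weak_gradient U u G" and L: "\<And>b. b \<in> Basis ==> Lp_on p U (\<lambda>x. G x \<bullet> b)"
 shows "W1_norm p U u powr p = (LINT x|lebesgue_on U. \<bar>u x\<bar> powr p) + (\<Sum>b\<in>Basis. LINT x|lebesgue_on U. \<bar>G x \<bullet> b\<bar> powr p)"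
proof -
 define H where "H = (SOME G. weak_gradient U u G)"
 have wH: "weak_gradient U u H" unfolding H_def by (rule someI[of "weak_gradient U u", OF wg])
 have eq: "(LINT x|lebesgue_on U. \<bar>H x \<bullet> b\<bar> powr p) = (LINT x|lebesgue_on U. \<bar>G x \<bullet> b\<bar> powr p)" if b: "b \<in> Basis" for b
 proof -
  have AE: "AE x in lebesgue_on U. G x \<bullet> b = H x \<bullet> b" by (rule weak_gradient_unique[OF U wg wH b])
  have Gm: "(\<lambda>x. G x \<bullet> b) \<in> borel_measurable (lebesgue_on U)" using L[OF b] unfolding Lp_on_def by simp
  have Um: "U \<in> sets lebesgue" using U by auto
  have "(\<lambda>x. indicat_real U x *\<^sub>R (G x \<bullet> b)) \<in> borel_measurable lebesgue"
   using Gm Um borel_measurable_restrict_space_iff[of U lebesgue "\<lambda>x. G x \<bullet> b"] by simp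
  moreover have "AE x in lebesgue. indicat_real U x *\<^sub>R (G x \<bullet> b) = indicat_real U x *\<^sub>R (H x \<bullet> b)"
   using AE Um by (subst (asm) AE_restrict_space_iff) (auto elim!: eventually_mono simp: indicator_def)
  ultimately have "(\<lambda>x. indicat_real U x *\<^sub>R (H x \<bullet> b)) \<in> borel_measurable lebesgue" by (rule borel_measurable_AE)
  then have Hm: "(\<lambda>x. H x \<bullet> b) \<in> borel_measurable (lebesgue_on U)"
   using Um borel_measurable_restrict_space_iff[of U lebesgue "\<lambda>x. H x \<bullet> b"] by simp
  show ?thesis by (rule integral_cong_AE) (use AE Gm Hm in \<open>auto elim!: eventually_mono\<close>)
 qed
 have "0 \<le> (LINT x|lebesgue_on U. \<bar>u x\<bar> powr p) + (\<Sum>b\<in>Basis. LINT x|lebesgue_on U. \<bar>H x \<bullet> b\<bar> powr p)"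
  by (intro add_nonneg_nonneg sum_nonneg integral_nonneg_AE) auto
 then have "W1_norm p U u powr p = (LINT x|lebesgue_on U. \<bar>u x\<bar> powr p) + (\<Sum>b\<in>Basis. LINT x|lebesgue_on U. \<bar>H x \<bullet> b\<bar> powr p)"
  unfolding W1_norm_def Let_def H_def[symmetric] using p by (simp add: powr_powr)
 then show ?thesis using eq by simp
qed

lemma W1_norm_nonneg: "0 \<le> W1_norm p U u"
 unfolding W1_norm_def Let_def by simp

lemma W1_norm_bounds:
 fixes u :: "'a::euclidean_space => real"
 assumes U: "open U" and p: "0 < p" and wg: "weak_gradient U u G" and L: "\<And>b. b \<in> Basis ==> Lp_on p U (\<lambda>x. G x \<bullet> b)"
 shows "(LINT x|lebesgue_on U. \<bar>u x\<bar> powr p) \<le> W1_norm p U u powr p"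
  "b \<in> Basis ==> (LINT x|lebesgue_on U. \<bar>G x \<bullet> b\<bar> powr p) \<le> W1_norm p U u powr p"
proof -
 have nn: "0 \<le> (LINT x|lebesgue_on U. \<bar>u x\<bar> powr p)" "\<And>b. 0 \<le> (LINT x|lebesgue_on U. \<bar>G x \<bullet> b\<bar> powr p)"
  by (intro integral_nonneg_AE; simp)+
 have e: "W1_norm p U u powr p = (LINT x|lebesgue_on U. \<bar>u x\<bar> powr p) + (\<Sum>b\<in>Basis. LINT x|lebesgue_on U. \<bar>G x \<bullet> b\<bar> powr p)"
  by (rule W1_norm_powr[OF U p wg L])
 show "(LINT x|lebesgue_on U. \<bar>u x\<bar> powr p) \<le> W1_norm p U u powr p"
  unfolding e using nn(2) by (simp add: sum_nonneg)
 assume b: "b \<in> Basis"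
 have "(LINT x|lebesgue_on U. \<bar>G x \<bullet> b\<bar> powr p) \<le> (\<Sum>b\<in>Basis. LINT x|lebesgue_on U. \<bar>G x \<bullet> b\<bar> powr p)"
  by (rule member_le_sum[OF b]) (use nn(2) in auto)
 then show "(LINT x|lebesgue_on U. \<bar>G x \<bullet> b\<bar> powr p) \<le> W1_norm p U u powr p" unfolding e using nn(1) by linarith
qed

lemma W1_norm_zero:
 assumes "open U" "0 < p" shows "W1_norm p U (\<lambda>x::'a::euclidean_space. 0) = 0"
proof -
 have "weak_gradient U (\<lambda>x::'a. 0) (\<lambda>x. 0)" unfolding weak_gradient_def locally_integrable_def by auto
 moreover have "Lp_on p U (\<lambda>x::'a. 0 \<bullet> b)" for b unfolding Lp_on_def using assms by simp
 ultimately have "W1_norm p U (\<lambda>x::'a. 0) powr p = 0" using W1_norm_powr[OF assms] assms(2) by simp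
 then show ?thesis by simp
qed

text \<open>
 The averages of all scales are bounded by the Sobolev norm, and averages bound the function.
 The scales start at the distance of \<open>K\<close> to the complement of \<open>U\<close>, on
 which the constant therefore depends.
\<close>

theorem interior_sobolev_bound:
 fixes U :: "'a::euclidean_space set"
 assumes p: "real DIM('a) < p" and U: "open U" and K: "compact K" "K \<subseteq> U"
 obtains C where "0 \<le> C" "\<And>u. sobolev_W1 p U u ==> AE x in lebesgue. x \<in> K \<longrightarrow> \<bar>u x\<bar> \<le> C * W1_norm p U u"
proof (cases "K = {}")
 case True
 then show ?thesis using that[of 0] by simp
next
 case False
 obtain A \<zeta> Z where "kernel_profile A \<zeta> Z"
  using smooth_step_exists kernel_profile.intro by metis
 then interpret kernel_profile A \<zeta> Z .
 obtain r L where r: "0 < r" and L: "compact L" "L \<subseteq> U" "\<And>x. infdist x K \<le> r ==> cube x r \<subseteq> L"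
  using compact_neighbourhood[OF K(1) U K(2) False] by metis
 obtain C where C: "0 \<le> C" and morrey: "\<And>U (u::'a => real) G W x k. open U ==> weak_gradient U u G ==> Lp_on p U u ==>
   (\<And>b. b \<in> Basis ==> Lp_on p U (\<lambda>y. G y \<bullet> b)) ==> 0 < W ==>
   (LINT y|lebesgue_on U. \<bar>u y\<bar> powr p) \<le> W powr p ==>
   (\<And>b. b \<in> Basis ==> (LINT y|lebesgue_on U. \<bar>G y \<bullet> b\<bar> powr p) \<le> W powr p) ==>
   cube x r \<subseteq> U ==> \<bar>LINT y|lebesgue_on U. u y * kern (\<lambda>_. r / 2 ^ k) x y\<bar> \<le> C * W"
  by (rule morrey_averages[OF p r]) blast
 let ?c = "kmass TYPE('a)"
 have p0: "0 < p" using p by (meson le_less_trans of_nat_0_le_iff)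
 show ?thesis
 proof (rule that[of "C / ?c"])
  show "0 \<le> C / ?c" using C kmass_pos[where 'a='a] by simp
  fix u :: "'a => real" assume u: "sobolev_W1 p U u"
  then obtain G where G: "Lp_on p U u" "weak_gradient U u G" "\<And>b. b \<in> Basis ==> Lp_on p U (\<lambda>x. G x \<bullet> b)"
   unfolding sobolev_W1_def by auto
   have nb: "(LINT x|lebesgue_on U. \<bar>u x\<bar> powr p) \<le> W1_norm p U u powr p"
   "\<And>b. b \<in> Basis ==> (LINT x|lebesgue_on U. \<bar>G x \<bullet> b\<bar> powr p) \<le> W1_norm p U u powr p"
   using W1_norm_bounds[OF U p0 G(2,3)] by auto
  have uL: "integrable (lebesgue_on L) u" using G(2) L unfolding weak_gradient_def locally_integrable_def by blast
  have "AE x in lebesgue. x \<in> K \<longrightarrow> ?c * \<bar>u x\<bar> \<le> C * (W1_norm p U u + 1 / real (Suc n))" for n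
  proof (rule local_ae_bound[OF U K(1) False r L(1,2) L(3) uL])
   fix x k assume x: "infdist x K \<le> r"
   let ?W = "W1_norm p U u + 1 / real (Suc n)"
   have W: "0 < ?W" using W1_norm_nonneg[of p U u] by (intro add_nonneg_pos) auto
   have le: "W1_norm p U u powr p \<le> ?W powr p" using W1_norm_nonneg[of p U u] p0 by (intro powr_mono2) auto
   show "\<bar>LINT y|lebesgue_on U. u y * kern (\<lambda>_. r / 2 ^ k) x y\<bar> \<le> C * ?W"
    by (rule morrey[OF U G(2,1,3) W order_trans[OF nb(1) le] order_trans[OF nb(2) le]]) (use L x in auto)
  qed
  then have "AE x in lebesgue. \<forall>n. x \<in> K \<longrightarrow> ?c * \<bar>u x\<bar> \<le> C * (W1_norm p U u + 1 / real (Suc n))"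
   unfolding AE_all_countable by blast
  then show "AE x in lebesgue. x \<in> K \<longrightarrow> \<bar>u x\<bar> \<le> C / ?c * W1_norm p U u"
  proof eventually_elim
   case (elim x)
   show ?case
   proof
    assume x: "x \<in> K"
    have "(\<lambda>n. C * (W1_norm p U u + 1 / real (Suc n))) \<longlonglongrightarrow> C * (W1_norm p U u + 0)"
     by (intro tendsto_intros LIMSEQ_Suc[OF lim_1_over_n])
    then have "?c * \<bar>u x\<bar> \<le> C * (W1_norm p U u + 0)"
     by (rule LIMSEQ_le_const) (use elim x in auto)
    then show "\<bar>u x\<bar> \<le> C / ?c * W1_norm p U u" using kmass_pos[where 'a='a] by (simp add: field_simps)
   qed
  qed
 qed
qed

section \<open>Mollified marginals\<close>

lemma bump_props:
 "(bump :: 'a::euclidean_space => real) \<in> borel_measurable borel" "0 \<le> bump (x::'a)" "bump x \<le> 1"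
 "norm x \<ge> 1 ==> bump x = 0" "norm x < 1 ==> 0 < bump x"
 "integrable lborel (bump :: 'a => real)" "0 < (LINT y|lebesgue. bump (y::'a))"
  "(LINT y|lebesgue. bump (y::'a)) = (LBINT y. bump (y::'a))"
proof -
 show m: "(bump :: 'a => real) \<in> borel_measurable borel" unfolding bump_def by measurable
 show nn: "0 \<le> bump x" for x :: 'a unfolding bump_def by simp
 show le: "bump x \<le> 1" for x :: 'a
 proof (cases "norm x < 1")
  case True
  then have "(norm x)\<^sup>2 < 1" by (simp add: power_less_one_iff abs_square_less_1)
  then show ?thesis unfolding bump_def using True by (simp add: field_simps)
 qed (simp add: bump_def)
 show "norm x \<ge> 1 ==> bump x = 0" for x :: 'a unfolding bump_def by simp
 show pos: "norm x < 1 ==> 0 < bump x" for x :: 'a unfolding bump_def by simp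
 show i: "integrable lborel (bump :: 'a => real)"
  by (rule integrable_bounded_support[OF m, of 1 "ball 0 1"]) (use nn le in \<open>auto simp: bump_def\<close>)
 show eq: "(LINT y|lebesgue. bump (y::'a)) = (LBINT y. bump (y::'a))"
  using m by (intro integral_completion) simp
 have "(LBINT y. bump (y::'a)) \<noteq> 0"
 proof
  assume "(LBINT y. bump (y::'a)) = 0"
  moreover have "AE y in lborel. 0 \<le> bump (y::'a)" using nn by simp
  ultimately have "AE y in lborel. bump (y::'a) = 0" using integral_nonneg_eq_0_iff_AE[OF i] by blast
  then have "AE y in lborel. y \<notin> ball (0::'a) 1" by eventually_elim (use pos in force)
  then have "ball (0::'a) 1 \<in> null_sets lborel" using AE_iff_null_sets[of "ball (0::'a) 1" lborel] by simp
  then have "negligible (ball (0::'a) 1)" using negligible_iff_null_sets null_sets_completionI by blast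
  then show False using open_not_negligible[of "ball (0::'a) 1"] by simp
 qed
 moreover have "0 \<le> (LBINT y. bump (y::'a))" using nn by (intro Bochner_Integration.integral_nonneg) auto
 ultimately show "0 < (LINT y|lebesgue. bump (y::'a))" unfolding eq by simp
qed

definition bump_mass :: "'a::euclidean_space itself => real" where
 "bump_mass _ = (LINT y|lebesgue. bump (y::'a))"

lemma mollifier_props:
 fixes x y :: "'a::euclidean_space"
 assumes \<delta>: "0 < \<delta>"
 shows "(\<lambda>z::'a. mollifier \<delta> z) \<in> borel_measurable borel" "0 \<le> mollifier \<delta> x"
  "mollifier \<delta> x \<le> 1 / (\<delta> ^ DIM('a) * bump_mass TYPE('a))" "dist x y \<ge> \<delta> ==> mollifier \<delta> (x - y) = 0"
  "integrable lborel (\<lambda>x. mollifier \<delta> (x - y))" "(LBINT x. mollifier \<delta> (x - y)) = 1"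
proof -
 let ?B = "bump_mass TYPE('a)"
 have B: "0 < ?B" unfolding bump_mass_def by (rule bump_props)
 have md: "mollifier \<delta> z = bump ((1/\<delta>) *\<^sub>R z) / (\<delta> ^ DIM('a) * ?B)" for z :: 'a
  unfolding mollifier_def bump_mass_def by (simp add: inverse_eq_divide)
 note [measurable] = bump_props(1)[where 'a='a]
 show m [measurable]: "(\<lambda>z::'a. mollifier \<delta> z) \<in> borel_measurable borel" unfolding md by measurable
 show nn: "0 \<le> mollifier \<delta> x" for x :: 'a unfolding md using bump_props(2)[where 'a='a] B \<delta> by simp
 show le: "mollifier \<delta> x \<le> 1 / (\<delta> ^ DIM('a) * ?B)" for x :: 'a
  unfolding md using bump_props(3)[where 'a='a] B \<delta> by (intro divide_right_mono) auto
 show z: "mollifier \<delta> (x - y) = 0" if "dist x y \<ge> \<delta>" for x y :: 'a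
  unfolding md using that \<delta> by (subst bump_props(4)) (auto simp: dist_norm le_divide_eq)
 show "integrable lborel (\<lambda>x. mollifier \<delta> (x - y))" for y :: 'a
  by (rule integrable_bounded_support[where B="1 / (\<delta> ^ DIM('a) * ?B)" and K="ball y \<delta>"])
   (use nn le z in \<open>auto simp: dist_commute\<close>)
 have "(LBINT x. mollifier \<delta> (x - y)) =
   (\<integral>x. mollifier \<delta> (x - y) \<partial>density (distr lborel borel (\<lambda>z. y + \<delta> *\<^sub>R z)) (\<lambda>_. ennreal (\<bar>\<delta>\<bar> ^ DIM('a))))"
  using lborel_affine[of \<delta> y] \<delta> by simp
 also have "\<dots> = (\<integral>x. (\<bar>\<delta>\<bar> ^ DIM('a)) *\<^sub>R mollifier \<delta> (x - y) \<partial>distr lborel borel (\<lambda>z. y + \<delta> *\<^sub>R z))"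
  by (intro integral_density) auto
 also have "\<dots> = (LBINT z. (\<bar>\<delta>\<bar> ^ DIM('a)) *\<^sub>R mollifier \<delta> (y + \<delta> *\<^sub>R z - y))"
  by (intro integral_distr) auto
 also have "\<dots> = (LBINT z. bump (z::'a) / ?B)"
  unfolding md using \<delta> by (intro Bochner_Integration.integral_cong) auto
 also have "\<dots> = 1" using B bump_props(8)[where 'a='a] unfolding bump_mass_def by simp
 finally show "(LBINT x. mollifier \<delta> (x - y)) = 1" .
qed

definition smooth_density :: "'a::euclidean_space set => real => 'a measure => 'a => real" where
 "smooth_density \<Omega> \<delta> M x = indicator \<Omega> x * ((\<integral>y. mollifier \<delta> (x - y) \<partial>M) + \<delta> / measure lebesgue \<Omega>)"

text \<open>
 A probability measure whose mass stays at distance \<open>\<rho>\<close> from the complement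
 of \<open>\<Omega>\<close>, so that mollification at scale \<open>\<delta> \<le>
 \<rho>\<close> loses no mass.
\<close>

locale deep_measure =
 fixes \<Omega> :: "'a::euclidean_space set" and \<rho> \<delta> :: real and M :: "'a measure"
 assumes \<Omega>: "compact \<Omega>" "interior \<Omega> \<noteq> {}" and M: "prob_space M" "sets M = sets borel"
  and deep: "AE y in M. ball y \<rho> \<subseteq> \<Omega>" and \<delta>: "0 < \<delta>" "\<delta> \<le> \<rho>"
begin

abbreviation "m \<equiv> smooth_density \<Omega> \<delta> M"
abbreviation "vol \<equiv> measure lebesgue \<Omega>"

lemmas mp = mollifier_props[OF \<delta>(1), where 'a='a]

lemma \<Omega>_borel: "\<Omega> \<in> sets borel" using \<Omega> by (simp add: borel_compact)

lemma vol_pos: "0 < vol"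
proof -
 have "\<not> negligible \<Omega>" using \<Omega>(2) open_not_negligible[OF open_interior] negligible_subset[OF _ interior_subset] by blast
 then have "vol \<noteq> 0" using lmeasurable_compact[OF \<Omega>(1)] by (simp add: negligible_iff_measure)
 then show ?thesis using measure_nonneg[of lebesgue \<Omega>] by linarith
qed

lemma vol_lborel: "measure lborel \<Omega> = vol" using \<Omega>_borel by (simp add: measure_completion)

lemma \<Omega>_integrable: "integrable lborel (indicat_real \<Omega>)"
 by (rule integrable_bounded_support[where B=1 and K=\<Omega>]) (use \<Omega> \<Omega>_borel in \<open>auto intro: compact_imp_bounded\<close>)

lemma moll_pair [measurable]: "(\<lambda>z. mollifier \<delta> (fst z - snd z)) \<in> borel_measurable (borel \<Otimes>\<^sub>M (borel :: 'a measure))"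
 using mp(1) by measurable

lemma moll_M: "(\<lambda>y. mollifier \<delta> (x - y)) \<in> borel_measurable M"
 by (rule measurable_borel_sets[OF M(2)]) (use mp(1) in measurable)

lemma moll_avg: "(\<lambda>x. \<integral>y. mollifier \<delta> (x - y) \<partial>M) \<in> borel_measurable borel"
  "0 \<le> (\<integral>y. mollifier \<delta> (x - y) \<partial>M)" "(\<integral>y. mollifier \<delta> (x - y) \<partial>M) \<le> 1 / (\<delta> ^ DIM('a) * bump_mass TYPE('a))"
proof -
 interpret prob_space M by (rule M)
 have "(\<lambda>z. mollifier \<delta> (fst z - snd z)) \<in> borel_measurable (borel \<Otimes>\<^sub>M M)"
  using moll_pair measurable_cong_sets[OF sets_pair_measure_cong[OF refl M(2)] refl] by blast
 then have "(\<lambda>(x, y). mollifier \<delta> (x - y)) \<in> borel_measurable (borel \<Otimes>\<^sub>M M)" by (simp add: case_prod_beta')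
 then show "(\<lambda>x. \<integral>y. mollifier \<delta> (x - y) \<partial>M) \<in> borel_measurable borel" by (rule borel_measurable_lebesgue_integral)
 show "0 \<le> (\<integral>y. mollifier \<delta> (x - y) \<partial>M)" using mp(2) by (intro Bochner_Integration.integral_nonneg) auto
 have "(\<integral>y. mollifier \<delta> (x - y) \<partial>M) \<le> (\<integral>y. 1 / (\<delta> ^ DIM('a) * bump_mass TYPE('a)) \<partial>M)"
 proof (rule integral_mono)
  show "integrable M (\<lambda>y. mollifier \<delta> (x - y))"
   by (rule integrable_const_bound[where B="1 / (\<delta> ^ DIM('a) * bump_mass TYPE('a))"])
    (use mp(2,3) moll_M in auto)
 qed (use mp(3) in auto)
 then show "(\<integral>y. mollifier \<delta> (x - y) \<partial>M) \<le> 1 / (\<delta> ^ DIM('a) * bump_mass TYPE('a))" by (simp add: prob_space)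
qed

lemma m_measurable [measurable]: "m \<in> borel_measurable borel"
 unfolding smooth_density_def using moll_avg(1) \<Omega>_borel by measurable

lemma m_zero: "x \<notin> \<Omega> ==> m x = 0" unfolding smooth_density_def by simp

lemma m_nonneg: "0 \<le> m x"
 unfolding smooth_density_def using moll_avg(2)[of x] vol_pos \<delta> by simp

text \<open>
 The additive constant \<open>\<delta> / vol\<close> is absorbed into the bound of the
 mollifier, so that \<open>\<delta>\<close> enters only through one power.
\<close>

lemma m_le: "m x \<le> (1 / bump_mass TYPE('a) + \<rho> ^ (DIM('a) + 1) / vol) / \<delta> ^ DIM('a)"
proof -
 have B: "0 < bump_mass TYPE('a)" unfolding bump_mass_def by (rule bump_props)
 have \<rho>: "0 < \<rho>" using \<delta> by linarith
 have "\<delta> * \<delta> ^ DIM('a) \<le> \<rho> ^ (DIM('a) + 1)" using power_mono[OF \<delta>(2), of "DIM('a) + 1"] \<delta>(1) by simp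
 then have "\<delta> \<le> \<rho> ^ (DIM('a) + 1) / \<delta> ^ DIM('a)" using \<delta>(1) by (simp add: le_divide_eq)
 then have "\<delta> / vol \<le> \<rho> ^ (DIM('a) + 1) / \<delta> ^ DIM('a) / vol" using vol_pos by (intro divide_right_mono) auto
 then have "(\<integral>y. mollifier \<delta> (x - y) \<partial>M) + \<delta> / vol \<le> (1 / bump_mass TYPE('a) + \<rho> ^ (DIM('a) + 1) / vol) / \<delta> ^ DIM('a)"
  using moll_avg(3)[of x] by (simp add: add_divide_distrib mult.commute)
 moreover have "0 \<le> (1 / bump_mass TYPE('a) + \<rho> ^ (DIM('a) + 1) / vol) / \<delta> ^ DIM('a)"
  using B \<rho> vol_pos \<delta> by simp
 ultimately show ?thesis unfolding smooth_density_def by (auto simp: indicator_def)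
qed

lemma m_mult_integrable:
 assumes "g \<in> borel_measurable borel" "\<And>x. \<bar>g x\<bar> \<le> B"
 shows "integrable lborel (\<lambda>x. g x * m x)"
proof (rule integrable_bounded_support[where K=\<Omega> and B="B * ((1 / bump_mass TYPE('a) + \<rho> ^ (DIM('a) + 1) / vol) / \<delta> ^ DIM('a))"])
 show "(\<lambda>x. g x * m x) \<in> borel_measurable borel" using assms(1) by measurable
 show "\<bar>g x * m x\<bar> \<le> B * ((1 / bump_mass TYPE('a) + \<rho> ^ (DIM('a) + 1) / vol) / \<delta> ^ DIM('a))" for x
  unfolding abs_mult using assms(2)[of x] m_nonneg[of x] m_le[of x] by (intro mult_mono) auto
qed (use \<Omega> m_zero in \<open>auto intro: compact_imp_bounded\<close>)

lemma m_integrable: "integrable lborel m"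
 using m_mult_integrable[of "\<lambda>_. 1" 1] by simp

lemma m_integral_identity:
 fixes g :: "'a => real"
 assumes g: "g \<in> borel_measurable borel" "\<And>x. \<bar>g x\<bar> \<le> B"
 shows "integrable M (\<lambda>y. \<integral>x. g x * (indicator \<Omega> x * mollifier \<delta> (x - y)) \<partial>lborel)"
  "(LBINT x. g x * m x) = (\<integral>y. (LBINT x. g x * (indicator \<Omega> x * mollifier \<delta> (x - y))) \<partial>M)
    + \<delta> / vol * (LBINT x. indicator \<Omega> x * g x)"
proof -
 interpret P: prob_space M by (rule M)
 interpret pair_sigma_finite lborel M ..
 note [measurable] = g(1) \<Omega>_borel
 define C where "C = 1 / (\<delta> ^ DIM('a) * bump_mass TYPE('a))"
 have int2: "integrable (lborel \<Otimes>\<^sub>M M) (\<lambda>z. g (fst z) * (indicator \<Omega> (fst z) * mollifier \<delta> (fst z - snd z)))"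
 proof (rule Bochner_Integration.integrable_bound[where f="\<lambda>z. (B * C * indicator \<Omega> (fst z)) * (\<lambda>_. 1) (snd z)"])
  show "integrable (lborel \<Otimes>\<^sub>M M) (\<lambda>z. (B * C * indicator \<Omega> (fst z)) * (\<lambda>_. 1) (snd z))"
   by (rule integrable_times) (use \<Omega>_integrable in auto)
  have "(\<lambda>z. g (fst z) * (indicator \<Omega> (fst z) * mollifier \<delta> (fst z - snd z))) \<in> borel_measurable (borel \<Otimes>\<^sub>M borel)" by measurable
  moreover have "sets (lborel \<Otimes>\<^sub>M M) = sets (borel \<Otimes>\<^sub>M borel)" by (rule sets_pair_measure_cong) (simp_all add: M)
  ultimately show "(\<lambda>z. g (fst z) * (indicator \<Omega> (fst z) * mollifier \<delta> (fst z - snd z))) \<in> borel_measurable (lborel \<Otimes>\<^sub>M M)"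
   using measurable_cong_sets by blast
  have "\<bar>g x\<bar> * \<bar>mollifier \<delta> (x - y)\<bar> \<le> \<bar>B\<bar> * \<bar>C\<bar>" for x y
  proof (rule mult_mono)
   show "\<bar>g x\<bar> \<le> \<bar>B\<bar>" using g(2)[of x] by linarith
   show "\<bar>mollifier \<delta> (x - y)\<bar> \<le> \<bar>C\<bar>" using mp(2)[of "x - y"] mp(3)[of "x - y"] unfolding C_def by linarith
  qed auto
  then show "AE z in lborel \<Otimes>\<^sub>M M. norm (g (fst z) * (indicator \<Omega> (fst z) * mollifier \<delta> (fst z - snd z))) \<le> norm ((B * C * indicator \<Omega> (fst z)) * (\<lambda>_. 1) (snd z))"
   by (intro AE_I2) (auto simp: indicator_def abs_mult)
 qed
 show "integrable M (\<lambda>y. \<integral>x. g x * (indicator \<Omega> x * mollifier \<delta> (x - y)) \<partial>lborel)"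
  using integrable_snd[of "\<lambda>x y. g x * (indicator \<Omega> x * mollifier \<delta> (x - y))"] int2 by (simp add: case_prod_beta')
 have fub: "(\<integral>y. (LBINT x. g x * (indicator \<Omega> x * mollifier \<delta> (x - y))) \<partial>M) = (LBINT x. (\<integral>y. g x * (indicator \<Omega> x * mollifier \<delta> (x - y)) \<partial>M))"
  by (rule Fubini_integral) (use int2 in \<open>simp add: case_prod_beta'\<close>)
 have i1: "integrable lborel (\<lambda>x. (\<integral>y. g x * (indicator \<Omega> x * mollifier \<delta> (x - y)) \<partial>M))"
  using integrable_fst[of "\<lambda>x y. g x * (indicator \<Omega> x * mollifier \<delta> (x - y))"] int2 by (simp add: case_prod_beta')
 have i2: "integrable lborel (\<lambda>x. indicator \<Omega> x * g x)"
  by (rule integrable_bounded_support[where B=B and K=\<Omega>])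
   (use g \<Omega> order_trans[OF abs_ge_zero g(2)] in \<open>auto simp: indicator_def intro: compact_imp_bounded\<close>)
 have "(\<lambda>x. g x * m x) = (\<lambda>x. (\<integral>y. g x * (indicator \<Omega> x * mollifier \<delta> (x - y)) \<partial>M) + \<delta> / vol * (indicator \<Omega> x * g x))"
  unfolding smooth_density_def by (auto simp: algebra_simps fun_eq_iff)
 then show "(LBINT x. g x * m x) = (\<integral>y. (LBINT x. g x * (indicator \<Omega> x * mollifier \<delta> (x - y))) \<partial>M)
    + \<delta> / vol * (LBINT x. indicator \<Omega> x * g x)"
  unfolding fub using i1 i2 by simp
qed

lemma deep_moll: "ball y \<rho> \<subseteq> \<Omega> ==> indicator \<Omega> x * mollifier \<delta> (x - y) = mollifier \<delta> (x - y)"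
 using mp(4)[of x y] \<delta>(2) by (cases "dist x y < \<delta>") (auto simp: indicator_def subset_iff dist_commute)

lemma m_mass: "(LBINT x. m x) = 1 + \<delta>"
proof -
 interpret P: prob_space M by (rule M)
 have "(\<integral>y. (LBINT x. 1 * (indicator \<Omega> x * mollifier \<delta> (x - y))) \<partial>M) = (\<integral>y. 1 \<partial>M)"
 proof (rule integral_cong_AE)
  show "AE y in M. (LBINT x. 1 * (indicator \<Omega> x * mollifier \<delta> (x - y))) = 1"
   using deep by eventually_elim (simp add: deep_moll mp(6))
 qed (use m_integral_identity(1)[of "\<lambda>_. 1" 1] in \<open>auto dest: borel_measurable_integrable\<close>)
 moreover have "(LBINT x. indicator \<Omega> x * 1) = vol" using \<Omega>_borel vol_lborel by simp
 ultimately show ?thesis using m_integral_identity(2)[of "\<lambda>_. 1" 1] vol_pos by (simp add: P.prob_space)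
qed

lemma m_close:
 fixes g :: "'a => real"
 assumes g: "g \<in> borel_measurable borel" "\<And>x. \<bar>g x\<bar> \<le> B"
  and \<omega>: "\<And>x y. x \<in> \<Omega> ==> y \<in> \<Omega> ==> dist x y \<le> \<delta> ==> \<bar>g x - g y\<bar> \<le> \<omega>"
 shows "\<bar>(LBINT x. g x * m x) - (\<integral>y. g y \<partial>M)\<bar> \<le> \<omega> + \<delta> * B"
proof -
 interpret P: prob_space M by (rule M)
 note id = m_integral_identity[OF g]
 define h where "h y = (LBINT x. g x * (indicator \<Omega> x * mollifier \<delta> (x - y)))" for y
 have gM: "integrable M g" by (rule integrable_bounded_borel[OF P.finite_measure_axioms M(2) g])
 have AE: "AE y in M. \<bar>h y - g y\<bar> \<le> \<omega>"
  using deep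
 proof eventually_elim
  case (elim y)
  have mi: "integrable lborel (\<lambda>x. mollifier \<delta> (x - y))" by (rule mp(5))
  have gi: "integrable lborel (\<lambda>x. g x * mollifier \<delta> (x - y))"
   by (rule Bochner_Integration.integrable_bound[where f="\<lambda>x. B * mollifier \<delta> (x - y)"])
    (use mi g order_trans[OF abs_ge_zero g(2)] mp(2) borel_measurable_integrable[OF mi] in \<open>auto simp: abs_mult intro!: mult_right_mono\<close>)
  have yO: "y \<in> \<Omega>" using elim \<delta> by auto
  have "h y - g y = (LBINT x. g x * mollifier \<delta> (x - y)) - (LBINT x. g y * mollifier \<delta> (x - y))"
   unfolding h_def deep_moll[OF elim] using mp(6)[of y] by simp
  also have "\<dots> = (LBINT x. (g x - g y) * mollifier \<delta> (x - y))" using gi mi by (simp add: left_diff_distrib)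
  also have "\<bar>\<dots>\<bar> \<le> (LBINT x. \<bar>(g x - g y) * mollifier \<delta> (x - y)\<bar>)" by (rule integral_abs_bound)
  also have "\<dots> \<le> (LBINT x. \<omega> * mollifier \<delta> (x - y))"
  proof (rule integral_mono)
   show "integrable lborel (\<lambda>x. \<bar>(g x - g y) * mollifier \<delta> (x - y)\<bar>)" using gi mi by (intro integrable_abs) (simp add: left_diff_distrib)
   show "\<bar>(g x - g y) * mollifier \<delta> (x - y)\<bar> \<le> \<omega> * mollifier \<delta> (x - y)" for x
   proof (cases "dist x y < \<delta>")
    case True
    then have "x \<in> \<Omega>" using elim \<delta> by (auto simp: dist_commute subset_iff)
    then have "\<bar>g x - g y\<bar> \<le> \<omega>" using \<omega> yO True by auto
    then show ?thesis using mp(2)[of "x - y"] by (simp add: abs_mult mult_right_mono)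
   qed (use mp(4)[of x y] in simp)
  qed (use mi in simp)
  also have "\<dots> = \<omega>" using mp(6)[of y] by simp
  finally show ?case .
 qed
 have "\<bar>(\<integral>y. h y \<partial>M) - (\<integral>y. g y \<partial>M)\<bar> = \<bar>\<integral>y. h y - g y \<partial>M\<bar>" using id(1) gM unfolding h_def by simp
 also have "\<dots> \<le> (\<integral>y. \<bar>h y - g y\<bar> \<partial>M)" by (rule integral_abs_bound)
 also have "\<dots> \<le> (\<integral>y. \<omega> \<partial>M)" by (rule integral_mono_AE) (use AE id(1) gM in \<open>auto simp: h_def\<close>)
 also have "\<dots> = \<omega>" by (simp add: P.prob_space)
 finally have 1: "\<bar>(\<integral>y. h y \<partial>M) - (\<integral>y. g y \<partial>M)\<bar> \<le> \<omega>" .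
 have "\<bar>\<integral>x. indicator \<Omega> x * g x \<partial>lborel\<bar> \<le> (LBINT x. \<bar>indicator \<Omega> x * g x\<bar>)" by (rule integral_abs_bound)
 also have "\<dots> \<le> (LBINT x. B * indicator \<Omega> x)"
 proof (rule integral_mono)
  show "integrable lborel (\<lambda>x. \<bar>indicator \<Omega> x * g x\<bar>)"
   by (rule integrable_bounded_support[where B=B and K=\<Omega>])
    (use g \<Omega> \<Omega>_borel order_trans[OF abs_ge_zero g(2)] in \<open>auto simp: indicator_def intro: compact_imp_bounded\<close>)
  show "integrable lborel (\<lambda>x. B * indicat_real \<Omega> x)" using \<Omega>_integrable by simp
  show "\<bar>indicator \<Omega> x * g x\<bar> \<le> B * indicat_real \<Omega> x" for x
   using g(2)[of x] by (auto simp: indicator_def)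
 qed
 also have "\<dots> = B * vol" using \<Omega>_borel vol_lborel by simp
 finally have "\<bar>\<delta> / vol * (LBINT x. indicator \<Omega> x * g x)\<bar> \<le> \<delta> / vol * (B * vol)"
  using vol_pos \<delta> unfolding abs_mult by (intro mult_mono) auto
 then have 2: "\<bar>\<delta> / vol * (LBINT x. indicator \<Omega> x * g x)\<bar> \<le> \<delta> * B" using vol_pos by simp
 show ?thesis using 1 2 id(2) unfolding h_def by linarith
qed

text \<open>
 The mollified measure does not reach the boundary layer; only the added constant density
 contributes.
\<close>

lemma m_near_boundary:
 assumes \<delta>2: "\<delta> \<le> \<rho> / 2"
 shows "(LBINT x. indicator {x \<in> \<Omega>. infdist x (frontier \<Omega>) < \<rho> / 2} x * m x) \<le> \<delta>"
proof -
 let ?A = "{x \<in> \<Omega>. infdist x (frontier \<Omega>) < \<rho> / 2}"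
 have fne: "frontier \<Omega> \<noteq> {}"
 proof
  assume "frontier \<Omega> = {}"
  then have "\<Omega> = {} \<or> \<Omega> = UNIV" using frontier_eq_empty by blast
  then show False using \<Omega> compact_imp_bounded not_bounded_UNIV by auto
 qed
 have mA: "m x = \<delta> / vol" if x: "x \<in> ?A" for x
 proof -
  obtain z where z0: "z \<in> frontier \<Omega>" "infdist x (frontier \<Omega>) = dist x z"
   by (rule infdist_attains_inf[OF frontier_closed fne])
  then have z: "z \<in> frontier \<Omega>" "dist x z < \<rho> / 2" using x by auto
  have "AE y in M. mollifier \<delta> (x - y) = 0"
   using deep
  proof eventually_elim
   case (elim y)
   show ?case
   proof (cases "dist x y < \<delta>")
    case True
    have "dist y z < \<rho>" using True z(2) \<delta>2 dist_triangle[of y z x] by (simp add: dist_commute)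
    then have "z \<in> ball y \<rho>" by simp
    also have "ball y \<rho> \<subseteq> interior \<Omega>" using elim by (simp add: interior_maximal)
    finally show ?thesis using z(1) unfolding frontier_def by simp
   qed (use mp(4)[of x y] in simp)
  qed
  then have "(\<integral>y. mollifier \<delta> (x - y) \<partial>M) = 0" by (rule integral_eq_zero_AE)
  then show ?thesis using x unfolding smooth_density_def by simp
 qed
 have Ab: "?A \<in> sets borel"
 proof -
  have "?A = \<Omega> \<inter> {x. infdist x (frontier \<Omega>) < \<rho> / 2}" by auto
  moreover have "open {x. infdist x (frontier \<Omega>) < \<rho> / 2}" by (intro open_Collect_less continuous_intros)
  ultimately show ?thesis using \<Omega>_borel by auto
 qed
 have "(LBINT x. indicator ?A x * m x) \<le> (LBINT x. \<delta> / vol * indicator \<Omega> x)"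
 proof (rule integral_mono)
  show "integrable lborel (\<lambda>x. indicator ?A x * m x)" by (rule m_mult_integrable[where B=1, OF borel_measurable_indicator[OF Ab]]) simp
  show "indicator ?A x * m x \<le> \<delta> / vol * indicator \<Omega> x" for x
   using mA[of x] \<delta>(1) vol_pos by (auto simp: indicator_def)
 qed (use \<Omega>_integrable in simp)
 also have "\<dots> = \<delta>" using \<Omega>_borel vol_lborel vol_pos by simp
 finally show ?thesis .
qed

end

section \<open>Square integrable couplings with Borel densities\<close>

text \<open>
 Borel densities that vanish off \<open>\<Omega> \<times> \<Omega>\<close> represent the
 elements of \<open>L2_couplings\<close> without exceptional null sets.
\<close>

definition bcoup :: "'a::euclidean_space set => ('a => real) => ('a => real) => ('a \<times> 'a => real) => bool" where
 "bcoup \<Omega> m1 m2 f \<longleftrightarrow> f \<in> borel_measurable borel \<and> (\<forall>z. 0 \<le> f z) \<and> (\<forall>z. z \<notin> \<Omega> \<times> \<Omega> \<longrightarrow> f z = 0) \<and>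
   integrable lborel f \<and> integrable lborel (\<lambda>z. (f z)\<^sup>2) \<and>
   is_coupling (density lborel (\<lambda>z. ennreal (f z))) (density lborel (\<lambda>x. ennreal (m1 x))) (density lborel (\<lambda>x. ennreal (m2 x)))"

definition marginal_density :: "'a::euclidean_space set => ('a => real) => bool" where
 "marginal_density \<Omega> m \<longleftrightarrow> m \<in> borel_measurable borel \<and> (\<forall>x. 0 \<le> m x) \<and> (\<forall>x. x \<notin> \<Omega> \<longrightarrow> m x = 0) \<and> integrable lborel m"

lemma integrable_mult_bounded:
 fixes f g :: "'a => real"
 assumes "integrable M f" "g \<in> borel_measurable M" "\<And>x. \<bar>g x\<bar> \<le> B"
 shows "integrable M (\<lambda>x. g x * f x)"
proof (rule Bochner_Integration.integrable_bound[where f="\<lambda>x. B * f x"])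
 show "AE x in M. norm (g x * f x) \<le> norm (B * f x)"
 proof (rule AE_I2)
  fix x
  have "\<bar>g x\<bar> * \<bar>f x\<bar> \<le> \<bar>B\<bar> * \<bar>f x\<bar>" using assms(3)[of x] by (intro mult_right_mono) auto
  then show "norm (g x * f x) \<le> norm (B * f x)" by (simp add: abs_mult)
 qed
qed (use assms in auto)

lemma finite_density:
 fixes f :: "'a => real"
 assumes "integrable M f" "\<And>z. 0 \<le> f z"
 shows "finite_measure (density M (\<lambda>z. ennreal (f z)))"
proof (rule finite_measureI)
 have "emeasure (density M (\<lambda>z. ennreal (f z))) (space M) = (\<integral>\<^sup>+z. ennreal (f z) \<partial>M)"
  using assms(1) by (subst emeasure_density) (auto intro!: nn_integral_cong simp: indicator_def)
 also have "\<dots> < \<infinity>" using assms unfolding integrable_iff_bounded by simp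
 finally show "emeasure (density M (\<lambda>z. ennreal (f z))) (space (density M (\<lambda>z. ennreal (f z)))) \<noteq> \<infinity>" by simp
qed

lemma integral_lborel_density:
 fixes f g :: "'a::euclidean_space => real"
 assumes "f \<in> borel_measurable borel" "\<And>z. 0 \<le> f z" "g \<in> borel_measurable borel"
 shows "(\<integral>z. g z \<partial>density lborel (\<lambda>z. ennreal (f z))) = (LBINT z. g z * f z)"
 using assms by (subst integral_density) (auto simp: mult.commute)

text \<open>
 Finite measures agree once they agree on indicators.
\<close>

lemma bcoup_iff_integrals:
 fixes f :: "'a::euclidean_space \<times> 'a => real"
 assumes f: "f \<in> borel_measurable borel" "\<And>z. 0 \<le> f z" "integrable lborel f" and m: "marginal_density \<Omega> m1" "marginal_density \<Omega> m2"
 shows "is_coupling (density lborel (\<lambda>z. ennreal (f z))) (density lborel (\<lambda>x. ennreal (m1 x))) (density lborel (\<lambda>x. ennreal (m2 x))) \<longleftrightarrow>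
  (\<forall>S\<in>sets borel. (LBINT z. indicat_real S (fst z) * f z) = (LBINT x. indicat_real S x * m1 x)
         \<and> (LBINT z. indicat_real S (snd z) * f z) = (LBINT x. indicat_real S x * m2 x))"
proof -
 have mm: "m1 \<in> borel_measurable borel" "\<And>x. 0 \<le> m1 x" "integrable lborel m1" "m2 \<in> borel_measurable borel" "\<And>x. 0 \<le> m2 x" "integrable lborel m2"
  using m unfolding marginal_density_def by auto
 have gen: "distr (density lborel (\<lambda>z. ennreal (f z))) borel pj = density lborel (\<lambda>x. ennreal (m x)) \<longleftrightarrow>
  (\<forall>S\<in>sets borel. (LBINT z. indicat_real S (pj z) * f z) = (LBINT x. indicat_real S x * m x))"
  if pj: "pj \<in> borel_measurable borel" and m: "m \<in> borel_measurable borel" "\<And>x. 0 \<le> m x" "integrable lborel m"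
  for pj :: "'a \<times> 'a => 'a" and m
 proof -
  let ?F = "density lborel (\<lambda>z. ennreal (f z))" and ?m = "density lborel (\<lambda>x. ennreal (m x))"
  have fin: "finite_measure ?F" "finite_measure ?m" using f m by (auto intro: finite_density)
  have pF: "pj \<in> borel_measurable ?F" using pj by simp
  have 1: "(\<integral>z. indicat_real S (pj z) \<partial>?F) = (LBINT z. indicat_real S (pj z) * f z)" if "S \<in> sets borel" for S
   by (rule integral_lborel_density[OF f(1,2) measurable_compose[OF pj borel_measurable_indicator[OF that]]])
  have 2: "measure ?m S = (LBINT x. indicat_real S x * m x)" if "S \<in> sets borel" for S
  proof -
   have "measure ?m S = (\<integral>x. indicat_real S x \<partial>?m)" using that by simp
   then show ?thesis using integral_lborel_density[OF m(1,2), of "indicat_real S"] that by simp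
  qed
  have 3: "measure (distr ?F borel pj) S = (LBINT z. indicat_real S (pj z) * f z)" if "S \<in> sets borel" for S
  proof -
   have "(\<integral>z. indicat_real S (pj z) \<partial>?F) = (\<integral>x. indicat_real S x \<partial>distr ?F borel pj)" using pF that by (subst integral_distr) auto
   then show ?thesis using 1[OF that] that by simp
  qed
  show ?thesis
  proof
   assume "distr ?F borel pj = ?m"
   then show "\<forall>S\<in>sets borel. (LBINT z. indicat_real S (pj z) * f z) = (LBINT x. indicat_real S x * m x)"
    using 2 3 by metis
  next
   assume *: "\<forall>S\<in>sets borel. (LBINT z. indicat_real S (pj z) * f z) = (LBINT x. indicat_real S x * m x)"
   show "distr ?F borel pj = ?m"
    by (rule distr_eqI_integral[OF fin(2) _ fin(1) pF]) (use * 1 2 in auto)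
  qed
 qed
 show ?thesis unfolding is_coupling_def using gen[OF fst_borel mm(1-3)] gen[OF snd_borel mm(4-6)] by auto
qed

lemma bcoupD:
 assumes "bcoup \<Omega> m1 m2 f"
 shows "f \<in> borel_measurable borel" "0 \<le> f z" "z \<notin> \<Omega> \<times> \<Omega> ==> f z = 0" "integrable lborel f" "integrable lborel (\<lambda>z. (f z)\<^sup>2)"
 using assms unfolding bcoup_def by blast+

lemma bcoup_integral:
 fixes f :: "'a::euclidean_space \<times> 'a => real"
 assumes b: "bcoup \<Omega> m1 m2 f" and m: "marginal_density \<Omega> m1" "marginal_density \<Omega> m2" and g: "g \<in> borel_measurable borel"
 shows "(LBINT z. g (fst z) * f z) = (LBINT x. g x * m1 x)" "(LBINT z. g (snd z) * f z) = (LBINT x. g x * m2 x)"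
proof -
 let ?F = "density lborel (\<lambda>z. ennreal (f z))"
 have d: "distr ?F borel fst = density lborel (\<lambda>x. ennreal (m1 x))" "distr ?F borel snd = density lborel (\<lambda>x. ennreal (m2 x))"
  using b unfolding bcoup_def is_coupling_def by auto
 note f = bcoupD[OF b]
 have mm: "m1 \<in> borel_measurable borel" "\<And>x. 0 \<le> m1 x" "m2 \<in> borel_measurable borel" "\<And>x. 0 \<le> m2 x" using m unfolding marginal_density_def by auto
 have "(LBINT z. g (fst z) * f z) = (\<integral>z. g (fst z) \<partial>?F)"
  using f g by (intro integral_lborel_density[symmetric]) (auto intro: measurable_compose[OF fst_borel])
 also have "\<dots> = (\<integral>x. g x \<partial>distr ?F borel fst)" using g by (intro integral_distr[symmetric]) auto
 finally show "(LBINT z. g (fst z) * f z) = (LBINT x. g x * m1 x)"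
  unfolding d using integral_lborel_density[OF mm(1,2) g] by simp
 have "(LBINT z. g (snd z) * f z) = (\<integral>z. g (snd z) \<partial>?F)"
  using f g by (intro integral_lborel_density[symmetric]) (auto intro: measurable_compose[OF snd_borel])
 also have "\<dots> = (\<integral>x. g x \<partial>distr ?F borel snd)" using g by (intro integral_distr[symmetric]) auto
 finally show "(LBINT z. g (snd z) * f z) = (LBINT x. g x * m2 x)"
  unfolding d using integral_lborel_density[OF mm(3,4) g] by simp
qed

lemma bcoup_mass:
 assumes b: "bcoup \<Omega> m1 m2 f" and m: "marginal_density \<Omega> m1" "marginal_density \<Omega> m2"
 shows "(LBINT z. f z) = (LBINT x. m1 x)"
 using bcoup_integral(1)[OF b m, of "\<lambda>_. 1"] by simp

lemma marginal_fst_iff: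
 fixes f :: "'a::euclidean_space \<times> 'a => real"
 assumes f: "f \<in> borel_measurable borel" and m: "m \<in> borel_measurable borel"
 shows "distr (density lborel (\<lambda>z. ennreal (f z))) borel fst = density lborel (\<lambda>x. ennreal (m x)) \<longleftrightarrow>
   (AE x in lborel. (\<integral>\<^sup>+y. ennreal (f (x, y)) \<partial>lborel) = ennreal (m x))"
  and "distr (density lborel (\<lambda>z. ennreal (f z))) borel snd = density lborel (\<lambda>x. ennreal (m x)) \<longleftrightarrow>
   (AE y in lborel. (\<integral>\<^sup>+x. ennreal (f (x, y)) \<partial>lborel) = ennreal (m y))"
proof -
 have fp: "f \<in> borel_measurable (lborel \<Otimes>\<^sub>M lborel)" using f by (simp add: lborel_prod)
 then have fp': "(\<lambda>(x, y). ennreal (f (x, y))) \<in> borel_measurable (lborel \<Otimes>\<^sub>M lborel)" "(\<lambda>(y, x). ennreal (f (x, y))) \<in> borel_measurable (lborel \<Otimes>\<^sub>M lborel)"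
  by (auto simp: case_prod_beta' intro!: measurable_compose[OF measurable_pair_swap' fp, unfolded case_prod_beta'] measurable_compose[OF _ measurable_ennreal])
 have m1: "(\<lambda>x. \<integral>\<^sup>+y. ennreal (f (x, y)) \<partial>lborel) \<in> borel_measurable lborel"
  using lborel.borel_measurable_nn_integral[OF fp'(1)] by simp
 have m2: "(\<lambda>y. \<integral>\<^sup>+x. ennreal (f (x, y)) \<partial>lborel) \<in> borel_measurable lborel"
  using lborel.borel_measurable_nn_integral[OF fp'(2)] by simp
 have e1: "distr (density lborel (\<lambda>z. ennreal (f z))) borel fst = density lborel (\<lambda>x. \<integral>\<^sup>+y. ennreal (f (x, y)) \<partial>lborel)"
 proof (rule measure_eqI)
  fix S assume "S \<in> sets (distr (density lborel (\<lambda>z. ennreal (f z))) borel fst)"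
  then have S: "S \<in> sets borel" by simp
  have fS: "fst -` S \<in> sets (borel :: ('a \<times> 'a) measure)" using measurable_sets[OF fst_borel S] by simp
  have "emeasure (distr (density lborel (\<lambda>z. ennreal (f z))) borel fst) S = (\<integral>\<^sup>+z. ennreal (f z) * indicator (fst -` S) z \<partial>lborel)"
   using S fS f by (subst emeasure_distr) (auto simp: emeasure_density)
  also have "\<dots> = (\<integral>\<^sup>+z. ennreal (f z) * indicator (fst -` S) z \<partial>(lborel \<Otimes>\<^sub>M lborel))" by (simp add: lborel_prod)
  also have "\<dots> = (\<integral>\<^sup>+x. \<integral>\<^sup>+y. ennreal (f (x, y)) * indicator (fst -` S) (x, y) \<partial>lborel \<partial>lborel)"
   using f fS by (intro lborel.nn_integral_fst[symmetric]) (simp add: lborel_prod)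
  also have "\<dots> = (\<integral>\<^sup>+x. (\<integral>\<^sup>+y. ennreal (f (x, y)) \<partial>lborel) * indicator S x \<partial>lborel)"
   by (intro nn_integral_cong) (auto simp: indicator_def)
  finally show "emeasure (distr (density lborel (\<lambda>z. ennreal (f z))) borel fst) S = emeasure (density lborel (\<lambda>x. \<integral>\<^sup>+y. ennreal (f (x, y)) \<partial>lborel)) S"
   using S m1 by (simp add: emeasure_density)
 qed simp
 have e2: "distr (density lborel (\<lambda>z. ennreal (f z))) borel snd = density lborel (\<lambda>y. \<integral>\<^sup>+x. ennreal (f (x, y)) \<partial>lborel)"
 proof (rule measure_eqI)
  fix S assume "S \<in> sets (distr (density lborel (\<lambda>z. ennreal (f z))) borel snd)"
  then have S: "S \<in> sets borel" by simp
  have fS: "snd -` S \<in> sets (borel :: ('a \<times> 'a) measure)" using measurable_sets[OF snd_borel S] by simp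
  have "emeasure (distr (density lborel (\<lambda>z. ennreal (f z))) borel snd) S = (\<integral>\<^sup>+z. ennreal (f z) * indicator (snd -` S) z \<partial>lborel)"
   using S fS f by (subst emeasure_distr) (auto simp: emeasure_density)
  also have "\<dots> = (\<integral>\<^sup>+z. ennreal (f z) * indicator (snd -` S) z \<partial>(lborel \<Otimes>\<^sub>M lborel))" by (simp add: lborel_prod)
  also have "\<dots> = (\<integral>\<^sup>+y. \<integral>\<^sup>+x. ennreal (f (x, y)) * indicator (snd -` S) (x, y) \<partial>lborel \<partial>lborel)"
   using f fS by (intro lborel_pair.nn_integral_snd[symmetric]) (simp add: lborel_prod)
  also have "\<dots> = (\<integral>\<^sup>+y. (\<integral>\<^sup>+x. ennreal (f (x, y)) \<partial>lborel) * indicator S y \<partial>lborel)"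
   by (intro nn_integral_cong) (auto simp: indicator_def)
  finally show "emeasure (distr (density lborel (\<lambda>z. ennreal (f z))) borel snd) S = emeasure (density lborel (\<lambda>y. \<integral>\<^sup>+x. ennreal (f (x, y)) \<partial>lborel)) S"
   using S m2 by (simp add: emeasure_density)
 qed simp
 show "distr (density lborel (\<lambda>z. ennreal (f z))) borel fst = density lborel (\<lambda>x. ennreal (m x)) \<longleftrightarrow>
   (AE x in lborel. (\<integral>\<^sup>+y. ennreal (f (x, y)) \<partial>lborel) = ennreal (m x))"
  unfolding e1 using m1 m by (intro sigma_finite_measure.density_unique_iff[OF sigma_finite_lborel]) auto
 show "distr (density lborel (\<lambda>z. ennreal (f z))) borel snd = density lborel (\<lambda>x. ennreal (m x)) \<longleftrightarrow>
   (AE y in lborel. (\<integral>\<^sup>+x. ennreal (f (x, y)) \<partial>lborel) = ennreal (m y))"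
  unfolding e2 using m2 m by (intro sigma_finite_measure.density_unique_iff[OF sigma_finite_lborel]) auto
qed

lemma lebesgue_on_lborel:
 fixes g :: "'a::euclidean_space => real"
 assumes "g \<in> borel_measurable borel" "\<And>x. x \<notin> S ==> g x = 0" "S \<in> sets borel"
 shows "(LINT x|lebesgue_on S. g x) = (LBINT x. g x)" "integrable (lebesgue_on S) g \<longleftrightarrow> integrable lborel g"
  "g \<in> borel_measurable (lebesgue_on S)"
proof -
 have S: "S \<in> sets lebesgue" using assms(3) by simp
 have eq: "(\<lambda>x. indicat_real S x *\<^sub>R g x) = g" using assms(2) by (auto simp: indicator_def fun_eq_iff)
 have gl: "g \<in> borel_measurable lborel" using assms(1) by simp
 show "(LINT x|lebesgue_on S. g x) = (LBINT x. g x)"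
  using S gl eq by (simp add: integral_restrict_space integral_completion)
 show "integrable (lebesgue_on S) g \<longleftrightarrow> integrable lborel g"
  using S gl eq by (simp add: integrable_restrict_space integrable_completion)
 show "g \<in> borel_measurable (lebesgue_on S)"
  using measurable_completion[OF gl] by (rule measurable_restrict_space1)
qed

lemma AE_lborel_lebesgue_on:
 assumes "S \<in> sets borel"
 shows "(AE x in lebesgue_on S. P x) \<longleftrightarrow> (AE x in lborel. x \<in> S \<longrightarrow> P x)"
 using assms by (subst AE_restrict_space_iff) (auto simp: AE_completion_iff)

lemma Lp_on_2: "Lp_on 2 S f \<longleftrightarrow> f \<in> borel_measurable (lebesgue_on S) \<and> integrable (lebesgue_on S) (\<lambda>x. (f x)\<^sup>2)"
proof -
 have "\<bar>f x\<bar> powr 2 = (f x)\<^sup>2" for x by (cases "f x = 0") (auto simp: powr_numeral)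
 then show ?thesis unfolding Lp_on_def by simp
qed

lemma bcoup_L2_coupling:
 fixes \<Omega> :: "'a::euclidean_space set"
 assumes \<Omega>: "compact \<Omega>" and m: "marginal_density \<Omega> m1" "marginal_density \<Omega> m2" and b: "bcoup \<Omega> m1 m2 f"
  and mm: "\<And>x. x \<in> \<Omega> ==> m1' x = m1 x" "\<And>x. x \<in> \<Omega> ==> m2' x = m2 x"
 shows "f \<in> L2_couplings \<Omega> \<Omega> m1' m2'"
proof -
 note f = bcoupD[OF b]
 have \<Omega>b: "\<Omega> \<in> sets borel" "\<Omega> \<times> \<Omega> \<in> sets borel" using \<Omega> compact_Times[OF \<Omega> \<Omega>] by (auto simp: borel_compact)
 have mb: "m1 \<in> borel_measurable borel" "m2 \<in> borel_measurable borel" "\<And>x. 0 \<le> m1 x" "\<And>x. 0 \<le> m2 x" using m unfolding marginal_density_def by auto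
 have d: "AE x in lborel. (\<integral>\<^sup>+y. ennreal (f (x, y)) \<partial>lborel) = ennreal (m1 x)" "AE y in lborel. (\<integral>\<^sup>+x. ennreal (f (x, y)) \<partial>lborel) = ennreal (m2 y)"
  using b marginal_fst_iff[OF f(1) mb(1)] marginal_fst_iff[OF f(1) mb(2)] unfolding bcoup_def is_coupling_def by auto
 have sl: "(\<lambda>y. f (x, y)) \<in> borel_measurable borel" "(\<lambda>x. f (x, y)) \<in> borel_measurable borel" for x y
  using f(1) by (auto intro!: measurable_compose[OF _ f(1)] borel_measurable_Pair)
 have "(LINT x2|lebesgue_on \<Omega>. f (x1, x2)) = enn2real (\<integral>\<^sup>+y. ennreal (f (x1, y)) \<partial>lborel)" for x1
  using lebesgue_on_lborel(1)[OF sl(1) _ \<Omega>b(1), of x1] f(3) integral_eq_nn_integral[of "\<lambda>y. f (x1, y)" lborel] sl f(2) by auto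
 moreover have "(LINT x1|lebesgue_on \<Omega>. f (x1, x2)) = enn2real (\<integral>\<^sup>+x. ennreal (f (x, x2)) \<partial>lborel)" for x2
  using lebesgue_on_lborel(1)[OF sl(2) _ \<Omega>b(1), of x2] f(3) integral_eq_nn_integral[of "\<lambda>x. f (x, x2)" lborel] sl f(2) by auto
 ultimately have i: "\<And>x1. (LINT x2|lebesgue_on \<Omega>. f (x1, x2)) = enn2real (\<integral>\<^sup>+y. ennreal (f (x1, y)) \<partial>lborel)"
  "\<And>x2. (LINT x1|lebesgue_on \<Omega>. f (x1, x2)) = enn2real (\<integral>\<^sup>+x. ennreal (f (x, x2)) \<partial>lborel)" by auto
 have "AE x1 in lebesgue_on \<Omega>. (LINT x2|lebesgue_on \<Omega>. f (x1, x2)) = m1' x1"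
  unfolding AE_lborel_lebesgue_on[OF \<Omega>b(1)] i using d(1) by eventually_elim (use mm mb in auto)
 moreover have "AE x2 in lebesgue_on \<Omega>. (LINT x1|lebesgue_on \<Omega>. f (x1, x2)) = m2' x2"
  unfolding AE_lborel_lebesgue_on[OF \<Omega>b(1)] i using d(2) by eventually_elim (use mm mb in auto)
 moreover have "Lp_on 2 (\<Omega> \<times> \<Omega>) f"
  unfolding Lp_on_2 using lebesgue_on_lborel(3)[OF f(1) f(3) \<Omega>b(2)] lebesgue_on_lborel(2)[of "\<lambda>z. (f z)\<^sup>2", OF _ _ \<Omega>b(2)] f by auto
 ultimately show ?thesis unfolding L2_couplings_def using f(2) by auto
qed

lemma L2_coupling_bcoup:
 fixes \<Omega> :: "'a::euclidean_space set"
 assumes \<Omega>: "compact \<Omega>" and m: "marginal_density \<Omega> m1" "marginal_density \<Omega> m2" and \<pi>: "\<pi> \<in> L2_couplings \<Omega> \<Omega> m1' m2'"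
  and mm: "\<And>x. x \<in> \<Omega> ==> m1' x = m1 x" "\<And>x. x \<in> \<Omega> ==> m2' x = m2 x"
 obtains f where "bcoup \<Omega> m1 m2 f" "AE z in lebesgue_on (\<Omega> \<times> \<Omega>). \<pi> z = f z"
proof -
 let ?X = "\<Omega> \<times> \<Omega>"
 have \<Omega>b: "\<Omega> \<in> sets borel" "?X \<in> sets borel" using \<Omega> compact_Times[OF \<Omega> \<Omega>] by (auto simp: borel_compact)
 have Xl: "?X \<in> sets lebesgue" using \<Omega>b by simp
 have mb: "m1 \<in> borel_measurable borel" "m2 \<in> borel_measurable borel" "\<And>x. 0 \<le> m1 x" "\<And>x. 0 \<le> m2 x"
  "\<And>x. x \<notin> \<Omega> ==> m1 x = 0" "\<And>x. x \<notin> \<Omega> ==> m2 x = 0" "integrable lborel m1" "integrable lborel m2" using m unfolding marginal_density_def by auto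
 have \<pi>m: "\<pi> \<in> borel_measurable (lebesgue_on ?X)" and \<pi>2: "integrable (lebesgue_on ?X) (\<lambda>z. (\<pi> z)\<^sup>2)"
  and \<pi>0: "AE z in lebesgue_on ?X. 0 \<le> \<pi> z"
  and \<pi>a: "AE x1 in lebesgue_on \<Omega>. (LINT x2|lebesgue_on \<Omega>. \<pi> (x1, x2)) = m1' x1"
  and \<pi>b: "AE x2 in lebesgue_on \<Omega>. (LINT x1|lebesgue_on \<Omega>. \<pi> (x1, x2)) = m2' x2"
  using \<pi> unfolding L2_couplings_def Lp_on_2 by auto
 have "(\<lambda>z. indicat_real ?X z *\<^sub>R \<pi> z) \<in> borel_measurable lebesgue"
  using \<pi>m Xl borel_measurable_restrict_space_iff[of ?X lebesgue \<pi>] by simp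
 then obtain f0 where f0: "f0 \<in> borel_measurable lborel" "AE z in lborel. indicat_real ?X z *\<^sub>R \<pi> z = f0 z"
  using completion_ex_borel_measurable_real by blast
 define f where "f z = indicat_real ?X z * max 0 (f0 z)" for z
 have fm: "f \<in> borel_measurable borel" unfolding f_def using f0(1) \<Omega>b by measurable
 have f_nn: "0 \<le> f z" for z unfolding f_def by simp
 have f_z: "f z = 0" if "z \<notin> ?X" for z unfolding f_def using that by simp
 have AEl: "AE z in lborel. z \<in> ?X \<longrightarrow> \<pi> z = f z"
  using f0(2) \<pi>0[unfolded AE_lborel_lebesgue_on[OF \<Omega>b(2)]] by eventually_elim (auto simp: f_def)
 then have AE: "AE z in lebesgue_on ?X. \<pi> z = f z" unfolding AE_lborel_lebesgue_on[OF \<Omega>b(2)] .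
 have f2: "integrable lborel (\<lambda>z. (f z)\<^sup>2)"
 proof -
  have m2: "(\<lambda>z. (f z)\<^sup>2) \<in> borel_measurable (lebesgue_on ?X)" using lebesgue_on_lborel(3)[OF fm f_z \<Omega>b(2)] by measurable
  have "integrable (lebesgue_on ?X) (\<lambda>z. (f z)\<^sup>2)"
   by (rule integrable_cong_AE_imp[OF \<pi>2 m2]) (use AE in \<open>auto elim!: eventually_mono\<close>)
  then show ?thesis using lebesgue_on_lborel(2)[of "\<lambda>z. (f z)\<^sup>2", OF _ _ \<Omega>b(2)] fm f_z by auto
 qed
 have f1: "integrable lborel f"
 proof (rule Bochner_Integration.integrable_bound[where f="\<lambda>z. indicat_real ?X z + (f z)\<^sup>2"])
  have "integrable lborel (indicat_real ?X)"
   by (rule integrable_bounded_support[where B=1 and K="?X"]) (use \<Omega>b compact_imp_bounded[OF compact_Times[OF \<Omega> \<Omega>]] in auto)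
  then show "integrable lborel (\<lambda>z. indicat_real ?X z + (f z)\<^sup>2)" using f2 by simp
  have "f z \<le> indicat_real ?X z + (f z)\<^sup>2" for z
  proof (cases "z \<in> ?X")
   case True
   have "0 \<le> (f z - 1/2)\<^sup>2" by simp
   then have "f z \<le> 1 + (f z)\<^sup>2" by (simp add: power2_eq_square algebra_simps)
   then show ?thesis using True by simp
  qed (simp add: f_z)
  then show "AE z in lborel. norm (f z) \<le> norm (indicat_real ?X z + (f z)\<^sup>2)" using f_nn by (intro AE_I2) auto
 qed (use fm in simp)
 have sl: "(\<lambda>y. f (x, y)) \<in> borel_measurable borel" "(\<lambda>x. f (x, y)) \<in> borel_measurable borel" for x y
  using fm by (auto intro!: measurable_compose[OF _ fm] borel_measurable_Pair)
 have AEp: "AE z in lborel \<Otimes>\<^sub>M lborel. z \<in> ?X \<longrightarrow> \<pi> z = f z" using AEl unfolding lborel_prod .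
 have AEq: "AE z in lborel \<Otimes>\<^sub>M lborel. (snd z, fst z) \<in> ?X \<longrightarrow> \<pi> (snd z, fst z) = f (snd z, fst z)"
 proof -
  have "AE z in distr (lborel \<Otimes>\<^sub>M lborel) (lborel \<Otimes>\<^sub>M lborel) (\<lambda>(x::'a, y::'a). (y, x)). z \<in> ?X \<longrightarrow> \<pi> z = f z"
   unfolding lborel_pair.distr_pair_swap[symmetric] by (rule AEp)
  then have "AE z in lborel \<Otimes>\<^sub>M lborel. (\<lambda>(x, y). (y, x)) z \<in> ?X \<longrightarrow> \<pi> ((\<lambda>(x, y). (y, x)) z) = f ((\<lambda>(x, y). (y, x)) z)"
   by (rule AE_distrD[OF measurable_pair_swap'])
  then show ?thesis by (simp add: case_prod_beta')
 qed
 have slice: "(LINT y|lebesgue_on \<Omega>. q y) = (LBINT y. g y)"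
  if AE: "AE y in lborel. y \<in> \<Omega> \<longrightarrow> q y = g y" and g: "g \<in> borel_measurable borel" "\<And>y. y \<notin> \<Omega> ==> g y = 0" for q g :: "'a => real"
 proof -
  have AE': "AE y in lebesgue. indicat_real \<Omega> y *\<^sub>R g y = indicat_real \<Omega> y *\<^sub>R q y"
   using AE by (intro AE_completion) (auto elim!: eventually_mono simp: indicator_def)
  have gm: "(\<lambda>y. indicat_real \<Omega> y *\<^sub>R g y) \<in> borel_measurable lebesgue" using g(1) \<Omega>b(1) by (intro measurable_completion) simp
  have qm: "(\<lambda>y. indicat_real \<Omega> y *\<^sub>R q y) \<in> borel_measurable lebesgue" by (rule borel_measurable_AE[OF gm AE'])
  have "(LINT y|lebesgue_on \<Omega>. q y) = (LINT y|lebesgue. indicat_real \<Omega> y *\<^sub>R q y)" using \<Omega>b by (simp add: integral_restrict_space)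
  also have "\<dots> = (LINT y|lebesgue. indicat_real \<Omega> y *\<^sub>R g y)" by (rule integral_cong_AE[OF qm gm]) (use AE' in \<open>auto elim!: eventually_mono\<close>)
  also have "\<dots> = (LINT y|lebesgue_on \<Omega>. g y)" using \<Omega>b by (simp add: integral_restrict_space)
  also have "\<dots> = (LBINT y. g y)" by (rule lebesgue_on_lborel(1)[OF g \<Omega>b(1)])
  finally show ?thesis .
 qed
 have fin1: "AE x in lborel. integrable lborel (\<lambda>y. f (x, y))" using lborel_pair.AE_integrable_fst[of "\<lambda>x y. f (x, y)"] f1 by (simp add: lborel_prod)
 have fin2: "AE y in lborel. integrable lborel (\<lambda>x. f (x, y))" using lborel_pair.AE_integrable_snd[of "\<lambda>x y. f (x, y)"] f1 by (simp add: lborel_prod)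
 have d1: "AE x in lborel. (\<integral>\<^sup>+y. ennreal (f (x, y)) \<partial>lborel) = ennreal (m1 x)"
  using lborel_pair.AE_pair[OF AEp] \<pi>a[unfolded AE_lborel_lebesgue_on[OF \<Omega>b(1)]] fin1
 proof eventually_elim
  case (elim x)
  have nn: "(\<integral>\<^sup>+y. ennreal (f (x, y)) \<partial>lborel) = ennreal (LBINT y. f (x, y))"
   by (rule nn_integral_eq_integral[OF elim(3)]) (simp add: f_nn)
  show ?case
  proof (cases "x \<in> \<Omega>")
   case True
   have "(LINT y|lebesgue_on \<Omega>. \<pi> (x, y)) = (LBINT y. f (x, y))"
    by (rule slice) (use elim(1) True sl f_z in auto)
   then show ?thesis using nn elim(2) True mm by simp
  next
   case False
   then show ?thesis using f_z mb(5) by simp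
  qed
 qed
 have d2: "AE y in lborel. (\<integral>\<^sup>+x. ennreal (f (x, y)) \<partial>lborel) = ennreal (m2 y)"
  using lborel_pair.AE_pair[OF AEq] \<pi>b[unfolded AE_lborel_lebesgue_on[OF \<Omega>b(1)]] fin2
 proof eventually_elim
  case (elim y)
  have nn: "(\<integral>\<^sup>+x. ennreal (f (x, y)) \<partial>lborel) = ennreal (LBINT x. f (x, y))"
   by (rule nn_integral_eq_integral[OF elim(3)]) (simp add: f_nn)
  show ?case
  proof (cases "y \<in> \<Omega>")
   case True
   have "(LINT x|lebesgue_on \<Omega>. \<pi> (x, y)) = (LBINT x. f (x, y))"
    by (rule slice) (use elim(1) True sl f_z in auto)
   then show ?thesis using nn elim(2) True mm by simp
  next
   case False
   then show ?thesis using f_z mb(6) by simp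
  qed
 qed
 have "bcoup \<Omega> m1 m2 f"
  unfolding bcoup_def is_coupling_def using fm f_nn f_z f1 f2 d1 d2 marginal_fst_iff(1)[OF fm mb(1)] marginal_fst_iff(2)[OF fm mb(2)] by auto
 then show ?thesis using that AE by blast
qed

section \<open>Existence of regularized minimizers\<close>

lemma compact_integrable_indicator:
 fixes X :: "'a::euclidean_space set"
 assumes "compact X" shows "integrable lborel (indicat_real X)"
 by (rule integrable_bounded_support[OF borel_measurable_indicator[OF borel_compact[OF assms]], where B=1 and K=X])
  (use assms in \<open>auto intro: compact_imp_bounded\<close>)

text \<open>
 The telescoping series of absolute differences is integrable, which yields the majorant and
 almost sure convergence.
\<close>

lemma rapid_L1_limit:
 fixes F :: "nat => 'a => real"
 assumes F: "\<And>k. integrable M (F k)" and C: "\<And>k. (\<integral>x. \<bar>F (Suc k) x - F k x\<bar> \<partial>M) \<le> C * (1/2) ^ k"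
 obtains G where "integrable M G" "\<And>k. AE x in M. \<bar>F k x\<bar> \<le> G x" "AE x in M. convergent (\<lambda>k. F k x)"
proof -
 define D where "D k x = \<bar>F (Suc k) x - F k x\<bar>" for k x
 have Di: "integrable M (D k)" for k unfolding D_def using F by auto
 have Dm [measurable]: "D k \<in> borel_measurable M" for k using Di by auto
 have C0: "0 \<le> C"
 proof -
  have "0 \<le> (\<integral>x. \<bar>F (Suc 0) x - F 0 x\<bar> \<partial>M)" by simp
  from order_trans[OF this C[of 0]] show ?thesis by simp
 qed
 define S where "S x = (\<Sum>k. ennreal (D k x))" for x
 have Sm: "S \<in> borel_measurable M" unfolding S_def by measurable
 have "(\<integral>\<^sup>+x. S x \<partial>M) = (\<Sum>k. \<integral>\<^sup>+x. ennreal (D k x) \<partial>M)" unfolding S_def by (rule nn_integral_suminf) measurable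
 also have "\<dots> \<le> (\<Sum>k. ennreal (C * (1/2) ^ k))"
 proof (rule suminf_le)
  show "(\<integral>\<^sup>+x. ennreal (D k x) \<partial>M) \<le> ennreal (C * (1/2) ^ k)" for k
  proof -
   have "(\<integral>\<^sup>+x. ennreal (D k x) \<partial>M) = ennreal (\<integral>x. D k x \<partial>M)"
    by (rule nn_integral_eq_integral[OF Di]) (simp add: D_def)
   moreover have "(\<integral>x. D k x \<partial>M) \<le> C * (1/2) ^ k" unfolding D_def by (rule C)
   ultimately show ?thesis by (simp only: ennreal_leI)
  qed
 qed auto
 also have "\<dots> = ennreal (\<Sum>k. C * (1/2) ^ k)"
  using C0 by (intro suminf_ennreal2) (auto intro!: summable_mult summable_geometric)
 finally have Sfin: "(\<integral>\<^sup>+x. S x \<partial>M) < \<infinity>" by (rule le_less_trans) simp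
 have AES: "AE x in M. S x \<noteq> \<infinity>" using nn_integral_PInf_AE[OF Sm] Sfin by auto
 define G where "G x = \<bar>F 0 x\<bar> + enn2real (S x)" for x
 have Gi: "integrable M G"
 proof -
  have "integrable M (\<lambda>x. enn2real (S x))"
  proof (rule integrableI_bounded)
   show "(\<integral>\<^sup>+x. ennreal (norm (enn2real (S x))) \<partial>M) < \<infinity>"
   proof (rule le_less_trans[OF nn_integral_mono Sfin])
    show "ennreal (norm (enn2real (S x))) \<le> S x" for x by (simp add: ennreal_enn2real_if)
   qed
  qed (use Sm in measurable)
  then show ?thesis unfolding G_def using F[of 0] by auto
 qed
 have sums: "summable (\<lambda>k. D k x)" "(\<Sum>k. D k x) = enn2real (S x)" if "S x \<noteq> \<infinity>" for x
 proof -
  have nn: "0 \<le> D k x" for k unfolding D_def by simp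
  show 1: "summable (\<lambda>k. D k x)" using that unfolding S_def by (intro summable_suminf_not_top) (auto simp: nn)
  show "(\<Sum>k. D k x) = enn2real (S x)" unfolding S_def using suminf_ennreal2[OF nn 1] suminf_nonneg[OF 1 nn] by simp
 qed
 have tel: "F k x = F 0 x + (\<Sum>j<k. F (Suc j) x - F j x)" for k x by (induction k) auto
 have bd: "\<bar>F k x\<bar> \<le> G x" if "S x \<noteq> \<infinity>" for k x
 proof -
  have "\<bar>\<Sum>j<k. F (Suc j) x - F j x\<bar> \<le> (\<Sum>j<k. D j x)" unfolding D_def by (rule sum_abs)
  also have "\<dots> \<le> (\<Sum>j. D j x)" by (rule sum_le_suminf[OF sums(1)[OF that]]) (auto simp: D_def)
  finally show ?thesis unfolding G_def using tel[of k x] sums(2)[OF that] by linarith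
 qed
 have conv: "convergent (\<lambda>k. F k x)" if "S x \<noteq> \<infinity>" for x
 proof -
  have "summable (\<lambda>j. F (Suc j) x - F j x)" using sums(1)[OF that] unfolding D_def by (rule summable_rabs_cancel)
  then have "convergent (\<lambda>k. \<Sum>j<k. F (Suc j) x - F j x)" by (simp add: summable_iff_convergent)
  then obtain l where "(\<lambda>k. \<Sum>j<k. F (Suc j) x - F j x) \<longlonglongrightarrow> l" unfolding convergent_def by blast
  then have "(\<lambda>k. F 0 x + (\<Sum>j<k. F (Suc j) x - F j x)) \<longlonglongrightarrow> F 0 x + l" by (intro tendsto_intros)
  then show ?thesis unfolding convergent_def tel[symmetric] by blast
 qed
 show ?thesis by (rule that[OF Gi]) (use AES bd conv in \<open>auto elim!: eventually_mono\<close>)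
qed

lemma bcoup_midpoint:
 assumes f: "bcoup \<Omega> m1 m2 f" and g: "bcoup \<Omega> m1 m2 g" and m: "marginal_density \<Omega> m1" "marginal_density \<Omega> m2"
 shows "bcoup \<Omega> m1 m2 (\<lambda>z. (f z + g z) / 2)" "integrable lborel (\<lambda>z. f z * g z)"
proof -
 note F = bcoupD[OF f] and G = bcoupD[OF g]
 show fg: "integrable lborel (\<lambda>z. f z * g z)"
 proof (rule Bochner_Integration.integrable_bound[where f="\<lambda>z. (f z)\<^sup>2 + (g z)\<^sup>2"])
  show "AE z in lborel. norm (f z * g z) \<le> norm ((f z)\<^sup>2 + (g z)\<^sup>2)"
  proof (rule AE_I2)
   fix z
   have "0 \<le> (f z - g z)\<^sup>2" by simp
   then have "2 * (f z * g z) \<le> (f z)\<^sup>2 + (g z)\<^sup>2" by (simp add: power2_eq_square algebra_simps)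
   moreover have "0 \<le> f z * g z" using F(2)[of z] G(2)[of z] by simp
   ultimately show "norm (f z * g z) \<le> norm ((f z)\<^sup>2 + (g z)\<^sup>2)" by simp
  qed
 qed (use F G in auto)
 have fm: "(\<lambda>z. (f z + g z) / 2) \<in> borel_measurable borel" using F(1) G(1) by measurable
 have nn: "0 \<le> (f z + g z) / 2" for z using F(2)[of z] G(2)[of z] by simp
 have i: "integrable lborel (\<lambda>z. (f z + g z) / 2)" using F(4) G(4) by simp
 have sq: "(\<lambda>z. ((f z + g z) / 2)\<^sup>2) = (\<lambda>z. (f z)\<^sup>2 / 4 + (g z)\<^sup>2 / 4 + f z * g z / 2)"
  by (auto simp: power2_eq_square field_simps)
 have half: "(LBINT z. indicat_real S (pj z) * ((f z + g z) / 2)) = ((LBINT z. indicat_real S (pj z) * f z) + (LBINT z. indicat_real S (pj z) * g z)) / 2"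
  if "S \<in> sets borel" "pj \<in> borel_measurable borel" for S and pj :: "'a \<times> 'a => 'a"
 proof -
  have im: "(\<lambda>z. indicat_real S (pj z)) \<in> borel_measurable lborel" using measurable_compose[OF that(2) borel_measurable_indicator[OF that(1)]] by simp
  have "integrable lborel (\<lambda>z. indicat_real S (pj z) * f z)" "integrable lborel (\<lambda>z. indicat_real S (pj z) * g z)"
   using integrable_mult_bounded[OF F(4) im, of 1] integrable_mult_bounded[OF G(4) im, of 1] by auto
  moreover have "(\<lambda>z. indicat_real S (pj z) * ((f z + g z) / 2)) = (\<lambda>z. (indicat_real S (pj z) * f z + indicat_real S (pj z) * g z) / 2)" by (auto simp: algebra_simps)
  ultimately show ?thesis by simp
 qed
 have "is_coupling (density lborel (\<lambda>z. ennreal ((f z + g z) / 2))) (density lborel (\<lambda>x. ennreal (m1 x))) (density lborel (\<lambda>x. ennreal (m2 x)))"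
  unfolding bcoup_iff_integrals[OF fm nn i m]
  using bcoup_integral[OF f m borel_measurable_indicator] bcoup_integral[OF g m borel_measurable_indicator] half fst_borel snd_borel by auto
 then show "bcoup \<Omega> m1 m2 (\<lambda>z. (f z + g z) / 2)"
  unfolding bcoup_def using fm nn i F(3,5) G(3,5) fg sq by auto
qed

text \<open>
 The parallelogram identity bounds the squared distance of two almost optimal couplings by
 their excess energy. Couplings whose excess is \<open>(1/4) ^ k\<close> therefore form a
 rapidly convergent sequence; dominated convergence preserves the marginals and Fatou's lemma
 the energy bound.
\<close>

theorem regularized_minimizer_exists:
 fixes \<Omega> :: "'a::euclidean_space set" and c :: "'a \<times> 'a => real"
 assumes \<Omega>: "compact \<Omega>" and m: "marginal_density \<Omega> m1" "marginal_density \<Omega> m2" and \<gamma>: "0 < \<gamma>"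
  and c: "c \<in> borel_measurable borel" "\<And>z. \<bar>c z\<bar> \<le> B" and ne: "bcoup \<Omega> m1 m2 f0"
 defines "E \<equiv> \<lambda>f. (LBINT z. c z * f z) + \<gamma> / 2 * (LBINT z. (f z)\<^sup>2)"
 obtains f where "bcoup \<Omega> m1 m2 f" "\<And>g. bcoup \<Omega> m1 m2 g ==> E f \<le> E g"
proof -
 let ?X = "\<Omega> \<times> \<Omega>"
 have Xc: "compact ?X" using \<Omega> by (simp add: compact_Times)
 have Xb: "?X \<in> sets borel" using Xc by (rule borel_compact)
 have Xi: "integrable lborel (indicat_real ?X)" by (rule compact_integrable_indicator[OF Xc])
 define V where "V = measure lborel ?X"
 have cl: "c \<in> borel_measurable lborel" using c(1) by simp
 have ci: "integrable lborel (\<lambda>z. c z * f z)" if "bcoup \<Omega> m1 m2 f" for f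
  using integrable_mult_bounded[OF bcoupD(4)[OF that] cl c(2)] .
 have low: "- B * (LBINT x. m1 x) \<le> E f" if b: "bcoup \<Omega> m1 m2 f" for f
 proof -
  have "(LBINT z. - B * f z) \<le> (LBINT z. c z * f z)"
  proof (rule integral_mono)
   show "- B * f z \<le> c z * f z" for z using c(2)[of z] bcoupD(2)[OF b] by (intro mult_right_mono) auto
  qed (use ci[OF b] bcoupD(4)[OF b] in auto)
  moreover have "0 \<le> \<gamma> / 2 * (LBINT z. (f z)\<^sup>2)" using \<gamma> by simp
  ultimately show ?thesis unfolding E_def using bcoup_mass[OF b m] by simp
 qed
 define I where "I = Inf (E ` {f. bcoup \<Omega> m1 m2 f})"
 have bdd: "bdd_below (E ` {f. bcoup \<Omega> m1 m2 f})" using low by (intro bdd_belowI2[where m="- B * (LBINT x. m1 x)"]) auto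
 have I: "I \<le> E f" if "bcoup \<Omega> m1 m2 f" for f unfolding I_def using that bdd by (intro cInf_lower) auto
 have "\<exists>f. bcoup \<Omega> m1 m2 f \<and> E f < I + (1/4) ^ k" for k
 proof -
  have "\<exists>e\<in>E ` {f. bcoup \<Omega> m1 m2 f}. e < I + (1/4) ^ k"
   unfolding I_def using ne by (intro cInf_lessD) auto
  then show ?thesis by auto
 qed
 then obtain F where F: "\<And>k. bcoup \<Omega> m1 m2 (F k)" "\<And>k. E (F k) < I + (1/4) ^ k" by metis
 have gap: "(LBINT z. (F (Suc k) z - F k z)\<^sup>2) \<le> 8 / \<gamma> * (1/4) ^ k"
  and gap_int: "integrable lborel (\<lambda>z. (F (Suc k) z - F k z)\<^sup>2)" for k
 proof -
  let ?f = "F (Suc k)" and ?g = "F k" let ?h = "\<lambda>z. (F (Suc k) z + F k z) / 2"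
  note mid = bcoup_midpoint[OF F(1)[of "Suc k"] F(1)[of k] m]
  have i: "integrable lborel (\<lambda>z. (?f z)\<^sup>2)" "integrable lborel (\<lambda>z. (?g z)\<^sup>2)" "integrable lborel (\<lambda>z. ?f z * ?g z)"
   using bcoupD(5)[OF F(1)] mid(2) by auto
  have sq: "(\<lambda>z. (?f z - ?g z)\<^sup>2) = (\<lambda>z. (?f z)\<^sup>2 + (?g z)\<^sup>2 - 2 * (?f z * ?g z))" by (auto simp: power2_eq_square algebra_simps)
  show "integrable lborel (\<lambda>z. (F (Suc k) z - F k z)\<^sup>2)" unfolding sq using i by simp
  define a b d where "a = (LBINT z. (?f z)\<^sup>2)" and "b = (LBINT z. (?g z)\<^sup>2)" and "d = (LBINT z. ?f z * ?g z)"
  have e1: "(LBINT z. (?f z - ?g z)\<^sup>2) = a + b - 2 * d" unfolding sq a_def b_def d_def using i by simp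
  have "(\<lambda>z. (?h z)\<^sup>2) = (\<lambda>z. (?f z)\<^sup>2 / 4 + (?g z)\<^sup>2 / 4 + ?f z * ?g z / 2)" by (auto simp: power2_eq_square field_simps)
  then have e2: "(LBINT z. (?h z)\<^sup>2) = a / 4 + b / 4 + d / 2" unfolding a_def b_def d_def using i by simp
  have "(\<lambda>z. c z * ?h z) = (\<lambda>z. c z * ?f z / 2 + c z * ?g z / 2)" by (auto simp: field_simps)
  then have e3: "(LBINT z. c z * ?h z) = (LBINT z. c z * ?f z) / 2 + (LBINT z. c z * ?g z) / 2"
   using ci[OF F(1)] by simp
  have "E ?h = (E ?f + E ?g) / 2 - \<gamma> / 8 * (a + b - 2 * d)"
   unfolding E_def e2 e3 a_def[symmetric] b_def[symmetric] by (simp add: field_simps)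
  then have "\<gamma> / 8 * (a + b - 2 * d) \<le> (E ?f + E ?g) / 2 - I" using I[OF mid(1)] by linarith
  also have "\<dots> \<le> ((1/4) ^ Suc k + (1/4) ^ k) / 2" using F(2)[of "Suc k"] F(2)[of k] by (simp add: field_simps)
  also have "\<dots> \<le> (1/4) ^ k" by simp
  finally show "(LBINT z. (F (Suc k) z - F k z)\<^sup>2) \<le> 8 / \<gamma> * (1/4) ^ k" unfolding e1 using \<gamma> by (simp add: field_simps)
 qed
 define C where "C = 4 / \<gamma> + V / 2"
 have L1: "(LBINT z. \<bar>F (Suc k) z - F k z\<bar>) \<le> C * (1/2) ^ k" for k
 proof -
  have pt: "\<bar>F (Suc k) z - F k z\<bar> \<le> 2 ^ k / 2 * (F (Suc k) z - F k z)\<^sup>2 + (1/2) ^ k / 2 * indicat_real ?X z" for z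
  proof (cases "z \<in> ?X")
   case True
   define a where "a = \<bar>F (Suc k) z - F k z\<bar>"
   define q :: real where "q = 2 ^ k"
   have q: "0 < q" "(1/2) ^ k = 1 / q" unfolding q_def by (auto simp: power_one_over)
   \<comment> \<open>from the second to the first power, at the price of the finite volume \<open>V\<close>\<close>
   have "0 \<le> (q * a - 1)\<^sup>2 / (2 * q)" using q by simp
   also have "\<dots> = q / 2 * a\<^sup>2 + 1 / q / 2 - a" using q by (simp add: power2_eq_square field_simps)
   finally have "a \<le> q / 2 * a\<^sup>2 + 1 / q / 2" by simp
   moreover have "a\<^sup>2 = (F (Suc k) z - F k z)\<^sup>2" unfolding a_def by simp
   ultimately show ?thesis using True q unfolding a_def[symmetric] q_def[symmetric] by simp
  next
   case False
   then show ?thesis using bcoupD(3)[OF F(1)] by simp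
  qed
  have "(LBINT z. \<bar>F (Suc k) z - F k z\<bar>) \<le> (LBINT z. 2 ^ k / 2 * (F (Suc k) z - F k z)\<^sup>2 + (1/2) ^ k / 2 * indicat_real ?X z)"
   using bcoupD(4)[OF F(1)] gap_int[of k] Xi pt by (intro integral_mono) auto
  also have "\<dots> = 2 ^ k / 2 * (LBINT z. (F (Suc k) z - F k z)\<^sup>2) + (1/2) ^ k / 2 * V"
   using gap_int[of k] Xi Xb unfolding V_def by (subst Bochner_Integration.integral_add) auto
  also have "\<dots> \<le> 2 ^ k / 2 * (8 / \<gamma> * (1/4) ^ k) + (1/2) ^ k / 2 * V" using gap[of k] by (intro add_right_mono mult_left_mono) auto
  also have "\<dots> = C * (1/2) ^ k"
  proof -
   have "(2::real) ^ k * (1/4) ^ k = (1/2) ^ k" by (simp flip: power_mult_distrib)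
   have A: "2 ^ k / 2 * (8 / \<gamma> * (1/4) ^ k) = 4 / \<gamma> * (2 ^ k * (1/4) ^ k)" by simp
   show ?thesis unfolding A \<open>2 ^ k * (1/4) ^ k = _\<close> C_def by (simp add: distrib_right)
  qed
  finally show ?thesis .
 qed
 obtain G where G: "integrable lborel G" "\<And>k. AE z in lborel. \<bar>F k z\<bar> \<le> G z" "AE z in lborel. convergent (\<lambda>k. F k z)"
  using rapid_L1_limit[OF bcoupD(4)[OF F(1)] L1] by blast
 define f where "f z = indicat_real ?X z * max 0 (lim (\<lambda>k. F k z))" for z
 have Fm: "F k \<in> borel_measurable borel" for k by (rule bcoupD(1)[OF F(1)])
 have fm: "f \<in> borel_measurable borel" unfolding f_def using Xb borel_measurable_lim_metric[OF Fm] by measurable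
 have f0: "0 \<le> f z" for z unfolding f_def by simp
 have fz: "f z = 0" if "z \<notin> ?X" for z unfolding f_def using that by simp
 have lim: "AE z in lborel. (\<lambda>k. F k z) \<longlonglongrightarrow> f z"
  using G(3)
 proof eventually_elim
  case (elim z)
  then have l: "(\<lambda>k. F k z) \<longlonglongrightarrow> lim (\<lambda>k. F k z)" by (simp add: convergent_LIMSEQ_iff)
  show ?case
  proof (cases "z \<in> ?X")
   case True
   have "0 \<le> lim (\<lambda>k. F k z)" by (rule LIMSEQ_le_const[OF l]) (use bcoupD(2)[OF F(1)] in auto)
   then show ?thesis using l True unfolding f_def by simp
  next
   case False
   then show ?thesis using bcoupD(3)[OF F(1)] fz by simp
  qed
 qed
 have fi: "integrable lborel f"
  by (rule integrable_dominated_convergence[OF _ _ G(1) lim]) (use fm Fm G(2) in auto)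
 have conv: "(\<lambda>k. \<integral>z. g z * F k z \<partial>lborel) \<longlonglongrightarrow> (LBINT z. g z * f z)"
  if g: "g \<in> borel_measurable borel" "\<And>z. \<bar>g z\<bar> \<le> Q" for g Q
 proof (rule integral_dominated_convergence[where w="\<lambda>z. Q * G z"])
  show "integrable lborel (\<lambda>z. Q * G z)" using G(1) by simp
  show "AE z in lborel. (\<lambda>k. g z * F k z) \<longlonglongrightarrow> g z * f z" using lim by eventually_elim (intro tendsto_intros)
  show "AE z in lborel. norm (g z * F k z) \<le> Q * G z" for k
   using G(2)[of k]
  proof eventually_elim
   case (elim z)
   have "\<bar>g z\<bar> * \<bar>F k z\<bar> \<le> Q * G z" using g(2)[of z] elim by (intro mult_mono) auto
   then show ?case by (simp add: abs_mult)
  qed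
 qed (use g fm Fm in auto)
 have sqlim: "(\<lambda>k. \<integral>z. c z * F k z \<partial>lborel) \<longlonglongrightarrow> (LBINT z. c z * f z)" by (rule conv[OF c])
 define Q where "Q = 2 / \<gamma> * (I - (LBINT z. c z * f z))"
 have nnsq: "(\<integral>\<^sup>+z. ennreal ((f z)\<^sup>2) \<partial>lborel) \<le> ennreal Q"
 proof -
  have "(\<integral>\<^sup>+z. ennreal ((f z)\<^sup>2) \<partial>lborel) = (\<integral>\<^sup>+z. liminf (\<lambda>k. ennreal ((F k z)\<^sup>2)) \<partial>lborel)"
  proof (rule nn_integral_cong_AE)
   show "AE z in lborel. ennreal ((f z)\<^sup>2) = liminf (\<lambda>k. ennreal ((F k z)\<^sup>2))"
    using lim
   proof eventually_elim
    case (elim z)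
    have "(\<lambda>k. ennreal ((F k z)\<^sup>2)) \<longlonglongrightarrow> ennreal ((f z)\<^sup>2)" by (intro tendsto_ennrealI tendsto_intros elim)
    then show ?case using lim_imp_Liminf[OF sequentially_bot] by metis
   qed
  qed
  also have "\<dots> \<le> liminf (\<lambda>k. \<integral>\<^sup>+z. ennreal ((F k z)\<^sup>2) \<partial>lborel)"
   by (rule nn_integral_liminf) (use Fm in measurable)
  also have "\<dots> \<le> liminf (\<lambda>k. ennreal (2 / \<gamma> * (I + (1/4) ^ k - (LBINT z. c z * F k z))))"
  proof (rule Liminf_mono, rule always_eventually, rule allI)
   fix k
   have "(\<integral>\<^sup>+z. ennreal ((F k z)\<^sup>2) \<partial>lborel) = ennreal (LBINT z. (F k z)\<^sup>2)"
    by (rule nn_integral_eq_integral[OF bcoupD(5)[OF F(1)]]) simp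
   also have "(LBINT z. (F k z)\<^sup>2) \<le> 2 / \<gamma> * (I + (1/4) ^ k - (LBINT z. c z * F k z))"
    using F(2)[of k] \<gamma> unfolding E_def by (simp add: field_simps)
   finally show "(\<integral>\<^sup>+z. ennreal ((F k z)\<^sup>2) \<partial>lborel) \<le> ennreal (2 / \<gamma> * (I + (1/4) ^ k - (LBINT z. c z * F k z)))"
    by (simp add: ennreal_leI)
  qed
  also have "\<dots> = ennreal Q"
  proof -
   have "(\<lambda>k. 2 / \<gamma> * (I + (1/4) ^ k - (LBINT z. c z * F k z))) \<longlonglongrightarrow> 2 / \<gamma> * (I + 0 - (LBINT z. c z * f z))"
    by (intro tendsto_intros sqlim LIMSEQ_power_zero) simp
   then have "(\<lambda>k. ennreal (2 / \<gamma> * (I + (1/4) ^ k - (LBINT z. c z * F k z)))) \<longlonglongrightarrow> ennreal Q"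
    unfolding Q_def by (intro tendsto_ennrealI) simp
   then show ?thesis by (rule lim_imp_Liminf[OF sequentially_bot])
  qed
  finally show ?thesis .
 qed
 have f2: "integrable lborel (\<lambda>z. (f z)\<^sup>2)"
  by (rule integrableI_bounded) (use fm nnsq le_less_trans[OF nnsq] in auto)
 have "ennreal (LBINT z. (f z)\<^sup>2) \<le> ennreal Q" using nnsq nn_integral_eq_integral[OF f2] by simp
 moreover have "0 \<le> Q"
 proof -
  have "(\<lambda>k. 2 / \<gamma> * (I + (1/4) ^ k - (LBINT z. c z * F k z))) \<longlonglongrightarrow> 2 / \<gamma> * (I + 0 - (LBINT z. c z * f z))"
   by (intro tendsto_intros sqlim LIMSEQ_power_zero) simp
  moreover have "0 \<le> 2 / \<gamma> * (I + (1/4) ^ k - (LBINT z. c z * F k z))" for k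
  proof -
   have "(LBINT z. (F k z)\<^sup>2) \<le> 2 / \<gamma> * (I + (1/4) ^ k - (LBINT z. c z * F k z))"
    using F(2)[of k] \<gamma> unfolding E_def by (simp add: field_simps)
   moreover have "0 \<le> (LBINT z. (F k z)\<^sup>2)" by simp
   ultimately show ?thesis by linarith
  qed
  ultimately have "0 \<le> 2 / \<gamma> * (I + 0 - (LBINT z. c z * f z))" by (intro LIMSEQ_le_const) auto
  then show ?thesis unfolding Q_def by simp
 qed
 ultimately have "(LBINT z. (f z)\<^sup>2) \<le> Q" by (simp add: ennreal_le_iff)
 then have Ef: "E f \<le> I" unfolding E_def Q_def using \<gamma> by (simp add: field_simps)
 have marg: "(LBINT z. indicat_real S (pj z) * f z) = v" if S: "S \<in> sets borel" and pj: "pj \<in> borel_measurable borel"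
  and v: "\<And>k. (LBINT z. indicat_real S (pj z) * F k z) = v" for S v and pj :: "'a \<times> 'a => 'a"
 proof -
  have "(\<lambda>k. \<integral>z. indicat_real S (pj z) * F k z \<partial>lborel) \<longlonglongrightarrow> (LBINT z. indicat_real S (pj z) * f z)"
   by (rule conv[where Q=1]) (use measurable_compose[OF pj borel_measurable_indicator[OF S]] in auto)
  then show ?thesis unfolding v using LIMSEQ_unique[OF tendsto_const] by metis
 qed
 have "is_coupling (density lborel (\<lambda>z. ennreal (f z))) (density lborel (\<lambda>x. ennreal (m1 x))) (density lborel (\<lambda>x. ennreal (m2 x)))"
  unfolding bcoup_iff_integrals[OF fm f0 fi m]
  using marg[OF _ fst_borel bcoup_integral(1)[OF F(1) m borel_measurable_indicator]] marg[OF _ snd_borel bcoup_integral(2)[OF F(1) m borel_measurable_indicator]] by auto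
 then have "bcoup \<Omega> m1 m2 f" unfolding bcoup_def using fm f0 fz fi f2 by auto
 then show ?thesis
 proof (rule that)
  fix g assume "bcoup \<Omega> m1 m2 g"
  then show "E f \<le> E g" using Ef I[of g] by linarith
 qed
qed

section \<open>Competitors built from blocks\<close>

lemma lborel_product_integral:
 fixes f g :: "'a::euclidean_space => real"
 assumes f: "integrable lborel f" and g: "integrable lborel g"
 shows "integrable lborel (\<lambda>z. f (fst z) * g (snd z))"
  "(LBINT z. f (fst z) * g (snd z)) = (LBINT x. f x) * (LBINT y. g y)"
proof -
 have i: "integrable (lborel \<Otimes>\<^sub>M lborel) (\<lambda>z. f (fst z) * g (snd z))" by (rule lborel_pair.integrable_times[OF f g])
 then show "integrable lborel (\<lambda>z. f (fst z) * g (snd z))" by (simp add: lborel_prod)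
 have "(LBINT z. f (fst z) * g (snd z)) = (\<integral>z. f (fst z) * g (snd z) \<partial>(lborel \<Otimes>\<^sub>M lborel))" by (simp add: lborel_prod)
 also have "\<dots> = (\<integral>x. \<integral>y. f x * g y \<partial>lborel \<partial>lborel)" using lborel_pair.integral_fst'[OF i] by simp
 finally show "(LBINT z. f (fst z) * g (snd z)) = (LBINT x. f x) * (LBINT y. g y)" by simp
qed

lemma sum_product_marginal:
 fixes \<kappa> :: "'i => 'i => real" and p q :: "'i => 'a::euclidean_space => real"
 assumes "finite I" and pq: "\<And>i. integrable lborel (p i)" "\<And>i. integrable lborel (q i)"
 shows "integrable lborel (\<lambda>z. \<Sum>i\<in>I. \<Sum>j\<in>I. \<kappa> i j * (p i (fst z) * q j (snd z)))"
  "(LBINT z. (\<Sum>i\<in>I. \<Sum>j\<in>I. \<kappa> i j * (p i (fst z) * q j (snd z)))) = (\<Sum>i\<in>I. \<Sum>j\<in>I. \<kappa> i j * ((LBINT x. p i x) * (LBINT y. q j y)))"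
 using lborel_product_integral[OF pq] by simp_all

text \<open>
 The share \<open>1 - s\<close> of the unit mass is distributed over the blocks in the
 proportions of \<open>\<Phi>\<close>, inside each block as a product of the marginals. The
 factor \<open>1 - s\<close> leaves a non-negative remainder of both marginals, of total mass
 \<open>r = T - (1 - s)\<close>, and the product of the two remainders divided by
 \<open>r\<close> completes the coupling. The bound \<open>K\<close> involves
 \<open>\<Phi>\<close> and the partition of unity but not the marginal densities, which is what
 makes it uniform along a sequence.
\<close>

theorem block_competitor:
 fixes \<Omega> :: "'a::euclidean_space set" and c :: "'a \<times> 'a => real" and \<eta> :: "'i => 'a => real"
 assumes m: "marginal_density \<Omega> m1" "marginal_density \<Omega> m2" and mQ: "\<And>x. m1 x \<le> Q" "\<And>x. m2 x \<le> Q"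
  and T: "(LBINT x. m1 x) = T" "(LBINT x. m2 x) = T" "1 \<le> T"
  and I: "finite I" and \<eta>: "\<And>i. \<eta> i \<in> borel_measurable borel" "\<And>i x. 0 \<le> \<eta> i x"
   "\<And>x. (\<Sum>i\<in>I. \<eta> i x) \<le> 1" "\<And>x. x \<in> \<Omega> ==> (\<Sum>i\<in>I. \<eta> i x) = 1"
  and A: "prob_space A" "sets A = sets borel" and B: "prob_space B" "sets B = sets borel"
  and \<Phi>: "is_coupling \<Phi> A B" "AE z in \<Phi>. z \<in> \<Omega> \<times> \<Omega>" and s: "0 < s" "s < 1"
  and close: "\<And>i. i \<in> I ==> (1 - s) * (\<integral>x. \<eta> i x \<partial>A) \<le> (LBINT x. \<eta> i x * m1 x)"
   "\<And>i. i \<in> I ==> (1 - s) * (\<integral>x. \<eta> i x \<partial>B) \<le> (LBINT x. \<eta> i x * m2 x)"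
  and c: "c \<in> borel_measurable borel" "\<And>z. \<bar>c z\<bar> \<le> C"
  and osc: "\<And>i j z z'. i \<in> I ==> j \<in> I ==> z \<in> \<Omega> \<times> \<Omega> ==> z' \<in> \<Omega> \<times> \<Omega> ==> 0 < \<eta> i (fst z) ==> 0 < \<eta> j (snd z) ==>
    0 < \<eta> i (fst z') ==> 0 < \<eta> j (snd z') ==> c z \<le> c z' + \<omega>" "0 \<le> \<omega>"
 defines "K \<equiv> (\<Sum>i\<in>I. \<Sum>j\<in>I. (\<integral>z. \<eta> i (fst z) * \<eta> j (snd z) \<partial>\<Phi>) / ((1 - s) * ((\<integral>x. \<eta> i x \<partial>A) * (\<integral>x. \<eta> j x \<partial>B)))) + 1 / s"
 obtains f where "bcoup \<Omega> m1 m2 f" "\<And>z. f z \<le> K * (m1 (fst z) * m2 (snd z))"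
  "(LBINT z. c z * f z) \<le> (\<integral>z. c z \<partial>\<Phi>) + \<omega> + C * (2 * s + (T - 1))"
proof -
 have mm: "m1 \<in> borel_measurable borel" "m2 \<in> borel_measurable borel" "\<And>x. 0 \<le> m1 x" "\<And>x. 0 \<le> m2 x"
  "\<And>x. x \<notin> \<Omega> ==> m1 x = 0" "\<And>x. x \<notin> \<Omega> ==> m2 x = 0" "integrable lborel m1" "integrable lborel m2" using m unfolding marginal_density_def by auto
 interpret A: prob_space A by (rule A)
 interpret B: prob_space B by (rule B)
 have S\<Phi>: "sets \<Phi> = sets borel" and d\<Phi>: "distr \<Phi> borel fst = A" "distr \<Phi> borel snd = B" using \<Phi>(1) unfolding is_coupling_def by auto
 have pm: "fst \<in> measurable \<Phi> borel" "snd \<in> measurable \<Phi> borel"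
  unfolding measurable_cong_sets[OF S\<Phi> refl] by (rule fst_borel, rule snd_borel)
 have P\<Phi>: "prob_space \<Phi>" using prob_space_distrD[OF pm(1)] A d\<Phi> by auto
 interpret \<Phi>: prob_space \<Phi> by (rule P\<Phi>)
 have \<eta>1: "\<eta> i x \<le> 1" if "i \<in> I" for i x
 proof -
  have "\<eta> i x \<le> (\<Sum>i\<in>I. \<eta> i x)" by (rule member_le_sum[OF that _ I]) (use \<eta>(2) in auto)
  then show ?thesis using \<eta>(3)[of x] by linarith
 qed
 have C0: "0 \<le> C" using c(2)[of undefined] by linarith
 define \<alpha> \<beta> a AA BB where "\<alpha> i = (\<integral>x. \<eta> i x \<partial>A)" and "\<beta> j = (\<integral>x. \<eta> j x \<partial>B)" and "a i j = (\<integral>z. \<eta> i (fst z) * \<eta> j (snd z) \<partial>\<Phi>)"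
  and "AA i = (LBINT x. \<eta> i x * m1 x)" and "BB j = (LBINT x. \<eta> j x * m2 x)" for i j
 note cl = close[folded \<alpha>_def \<beta>_def AA_def BB_def]
 have \<eta>\<Phi>: "(\<lambda>z. \<eta> i (fst z)) \<in> borel_measurable \<Phi>" "(\<lambda>z. \<eta> i (snd z)) \<in> borel_measurable \<Phi>" for i
  using measurable_compose[OF pm(1) \<eta>(1)] measurable_compose[OF pm(2) \<eta>(1)] by auto
 have \<eta>b: "\<bar>\<eta> i x\<bar> \<le> 1" if "i \<in> I" for i x using \<eta>(2)[of i x] \<eta>1[OF that, of x] by simp
 have i\<Phi>: "integrable \<Phi> (\<lambda>z. \<eta> i (fst z) * \<eta> j (snd z))" if "i \<in> I" "j \<in> I" for i j
  by (rule \<Phi>.integrable_const_bound[where B=1]) (use \<eta>\<Phi> \<eta>b that \<eta>(2) in \<open>auto simp: abs_mult intro!: mult_le_one\<close>)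
 have a0: "0 \<le> a i j" for i j unfolding a_def using \<eta>(2) by (intro Bochner_Integration.integral_nonneg) auto
 have \<alpha>0: "0 \<le> \<alpha> i" "0 \<le> \<beta> i" "0 \<le> AA i" "0 \<le> BB i" for i
  unfolding \<alpha>_def \<beta>_def AA_def BB_def using \<eta>(2) mm by (auto intro!: Bochner_Integration.integral_nonneg)
 have sum_a: "(\<Sum>j\<in>I. a i j) = \<alpha> i" "(\<Sum>j\<in>I. a j i) = \<beta> i" if i: "i \<in> I" for i
 proof -
  have AE1: "AE z in \<Phi>. (\<Sum>j\<in>I. \<eta> i (fst z) * \<eta> j (snd z)) = \<eta> i (fst z)" "AE z in \<Phi>. (\<Sum>j\<in>I. \<eta> j (fst z) * \<eta> i (snd z)) = \<eta> i (snd z)"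
   using \<Phi>(2) by (auto elim!: eventually_mono simp: \<eta>(4) simp flip: sum_distrib_left sum_distrib_right)
  have "(\<Sum>j\<in>I. a i j) = (\<integral>z. (\<Sum>j\<in>I. \<eta> i (fst z) * \<eta> j (snd z)) \<partial>\<Phi>)" unfolding a_def using i\<Phi> i by simp
  also have "\<dots> = (\<integral>z. \<eta> i (fst z) \<partial>\<Phi>)" by (rule integral_cong_AE) (use AE1 \<eta>\<Phi> in auto)
  also have "\<dots> = \<alpha> i" unfolding \<alpha>_def d\<Phi>(1)[symmetric] using pm \<eta>(1) by (subst integral_distr) auto
  finally show "(\<Sum>j\<in>I. a i j) = \<alpha> i" .
  have "(\<Sum>j\<in>I. a j i) = (\<integral>z. (\<Sum>j\<in>I. \<eta> j (fst z) * \<eta> i (snd z)) \<partial>\<Phi>)" unfolding a_def using i\<Phi> i by simp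
  also have "\<dots> = (\<integral>z. \<eta> i (snd z) \<partial>\<Phi>)" by (rule integral_cong_AE) (use AE1 \<eta>\<Phi> in auto)
  also have "\<dots> = \<beta> i" unfolding \<beta>_def d\<Phi>(2)[symmetric] using pm \<eta>(1) by (subst integral_distr) auto
  finally show "(\<Sum>j\<in>I. a j i) = \<beta> i" .
 qed
 have sum_\<alpha>: "(\<Sum>i\<in>I. \<alpha> i) = 1" "(\<Sum>i\<in>I. \<beta> i) = 1"
 proof -
  have "(\<Sum>i\<in>I. \<alpha> i) = (\<Sum>i\<in>I. \<Sum>j\<in>I. a i j)" using sum_a by simp
  also have "\<dots> = (\<integral>z. (\<Sum>i\<in>I. \<Sum>j\<in>I. \<eta> i (fst z) * \<eta> j (snd z)) \<partial>\<Phi>)" unfolding a_def using i\<Phi> by simp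
  also have "\<dots> = (\<integral>z. 1 \<partial>\<Phi>)"
   by (rule integral_cong_AE) (use \<Phi>(2) \<eta>\<Phi> in \<open>auto elim!: eventually_mono simp: \<eta>(4) simp flip: sum_distrib_left sum_distrib_right\<close>)
  finally show e: "(\<Sum>i\<in>I. \<alpha> i) = 1" by (simp add: \<Phi>.prob_space)
  have "(\<Sum>i\<in>I. \<beta> i) = (\<Sum>i\<in>I. \<Sum>j\<in>I. a j i)" using sum_a by simp
  also have "\<dots> = (\<Sum>i\<in>I. \<Sum>j\<in>I. a i j)" by (rule sum.swap)
  also have "\<dots> = 1" using sum_a e by simp
  finally show "(\<Sum>i\<in>I. \<beta> i) = 1" .
 qed
 have a_le: "a i j \<le> \<alpha> i" "a i j \<le> \<beta> j" if "i \<in> I" "j \<in> I" for i j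
  using sum_a[OF that(1)] sum_a[OF that(2)] member_le_sum[OF that(2), of "a i"] member_le_sum[OF that(1), of "\<lambda>i. a i j"] a0 I by auto
 have zeroA: "\<alpha> i = 0" if "i \<in> I" "AA i = 0" for i
 proof -
  have "(1 - s) * \<alpha> i \<le> 0" using cl(1)[OF that(1)] that(2) by simp
  then have "\<alpha> i \<le> 0" using s by (simp add: mult_le_0_iff)
  then show ?thesis using \<alpha>0(1)[of i] by linarith
 qed
 have zeroB: "\<beta> i = 0" if "i \<in> I" "BB i = 0" for i
 proof -
  have "(1 - s) * \<beta> i \<le> 0" using cl(2)[OF that(1)] that(2) by simp
  then have "\<beta> i \<le> 0" using s by (simp add: mult_le_0_iff)
  then show ?thesis using \<alpha>0(2)[of i] by linarith
 qed
 \<comment> \<open>the weight of a block relative to the product of the marginals: its mass under \<open>\<Phi>\<close> over its mass under that product\<close>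
 define \<kappa> where "\<kappa> i j = (1 - s) * a i j / (AA i * BB j)" for i j
 define u w where "u x = (\<Sum>i\<in>I. (1 - s) * \<alpha> i / AA i * \<eta> i x)" and "w x = (\<Sum>j\<in>I. (1 - s) * \<beta> j / BB j * \<eta> j x)" for x
 define r where "r = T - (1 - s)"
 have r: "s \<le> r" unfolding r_def using T(3) by linarith
 have \<kappa>0: "0 \<le> \<kappa> i j" for i j unfolding \<kappa>_def using s a0 \<alpha>0 by simp
 have \<kappa>B: "(\<Sum>j\<in>I. \<kappa> i j * BB j) = (1 - s) * \<alpha> i / AA i" if i: "i \<in> I" for i
 proof -
  have "(\<Sum>j\<in>I. \<kappa> i j * BB j) = (\<Sum>j\<in>I. (1 - s) / AA i * a i j)"
  proof (rule sum.cong[OF refl])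
   fix j assume j: "j \<in> I"
   show "\<kappa> i j * BB j = (1 - s) / AA i * a i j"
   proof (cases "BB j = 0")
    case True
    then have "a i j = 0" using zeroB[OF j] a_le(2)[OF i j] a0[of i j] by linarith
    then show ?thesis unfolding \<kappa>_def by simp
   qed (simp add: \<kappa>_def)
  qed
  then show ?thesis unfolding sum_distrib_left[symmetric] sum_a(1)[OF i] by simp
 qed
 have \<kappa>A: "(\<Sum>i\<in>I. \<kappa> i j * AA i) = (1 - s) * \<beta> j / BB j" if j: "j \<in> I" for j
 proof -
  have "(\<Sum>i\<in>I. \<kappa> i j * AA i) = (\<Sum>i\<in>I. (1 - s) / BB j * a i j)"
  proof (rule sum.cong[OF refl])
   fix i assume i: "i \<in> I"
   show "\<kappa> i j * AA i = (1 - s) / BB j * a i j"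
   proof (cases "AA i = 0")
    case True
    then have "a i j = 0" using zeroA[OF i] a_le(1)[OF i j] a0[of i j] by linarith
    then show ?thesis unfolding \<kappa>_def by simp
   qed (simp add: \<kappa>_def)
  qed
  then show ?thesis unfolding sum_distrib_left[symmetric] sum_a(2)[OF j] by simp
 qed
 have coef: "(1 - s) * \<alpha> i / AA i \<le> 1" "(1 - s) * \<beta> i / BB i \<le> 1" "0 \<le> (1 - s) * \<alpha> i / AA i" "0 \<le> (1 - s) * \<beta> i / BB i" if "i \<in> I" for i
  using cl(1)[OF that] cl(2)[OF that] \<alpha>0[of i] s by (auto simp: divide_le_eq_1)
 have u01: "0 \<le> u x" "u x \<le> 1" "0 \<le> w x" "w x \<le> 1" for x
 proof -
  have "u x \<le> (\<Sum>i\<in>I. 1 * \<eta> i x)" unfolding u_def by (intro sum_mono mult_right_mono coef \<eta>(2))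
  then show "u x \<le> 1" using \<eta>(3)[of x] by simp
  have "w x \<le> (\<Sum>i\<in>I. 1 * \<eta> i x)" unfolding w_def by (intro sum_mono mult_right_mono coef \<eta>(2))
  then show "w x \<le> 1" using \<eta>(3)[of x] by simp
  show "0 \<le> u x" unfolding u_def by (intro sum_nonneg mult_nonneg_nonneg coef \<eta>(2))
  show "0 \<le> w x" unfolding w_def by (intro sum_nonneg mult_nonneg_nonneg coef \<eta>(2))
 qed
 have um: "u \<in> borel_measurable borel" "w \<in> borel_measurable borel" unfolding u_def w_def using \<eta>(1) by measurable
 define p q where "p i x = (if i \<in> I then \<eta> i x * m1 x else 0)" and "q i x = (if i \<in> I then \<eta> i x * m2 x else 0)" for i x
 have pi: "integrable lborel (\<lambda>x. g x * p i x)" "integrable lborel (\<lambda>x. g x * q i x)" if g: "g \<in> borel_measurable borel" "\<And>x. \<bar>g x\<bar> \<le> 1" for g i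
 proof -
  have b: "(\<lambda>x. g x * \<eta> i x) \<in> borel_measurable lborel" "\<bar>g x * \<eta> i x\<bar> \<le> 1" if "i \<in> I" for x
   using g \<eta>(1) \<eta>b[OF that, of x] by (auto simp: abs_mult intro!: mult_le_one)
  show "integrable lborel (\<lambda>x. g x * p i x)"
   using integrable_mult_bounded[OF mm(7) b(1,2)] unfolding p_def by (cases "i \<in> I") (auto simp: mult.assoc)
  show "integrable lborel (\<lambda>x. g x * q i x)"
   using integrable_mult_bounded[OF mm(8) b(1,2)] unfolding q_def by (cases "i \<in> I") (auto simp: mult.assoc)
 qed
 have pi1: "integrable lborel (p i)" "integrable lborel (q i)" for i using pi[of "\<lambda>_. 1" i] by auto
 have pA: "(LBINT x. p i x) = AA i" "(LBINT x. q i x) = BB i" if "i \<in> I" for i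
  unfolding p_def q_def AA_def BB_def using that by auto
 have comp: "integrable lborel (\<lambda>x. g x * ((1 - u x) * m1 x))" "integrable lborel (\<lambda>x. g x * ((1 - w x) * m2 x))" if g: "g \<in> borel_measurable borel" "\<And>x. \<bar>g x\<bar> \<le> 1" for g
 proof -
  have "(\<lambda>x. g x * (1 - u x)) \<in> borel_measurable lborel" "(\<lambda>x. g x * (1 - w x)) \<in> borel_measurable lborel" using g um by auto
  moreover have "\<bar>g x * (1 - u x)\<bar> \<le> 1" "\<bar>g x * (1 - w x)\<bar> \<le> 1" for x
   unfolding abs_mult using g(2)[of x] u01[of x] by (auto intro!: mult_le_one)
  ultimately show "integrable lborel (\<lambda>x. g x * ((1 - u x) * m1 x))" "integrable lborel (\<lambda>x. g x * ((1 - w x) * m2 x))"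
   using integrable_mult_bounded[OF mm(7), of "\<lambda>x. g x * (1 - u x)" 1] integrable_mult_bounded[OF mm(8), of "\<lambda>x. g x * (1 - w x)" 1] by (auto simp: mult.assoc)
 qed
 have comp1: "integrable lborel (\<lambda>x. (1 - u x) * m1 x)" "integrable lborel (\<lambda>x. (1 - w x) * m2 x)" using comp[of "\<lambda>_. 1"] by auto
 have split1: "(LBINT x. g x * m1 x) = (\<Sum>i\<in>I. (1 - s) * \<alpha> i / AA i * (LBINT x. g x * p i x)) + (LBINT x. g x * ((1 - u x) * m1 x))"
  and split2: "(LBINT x. g x * m2 x) = (\<Sum>i\<in>I. (1 - s) * \<beta> i / BB i * (LBINT x. g x * q i x)) + (LBINT x. g x * ((1 - w x) * m2 x))"
  if g: "g \<in> borel_measurable borel" "\<And>x. \<bar>g x\<bar> \<le> 1" for g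
 proof -
  have "(\<lambda>x. g x * m1 x) = (\<lambda>x. (\<Sum>i\<in>I. (1 - s) * \<alpha> i / AA i * (g x * p i x)) + g x * ((1 - u x) * m1 x))"
  proof
   fix x
   have "(\<Sum>i\<in>I. (1 - s) * \<alpha> i / AA i * (g x * p i x)) = g x * m1 x * u x"
    unfolding u_def sum_distrib_left by (intro sum.cong) (auto simp: p_def)
   then show "g x * m1 x = (\<Sum>i\<in>I. (1 - s) * \<alpha> i / AA i * (g x * p i x)) + g x * ((1 - u x) * m1 x)" by (simp add: algebra_simps)
  qed
  then show "(LBINT x. g x * m1 x) = (\<Sum>i\<in>I. (1 - s) * \<alpha> i / AA i * (LBINT x. g x * p i x)) + (LBINT x. g x * ((1 - u x) * m1 x))"
   using pi[OF g] comp[OF g] by simp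
  have "(\<lambda>x. g x * m2 x) = (\<lambda>x. (\<Sum>i\<in>I. (1 - s) * \<beta> i / BB i * (g x * q i x)) + g x * ((1 - w x) * m2 x))"
  proof
   fix x
   have "(\<Sum>i\<in>I. (1 - s) * \<beta> i / BB i * (g x * q i x)) = g x * m2 x * w x"
    unfolding w_def sum_distrib_left by (intro sum.cong) (auto simp: q_def)
   then show "g x * m2 x = (\<Sum>i\<in>I. (1 - s) * \<beta> i / BB i * (g x * q i x)) + g x * ((1 - w x) * m2 x)" by (simp add: algebra_simps)
  qed
  then show "(LBINT x. g x * m2 x) = (\<Sum>i\<in>I. (1 - s) * \<beta> i / BB i * (LBINT x. g x * q i x)) + (LBINT x. g x * ((1 - w x) * m2 x))"
   using pi[OF g] comp[OF g] by simp
 qed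
 have rest: "(LBINT x. (1 - u x) * m1 x) = r" "(LBINT x. (1 - w x) * m2 x) = r"
 proof -
  have "(\<Sum>i\<in>I. (1 - s) * \<alpha> i / AA i * AA i) = (\<Sum>i\<in>I. (1 - s) * \<alpha> i)" using zeroA by (intro sum.cong) auto
  also have "\<dots> = 1 - s" unfolding sum_distrib_left[symmetric] sum_\<alpha> by simp
  finally show "(LBINT x. (1 - u x) * m1 x) = r" using split1[of "\<lambda>_. 1"] T(1) pA unfolding r_def by simp
  have "(\<Sum>i\<in>I. (1 - s) * \<beta> i / BB i * BB i) = (\<Sum>i\<in>I. (1 - s) * \<beta> i)" using zeroB by (intro sum.cong) auto
  also have "\<dots> = 1 - s" unfolding sum_distrib_left[symmetric] sum_\<alpha> by simp
  finally show "(LBINT x. (1 - w x) * m2 x) = r" using split2[of "\<lambda>_. 1"] T(2) pA unfolding r_def by simp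
 qed
 \<comment> \<open>\<open>f1\<close> transports the bulk block by block, \<open>f2\<close> couples what remains of the marginals\<close>
 define f1 f2 f where "f1 z = (\<Sum>i\<in>I. \<Sum>j\<in>I. \<kappa> i j * (p i (fst z) * q j (snd z)))"
  and "f2 z = 1 / r * (((1 - u (fst z)) * m1 (fst z)) * ((1 - w (snd z)) * m2 (snd z)))" and "f z = f1 z + f2 z" for z
 have p0: "0 \<le> p i x" "0 \<le> q i x" for i x unfolding p_def q_def using \<eta>(2) mm by auto
 have f0: "0 \<le> f1 z" "0 \<le> f2 z" for z
  unfolding f1_def f2_def using \<kappa>0 p0 u01 mm r s by (auto intro!: sum_nonneg mult_nonneg_nonneg)
 have fi: "integrable lborel f1" "integrable lborel f2"
  unfolding f1_def f2_def using sum_product_marginal(1)[OF I pi1] lborel_product_integral(1)[OF comp1] by auto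
 have fm: "f \<in> borel_measurable borel" unfolding f_def using borel_measurable_integrable[OF fi(1)] borel_measurable_integrable[OF fi(2)] by simp
 have fint: "integrable lborel f" unfolding f_def using fi by simp
 have pq0: "p i x = 0" "q i x = 0" if "x \<notin> \<Omega>" for i x unfolding p_def q_def using mm that by auto
 have fz: "f z = 0" if "z \<notin> \<Omega> \<times> \<Omega>" for z
 proof -
  have "fst z \<notin> \<Omega> \<or> snd z \<notin> \<Omega>" using that by (auto simp: mem_Times_iff)
  then show ?thesis unfolding f_def f1_def f2_def using pq0 mm by auto
 qed
 have K: "f z \<le> K * (m1 (fst z) * m2 (snd z))" for z
 proof -
  have "f1 z \<le> (\<Sum>i\<in>I. \<Sum>j\<in>I. a i j / ((1 - s) * (\<alpha> i * \<beta> j)) * (m1 (fst z) * m2 (snd z)))"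
   unfolding f1_def
  proof (intro sum_mono)
   fix i j assume ij: "i \<in> I" "j \<in> I"
   have "\<kappa> i j \<le> a i j / ((1 - s) * (\<alpha> i * \<beta> j))"
   proof (cases "a i j = 0")
    case False
    then have pos: "0 < a i j" "0 < \<alpha> i" "0 < \<beta> j" using a0[of i j] a_le[OF ij] by linarith+
    have AB0: "0 < AA i" "0 < BB j" using zeroA[OF ij(1)] zeroB[OF ij(2)] pos \<alpha>0[of i] \<alpha>0[of j] by (auto simp: less_le)
    have "((1 - s) * \<alpha> i) * ((1 - s) * \<beta> j) \<le> AA i * BB j" using cl(1)[OF ij(1)] cl(2)[OF ij(2)] s pos \<alpha>0 by (intro mult_mono) auto
    moreover have "0 < ((1 - s) * \<alpha> i) * ((1 - s) * \<beta> j)" using s pos by simp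
    ultimately have "(1 - s) * a i j / (AA i * BB j) \<le> (1 - s) * a i j / (((1 - s) * \<alpha> i) * ((1 - s) * \<beta> j))"
     using s pos AB0 by (intro divide_left_mono mult_pos_pos) auto
    also have "((1 - s) * \<alpha> i) * ((1 - s) * \<beta> j) = (1 - s) * ((1 - s) * (\<alpha> i * \<beta> j))" by (simp only: mult_ac)
    also have "(1 - s) * a i j / ((1 - s) * ((1 - s) * (\<alpha> i * \<beta> j))) = a i j / ((1 - s) * (\<alpha> i * \<beta> j))"
     using s by (intro mult_divide_mult_cancel_left) simp
    finally show ?thesis unfolding \<kappa>_def .
   qed (simp add: \<kappa>_def)
   moreover have "p i (fst z) * q j (snd z) \<le> m1 (fst z) * m2 (snd z)"
    unfolding p_def q_def using ij \<eta>1[OF ij(1)] \<eta>1[OF ij(2)] \<eta>(2) mm by (auto intro!: mult_mono mult_left_le_one_le)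
   ultimately show "\<kappa> i j * (p i (fst z) * q j (snd z)) \<le> a i j / ((1 - s) * (\<alpha> i * \<beta> j)) * (m1 (fst z) * m2 (snd z))"
    using \<kappa>0 p0 s a0 \<alpha>0 by (intro mult_mono[where a="\<kappa> i j"]) auto
  qed
  moreover have "f2 z \<le> 1 / s * (m1 (fst z) * m2 (snd z))"
   unfolding f2_def
  proof (rule mult_mono)
   show "1 / r \<le> 1 / s" using r s by (intro divide_left_mono) auto
   show "((1 - u (fst z)) * m1 (fst z)) * ((1 - w (snd z)) * m2 (snd z)) \<le> m1 (fst z) * m2 (snd z)"
    using u01 mm by (intro mult_mono mult_left_le_one_le) auto
  qed (use u01 mm s in auto)
  ultimately show ?thesis unfolding f_def K_def \<alpha>_def[symmetric] \<beta>_def[symmetric] a_def[symmetric] distrib_right sum_distrib_right by linarith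
 qed
 have sq: "integrable lborel (\<lambda>z. (f z)\<^sup>2)"
 proof (rule Bochner_Integration.integrable_bound[where f="\<lambda>z. \<bar>K\<bar> * (Q * Q) * f z"])
  have "(f z)\<^sup>2 \<le> \<bar>K\<bar> * (Q * Q) * f z" for z
  proof -
   have nn: "0 \<le> m1 (fst z) * m2 (snd z)" using mm by simp
   have "f z \<le> \<bar>K\<bar> * (m1 (fst z) * m2 (snd z))" using K[of z] nn mult_right_mono[OF abs_ge_self[of K] nn] by linarith
   also have "\<dots> \<le> \<bar>K\<bar> * (Q * Q)" using mQ mm order_trans[OF mm(3) mQ(1)] by (intro mult_left_mono mult_mono) auto
   finally show ?thesis unfolding power2_eq_square using f0[of z] f_def by (intro mult_right_mono) auto
  qed
  then show "AE z in lborel. norm ((f z)\<^sup>2) \<le> norm (\<bar>K\<bar> * (Q * Q) * f z)"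
   by (intro AE_I2) (auto intro: order_trans[OF _ abs_ge_self])
 qed (use fint fm in auto)
 have marg1: "(LBINT z. g (fst z) * f z) = (LBINT x. g x * m1 x)"
  and marg2: "(LBINT z. g (snd z) * f z) = (LBINT x. g x * m2 x)"
  if g: "g \<in> borel_measurable borel" "\<And>x. \<bar>g x\<bar> \<le> 1" for g
 proof -
  have r0: "r \<noteq> 0" using r s by auto
  have "(\<lambda>z. g (fst z) * f z) = (\<lambda>z. (\<Sum>i\<in>I. \<Sum>j\<in>I. \<kappa> i j * ((g (fst z) * p i (fst z)) * q j (snd z))) + 1 / r * ((g (fst z) * ((1 - u (fst z)) * m1 (fst z))) * ((1 - w (snd z)) * m2 (snd z))))"
   unfolding f_def f1_def f2_def by (auto simp: distrib_left sum_distrib_left mult_ac)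
  then have "(LBINT z. g (fst z) * f z) = (\<Sum>i\<in>I. \<Sum>j\<in>I. \<kappa> i j * ((LBINT x. g x * p i x) * (LBINT y. q j y)))
    + 1 / r * ((LBINT x. g x * ((1 - u x) * m1 x)) * (LBINT y. (1 - w y) * m2 y))"
   using sum_product_marginal[OF I pi(1)[OF g] pi1(2), of \<kappa>] lborel_product_integral[OF comp(1)[OF g] comp1(2)] by simp
  also have "(\<Sum>i\<in>I. \<Sum>j\<in>I. \<kappa> i j * ((LBINT x. g x * p i x) * (LBINT y. q j y))) = (\<Sum>i\<in>I. (\<Sum>j\<in>I. \<kappa> i j * BB j) * (LBINT x. g x * p i x))"
   unfolding sum_distrib_right using pA by (intro sum.cong refl) (auto simp: mult_ac)
  also have "\<dots> = (\<Sum>i\<in>I. (1 - s) * \<alpha> i / AA i * (LBINT x. g x * p i x))" using \<kappa>B by simp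
  finally show "(LBINT z. g (fst z) * f z) = (LBINT x. g x * m1 x)" unfolding split1[OF g] rest using r0 by simp
  have "(\<lambda>z. g (snd z) * f z) = (\<lambda>z. (\<Sum>i\<in>I. \<Sum>j\<in>I. \<kappa> i j * (p i (fst z) * (g (snd z) * q j (snd z)))) + 1 / r * (((1 - u (fst z)) * m1 (fst z)) * (g (snd z) * ((1 - w (snd z)) * m2 (snd z)))))"
   unfolding f_def f1_def f2_def by (auto simp: distrib_left sum_distrib_left mult_ac)
  then have "(LBINT z. g (snd z) * f z) = (\<Sum>i\<in>I. \<Sum>j\<in>I. \<kappa> i j * ((LBINT x. p i x) * (LBINT y. g y * q j y)))
    + 1 / r * ((LBINT x. (1 - u x) * m1 x) * (LBINT y. g y * ((1 - w y) * m2 y)))"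
   using sum_product_marginal[OF I pi1(1) pi(2)[OF g], of \<kappa>] lborel_product_integral[OF comp1(1) comp(2)[OF g]] by simp
  also have "(\<Sum>i\<in>I. \<Sum>j\<in>I. \<kappa> i j * ((LBINT x. p i x) * (LBINT y. g y * q j y))) = (\<Sum>j\<in>I. \<Sum>i\<in>I. \<kappa> i j * AA i * (LBINT x. g x * q j x))"
   by (subst sum.swap) (use pA in \<open>auto simp: mult_ac intro!: sum.cong\<close>)
  also have "\<dots> = (\<Sum>j\<in>I. (1 - s) * \<beta> j / BB j * (LBINT x. g x * q j x))" unfolding sum_distrib_right[symmetric] using \<kappa>A by simp
  finally show "(LBINT z. g (snd z) * f z) = (LBINT x. g x * m2 x)" unfolding split2[OF g] rest using r0 by simp
 qed
 have fnn: "0 \<le> f z" for z unfolding f_def using f0[of z] by simp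
 have ind: "\<bar>indicat_real S x\<bar> \<le> 1" for S and x :: 'a by (simp add: indicator_def)
 have "is_coupling (density lborel (\<lambda>z. ennreal (f z))) (density lborel (\<lambda>x. ennreal (m1 x))) (density lborel (\<lambda>x. ennreal (m2 x)))"
  unfolding bcoup_iff_integrals[OF fm fnn fint m] using marg1[OF borel_measurable_indicator ind] marg2[OF borel_measurable_indicator ind] by auto
 then have bc: "bcoup \<Omega> m1 m2 f" unfolding bcoup_def using fm fnn fz fint sq by auto
 have cl': "c \<in> borel_measurable lborel" using c(1) by simp
 have cf: "integrable lborel (\<lambda>z. c z * f1 z)" "integrable lborel (\<lambda>z. c z * f2 z)"
  using integrable_mult_bounded[OF fi(1) cl' c(2)] integrable_mult_bounded[OF fi(2) cl' c(2)] by auto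
 have cost2: "(LBINT z. c z * f2 z) \<le> C * r"
 proof -
  have "(LBINT z. c z * f2 z) \<le> (LBINT z. C * f2 z)"
  proof (rule integral_mono)
   show "c z * f2 z \<le> C * f2 z" for z using c(2)[of z] f0(2)[of z] by (intro mult_right_mono) auto
  qed (use cf fi in auto)
  also have "(LBINT z. C * f2 z) = C * (1 / r * (r * r))" unfolding f2_def using lborel_product_integral[OF comp1] rest by simp
  finally show ?thesis using r s by simp
 qed
 have icf: "integrable \<Phi> (\<lambda>z. \<eta> i (fst z) * \<eta> j (snd z) * c z)" if "i \<in> I" "j \<in> I" for i j
  using integrable_mult_bounded[OF i\<Phi>[OF that] measurable_borel_sets[OF S\<Phi> c(1)] c(2)] by (simp add: mult.commute)
 have pqi: "integrable lborel (\<lambda>z. c z * (p i (fst z) * q j (snd z)))" for i j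
  using integrable_mult_bounded[OF lborel_product_integral(1)[OF pi1(1)[of i] pi1(2)[of j]] cl' c(2)] .
 have cell: "\<kappa> i j * (LBINT z. c z * (p i (fst z) * q j (snd z))) \<le> (1 - s) * ((\<integral>z. \<eta> i (fst z) * \<eta> j (snd z) * c z \<partial>\<Phi>) + \<omega> * a i j)"
  if ij: "i \<in> I" "j \<in> I" for i j
 proof (cases "a i j = 0")
  case True
  have "AE z in \<Phi>. \<eta> i (fst z) * \<eta> j (snd z) = 0"
  proof -
   have "AE z in \<Phi>. 0 \<le> \<eta> i (fst z) * \<eta> j (snd z)" using \<eta>(2) by simp
   then show ?thesis using integral_nonneg_eq_0_iff_AE[OF i\<Phi>[OF ij]] True unfolding a_def by blast
  qed
  then have "(\<integral>z. \<eta> i (fst z) * \<eta> j (snd z) * c z \<partial>\<Phi>) = 0" by (intro integral_eq_zero_AE) (auto elim!: eventually_mono)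
  then show ?thesis using True unfolding \<kappa>_def by simp
 next
  case False
  then have pos: "0 < a i j" "\<alpha> i > 0" "\<beta> j > 0" using a0[of i j] a_le[OF ij] by linarith+
  have AB: "0 < AA i" "0 < BB j" using zeroA[OF ij(1)] zeroB[OF ij(2)] pos \<alpha>0[of i] \<alpha>0[of j] by (auto simp: less_le)
  define v where "v = (\<integral>z. \<eta> i (fst z) * \<eta> j (snd z) * c z \<partial>\<Phi>)"
  have pt: "a i j * c z \<le> v + \<omega> * a i j" if z: "z \<in> \<Omega> \<times> \<Omega>" "0 < \<eta> i (fst z)" "0 < \<eta> j (snd z)" for z
  proof -
   have "(\<integral>z'. \<eta> i (fst z') * \<eta> j (snd z') * c z \<partial>\<Phi>) \<le> (\<integral>z'. \<eta> i (fst z') * \<eta> j (snd z') * c z' + \<omega> * (\<eta> i (fst z') * \<eta> j (snd z')) \<partial>\<Phi>)"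
   proof (rule integral_mono_AE)
    show "AE z' in \<Phi>. \<eta> i (fst z') * \<eta> j (snd z') * c z \<le> \<eta> i (fst z') * \<eta> j (snd z') * c z' + \<omega> * (\<eta> i (fst z') * \<eta> j (snd z'))"
     using \<Phi>(2)
    proof eventually_elim
     case (elim z')
     show ?case
     proof (cases "0 < \<eta> i (fst z') \<and> 0 < \<eta> j (snd z')")
      case True
      then have "c z \<le> c z' + \<omega>" using osc(1)[OF ij z(1) elim z(2,3)] by simp
      then have "\<eta> i (fst z') * \<eta> j (snd z') * c z \<le> \<eta> i (fst z') * \<eta> j (snd z') * (c z' + \<omega>)"
       using \<eta>(2) by (intro mult_left_mono) auto
      then show ?thesis by (simp add: algebra_simps)
     next
      case False
      then have "\<eta> i (fst z') * \<eta> j (snd z') = 0" using \<eta>(2)[of i "fst z'"] \<eta>(2)[of j "snd z'"] by auto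
      then show ?thesis by (simp only: mult_zero_left mult_zero_right add_0 order_refl)
     qed
    qed
   qed (use i\<Phi>[OF ij] icf[OF ij] in auto)
   then show ?thesis using i\<Phi>[OF ij] icf[OF ij] unfolding v_def a_def by simp
  qed
  have "(LBINT z. a i j * (c z * (p i (fst z) * q j (snd z)))) \<le> (LBINT z. (v + \<omega> * a i j) * (p i (fst z) * q j (snd z)))"
  proof (rule integral_mono)
   fix z
   show "a i j * (c z * (p i (fst z) * q j (snd z))) \<le> (v + \<omega> * a i j) * (p i (fst z) * q j (snd z))"
   proof (cases "z \<in> \<Omega> \<times> \<Omega> \<and> 0 < \<eta> i (fst z) \<and> 0 < \<eta> j (snd z)")
    case True
    then have "a i j * c z * (p i (fst z) * q j (snd z)) \<le> (v + \<omega> * a i j) * (p i (fst z) * q j (snd z))"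
     using pt p0 by (intro mult_right_mono) auto
    then show ?thesis by (simp add: mult.assoc)
   next
    case False
    then consider "fst z \<notin> \<Omega>" | "snd z \<notin> \<Omega>" | "\<eta> i (fst z) \<le> 0" | "\<eta> j (snd z) \<le> 0"
     by (auto simp: mem_Times_iff not_less)
    then have "p i (fst z) = 0 \<or> q j (snd z) = 0"
    proof cases
     case 3
     then have "\<eta> i (fst z) = 0" using \<eta>(2)[of i "fst z"] by linarith
     then show ?thesis unfolding p_def by simp
    next
     case 4
     then have "\<eta> j (snd z) = 0" using \<eta>(2)[of j "snd z"] by linarith
     then show ?thesis unfolding q_def by simp
    qed (use pq0 in auto)
    then show ?thesis by auto
   qed
  qed (use pqi lborel_product_integral(1)[OF pi1(1)[of i] pi1(2)[of j]] in auto)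
  then have "a i j * (LBINT z. c z * (p i (fst z) * q j (snd z))) \<le> (v + \<omega> * a i j) * (AA i * BB j)"
   using lborel_product_integral(2)[OF pi1(1)[of i] pi1(2)[of j]] pA ij by simp
  then have "(1 - s) / (AA i * BB j) * (a i j * (LBINT z. c z * (p i (fst z) * q j (snd z)))) \<le> (1 - s) / (AA i * BB j) * ((v + \<omega> * a i j) * (AA i * BB j))"
   using s AB by (intro mult_left_mono) auto
  also have "\<dots> = (1 - s) * (v + \<omega> * a i j)" using AB by simp
  finally show ?thesis unfolding \<kappa>_def v_def by simp
 qed
 have cost1: "(LBINT z. c z * f1 z) \<le> (1 - s) * ((\<integral>z. c z \<partial>\<Phi>) + \<omega>)"
 proof -
  have "(\<lambda>z. c z * f1 z) = (\<lambda>z. \<Sum>i\<in>I. \<Sum>j\<in>I. \<kappa> i j * (c z * (p i (fst z) * q j (snd z))))"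
   unfolding f1_def by (auto simp: sum_distrib_left mult_ac)
  then have "(LBINT z. c z * f1 z) = (\<Sum>i\<in>I. \<Sum>j\<in>I. \<kappa> i j * (LBINT z. c z * (p i (fst z) * q j (snd z))))" using pqi by simp
  also have "\<dots> \<le> (\<Sum>i\<in>I. \<Sum>j\<in>I. (1 - s) * ((\<integral>z. \<eta> i (fst z) * \<eta> j (snd z) * c z \<partial>\<Phi>) + \<omega> * a i j))"
   by (intro sum_mono cell)
  also have "\<dots> = (1 - s) * ((\<Sum>i\<in>I. \<Sum>j\<in>I. (\<integral>z. \<eta> i (fst z) * \<eta> j (snd z) * c z \<partial>\<Phi>)) + \<omega> * (\<Sum>i\<in>I. \<Sum>j\<in>I. a i j))"
   by (simp add: sum_distrib_left sum.distrib distrib_left)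
  also have "(\<Sum>i\<in>I. \<Sum>j\<in>I. a i j) = 1" using sum_a sum_\<alpha> by simp
  also have "(\<Sum>i\<in>I. \<Sum>j\<in>I. (\<integral>z. \<eta> i (fst z) * \<eta> j (snd z) * c z \<partial>\<Phi>)) = (\<integral>z. (\<Sum>i\<in>I. \<Sum>j\<in>I. \<eta> i (fst z) * \<eta> j (snd z) * c z) \<partial>\<Phi>)"
   using icf by simp
  also have "\<dots> = (\<integral>z. c z \<partial>\<Phi>)"
  proof (rule integral_cong_AE)
   show "(\<lambda>z. \<Sum>i\<in>I. \<Sum>j\<in>I. \<eta> i (fst z) * \<eta> j (snd z) * c z) \<in> borel_measurable \<Phi>"
    using \<eta>\<Phi> measurable_borel_sets[OF S\<Phi> c(1)] by measurable
   show "c \<in> borel_measurable \<Phi>" by (rule measurable_borel_sets[OF S\<Phi> c(1)])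
   show "AE z in \<Phi>. (\<Sum>i\<in>I. \<Sum>j\<in>I. \<eta> i (fst z) * \<eta> j (snd z) * c z) = c z"
    using \<Phi>(2)
   proof eventually_elim
    case (elim z)
    then show ?case using \<eta>(4)[of "fst z"] \<eta>(4)[of "snd z"]
     by (simp add: mem_Times_iff flip: sum_distrib_left sum_distrib_right)
   qed
  qed
  finally show ?thesis by simp
 qed
 have "(LBINT z. c z * f z) = (LBINT z. c z * f1 z) + (LBINT z. c z * f2 z)"
  unfolding f_def distrib_left using cf by simp
 also have "\<dots> \<le> (1 - s) * ((\<integral>z. c z \<partial>\<Phi>) + \<omega>) + C * r" using cost1 cost2 by linarith
 also have "\<dots> \<le> (\<integral>z. c z \<partial>\<Phi>) + \<omega> + C * (2 * s + (T - 1))"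
 proof -
  have ic: "integrable \<Phi> c" by (rule \<Phi>.integrable_const_bound[where B=C]) (use c measurable_borel_sets[OF S\<Phi> c(1)] in auto)
  have "(\<integral>z. - C \<partial>\<Phi>) \<le> (\<integral>z. c z \<partial>\<Phi>)"
  proof (rule integral_mono)
   show "- C \<le> c z" for z using c(2)[of z] by linarith
  qed (use ic in auto)
  then have "- C \<le> (\<integral>z. c z \<partial>\<Phi>)" by (simp add: \<Phi>.prob_space)
  then have "s * - C \<le> s * ((\<integral>z. c z \<partial>\<Phi>) + \<omega>)" using s osc(2) by (intro mult_left_mono) auto
  then show ?thesis unfolding r_def by (simp add: algebra_simps)
 qed
 finally show ?thesis using that[OF bc K] by simp
qed

section \<open>Lipschitz boundaries, test functions and partitions of unity\<close>

text \<open>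
 Near a boundary point the boundary lies on a graph over the hyperplane orthogonal to
 \<open>e\<close>, and a graph is disjoint from its translates along \<open>e\<close>.
\<close>

lemma lipschitz_frontier_null:
 fixes S :: "'a::euclidean_space set"
 assumes S: "compact S" and lip: "lipschitz_boundary S"
 shows "frontier S \<in> null_sets lborel"
proof -
 have loc: "\<exists>d>0. frontier S \<inter> cball z d \<in> null_sets lborel" if z: "z \<in> frontier S" for z
 proof -
  obtain r e g L where r: "0 < r" and e: "norm e = 1" and g: "L-lipschitz_on {y. y \<bullet> e = 0} g"
   and Sr: "S \<inter> ball z r = {x \<in> ball z r. x \<bullet> e \<le> g (x - (x \<bullet> e) *\<^sub>R e)}"
   using lip[unfolded lipschitz_boundary_def, rule_format, OF z] by (elim exE conjE) (rule that; assumption)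
  have ee: "e \<bullet> e = 1" using e by (simp add: dot_square_norm)
  define \<Phi> where "\<Phi> x = g (x - (x \<bullet> e) *\<^sub>R e) - x \<bullet> e" for x
  have \<Phi>c: "continuous_on UNIV \<Phi>" unfolding \<Phi>_def
   by (intro continuous_intros continuous_on_compose2[OF lipschitz_on_continuous_on[OF g]])
    (auto simp: inner_diff_left ee)
  have graph: "\<Phi> x = 0" if x: "x \<in> frontier S" "x \<in> ball z r" for x
  proof (rule ccontr)
   assume "\<Phi> x \<noteq> 0"
   then consider "0 < \<Phi> x" | "\<Phi> x < 0" by linarith
   then show False
   proof cases
    case 1
    let ?N = "ball z r \<inter> {y. 0 < \<Phi> y}"
    have "open ?N" using \<Phi>c by (intro open_Int open_ball open_Collect_less continuous_intros) auto
    moreover have "?N \<subseteq> S"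
    proof
     fix y assume "y \<in> ?N"
     then have "y \<in> {x \<in> ball z r. x \<bullet> e \<le> g (x - (x \<bullet> e) *\<^sub>R e)}" unfolding \<Phi>_def by simp
     then show "y \<in> S" unfolding Sr[symmetric] by simp
    qed
    ultimately have "x \<in> interior S" using 1 x(2) by (intro interiorI) auto
    then show False using x(1) unfolding frontier_def by simp
   next
    case 2
    let ?N = "ball z r \<inter> {y. \<Phi> y < 0}"
    have "open ?N" using \<Phi>c by (intro open_Int open_ball open_Collect_less continuous_intros) auto
    moreover have "?N \<inter> S = {}"
    proof (rule ccontr)
     assume "?N \<inter> S \<noteq> {}"
     then obtain y where y: "y \<in> S \<inter> ball z r" "\<Phi> y < 0" by blast
     then have "y \<bullet> e \<le> g (y - (y \<bullet> e) *\<^sub>R e)" unfolding Sr by simp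
     then show False using y(2) unfolding \<Phi>_def by simp
    qed
    ultimately have "?N \<inter> closure S = {}" by (simp add: open_Int_closure_eq_empty)
    then show False using 2 x unfolding frontier_def by auto
   qed
  qed
  have "frontier S \<inter> cball z (r / 2) \<in> null_sets lborel"
  proof (rule disjoint_translates_null[where w=e])
   show "compact (frontier S \<inter> cball z (r / 2))" using S by (intro compact_Int_closed compact_frontier) auto
   fix y t assume y: "y \<in> frontier S \<inter> cball z (r / 2)" and t: "0 < t" "t \<le> (1::real)"
   show "y + t *\<^sub>R e \<notin> frontier S \<inter> cball z (r / 2)"
   proof
    assume y': "y + t *\<^sub>R e \<in> frontier S \<inter> cball z (r / 2)"
    have "\<Phi> y = 0" "\<Phi> (y + t *\<^sub>R e) = 0" using y y' r by (auto intro!: graph)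
    moreover have "\<Phi> (y + t *\<^sub>R e) = \<Phi> y - t" unfolding \<Phi>_def by (simp add: inner_add_left ee algebra_simps)
    ultimately show False using t by simp
   qed
  qed
  then show ?thesis using r by (intro exI[of _ "r / 2"]) auto
 qed
 then obtain d where d: "\<And>z. z \<in> frontier S ==> 0 < d z \<and> frontier S \<inter> cball z (d z) \<in> null_sets lborel" by metis
 have cov: "frontier S \<subseteq> (\<Union>z\<in>frontier S. ball z (d z))" using d by auto
 obtain D where D: "D \<subseteq> frontier S" "finite D" "frontier S \<subseteq> (\<Union>z\<in>D. ball z (d z))"
  by (rule compactE_image[OF compact_frontier[OF S] _ cov]) auto
 have eq: "frontier S = (\<Union>z\<in>D. frontier S \<inter> cball z (d z))"
 proof (intro equalityI subsetI)
  fix x assume x: "x \<in> frontier S"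
  obtain z where z: "z \<in> D" "x \<in> ball z (d z)" using subsetD[OF D(3) x] by (rule UN_E)
  then have "x \<in> cball z (d z)" by simp
  then show "x \<in> (\<Union>z\<in>D. frontier S \<inter> cball z (d z))" using x z(1) by blast
 qed blast
 have "(\<Union>z\<in>D. frontier S \<inter> cball z (d z)) \<in> null_sets lborel" using d D by (intro null_sets_UN' countable_finite) auto
 then show ?thesis using eq by simp
qed

text \<open>
 Closed sets are limits of continuous functions of the distance and generate the Borel sets.
\<close>

lemma measure_eq_continuous:
 fixes M N :: "'a::euclidean_space measure"
 assumes M: "finite_measure M" "sets M = sets borel" and N: "finite_measure N" "sets N = sets borel"
  and eq: "\<And>f B. continuous_on UNIV f ==> (\<And>x. \<bar>f x\<bar> \<le> B) ==> (\<integral>x. (f x :: real) \<partial>M) = (\<integral>x. f x \<partial>N)"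
 shows "M = N"
proof (rule measure_eqI_generator_eq[where E="Collect closed" and \<Omega>=UNIV and A="\<lambda>_. UNIV"])
 show "Int_stable (Collect (closed :: 'a set => bool))" by (auto simp: Int_stable_def)
 show "sets M = sigma_sets UNIV (Collect closed)" "sets N = sigma_sets UNIV (Collect closed)"
  using M N unfolding borel_eq_closed by auto
 show "emeasure M UNIV \<noteq> \<infinity>" using finite_measure.emeasure_finite[OF M(1)] by simp
 fix T :: "'a set" assume "T \<in> Collect closed"
 then have T: "closed T" by simp
 show "emeasure M T = emeasure N T"
 proof (cases "T = {}")
  case False
  define g where "g n x = max 0 (1 - real (Suc n) * infdist x T)" for n x
  have gc: "continuous_on UNIV (g n)" for n unfolding g_def by (intro continuous_intros)
  have gb: "\<bar>g n x\<bar> \<le> 1" for n x unfolding g_def using infdist_nonneg[of x T] by auto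
  have lim: "(\<lambda>n. g n x) \<longlonglongrightarrow> indicat_real T x" for x
  proof (cases "x \<in> T")
   case True then show ?thesis unfolding g_def by simp
  next
   case nT: False
   then have d: "0 < infdist x T" using infdist_pos_not_in_closed[OF T False] by blast
   obtain N where N: "1 / infdist x T < real N" using reals_Archimedean2 by blast
   have "g n x = 0" if "n \<ge> N" for n
   proof -
    have "1 / infdist x T \<le> real (Suc n)" using N that by linarith
    then have "1 \<le> real (Suc n) * infdist x T" using d by (simp add: field_simps)
    then show ?thesis unfolding g_def by simp
   qed
   then have "\<forall>\<^sub>F n in sequentially. g n x = indicat_real T x" using nT by (intro eventually_sequentiallyI[of N]) auto
   then show ?thesis by (rule tendsto_eventually)
  qed
  have l: "(\<lambda>n. \<integral>x. g n x \<partial>Q) \<longlonglongrightarrow> measure Q T" if Q: "finite_measure Q" "sets Q = sets borel" for Q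
  proof -
   interpret finite_measure Q by fact
   have TQ: "T \<in> sets Q" using T Q by simp
   have "(\<lambda>n. \<integral>x. g n x \<partial>Q) \<longlonglongrightarrow> (\<integral>x. indicat_real T x \<partial>Q)"
   proof (rule integral_dominated_convergence[where w="\<lambda>_. 1"])
    show "g n \<in> borel_measurable Q" for n
     by (rule measurable_borel_sets[OF Q(2) borel_measurable_continuous_onI[OF gc]])
   qed (use lim gb TQ in auto)
   then show ?thesis using TQ by simp
  qed
  have "measure M T = measure N T"
   by (rule LIMSEQ_unique[OF l[OF M]]) (use l[OF N] eq[OF gc gb] in simp)
  then show ?thesis using finite_measure.emeasure_eq_measure[OF M(1)] finite_measure.emeasure_eq_measure[OF N(1)] by simp
 qed simp
qed auto

lemma partition_of_unity:
 fixes \<Omega> :: "'a::euclidean_space set"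
 assumes \<Omega>: "compact \<Omega>" and \<tau>: "0 < \<tau>"
 obtains I :: "'a set" and \<eta> :: "'a => 'a => real" where "finite I" "\<And>i. \<eta> i \<in> borel_measurable borel" "\<And>i x. 0 \<le> \<eta> i x"
  "\<And>x. (\<Sum>i\<in>I. \<eta> i x) \<le> 1" "\<And>x. x \<in> \<Omega> ==> (\<Sum>i\<in>I. \<eta> i x) = 1" "\<And>i x y. 0 < \<eta> i x ==> 0 < \<eta> i y ==> dist x y < \<tau>"
  "\<And>i. i \<in> I ==> continuous_on \<Omega> (\<eta> i)"
proof -
 have cov: "\<Omega> \<subseteq> (\<Union>x\<in>\<Omega>. ball x (\<tau> / 2))" using \<tau> by auto
 obtain I where I: "I \<subseteq> \<Omega>" "finite I" "\<Omega> \<subseteq> (\<Union>x\<in>I. ball x (\<tau> / 2))"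
  by (rule compactE_image[OF \<Omega> _ cov]) auto
 define b where "b i x = max 0 (\<tau> / 2 - dist x i)" for i x :: 'a
 \<comment> \<open>off the balls \<open>S\<close> vanishes and division by zero gives 0, so the sum is at most 1 everywhere\<close>
 define S where "S x = (\<Sum>i\<in>I. b i x)" for x
 define \<eta> where "\<eta> i x = b i x / S x" for i x
 have b0: "0 \<le> b i x" for i x unfolding b_def by simp
 have S0: "0 \<le> S x" for x unfolding S_def using b0 by (intro sum_nonneg)
 have bc: "continuous_on T (b i)" for i T unfolding b_def by (intro continuous_intros)
 have Sc: "continuous_on T S" for T unfolding S_def by (intro continuous_intros bc)
 have Spos: "0 < S x" if x: "x \<in> \<Omega>" for x
 proof -
  obtain i where i: "i \<in> I" "dist i x < \<tau> / 2" using subsetD[OF I(3) x] by auto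
  then have "0 < b i x" unfolding b_def by (simp add: dist_commute)
  also have "b i x \<le> S x" unfolding S_def by (rule member_le_sum[OF i(1) _ I(2)]) (use b0 in auto)
  finally show ?thesis .
 qed
 have sum: "(\<Sum>i\<in>I. \<eta> i x) = (if S x = 0 then 0 else 1)" for x
  unfolding \<eta>_def sum_divide_distrib[symmetric] S_def[symmetric] by simp
 show ?thesis
 proof (rule that[of I \<eta>])
  have "b i \<in> borel_measurable borel" "S \<in> borel_measurable borel" for i
   using bc Sc by (auto intro: borel_measurable_continuous_onI)
  then show "\<eta> i \<in> borel_measurable borel" for i unfolding \<eta>_def by (intro borel_measurable_divide)
  show "0 \<le> \<eta> i x" for i x unfolding \<eta>_def using b0 S0 by simp
  show "(\<Sum>i\<in>I. \<eta> i x) = 1" if "x \<in> \<Omega>" for x using sum[of x] Spos[OF that] by simp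
  show "continuous_on \<Omega> (\<eta> i)" for i unfolding \<eta>_def using Spos by (intro continuous_on_divide bc Sc) force
  fix i x y assume "0 < \<eta> i x" "0 < \<eta> i y"
  then have "b i x \<noteq> 0" "b i y \<noteq> 0" unfolding \<eta>_def by auto
  then have "dist x i < \<tau> / 2" "dist y i < \<tau> / 2" unfolding b_def by (auto simp: max_def split: if_splits)
  then show "dist x y < \<tau>" using dist_triangle2[of x y i] by linarith
 qed (use I sum in auto)
qed

text \<open>
 Small values of \<open>e\<close> are charged to \<open>L * f\<close>. For values above
 \<open>L\<close> the square \<open>e\<^sup>2\<close> that Young's inequality produces is
 dominated by \<open>e powr p\<close> with a small factor, because \<open>p > 2\<close>.
\<close>

lemma error_young:
 fixes e f \<gamma> \<kappa> p :: real
 assumes p: "2 < p" and \<kappa>: "0 < \<kappa>" and L: "1 \<le> L" "1 / (4 * \<kappa>\<^sup>2) \<le> L powr (p - 2)"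
  and \<gamma>: "0 < \<gamma>" and ef: "0 \<le> e" "0 \<le> f"
 shows "e * f \<le> \<kappa> * (e powr p / \<gamma>) + \<kappa> * (\<gamma> * f\<^sup>2) + L * f"
proof (cases "e \<le> L")
 case True
 then have "e * f \<le> L * f" using ef by (intro mult_right_mono)
 moreover have "0 \<le> \<kappa> * (e powr p / \<gamma>) + \<kappa> * (\<gamma> * f\<^sup>2)" using \<kappa> \<gamma> by simp
 ultimately show ?thesis by linarith
next
 case False
 then have e: "L < e" "0 < e" using L by auto
 have "0 \<le> (2 * \<kappa> * \<gamma> * f - e)\<^sup>2 / (4 * \<kappa> * \<gamma>)" using \<kappa> \<gamma> by simp
 also have "\<dots> = \<kappa> * (\<gamma> * f\<^sup>2) - e * f + e\<^sup>2 / (4 * \<kappa> * \<gamma>)" using \<kappa> \<gamma> by (simp add: power2_eq_square field_simps)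
 finally have 1: "e * f \<le> \<kappa> * (\<gamma> * f\<^sup>2) + e\<^sup>2 / (4 * \<kappa> * \<gamma>)" by simp
 have "1 / (4 * \<kappa>\<^sup>2) \<le> e powr (p - 2)" using L(2) powr_mono2[of "p - 2" L e] p L e by simp
 then have "e\<^sup>2 * (1 / (4 * \<kappa>\<^sup>2)) \<le> e\<^sup>2 * e powr (p - 2)" by (intro mult_left_mono) auto
 also have "e\<^sup>2 * e powr (p - 2) = e powr p" using e by (simp flip: powr_numeral powr_add)
 finally have "e\<^sup>2 * (1 / (4 * \<kappa>\<^sup>2)) * (\<kappa> / \<gamma>) \<le> e powr p * (\<kappa> / \<gamma>)" using \<kappa> \<gamma> by (intro mult_right_mono) auto
 then have "e\<^sup>2 / (4 * \<kappa> * \<gamma>) \<le> \<kappa> * (e powr p / \<gamma>)" using \<kappa> \<gamma> by (simp add: power2_eq_square field_simps)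
 moreover have "0 \<le> L * f" using L ef by simp
 ultimately show ?thesis using 1 by linarith
qed

section \<open>Stability of the regularized problems\<close>

text \<open>
 The marginals converge weakly while the mollification scale tends to zero.
\<close>

locale smoothed_sequence =
 fixes \<Omega> :: "'a::euclidean_space set" and \<rho> :: real and \<delta> :: "nat => real" and An :: "nat => 'a measure" and A :: "'a measure"
 assumes deep_n: "\<And>n. deep_measure \<Omega> \<rho> (\<delta> n) (An n)" and \<delta>_lim: "\<delta> \<longlonglongrightarrow> 0"
  and A: "prob_space A" "sets A = sets borel" "AE x in A. x \<in> \<Omega>"
  and weak: "\<And>g :: 'a => real. continuous_on \<Omega> g ==> (\<lambda>n. \<integral>x. indicator \<Omega> x * g x \<partial>An n) \<longlonglongrightarrow> (\<integral>x. indicator \<Omega> x * g x \<partial>A)"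
begin

abbreviation mn where "mn n \<equiv> smooth_density \<Omega> (\<delta> n) (An n)"

lemma \<Omega>_compact: "compact \<Omega>" and \<delta>_pos: "0 < \<delta> n" "\<delta> n \<le> \<rho>" and An: "prob_space (An n)" "sets (An n) = sets borel" "AE x in An n. x \<in> \<Omega>"
proof -
 show "compact \<Omega>" "0 < \<delta> n" "\<delta> n \<le> \<rho>" "prob_space (An n)" "sets (An n) = sets borel"
  using deep_n[of n] unfolding deep_measure_def by auto
 have "AE y in An n. ball y \<rho> \<subseteq> \<Omega>" "0 < \<rho>" using deep_n[of n] unfolding deep_measure_def by auto
 then show "AE x in An n. x \<in> \<Omega>" by (auto elim!: eventually_mono simp: subset_iff)
qed

lemma mn_density: "marginal_density \<Omega> (mn n)"
 unfolding marginal_density_def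
 using deep_measure.m_measurable[OF deep_n] deep_measure.m_nonneg[OF deep_n] deep_measure.m_zero[OF deep_n] deep_measure.m_integrable[OF deep_n] by blast

lemma mn_weak:
 assumes g: "g \<in> borel_measurable borel" "\<And>x. \<bar>g x\<bar> \<le> B" "continuous_on \<Omega> g"
 shows "(\<lambda>n. \<integral>x. g x * mn n x \<partial>lborel) \<longlonglongrightarrow> (\<integral>x. g x \<partial>A)"
proof -
 have ind: "(\<integral>x. indicator \<Omega> x * g x \<partial>M) = (\<integral>x. g x \<partial>M)" if "sets M = sets borel" "AE x in M. x \<in> \<Omega>" for M
 proof (rule integral_cong_AE)
  have "\<Omega> \<in> sets borel" using \<Omega>_compact by (simp add: borel_compact)
  then show "(\<lambda>x. indicator \<Omega> x * g x) \<in> borel_measurable M" by (intro measurable_borel_sets[OF that(1)] borel_measurable_times borel_measurable_indicator g(1))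
 qed (use that g in \<open>auto elim!: eventually_mono intro: measurable_borel_sets\<close>)
 have 1: "(\<lambda>n. \<integral>x. g x \<partial>An n) \<longlonglongrightarrow> (\<integral>x. g x \<partial>A)"
  using weak[OF g(3)] unfolding ind[OF An(2,3)] ind[OF A(2,3)] .
 have "(\<lambda>n. (LBINT x. g x * mn n x) - (\<integral>x. g x \<partial>An n)) \<longlonglongrightarrow> 0"
 proof (rule LIMSEQ_I)
  fix e :: real assume e: "0 < e"
  obtain d where d: "0 < d" "\<And>x y. x \<in> \<Omega> ==> y \<in> \<Omega> ==> dist y x < d ==> dist (g y) (g x) < e / 2"
   using compact_uniformly_continuous[OF g(3) \<Omega>_compact] e unfolding uniformly_continuous_on_def by (meson half_gt_zero)
  have "(\<lambda>n. \<delta> n * B) \<longlonglongrightarrow> 0" using tendsto_mult_left_zero[OF \<delta>_lim] .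
  then have "\<forall>\<^sub>F n in sequentially. \<delta> n * B < e / 2 \<and> \<delta> n < d"
   using half_gt_zero[OF e] d(1) by (intro eventually_conj order_tendstoD(2)[where y=0] \<delta>_lim)
  then obtain N where N: "\<And>n. n \<ge> N ==> \<delta> n * B < e / 2 \<and> \<delta> n < d" unfolding eventually_sequentially by blast
  have "\<bar>(LBINT x. g x * mn n x) - (\<integral>x. g x \<partial>An n)\<bar> < e" if "n \<ge> N" for n
  proof -
   have w: "\<bar>g x - g y\<bar> \<le> e / 2" if "x \<in> \<Omega>" "y \<in> \<Omega>" "dist x y \<le> \<delta> n" for x y
    using d(2)[OF that(2,1)] that(3) N[OF \<open>n \<ge> N\<close>] by (auto simp: dist_real_def)
   show ?thesis using deep_measure.m_close[OF deep_n[of n] g(1,2) w] N[OF that] by linarith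
  qed
  then show "\<exists>no. \<forall>n\<ge>no. norm ((LBINT x. g x * mn n x) - (\<integral>x. g x \<partial>An n) - 0) < e" by auto
 qed
 from tendsto_add[OF this 1] show ?thesis by simp
qed

end

text \<open>
 The partition of unity is fine enough for the cost to oscillate by less than \<open>\<epsilon>
 / 2\<close> on a block. It is fixed before \<open>n\<close>, so the constant \<open>K\<close>
 of \<open>block_competitor\<close> does not depend on \<open>n\<close>, and the squared norms
 grow at most like \<open>\<delta> n powr (- 2 * DIM('a))\<close>.
\<close>

lemma near_optimal_competitors:
 fixes c :: "'a::euclidean_space \<times> 'a => real"
 assumes A: "smoothed_sequence \<Omega> \<rho> \<delta> An A" and B: "smoothed_sequence \<Omega> \<rho> \<delta> Bn B"
  and c: "continuous_on UNIV c" "\<And>z. \<bar>c z\<bar> \<le> C"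
  and \<Phi>: "is_coupling \<Phi> A B" "AE z in \<Phi>. z \<in> \<Omega> \<times> \<Omega>"
  and \<gamma>: "\<And>n. 0 < \<gamma> n" "(\<lambda>n. \<gamma> n / \<delta> n ^ (DIM('a) + DIM('a))) \<longlonglongrightarrow> 0" and \<epsilon>: "0 < \<epsilon>"
 shows "\<forall>\<^sub>F n in sequentially. \<exists>g. bcoup \<Omega> (smooth_density \<Omega> (\<delta> n) (An n)) (smooth_density \<Omega> (\<delta> n) (Bn n)) g \<and>
   (LBINT z. c z * g z) \<le> (\<integral>z. c z \<partial>\<Phi>) + \<epsilon> \<and> \<gamma> n * (LBINT z. (g z)\<^sup>2) \<le> \<epsilon>"
proof -
 interpret A: smoothed_sequence \<Omega> \<rho> \<delta> An A by (rule A)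
 interpret B: smoothed_sequence \<Omega> \<rho> \<delta> Bn B by (rule B)
 have C0: "0 \<le> C" using c(2)[of undefined] by linarith
 have cm: "c \<in> borel_measurable borel" using c(1) by (rule borel_measurable_continuous_onI)
 have \<Omega>2: "compact (\<Omega> \<times> \<Omega>)" using A.\<Omega>_compact by (intro compact_Times)
 obtain d where d: "0 < d" "\<And>z z'. z \<in> \<Omega> \<times> \<Omega> ==> z' \<in> \<Omega> \<times> \<Omega> ==> dist z' z < d ==> dist (c z') (c z) < \<epsilon> / 2"
  using compact_uniformly_continuous[OF continuous_on_subset[OF c(1) subset_UNIV] \<Omega>2] \<epsilon> unfolding uniformly_continuous_on_def by (meson half_gt_zero)
 have d2: "0 < d / 2" using d by simp
 obtain I :: "'a set" and \<eta> where I: "finite I" and \<eta>: "\<And>i. \<eta> i \<in> borel_measurable borel" "\<And>i x. (0::real) \<le> \<eta> i x"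
  "\<And>x. (\<Sum>i\<in>I. \<eta> i x) \<le> 1" "\<And>x. x \<in> \<Omega> ==> (\<Sum>i\<in>I. \<eta> i x) = 1" "\<And>i x y. 0 < \<eta> i x ==> 0 < \<eta> i y ==> dist x y < d / 2"
  "\<And>i. i \<in> I ==> continuous_on \<Omega> (\<eta> i)"
  by (rule partition_of_unity[OF A.\<Omega>_compact d2]) blast
 have \<eta>b: "\<bar>\<eta> i x\<bar> \<le> 1" if "i \<in> I" for i x
 proof -
  have "\<eta> i x \<le> (\<Sum>i\<in>I. \<eta> i x)" by (rule member_le_sum[OF that _ I]) (use \<eta>(2) in auto)
  then show ?thesis using \<eta>(2)[of i x] \<eta>(3)[of x] by linarith
 qed
 \<comment> \<open>makes the contribution \<open>2 * s * C\<close> of the remainder at most \<open>\<epsilon> / 4\<close>\<close>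
 define s where "s = min (1/2) (\<epsilon> / (8 * (C + 1)))"
 have s: "0 < s" "s < 1" "2 * s * C \<le> \<epsilon> / 4"
 proof -
  show "0 < s" "s < 1" unfolding s_def using \<epsilon> C0 by auto
  have "s \<le> \<epsilon> / (8 * (C + 1))" unfolding s_def by simp
  then have "s * (C + 1) \<le> \<epsilon> / 8" using C0 by (simp add: field_simps)
  moreover have "s * C \<le> s * (C + 1)" using \<open>0 < s\<close> by simp
  ultimately show "2 * s * C \<le> \<epsilon> / 4" by simp
 qed
 have ev: "\<forall>\<^sub>F n in sequentially. (1 - s) * L \<le> l n" if l: "l \<longlonglongrightarrow> L" "0 \<le> L" "\<And>n. 0 \<le> l n" for l L
 proof (cases "L = 0")
  case False
  then have "(1 - s) * L < L" using l(2) s by (simp add: algebra_simps)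
  from order_tendstoD(1)[OF l(1) this] show ?thesis by (rule eventually_mono) simp
 qed (use l in simp)
 have closeA: "\<forall>\<^sub>F n in sequentially. \<forall>i\<in>I. (1 - s) * (\<integral>x. \<eta> i x \<partial>A) \<le> (LBINT x. \<eta> i x * A.mn n x)"
  by (intro eventually_ball_finite I ballI ev A.mn_weak[OF \<eta>(1) \<eta>b \<eta>(6)])
   (auto intro!: Bochner_Integration.integral_nonneg \<eta>(2) mult_nonneg_nonneg deep_measure.m_nonneg[OF A.deep_n])
 have closeB: "\<forall>\<^sub>F n in sequentially. \<forall>i\<in>I. (1 - s) * (\<integral>x. \<eta> i x \<partial>B) \<le> (LBINT x. \<eta> i x * B.mn n x)"
  by (intro eventually_ball_finite I ballI ev B.mn_weak[OF \<eta>(1) \<eta>b \<eta>(6)])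
   (auto intro!: Bochner_Integration.integral_nonneg \<eta>(2) mult_nonneg_nonneg deep_measure.m_nonneg[OF B.deep_n])
 define K where "K = (\<Sum>i\<in>I. \<Sum>j\<in>I. (\<integral>z. \<eta> i (fst z) * \<eta> j (snd z) \<partial>\<Phi>) / ((1 - s) * ((\<integral>x. \<eta> i x \<partial>A) * (\<integral>x. \<eta> j x \<partial>B)))) + 1 / s"
 define Q where "Q = 1 / bump_mass TYPE('a) + \<rho> ^ (DIM('a) + 1) / measure lebesgue \<Omega>"
 have "(\<lambda>n. (K * Q * (1 + \<delta> n))\<^sup>2 * (\<gamma> n / \<delta> n ^ (DIM('a) + DIM('a)))) \<longlonglongrightarrow> (K * Q * (1 + 0))\<^sup>2 * 0"
  by (intro tendsto_intros A.\<delta>_lim \<gamma>)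
 then have evK: "\<forall>\<^sub>F n in sequentially. (K * Q * (1 + \<delta> n))\<^sup>2 * (\<gamma> n / \<delta> n ^ (DIM('a) + DIM('a))) < \<epsilon>"
  using order_tendstoD(2)[OF _ \<epsilon>] by simp
 have evd: "\<forall>\<^sub>F n in sequentially. C * \<delta> n < \<epsilon> / 4"
  by (rule order_tendstoD(2)[OF tendsto_mult_right_zero[OF A.\<delta>_lim]]) (use \<epsilon> in simp)
 show ?thesis using closeA closeB evK evd
 proof eventually_elim
  case (elim n)
  have \<delta>: "0 < \<delta> n" by (rule A.\<delta>_pos)
  obtain g where g: "bcoup \<Omega> (A.mn n) (B.mn n) g" "\<And>z. g z \<le> K * (A.mn n (fst z) * B.mn n (snd z))"
   "(LBINT z. c z * g z) \<le> (\<integral>z. c z \<partial>\<Phi>) + \<epsilon> / 2 + C * (2 * s + ((1 + \<delta> n) - 1))"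
   unfolding K_def
  proof (rule block_competitor[OF A.mn_density B.mn_density, where Q="Q / \<delta> n ^ DIM('a)" and I=I and \<eta>=\<eta> and s=s and c=c and \<omega>="\<epsilon> / 2" and A=A and B=B and \<Phi>=\<Phi> and C=C and T="1 + \<delta> n"])
   show "A.mn n x \<le> Q / \<delta> n ^ DIM('a)" "B.mn n x \<le> Q / \<delta> n ^ DIM('a)" for x
    unfolding Q_def by (rule deep_measure.m_le[OF A.deep_n], rule deep_measure.m_le[OF B.deep_n])
   show "(LBINT x. A.mn n x) = 1 + \<delta> n" "(LBINT x. B.mn n x) = 1 + \<delta> n"
    by (rule deep_measure.m_mass[OF A.deep_n], rule deep_measure.m_mass[OF B.deep_n])
   fix i j z z' assume z: "z \<in> \<Omega> \<times> \<Omega>" "z' \<in> \<Omega> \<times> \<Omega>" and p: "0 < \<eta> i (fst z)" "0 < \<eta> j (snd z)" "0 < \<eta> i (fst z')" "0 < \<eta> j (snd z')"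
   have "dist z z' \<le> dist (fst z) (fst z') + dist (snd z) (snd z')"
    by (cases z; cases z') (auto simp: dist_Pair_Pair sqrt_sum_squares_le_sum)
   also have "\<dots> < d / 2 + d / 2" by (intro add_strict_mono \<eta>(5)[OF p(1,3)] \<eta>(5)[OF p(2,4)])
   finally have "dist (c z) (c z') < \<epsilon> / 2" using d(2)[OF z(2,1)] by simp
   then show "c z \<le> c z' + \<epsilon> / 2" unfolding dist_real_def by linarith
  qed (use I \<eta>(1-4) A.A B.A \<Phi> s elim cm c(2) \<delta> \<epsilon> in auto)
  have gd: "0 \<le> g z" for z using bcoupD(2)[OF g(1)] .
  let ?m = "\<lambda>z. A.mn n (fst z) * B.mn n (snd z)" and ?R = "(Q / \<delta> n ^ DIM('a))\<^sup>2"
  have m0: "0 \<le> A.mn n x" "0 \<le> B.mn n x" for x by (rule deep_measure.m_nonneg[OF A.deep_n], rule deep_measure.m_nonneg[OF B.deep_n])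
  have mi: "integrable lborel (A.mn n)" "integrable lborel (B.mn n)" by (rule deep_measure.m_integrable[OF A.deep_n], rule deep_measure.m_integrable[OF B.deep_n])
  have "(g z)\<^sup>2 \<le> K\<^sup>2 * ?R * ?m z" for z
  proof -
   have "A.mn n (fst z) \<le> Q / \<delta> n ^ DIM('a)" "B.mn n (snd z) \<le> Q / \<delta> n ^ DIM('a)"
    unfolding Q_def by (rule deep_measure.m_le[OF A.deep_n], rule deep_measure.m_le[OF B.deep_n])
   then have m: "?m z \<le> ?R" unfolding power2_eq_square using m0[of "fst z"] m0[of "snd z"] by (intro mult_mono) auto
   have "(g z)\<^sup>2 \<le> (K * ?m z)\<^sup>2" using g(2) gd by (intro power_mono)
   also have "\<dots> = K\<^sup>2 * ?m z * ?m z" by (simp add: power2_eq_square algebra_simps)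
   also have "\<dots> \<le> K\<^sup>2 * ?m z * ?R" using m m0 by (intro mult_left_mono) auto
   finally show ?thesis by (simp add: algebra_simps)
  qed
  then have "(LBINT z. (g z)\<^sup>2) \<le> (LBINT z. K\<^sup>2 * ?R * ?m z)"
   using bcoupD(5)[OF g(1)] lborel_product_integral(1)[OF mi] by (intro integral_mono) auto
  also have "\<dots> = K\<^sup>2 * ?R * ((1 + \<delta> n) * (1 + \<delta> n))"
   using lborel_product_integral(2)[OF mi] deep_measure.m_mass[OF A.deep_n, of n] deep_measure.m_mass[OF B.deep_n, of n] by simp
  also have "\<dots> = (K * Q * (1 + \<delta> n))\<^sup>2 / \<delta> n ^ (DIM('a) + DIM('a))"
   by (simp add: power2_eq_square power_add algebra_simps)
  finally have "\<gamma> n * (LBINT z. (g z)\<^sup>2) \<le> \<gamma> n * ((K * Q * (1 + \<delta> n))\<^sup>2 / \<delta> n ^ (DIM('a) + DIM('a)))"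
   using \<gamma>(1)[of n] by (intro mult_left_mono) auto
  then have "\<gamma> n * (LBINT z. (g z)\<^sup>2) \<le> \<epsilon>" using elim(3) by (simp add: mult.commute)
  moreover have "(LBINT z. c z * g z) \<le> (\<integral>z. c z \<partial>\<Phi>) + \<epsilon>"
   using g(3) s(3) elim(4) by (simp add: algebra_simps)
  ultimately show ?case using g(1) by blast
 qed
qed

text \<open>
 In the interior the error is at most \<open>\<epsilon>\<close>. In the boundary layer, where
 the coupling has mass at most \<open>2 * \<delta>\<close>, it is split by
 \<open>error_young\<close>.
\<close>

lemma cost_error_bound:
 fixes e f :: "'a::euclidean_space \<times> 'a => real"
 assumes A: "deep_measure \<Omega> \<rho> \<delta> A" and B: "deep_measure \<Omega> \<rho> \<delta> B" and \<delta>: "\<delta> \<le> \<rho> / 2"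
  and f: "bcoup \<Omega> (smooth_density \<Omega> \<delta> A) (smooth_density \<Omega> \<delta> B) f"
  and p: "2 < p" and \<kappa>: "0 < \<kappa>" and L: "1 \<le> L" "1 / (4 * \<kappa>\<^sup>2) \<le> L powr (p - 2)" and \<gamma>: "0 < \<gamma>"
  and e: "e \<in> borel_measurable borel" "integrable lborel (\<lambda>z. \<bar>e z\<bar> powr p)" "(LBINT z. \<bar>e z\<bar> powr p) \<le> M * \<gamma>" and \<epsilon>: "0 \<le> \<epsilon>"
  and inner: "AE z in lborel. z \<in> \<Omega> \<times> \<Omega> \<longrightarrow> \<rho> / 2 \<le> infdist (fst z) (frontier \<Omega>) \<longrightarrow> \<rho> / 2 \<le> infdist (snd z) (frontier \<Omega>) \<longrightarrow> \<bar>e z\<bar> \<le> \<epsilon>"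
 shows "integrable lborel (\<lambda>z. e z * f z)"
  "\<bar>\<integral>z. e z * f z \<partial>lborel\<bar> \<le> \<epsilon> * (1 + \<delta>) + \<kappa> * M + \<kappa> * (\<gamma> * (LBINT z. (f z)\<^sup>2)) + 2 * L * \<delta>"
proof -
 interpret A: deep_measure \<Omega> \<rho> \<delta> A by (rule A)
 interpret B: deep_measure \<Omega> \<rho> \<delta> B by (rule B)
 note fD = bcoupD[OF f]
 have mA: "marginal_density \<Omega> A.m" unfolding marginal_density_def using A.m_measurable A.m_nonneg A.m_zero A.m_integrable by blast
 have mB: "marginal_density \<Omega> B.m" unfolding marginal_density_def using B.m_measurable B.m_nonneg B.m_zero B.m_integrable by blast
 define N where "N = {x \<in> \<Omega>. infdist x (frontier \<Omega>) < \<rho> / 2}"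
 have Nb [measurable]: "N \<in> sets borel"
 proof -
  have "N = \<Omega> \<inter> {x. infdist x (frontier \<Omega>) < \<rho> / 2}" unfolding N_def by auto
  moreover have "open {x. infdist x (frontier \<Omega>) < \<rho> / 2}" by (intro open_Collect_less continuous_intros)
  ultimately show ?thesis using A.\<Omega>_borel by auto
 qed
 define G where "G z = \<epsilon> * f z + (\<kappa> / \<gamma>) * \<bar>e z\<bar> powr p + \<kappa> * \<gamma> * (f z)\<^sup>2 + L * (indicat_real N (fst z) * f z) + L * (indicat_real N (snd z) * f z)" for z
 have iN: "integrable lborel (\<lambda>z. indicat_real N (fst z) * f z)" "integrable lborel (\<lambda>z. indicat_real N (snd z) * f z)"
  by (rule integrable_mult_bounded[OF fD(4), where B=1]; auto intro!: measurable_compose[OF fst_borel] measurable_compose[OF snd_borel] simp: indicator_def)+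
 have iG: "integrable lborel G" unfolding G_def using iN fD(4,5) e(2) by simp
 have bd: "AE z in lborel. \<bar>e z * f z\<bar> \<le> G z" using inner
 proof eventually_elim
  case (elim z)
  have t: "0 \<le> \<epsilon> * f z" "0 \<le> (\<kappa> / \<gamma>) * \<bar>e z\<bar> powr p" "0 \<le> \<kappa> * \<gamma> * (f z)\<^sup>2" "0 \<le> L * (indicat_real N (fst z) * f z)" "0 \<le> L * (indicat_real N (snd z) * f z)"
   using \<epsilon> \<kappa> \<gamma> L fD(2) by auto
  consider "z \<notin> \<Omega> \<times> \<Omega>" | "z \<in> \<Omega> \<times> \<Omega>" "fst z \<notin> N" "snd z \<notin> N" | "fst z \<in> N \<or> snd z \<in> N" by blast
  then show ?case
  proof cases
   case 1 then show ?thesis using t fD(3)[OF 1] unfolding G_def by simp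
  next
   case 2
   then have "\<bar>e z\<bar> \<le> \<epsilon>" using elim unfolding N_def by auto
   then have "\<bar>e z\<bar> * f z \<le> \<epsilon> * f z" using fD(2) by (intro mult_right_mono)
   then show ?thesis using t fD(2)[of z] unfolding G_def by (simp add: abs_mult)
  next
   case 3
   then have "L * f z \<le> L * (indicat_real N (fst z) * f z) + L * (indicat_real N (snd z) * f z)" using L fD(2)[of z] by auto
   moreover have "\<bar>e z\<bar> * f z \<le> \<kappa> * (\<bar>e z\<bar> powr p / \<gamma>) + \<kappa> * (\<gamma> * (f z)\<^sup>2) + L * f z"
    by (rule error_young[OF p \<kappa> L \<gamma>]) (use fD(2) in auto)
   ultimately show ?thesis using t fD(2)[of z] unfolding G_def by (simp add: abs_mult algebra_simps)
  qed
 qed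
 show i: "integrable lborel (\<lambda>z. e z * f z)"
  by (rule Bochner_Integration.integrable_bound[OF iG]) (use e(1) fD(1) bd in \<open>auto elim!: eventually_mono\<close>)
 have n1: "(LBINT z. indicat_real N (fst z) * f z) \<le> \<delta>" "(LBINT z. indicat_real N (snd z) * f z) \<le> \<delta>"
  using bcoup_integral[OF f mA mB, of "indicat_real N"] A.m_near_boundary[OF \<delta>] B.m_near_boundary[OF \<delta>] Nb unfolding N_def by auto
 have "\<bar>\<integral>z. e z * f z \<partial>lborel\<bar> \<le> (LBINT z. \<bar>e z * f z\<bar>)" by (rule integral_abs_bound)
 also have "\<dots> \<le> (LBINT z. G z)" by (rule integral_mono_AE[OF _ iG bd]) (use i in auto)
 also have "\<dots> = \<epsilon> * (1 + \<delta>) + (\<kappa> / \<gamma>) * (LBINT z. \<bar>e z\<bar> powr p) + \<kappa> * \<gamma> * (LBINT z. (f z)\<^sup>2)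
   + L * (LBINT z. indicat_real N (fst z) * f z) + L * (LBINT z. indicat_real N (snd z) * f z)"
  unfolding G_def using iN fD(4,5) e(2) bcoup_mass[OF f mA mB] A.m_mass by simp
 also have "\<dots> \<le> \<epsilon> * (1 + \<delta>) + (\<kappa> / \<gamma>) * (M * \<gamma>) + \<kappa> * \<gamma> * (LBINT z. (f z)\<^sup>2) + L * \<delta> + L * \<delta>"
  using n1 e(3) \<kappa> \<gamma> L by (intro add_mono mult_left_mono order_refl) auto
 finally show "\<bar>\<integral>z. e z * f z \<partial>lborel\<bar> \<le> \<epsilon> * (1 + \<delta>) + \<kappa> * M + \<kappa> * (\<gamma> * (LBINT z. (f z)\<^sup>2)) + 2 * L * \<delta>"
  using \<gamma> by (simp add: mult.assoc)
qed

text \<open>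
 The optimality of \<open>f n\<close> is tested with the competitors for \<open>\<Phi>\<close>.
 The choice \<open>\<kappa> \<le> 1/2\<close> lets the energy of \<open>f n\<close> absorb its
 own share of the error, so no bound on that energy has to be known.
\<close>

lemma limit_of_minimizers:
 fixes c :: "'a::euclidean_space \<times> 'a => real" and f e :: "nat => 'a \<times> 'a => real"
 assumes A: "smoothed_sequence \<Omega> \<rho> \<delta> An A" and B: "smoothed_sequence \<Omega> \<rho> \<delta> Bn B"
  and c: "continuous_on UNIV c" "\<And>z. \<bar>c z\<bar> \<le> C"
  and \<gamma>: "\<And>n. 0 < \<gamma> n" "(\<lambda>n. \<gamma> n / \<delta> n ^ (DIM('a) + DIM('a))) \<longlonglongrightarrow> 0" and p: "2 < p"
  and f: "\<And>n. bcoup \<Omega> (smooth_density \<Omega> (\<delta> n) (An n)) (smooth_density \<Omega> (\<delta> n) (Bn n)) (f n)"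
  and e: "\<And>n. e n \<in> borel_measurable borel" "\<And>n. integrable lborel (\<lambda>z. \<bar>e n z\<bar> powr p)" "\<And>n. (LBINT z. \<bar>e n z\<bar> powr p) \<le> M * \<gamma> n"
  and \<epsilon>: "\<And>n. 0 \<le> \<epsilon> n" "\<epsilon> \<longlonglongrightarrow> 0"
  and inner: "\<And>n. AE z in lborel. z \<in> \<Omega> \<times> \<Omega> \<longrightarrow> \<rho> / 2 \<le> infdist (fst z) (frontier \<Omega>) \<longrightarrow> \<rho> / 2 \<le> infdist (snd z) (frontier \<Omega>) \<longrightarrow> \<bar>e n z\<bar> \<le> \<epsilon> n"
  and opt: "\<And>n g. bcoup \<Omega> (smooth_density \<Omega> (\<delta> n) (An n)) (smooth_density \<Omega> (\<delta> n) (Bn n)) g ==>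
   (LBINT z. c z * f n z) + (LBINT z. e n z * f n z) + \<gamma> n / 2 * (LBINT z. (f n z)\<^sup>2)
   \<le> (LBINT z. c z * g z) + (LBINT z. e n z * g z) + \<gamma> n / 2 * (LBINT z. (g z)\<^sup>2)"
  and v: "(\<lambda>n. \<integral>z. c z * f n z \<partial>lborel) \<longlonglongrightarrow> v"
  and \<Phi>: "is_coupling \<Phi> A B" "AE z in \<Phi>. z \<in> \<Omega> \<times> \<Omega>"
 shows "v \<le> (\<integral>z. c z \<partial>\<Phi>)"
proof (rule field_le_epsilon)
 interpret A: smoothed_sequence \<Omega> \<rho> \<delta> An A by (rule A)
 interpret B: smoothed_sequence \<Omega> \<rho> \<delta> Bn B by (rule B)
 fix E :: real assume E0: "0 < E"
 define E1 where "E1 = E / 3"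
 have E: "0 < E1" using E0 unfolding E1_def by simp
 have M0: "0 \<le> M"
 proof -
  have "0 \<le> (LBINT z. \<bar>e 0 z\<bar> powr p)" by (intro Bochner_Integration.integral_nonneg) simp
  then have "0 \<le> M * \<gamma> 0" using e(3)[of 0] by linarith
  then show ?thesis using \<gamma>(1)[of 0] by (simp add: zero_le_mult_iff)
 qed
 \<comment> \<open>at most \<open>1/2\<close> for the absorption, and small enough for \<open>2 * \<kappa> * M\<close> to be at most \<open>E1\<close>\<close>
 define \<kappa> where "\<kappa> = min (1/2) (E1 / (2 * M + 1))"
 have \<kappa>: "0 < \<kappa>" "\<kappa> \<le> 1/2" "2 * \<kappa> * M \<le> E1"
 proof -
  show "0 < \<kappa>" unfolding \<kappa>_def using E M0 by simp
  show "\<kappa> \<le> 1/2" unfolding \<kappa>_def by (rule min.cobounded1)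
  have "\<kappa> \<le> E1 / (2 * M + 1)" unfolding \<kappa>_def by simp
  then have "\<kappa> * (2 * M + 1) \<le> E1" using M0 by (simp add: field_simps)
  then show "2 * \<kappa> * M \<le> E1" using \<open>0 < \<kappa>\<close> by (simp add: algebra_simps)
 qed
 \<comment> \<open>the least \<open>L\<close> that \<open>error_young\<close> admits for this \<open>\<kappa>\<close>\<close>
 define L where "L = max 1 ((1 / (4 * \<kappa>\<^sup>2)) powr (1 / (p - 2)))"
 have L: "1 \<le> L" "1 / (4 * \<kappa>\<^sup>2) \<le> L powr (p - 2)"
 proof -
  show "1 \<le> L" unfolding L_def by simp
  have "((1 / (4 * \<kappa>\<^sup>2)) powr (1 / (p - 2))) powr (p - 2) = 1 / (4 * \<kappa>\<^sup>2)" using p \<kappa> by (simp add: powr_powr)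
  moreover have "((1 / (4 * \<kappa>\<^sup>2)) powr (1 / (p - 2))) powr (p - 2) \<le> L powr (p - 2)" unfolding L_def using p by (intro powr_mono2) auto
  ultimately show "1 / (4 * \<kappa>\<^sup>2) \<le> L powr (p - 2)" by simp
 qed
 have "0 < \<rho>" using A.\<delta>_pos[of 0] by linarith
 then have ev\<delta>: "\<forall>\<^sub>F n in sequentially. \<delta> n < \<rho> / 2" by (intro order_tendstoD(2)[OF A.\<delta>_lim]) simp
 have "\<forall>\<^sub>F n in sequentially. (LBINT z. c z * f n z) \<le> (\<integral>z. c z \<partial>\<Phi>) + 3 * E1 + (2 * (\<epsilon> n * (1 + \<delta> n)) + 4 * L * \<delta> n)"
  using near_optimal_competitors[OF A B c \<Phi> \<gamma> E] ev\<delta>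
 proof eventually_elim
  case (elim n)
  then obtain g where g: "bcoup \<Omega> (A.mn n) (B.mn n) g" "(LBINT z. c z * g z) \<le> (\<integral>z. c z \<partial>\<Phi>) + E1" "\<gamma> n * (LBINT z. (g z)\<^sup>2) \<le> E1" by blast
  have \<delta>n: "\<delta> n \<le> \<rho> / 2" using elim by simp
  note bnd = cost_error_bound(2)[OF A.deep_n B.deep_n \<delta>n _ p \<kappa>(1) L \<gamma>(1)[of n] e(1)[of n] e(2)[of n] e(3)[of n] \<epsilon>(1)[of n] inner[of n]]
  have "0 \<le> \<gamma> n * (LBINT z. (g z)\<^sup>2)" "0 \<le> \<gamma> n * (LBINT z. (f n z)\<^sup>2)" using \<gamma>(1)[of n] by auto
  then have "\<kappa> * (\<gamma> n * (LBINT z. (g z)\<^sup>2)) \<le> 1/2 * (\<gamma> n * (LBINT z. (g z)\<^sup>2))"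
   "\<kappa> * (\<gamma> n * (LBINT z. (f n z)\<^sup>2)) \<le> 1/2 * (\<gamma> n * (LBINT z. (f n z)\<^sup>2))"
   using \<kappa> by (intro mult_right_mono; simp)+
  then show ?case using bnd[OF f] bnd[OF g(1)] opt[OF g(1)] g(2,3) \<kappa>(3) unfolding abs_le_iff
   by (simp add: algebra_simps)
 qed
 moreover have "(\<lambda>n. (\<integral>z. c z \<partial>\<Phi>) + 3 * E1 + (2 * (\<epsilon> n * (1 + \<delta> n)) + 4 * L * \<delta> n)) \<longlonglongrightarrow> (\<integral>z. c z \<partial>\<Phi>) + 3 * E1 + (2 * (0 * (1 + 0)) + 4 * L * 0)"
  by (intro tendsto_intros \<epsilon> A.\<delta>_lim)
 ultimately have "v \<le> (\<integral>z. c z \<partial>\<Phi>) + 3 * E1 + (2 * (0 * (1 + 0)) + 4 * L * 0)"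
  by (intro tendsto_le[OF sequentially_bot _ v]) auto
 then show "v \<le> (\<integral>z. c z \<partial>\<Phi>) + E" unfolding E1_def by simp
qed

text \<open>
 Continuous functions of one variable are admissible in the weak limit and determine the
 marginals.
\<close>

lemma limit_is_coupling:
 assumes A: "smoothed_sequence \<Omega> \<rho> \<delta> An A" and B: "smoothed_sequence \<Omega> \<rho> \<delta> Bn B"
  and f: "\<And>n. bcoup \<Omega> (smooth_density \<Omega> (\<delta> n) (An n)) (smooth_density \<Omega> (\<delta> n) (Bn n)) (f n)"
  and N: "prob_space N" "sets N = sets borel" "AE z in N. z \<in> \<Omega> \<times> \<Omega>"
  and lim: "\<And>g :: 'a::euclidean_space \<times> 'a => real. continuous_on UNIV g ==> (\<lambda>n. \<integral>z. g z * f n z \<partial>lborel) \<longlonglongrightarrow> (\<integral>z. g z \<partial>N)"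
 shows "is_coupling N A B"
proof -
 interpret A: smoothed_sequence \<Omega> \<rho> \<delta> An A by (rule A)
 interpret B: smoothed_sequence \<Omega> \<rho> \<delta> Bn B by (rule B)
 have pm: "fst \<in> measurable N borel" "snd \<in> measurable N borel"
  unfolding measurable_cong_sets[OF N(2) refl] by (rule fst_borel, rule snd_borel)
 interpret N: prob_space N by (rule N)
 have fin: "finite_measure A" "finite_measure B" using A.A(1) B.A(1) by (auto intro: prob_space.finite_measure)
 have "distr N borel fst = A"
 proof (rule measure_eq_continuous)
  fix g :: "'a => real" and b assume g: "continuous_on UNIV g" "\<And>x. \<bar>g x\<bar> \<le> b"
  have gm: "g \<in> borel_measurable borel" using g(1) by (rule borel_measurable_continuous_onI)
  have "(\<lambda>n. \<integral>z. g (fst z) * f n z \<partial>lborel) \<longlonglongrightarrow> (\<integral>z. g (fst z) \<partial>N)" by (rule lim) (intro continuous_intros continuous_on_compose2[OF g(1)], auto)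
  then have "(\<lambda>n. \<integral>x. g x * A.mn n x \<partial>lborel) \<longlonglongrightarrow> (\<integral>z. g (fst z) \<partial>N)"
   unfolding bcoup_integral(1)[OF f A.mn_density B.mn_density gm] .
  from LIMSEQ_unique[OF this A.mn_weak[OF gm g(2) continuous_on_subset[OF g(1)]]]
  show "(\<integral>x. g x \<partial>distr N borel fst) = (\<integral>x. g x \<partial>A)" using gm by (simp add: integral_distr[OF pm(1)])
 qed (use fin A.A in \<open>auto intro: N.finite_measure_distr pm\<close>)
 moreover have "distr N borel snd = B"
 proof (rule measure_eq_continuous)
  fix g :: "'a => real" and b assume g: "continuous_on UNIV g" "\<And>x. \<bar>g x\<bar> \<le> b"
  have gm: "g \<in> borel_measurable borel" using g(1) by (rule borel_measurable_continuous_onI)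
  have "(\<lambda>n. \<integral>z. g (snd z) * f n z \<partial>lborel) \<longlonglongrightarrow> (\<integral>z. g (snd z) \<partial>N)" by (rule lim) (intro continuous_intros continuous_on_compose2[OF g(1)], auto)
  then have "(\<lambda>n. \<integral>x. g x * B.mn n x \<partial>lborel) \<longlonglongrightarrow> (\<integral>z. g (snd z) \<partial>N)"
   unfolding bcoup_integral(2)[OF f A.mn_density B.mn_density gm] .
  from LIMSEQ_unique[OF this B.mn_weak[OF gm g(2) continuous_on_subset[OF g(1)]]]
  show "(\<integral>x. g x \<partial>distr N borel snd) = (\<integral>x. g x \<partial>B)" using gm by (simp add: integral_distr[OF pm(2)])
 qed (use fin B.A in \<open>auto intro: N.finite_measure_distr pm\<close>)
 ultimately show ?thesis unfolding is_coupling_def using N(2) by simp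
qed

section \<open>Measures supported away from the boundary, and representatives\<close>

definition deep_set :: "'a::euclidean_space set => real => 'a set" where
 "deep_set \<Omega> \<rho> = {x \<in> \<Omega>. \<rho> \<le> infdist x (frontier \<Omega>)}"

lemma deep_set_compact: "compact \<Omega> ==> compact (deep_set \<Omega> \<rho>)"
proof -
 assume \<Omega>: "compact \<Omega>"
 have "deep_set \<Omega> \<rho> = \<Omega> \<inter> {x. \<rho> \<le> infdist x (frontier \<Omega>)}" unfolding deep_set_def by auto
 moreover have "closed {x. \<rho> \<le> infdist x (frontier \<Omega>)}" by (intro closed_Collect_le continuous_intros)
 ultimately show ?thesis using \<Omega> by (simp add: compact_Int_closed)
qed

text \<open>
 A ball that meets \<open>\<Omega>\<close> and its complement meets the boundary.
\<close>

lemma deep_set_ball: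
 assumes "x \<in> deep_set \<Omega> \<rho>" "0 < \<rho>" shows "ball x \<rho> \<subseteq> \<Omega>"
proof (rule ccontr)
 assume "\<not> ball x \<rho> \<subseteq> \<Omega>"
 moreover have "x \<in> ball x \<rho> \<inter> \<Omega>" using assms unfolding deep_set_def by simp
 ultimately obtain y where "y \<in> ball x \<rho>" "y \<in> frontier \<Omega>"
  using connected_Int_frontier[OF connected_ball, of x \<rho> \<Omega>] by blast
 then show False using infdist_le[of y "frontier \<Omega>" x] assms(1) unfolding deep_set_def by simp
qed

lemma deep_set_interior:
 assumes "closed \<Omega>" "0 < \<rho>" shows "deep_set \<Omega> \<rho> \<subseteq> interior \<Omega>"
proof
 fix x assume x: "x \<in> deep_set \<Omega> \<rho>"
 then have "infdist x (frontier \<Omega>) \<noteq> 0" using assms(2) unfolding deep_set_def by auto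
 then have "x \<notin> frontier \<Omega>" by auto
 then show "x \<in> interior \<Omega>" using x assms(1) unfolding deep_set_def frontier_def by auto
qed

text \<open>
 The support is the smallest closed set of full measure and the points at distance
 \<open>\<rho>\<close> from the boundary form a closed set. In this form the constraint passes
 to weak limits.
\<close>

lemma upper_level_iff:
 fixes \<Omega> :: "'a::euclidean_space set"
 assumes \<Omega>: "compact \<Omega>" "interior \<Omega> \<noteq> {}" and \<rho>: "0 < \<rho>"
 shows "\<mu> \<in> upper_level_set \<Omega> \<rho> \<longleftrightarrow> \<mu> \<in> prob_measures \<Omega> \<and> (AE x in pos_part \<mu>. x \<in> deep_set \<Omega> \<rho>)"
proof (cases "\<mu> \<in> prob_measures \<Omega>")
 case True
 have \<mu>: "\<mu> \<in> signed_measures \<Omega>" "nonneg_smeas \<mu>" using True unfolding prob_measures_def by auto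
 have \<Omega>b: "\<Omega> \<in> sets borel" using \<Omega> by (simp add: borel_compact)
 note pp = pos_part_eq[OF \<mu> \<Omega>b]
 interpret P: prob_space "pos_part \<mu>" by (rule coupling_dictionary(4)[OF \<Omega>(1) \<Omega>(1) True True])
 have supp: "supp \<mu> = msupp (pos_part \<mu>)"
 proof -
  have "variation \<mu> U = emeasure (pos_part \<mu>) U" if "open U" for U
   using variation_eq[of \<mu> "pos_part \<mu>" U] pp(1,2) \<mu>(2) that unfolding nonneg_smeas_def by simp
  then show ?thesis unfolding supp_def msupp_def by auto
 qed
 have sub: "msupp (pos_part \<mu>) \<subseteq> \<Omega>" by (rule msupp_subset[OF pp(1) compact_imp_closed[OF \<Omega>(1)] pp(4)])
 have fr: "frontier \<Omega> \<noteq> {}"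
 proof -
  have "\<Omega> \<noteq> UNIV" using \<Omega>(1) compact_imp_bounded not_bounded_UNIV by auto
  moreover have "\<Omega> \<noteq> {}" using \<Omega>(2) by auto
  ultimately show ?thesis unfolding frontier_eq_empty by simp
 qed
 have ne: "msupp (pos_part \<mu>) \<noteq> {}"
 proof
  assume "msupp (pos_part \<mu>) = {}"
  then show False using msupp_compl(2)[OF pp(1)] P.AE_False by simp
 qed
 have "\<rho> \<le> setdist (supp \<mu>) (frontier \<Omega>) \<longleftrightarrow> (AE x in pos_part \<mu>. x \<in> deep_set \<Omega> \<rho>)"
 proof
  assume l: "\<rho> \<le> setdist (supp \<mu>) (frontier \<Omega>)"
  have "x \<in> deep_set \<Omega> \<rho>" if x: "x \<in> msupp (pos_part \<mu>)" for x
  proof -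
   have "\<rho> \<le> setdist {x} (frontier \<Omega>)" by (rule le_setdistI) (use l x fr supp setdist_le_dist[of x "supp \<mu>" _ "frontier \<Omega>"] in force)+
   then show ?thesis using x sub unfolding deep_set_def infdist_eq_setdist by auto
  qed
  then show "AE x in pos_part \<mu>. x \<in> deep_set \<Omega> \<rho>" using msupp_compl(2)[OF pp(1)] by (auto elim!: eventually_mono)
 next
  assume "AE x in pos_part \<mu>. x \<in> deep_set \<Omega> \<rho>"
  from msupp_subset[OF pp(1) compact_imp_closed[OF deep_set_compact[OF \<Omega>(1)]] this]
  have s: "supp \<mu> \<subseteq> deep_set \<Omega> \<rho>" unfolding supp .
  show "\<rho> \<le> setdist (supp \<mu>) (frontier \<Omega>)"
  proof (rule le_setdistI)
   fix x y assume xy: "x \<in> supp \<mu>" "y \<in> frontier \<Omega>"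
   then have "\<rho> \<le> infdist x (frontier \<Omega>)" using s unfolding deep_set_def by auto
   then show "\<rho> \<le> dist x y" using infdist_le[OF xy(2), of x] by linarith
  qed (use ne fr supp in auto)
 qed
 then show ?thesis using True unfolding upper_level_set_def by simp
qed (simp add: upper_level_set_def)

lemma weak_star_smeas_of:
 fixes X :: "'a::euclidean_space set"
 assumes X: "X \<in> sets borel" and Mn: "\<And>n. finite_measure (Mn n)" "\<And>n. sets (Mn n) = sets borel" "\<And>n. AE x in Mn n. x \<in> X"
  and M: "finite_measure M" "sets M = sets borel" "AE x in M. x \<in> X"
  and lim: "\<And>f :: 'a => real. continuous_on X f ==> (\<lambda>n. \<integral>x. indicator X x * f x \<partial>Mn n) \<longlonglongrightarrow> (\<integral>x. indicator X x * f x \<partial>M)"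
 shows "weak_star_tendsto X (\<lambda>n. smeas_of (Mn n)) (smeas_of M)"
 unfolding weak_star_tendsto_def
proof (intro allI impI)
 fix f :: "'a => real" assume f: "continuous_on X f"
 have e: "sm_integral X (smeas_of N) f = (\<integral>x. indicator X x * f x \<partial>N)" if "finite_measure N" "sets N = sets borel" "AE x in N. x \<in> X" for N
  using sm_integral_eq[OF smeas_of(1,2)[OF that(1,2) X that(3)] X] smeas_of(3)[OF that(1,2) X that(3)] by simp
 show "(\<lambda>n. sm_integral X (smeas_of (Mn n)) f) \<longlonglongrightarrow> sm_integral X (smeas_of M) f"
  unfolding e[OF Mn] e[OF M] by (rule lim[OF f])
qed

text \<open>
 Completeness of Lebesgue measure supplies the measurability of the integrand on the left.
\<close>

lemma lebesgue_on_integral_AE: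
 fixes F G :: "'a::euclidean_space => real"
 assumes X: "X \<in> sets borel" and G: "G \<in> borel_measurable borel" "\<And>z. z \<notin> X ==> G z = 0"
  and AE: "AE z in lborel. z \<in> X \<longrightarrow> F z = G z"
 shows "(LINT z|lebesgue_on X. F z) = (LBINT z. G z)"
proof -
 have Gl: "G \<in> borel_measurable lebesgue" using measurable_completion[of G lborel borel] G(1) by simp
 have ae: "AE z in lebesgue. G z = indicat_real X z *\<^sub>R F z"
  unfolding AE_completion_iff using AE by eventually_elim (use G(2) in \<open>auto simp: indicator_def\<close>)
 have "(LINT z|lebesgue_on X. F z) = (LINT z|lebesgue. indicat_real X z *\<^sub>R F z)" using X by (intro integral_restrict_space) simp
 also have "\<dots> = (LINT z|lebesgue. G z)"
  by (rule integral_cong_AE[OF borel_measurable_AE[OF Gl ae] Gl]) (use ae in \<open>auto elim!: eventually_mono\<close>)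
 also have "\<dots> = (LBINT z. G z)" using G(1) by (simp add: integral_completion)
 finally show ?thesis .
qed

lemma density_smeas_eq:
 fixes f :: "'a::euclidean_space => real"
 assumes X: "X \<in> sets borel" and f: "f \<in> borel_measurable borel" "\<And>z. 0 \<le> f z" "\<And>z. z \<notin> X ==> f z = 0" "integrable lborel f"
  and AE: "AE z in lborel. z \<in> X \<longrightarrow> \<pi> z = f z"
 shows "density_smeas X \<pi> = smeas_of (density lborel (\<lambda>z. ennreal (f z)))"
proof
 fix A
 show "density_smeas X \<pi> A = smeas_of (density lborel (\<lambda>z. ennreal (f z))) A"
 proof (cases "A \<in> sets borel")
  case True
  have "(LINT x:A|lebesgue_on X. \<pi> x) = (LBINT z. indicat_real A z * f z)"
   unfolding set_lebesgue_integral_def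
   by (rule lebesgue_on_integral_AE[OF X]) (use True f AE in \<open>auto elim!: eventually_mono\<close>)
  also have "\<dots> = (\<integral>z. indicat_real A z \<partial>density lborel (\<lambda>z. ennreal (f z)))" using True f by (intro integral_lborel_density[symmetric]) auto
  finally show ?thesis using True unfolding density_smeas_def smeas_of_def by simp
 qed (simp add: density_smeas_def smeas_of_def)
qed

lemma sobolev_borel_representative:
 fixes w :: "'a::euclidean_space => real"
 assumes U: "open U" and p: "0 < p" and w: "sobolev_W1 p U w"
 obtains e where "e \<in> borel_measurable borel" "\<And>z. z \<notin> U ==> e z = 0" "AE z in lborel. z \<in> U \<longrightarrow> w z = e z"
  "integrable lborel (\<lambda>z. \<bar>e z\<bar> powr p)" "(LBINT z. \<bar>e z\<bar> powr p) \<le> W1_norm p U w powr p"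
proof -
 have Ub: "U \<in> sets borel" "U \<in> sets lebesgue" using U by auto
 obtain G where G: "weak_gradient U w G" "\<And>b. b \<in> Basis ==> Lp_on p U (\<lambda>x. G x \<bullet> b)" and L: "Lp_on p U w" using w unfolding sobolev_W1_def by blast
 have "(\<lambda>z. indicat_real U z *\<^sub>R w z) \<in> borel_measurable lebesgue"
  using L borel_measurable_restrict_space_iff[of U lebesgue w] Ub unfolding Lp_on_def by simp
 then obtain e0 where e0: "e0 \<in> borel_measurable lborel" "AE z in lborel. indicat_real U z *\<^sub>R w z = e0 z"
  using completion_ex_borel_measurable_real by blast
 define e where "e z = indicat_real U z * e0 z" for z
 have em: "e \<in> borel_measurable borel" unfolding e_def using e0(1) Ub by measurable
 have ez: "e z = 0" if "z \<notin> U" for z unfolding e_def using that by simp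
 have AE: "AE z in lborel. z \<in> U \<longrightarrow> w z = e z" using e0(2) by eventually_elim (auto simp: e_def)
 have pm: "(\<lambda>z. \<bar>e z\<bar> powr p) \<in> borel_measurable borel" using em by measurable
 have pz: "\<bar>e z\<bar> powr p = 0" if "z \<notin> U" for z using ez[OF that] p by simp
 have "integrable (lebesgue_on U) (\<lambda>z. \<bar>e z\<bar> powr p)"
 proof (rule integrable_cong_AE_imp)
  show "integrable (lebesgue_on U) (\<lambda>z. \<bar>w z\<bar> powr p)" using L unfolding Lp_on_def by simp
  show "(\<lambda>z. \<bar>e z\<bar> powr p) \<in> borel_measurable (lebesgue_on U)" by (rule lebesgue_on_lborel(3)[OF pm pz Ub(1)])
  show "AE z in lebesgue_on U. \<bar>w z\<bar> powr p = \<bar>e z\<bar> powr p"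
   unfolding AE_lborel_lebesgue_on[OF Ub(1)] using AE by eventually_elim auto
 qed
 then have i: "integrable lborel (\<lambda>z. \<bar>e z\<bar> powr p)" using lebesgue_on_lborel(2)[OF pm pz Ub(1)] by simp
 have "(LINT z|lebesgue_on U. \<bar>w z\<bar> powr p) = (LBINT z. \<bar>e z\<bar> powr p)"
  by (rule lebesgue_on_integral_AE[OF Ub(1) pm pz]) (use AE in \<open>auto elim!: eventually_mono\<close>)
 then show ?thesis using that[of e] em ez AE i W1_norm_bounds(1)[OF U p G] by simp
qed

text \<open>
 A single block suffices when only existence matters.
\<close>

lemma bcoup_exists:
 fixes \<Omega> :: "'a::euclidean_space set"
 assumes A: "deep_measure \<Omega> \<rho> \<delta> A" and B: "deep_measure \<Omega> \<rho> \<delta> B" and \<Phi>: "is_coupling \<Phi> A B" "AE z in \<Phi>. z \<in> \<Omega> \<times> \<Omega>"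
 obtains f where "bcoup \<Omega> (smooth_density \<Omega> \<delta> A) (smooth_density \<Omega> \<delta> B) f"
proof -
 interpret A: deep_measure \<Omega> \<rho> \<delta> A by (rule A)
 interpret B: deep_measure \<Omega> \<rho> \<delta> B by (rule B)
 interpret AP: prob_space A by (rule A.M)
 interpret BP: prob_space B by (rule B.M)
 have mA: "marginal_density \<Omega> A.m" unfolding marginal_density_def using A.m_measurable A.m_nonneg A.m_zero A.m_integrable by blast
 have mB: "marginal_density \<Omega> B.m" unfolding marginal_density_def using B.m_measurable B.m_nonneg B.m_zero B.m_integrable by blast
 show ?thesis
 proof (rule block_competitor[OF mA mB A.m_le B.m_le A.m_mass B.m_mass, where I="{()}" and \<eta>="\<lambda>_ _. 1" and A=A and B=B and \<Phi>=\<Phi> and s="1/2" and c="\<lambda>_. 0" and C=0 and \<omega>=0])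
  show "(1 - 1 / 2) * (\<integral>x. 1 \<partial>A) \<le> (LBINT x. 1 * A.m x)" "(1 - 1 / 2) * (\<integral>x. 1 \<partial>B) \<le> (LBINT x. 1 * B.m x)"
   using A.m_mass B.m_mass A.\<delta> AP.prob_space BP.prob_space by simp_all
 qed (use A.M B.M \<Phi> A.\<delta> that in auto)
qed

section \<open>Convergence of regularized minimizers\<close>

text \<open>
 The second marginal and the cost are the same for all \<open>n\<close>; the cost is extended
 to the whole space so that it is Borel measurable and bounded everywhere.
\<close>

locale fixed_target =
 fixes \<Omega> :: "'a::euclidean_space set" and \<rho> :: real and B :: "'a measure" and c :: "'a \<times> 'a => real" and C :: real
 assumes \<Omega>: "compact \<Omega>" "interior \<Omega> \<noteq> {}" and \<rho>: "0 < \<rho>"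
  and B: "prob_space B" "sets B = sets borel" "AE x in B. x \<in> deep_set \<Omega> \<rho>"
  and c: "continuous_on UNIV c" "\<And>z. \<bar>c z\<bar> \<le> C"
begin

lemma \<Omega>_borel: "\<Omega> \<in> sets borel" "\<Omega> \<times> \<Omega> \<in> sets borel" and \<Omega>2: "compact (\<Omega> \<times> \<Omega>)"
 using \<Omega>(1) compact_Times[OF \<Omega>(1) \<Omega>(1)] by (auto simp: borel_compact)

lemma c_borel: "c \<in> borel_measurable borel" using c(1) by (rule borel_measurable_continuous_onI)

lemma deep_measureI:
 assumes "prob_space M" "sets M = sets borel" "AE x in M. x \<in> deep_set \<Omega> \<rho>" "0 < d" "d \<le> \<rho>"
 shows "deep_measure \<Omega> \<rho> d M"
 unfolding deep_measure_def using assms \<Omega> deep_set_ball[OF _ \<rho>] by (auto elim!: eventually_mono)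

lemma deep_in: "AE x in M. x \<in> deep_set \<Omega> \<rho> ==> AE x in M. x \<in> \<Omega>"
 by (auto elim!: eventually_mono simp: deep_set_def)

lemma coupling_props:
 assumes "is_coupling \<Phi> A B" "prob_space A" "AE x in A. x \<in> \<Omega>"
 shows "prob_space \<Phi>" "sets \<Phi> = sets borel" "AE z in \<Phi>. z \<in> \<Omega> \<times> \<Omega>"
proof -
 have s: "sets \<Phi> = sets borel" "distr \<Phi> borel fst = A" "distr \<Phi> borel snd = B" using assms(1) unfolding is_coupling_def by auto
 have pm: "fst \<in> measurable \<Phi> borel" "snd \<in> measurable \<Phi> borel"
  unfolding measurable_cong_sets[OF s(1) refl] by (rule fst_borel, rule snd_borel)
 show "sets \<Phi> = sets borel" "prob_space \<Phi>" using s prob_space_distrD[OF pm(1)] assms by auto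
 have "AE z in \<Phi>. fst z \<in> \<Omega>" "AE z in \<Phi>. snd z \<in> \<Omega>"
  using AE_distrD[OF pm(1), of "\<lambda>x. x \<in> \<Omega>"] AE_distrD[OF pm(2), of "\<lambda>x. x \<in> \<Omega>"] s assms(3) deep_in[OF B(3)] by auto
 then show "AE z in \<Phi>. z \<in> \<Omega> \<times> \<Omega>" by eventually_elim (auto simp: mem_Times_iff)
qed

lemma density_props:
 assumes "bcoup \<Omega> m1 m2 f"
 shows "finite_measure (density lborel (\<lambda>z. ennreal (f z)))" "sets (density lborel (\<lambda>z. ennreal (f z))) = sets borel"
  "AE z in density lborel (\<lambda>z. ennreal (f z)). z \<in> \<Omega> \<times> \<Omega>"
proof -
 note f = bcoupD[OF assms]
 show "finite_measure (density lborel (\<lambda>z. ennreal (f z)))" by (rule finite_density[OF f(4,2)])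
 show "AE z in density lborel (\<lambda>z. ennreal (f z)). z \<in> \<Omega> \<times> \<Omega>"
 proof (subst AE_density)
  show "AE z in lborel. 0 < ennreal (f z) \<longrightarrow> z \<in> \<Omega> \<times> \<Omega>"
   by (intro AE_I2 impI, rule ccontr) (use f(3) in simp)
 qed (use f(1) in simp)
qed simp

lemma smooth_density_marginal:
 assumes "deep_measure \<Omega> \<rho> d A" shows "marginal_density \<Omega> (smooth_density \<Omega> d A)"
proof -
 interpret A: deep_measure \<Omega> \<rho> d A by (rule assms)
 show ?thesis unfolding marginal_density_def using A.m_measurable A.m_nonneg A.m_zero A.m_integrable by blast
qed

lemma smooth_coupling_mass:
 assumes "deep_measure \<Omega> \<rho> d A" "deep_measure \<Omega> \<rho> d B'" "bcoup \<Omega> (smooth_density \<Omega> d A) (smooth_density \<Omega> d B') f"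
 shows "(LBINT z. f z) = 1 + d"
 using bcoup_mass[OF assms(3) smooth_density_marginal[OF assms(1)] smooth_density_marginal[OF assms(2)]] deep_measure.m_mass[OF assms(1)] by simp

text \<open>
 The plans have mass \<open>1 + \<delta> n\<close>; after normalisation compactness applies
 first to the marginals and then to the plans, and the mass factor disappears in the limit.
\<close>

lemma minimizers_subsequence:
 fixes f e :: "nat => 'a \<times> 'a => real"
 assumes An: "\<And>n. prob_space (An n)" "\<And>n. sets (An n) = sets borel" "\<And>n. AE x in An n. x \<in> deep_set \<Omega> \<rho>"
  and \<delta>: "\<And>n. 0 < \<delta> n" "\<And>n. \<delta> n \<le> \<rho>" "\<delta> \<longlonglongrightarrow> 0"
  and \<gamma>: "\<And>n. 0 < \<gamma> n" "(\<lambda>n. \<gamma> n / \<delta> n ^ (DIM('a) + DIM('a))) \<longlonglongrightarrow> 0" and p: "2 < p"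
  and f: "\<And>n. bcoup \<Omega> (smooth_density \<Omega> (\<delta> n) (An n)) (smooth_density \<Omega> (\<delta> n) B) (f n)"
  and e: "\<And>n. e n \<in> borel_measurable borel" "\<And>n. integrable lborel (\<lambda>z. \<bar>e n z\<bar> powr p)" "\<And>n. (LBINT z. \<bar>e n z\<bar> powr p) \<le> M * \<gamma> n"
  and \<epsilon>: "\<And>n. 0 \<le> \<epsilon> n" "\<epsilon> \<longlonglongrightarrow> 0"
  and inner: "\<And>n. AE z in lborel. z \<in> deep_set \<Omega> (\<rho> / 2) \<times> deep_set \<Omega> (\<rho> / 2) \<longrightarrow> \<bar>e n z\<bar> \<le> \<epsilon> n"
  and opt: "\<And>n g. bcoup \<Omega> (smooth_density \<Omega> (\<delta> n) (An n)) (smooth_density \<Omega> (\<delta> n) B) g ==>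
   (LBINT z. c z * f n z) + (LBINT z. e n z * f n z) + \<gamma> n / 2 * (LBINT z. (f n z)\<^sup>2)
   \<le> (LBINT z. c z * g z) + (LBINT z. e n z * g z) + \<gamma> n / 2 * (LBINT z. (g z)\<^sup>2)"
 obtains r A N where "strict_mono (r :: nat => nat)" "prob_space A" "sets A = sets borel" "AE x in A. x \<in> deep_set \<Omega> \<rho>"
  "\<And>g :: 'a => real. continuous_on \<Omega> g ==> (\<lambda>n. \<integral>x. indicator \<Omega> x * g x \<partial>An (r n)) \<longlonglongrightarrow> (\<integral>x. indicator \<Omega> x * g x \<partial>A)"
  "optimal_coupling c N A B"
  "\<And>g :: 'a \<times> 'a => real. continuous_on (\<Omega> \<times> \<Omega>) g ==>
    (\<lambda>n. \<integral>z. indicator (\<Omega> \<times> \<Omega>) z * g z \<partial>density lborel (\<lambda>z. ennreal (f (r n) z))) \<longlonglongrightarrow> (\<integral>z. indicator (\<Omega> \<times> \<Omega>) z * g z \<partial>N)"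
proof -
 let ?X = "\<Omega> \<times> \<Omega>"
 have deep: "deep_measure \<Omega> \<rho> (\<delta> n) (An n)" "deep_measure \<Omega> \<rho> (\<delta> n) B" for n
  by (rule deep_measureI[OF An \<delta>(1,2)], rule deep_measureI[OF B \<delta>(1,2)])
 obtain r1 A where r1: "strict_mono (r1 :: nat => nat)" and A: "prob_space A" "sets A = sets borel" "AE x in A. x \<in> deep_set \<Omega> \<rho>"
  and limA: "\<And>g :: 'a => real. continuous_on (deep_set \<Omega> \<rho>) g ==>
    (\<lambda>n. \<integral>x. indicator (deep_set \<Omega> \<rho>) x * g x \<partial>An (r1 n)) \<longlonglongrightarrow> (\<integral>x. indicator (deep_set \<Omega> \<rho>) x * g x \<partial>A)"
  by (rule prob_measures_compact_subseq[where M=An, OF deep_set_compact[OF \<Omega>(1)] An]) (rule that; assumption)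
 have db: "deep_set \<Omega> \<rho> \<in> sets borel" using deep_set_compact[OF \<Omega>(1)] by (simp add: borel_compact)
 have sub: "deep_set \<Omega> \<rho> \<subseteq> \<Omega>" unfolding deep_set_def by auto
 have limA': "(\<lambda>n. \<integral>x. indicator \<Omega> x * g x \<partial>An (r1 n)) \<longlonglongrightarrow> (\<integral>x. indicator \<Omega> x * g x \<partial>A)" if g: "continuous_on \<Omega> g" for g :: "'a => real"
 proof -
  have m: "(\<lambda>x. indicator \<Omega> x * g x) \<in> borel_measurable borel" "(\<lambda>x. indicator (deep_set \<Omega> \<rho>) x * g x) \<in> borel_measurable borel"
   using borel_measurable_continuous_on_indicator[OF \<Omega>_borel(1) g] borel_measurable_continuous_on_indicator[OF db continuous_on_subset[OF g sub]] by simp_all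
  have "(\<integral>x. indicator \<Omega> x * g x \<partial>Q) = (\<integral>x. indicator (deep_set \<Omega> \<rho>) x * g x \<partial>Q)" if "sets Q = sets borel" "AE x in Q. x \<in> deep_set \<Omega> \<rho>" for Q
   by (rule integral_cong_AE[OF measurable_borel_sets[OF that(1) m(1)] measurable_borel_sets[OF that(1) m(2)]])
    (use that(2) sub in \<open>auto elim!: eventually_mono\<close>)
  from this[OF An(2,3)] this[OF A(2,3)] show ?thesis using limA[OF continuous_on_subset[OF g sub]] by simp
 qed
 define Mn where "Mn n = density lborel (\<lambda>z. ennreal (f (r1 n) z / (1 + \<delta> (r1 n))))" for n
 have mass: "(LBINT z. f n z) = 1 + \<delta> n" for n by (rule smooth_coupling_mass[OF deep f])
 have \<delta>1: "0 < 1 + \<delta> n" for n using \<delta>(1)[of n] by simp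
 have Mn: "prob_space (Mn n)" "sets (Mn n) = sets borel" "AE z in Mn n. z \<in> ?X" for n
 proof -
  note fn = bcoupD[OF f[of "r1 n"]]
  show "sets (Mn n) = sets borel" unfolding Mn_def by simp
  show "AE z in Mn n. z \<in> ?X" unfolding Mn_def
  proof (subst AE_density)
   show "AE z in lborel. 0 < ennreal (f (r1 n) z / (1 + \<delta> (r1 n))) \<longrightarrow> z \<in> ?X"
    by (intro AE_I2 impI, rule ccontr) (use fn(3) in simp)
  qed (use fn(1) in simp)
  have "emeasure (Mn n) UNIV = (\<integral>\<^sup>+z. ennreal (f (r1 n) z / (1 + \<delta> (r1 n))) \<partial>lborel)"
   unfolding Mn_def using fn(1) by (simp add: emeasure_density)
  also have "\<dots> = ennreal (LBINT z. f (r1 n) z / (1 + \<delta> (r1 n)))"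
   by (intro nn_integral_eq_integral Bochner_Integration.integrable_divide fn(4) AE_I2 divide_nonneg_pos fn(2) \<delta>1)
  finally show "prob_space (Mn n)" using mass[of "r1 n"] \<delta>1[of "r1 n"] by (intro prob_spaceI) (simp add: Mn_def)
 qed
 obtain r2 N where r2: "strict_mono (r2 :: nat => nat)" and N: "prob_space N" "sets N = sets borel" "AE z in N. z \<in> ?X"
  and limN: "\<And>g :: 'a \<times> 'a => real. continuous_on ?X g ==> (\<lambda>n. \<integral>x. indicator ?X x * g x \<partial>Mn (r2 n)) \<longlonglongrightarrow> (\<integral>x. indicator ?X x * g x \<partial>N)"
  by (rule prob_measures_compact_subseq[where M=Mn, OF \<Omega>2 Mn]) (rule that; assumption)
 define r where "r = r1 \<circ> r2"
 have r: "strict_mono r" unfolding r_def by (rule strict_mono_o[OF r1 r2])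
 have lim: "(\<lambda>n. \<integral>z. indicator ?X z * g z \<partial>density lborel (\<lambda>z. ennreal (f (r n) z))) \<longlonglongrightarrow> (\<integral>z. indicator ?X z * g z \<partial>N)"
  and lim_lb: "(\<lambda>n. \<integral>z. g z * f (r n) z \<partial>lborel) \<longlonglongrightarrow> (\<integral>z. indicator ?X z * g z \<partial>N)" if g: "continuous_on ?X g" for g
 proof -
  have m: "(\<lambda>x. indicator ?X x * g x) \<in> borel_measurable borel"
   using borel_measurable_continuous_on_indicator[OF \<Omega>_borel(2) g] by simp
  have Mi: "(\<integral>z. indicator ?X z * g z \<partial>Mn (r2 n)) = (LBINT z. g z * f (r n) z) / (1 + \<delta> (r n))" for n
  proof -
   have "(\<integral>z. indicator ?X z * g z \<partial>Mn (r2 n)) = (LBINT z. indicator ?X z * g z * (f (r n) z / (1 + \<delta> (r n))))"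
    unfolding Mn_def r_def o_def using bcoupD[OF f] less_imp_le[OF \<delta>1] m by (intro integral_lborel_density) auto
   also have "\<dots> = (LBINT z. g z * f (r n) z / (1 + \<delta> (r n)))"
    using bcoupD(3)[OF f[of "r n"]] by (intro Bochner_Integration.integral_cong) (auto simp: indicator_def)
   finally show ?thesis by simp
  qed
  have Di: "(\<integral>z. indicator ?X z * g z \<partial>density lborel (\<lambda>z. ennreal (f (r n) z))) = (LBINT z. g z * f (r n) z)" for n
  proof -
   have "(\<integral>z. indicator ?X z * g z \<partial>density lborel (\<lambda>z. ennreal (f (r n) z))) = (LBINT z. indicator ?X z * g z * f (r n) z)"
    using bcoupD[OF f] m by (intro integral_lborel_density) auto
   also have "\<dots> = (LBINT z. g z * f (r n) z)"
    using bcoupD(3)[OF f[of "r n"]] by (intro Bochner_Integration.integral_cong) (auto simp: indicator_def)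
   finally show ?thesis .
  qed
  have "(\<lambda>n. (1 + \<delta> (r n)) * (\<integral>z. indicator ?X z * g z \<partial>Mn (r2 n))) \<longlonglongrightarrow> (1 + 0) * (\<integral>z. indicator ?X z * g z \<partial>N)"
   using LIMSEQ_subseq_LIMSEQ[OF \<delta>(3) r] by (intro tendsto_intros limN[OF g]) (simp add: o_def)
  moreover have "(1 + \<delta> (r n)) * (\<integral>z. indicator ?X z * g z \<partial>Mn (r2 n)) = (LBINT z. g z * f (r n) z)" for n
   unfolding Mi using \<delta>1[of "r n"] by simp
  ultimately show "(\<lambda>n. \<integral>z. g z * f (r n) z \<partial>lborel) \<longlonglongrightarrow> (\<integral>z. indicator ?X z * g z \<partial>N)" by simp
  then show "(\<lambda>n. \<integral>z. indicator ?X z * g z \<partial>density lborel (\<lambda>z. ennreal (f (r n) z))) \<longlonglongrightarrow> (\<integral>z. indicator ?X z * g z \<partial>N)" unfolding Di .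
 qed
 have limA2: "(\<lambda>n. \<integral>x. indicator \<Omega> x * g x \<partial>An (r n)) \<longlonglongrightarrow> (\<integral>x. indicator \<Omega> x * g x \<partial>A)" if g: "continuous_on \<Omega> g" for g :: "'a => real"
  using LIMSEQ_subseq_LIMSEQ[OF limA'[OF g] r2] by (simp add: o_def r_def)
 have dr: "(\<lambda>n. \<delta> (r n)) \<longlonglongrightarrow> 0" using LIMSEQ_subseq_LIMSEQ[OF \<delta>(3) r] by (simp add: o_def)
 have sA: "smoothed_sequence \<Omega> \<rho> (\<lambda>n. \<delta> (r n)) (\<lambda>n. An (r n)) A" by (rule smoothed_sequence.intro[OF deep(1) dr A(1,2) deep_in[OF A(3)] limA2])
 have sB: "smoothed_sequence \<Omega> \<rho> (\<lambda>n. \<delta> (r n)) (\<lambda>n. B) B" by (rule smoothed_sequence.intro[OF deep(2) dr B(1,2) deep_in[OF B(3)] tendsto_const])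
 have indN: "(\<integral>z. indicator ?X z * g z \<partial>N) = (\<integral>z. g z \<partial>N)" if "continuous_on UNIV g" for g :: "'a \<times> 'a => real"
 proof (rule integral_cong_AE)
  have gm: "g \<in> borel_measurable borel" using that by (rule borel_measurable_continuous_onI)
  show "(\<lambda>z. indicator ?X z * g z) \<in> borel_measurable N" "g \<in> borel_measurable N"
   by (intro measurable_borel_sets[OF N(2)] borel_measurable_times borel_measurable_indicator \<Omega>_borel gm)+
 qed (use N(3) in \<open>auto elim!: eventually_mono\<close>)
 have coup: "is_coupling N A B"
 proof (rule limit_is_coupling[OF sA sB f N])
  fix g :: "'a \<times> 'a => real" assume g: "continuous_on UNIV g"
  show "(\<lambda>n. \<integral>z. g z * f (r n) z \<partial>lborel) \<longlonglongrightarrow> (\<integral>z. g z \<partial>N)"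
   using lim_lb[OF continuous_on_subset[OF g]] indN[OF g] by simp
 qed
 have opt_N: "optimal_coupling c N A B" unfolding optimal_coupling_def
 proof (intro conjI allI impI coup)
  fix \<Phi> assume \<Phi>: "is_coupling \<Phi> A B"
  have \<gamma>r: "(\<lambda>n. \<gamma> (r n) / \<delta> (r n) ^ (DIM('a) + DIM('a))) \<longlonglongrightarrow> 0" using LIMSEQ_subseq_LIMSEQ[OF \<gamma>(2) r] by (simp add: o_def)
  have \<epsilon>r: "(\<lambda>n. \<epsilon> (r n)) \<longlonglongrightarrow> 0" using LIMSEQ_subseq_LIMSEQ[OF \<epsilon>(2) r] by (simp add: o_def)
  have cl: "(\<lambda>n. \<integral>z. c z * f (r n) z \<partial>lborel) \<longlonglongrightarrow> (\<integral>z. c z \<partial>N)"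
   using lim_lb[OF continuous_on_subset[OF c(1)]] indN[OF c(1)] by simp
  have inn: "AE z in lborel. z \<in> \<Omega> \<times> \<Omega> \<longrightarrow> \<rho> / 2 \<le> infdist (fst z) (frontier \<Omega>) \<longrightarrow> \<rho> / 2 \<le> infdist (snd z) (frontier \<Omega>) \<longrightarrow> \<bar>e (r n) z\<bar> \<le> \<epsilon> (r n)" for n
   using inner[of "r n"] by eventually_elim (auto simp: deep_set_def)
  show "(\<integral>z. c z \<partial>N) \<le> (\<integral>z. c z \<partial>\<Phi>)"
   by (rule limit_of_minimizers[OF sA sB c \<gamma>(1) \<gamma>r p f e \<epsilon>(1) \<epsilon>r inn opt cl \<Phi> coupling_props(3)[OF \<Phi> A(1) deep_in[OF A(3)]]])
 qed
 show ?thesis by (rule that[OF r A limA2 opt_N lim])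
qed

end

section \<open>Both bilevel problems in terms of Borel measures\<close>

text \<open>
 The null boundary is what allows functions that are only defined up to null sets in the
 interior to act as costs on the closed product.
\<close>

locale bilevel = fixed_target \<Omega> \<rho> "pos_part \<mu>2" c C
 for \<Omega> :: "'a::euclidean_space set" and \<rho> :: real and \<mu>2 :: "'a smeas" and c :: "'a \<times> 'a => real" and C :: real +
 fixes p :: real and cd :: "'a \<times> 'a => real"
 assumes \<mu>2: "\<mu>2 \<in> prob_measures \<Omega>" and p: "real (DIM('a) + DIM('a)) < p"
  and cd: "sobolev_W1 p (interior (\<Omega> \<times> \<Omega>)) cd" "\<And>z. z \<in> \<Omega> \<times> \<Omega> ==> cd z = c z"
  and boundary_null: "\<Omega> \<times> \<Omega> - interior (\<Omega> \<times> \<Omega>) \<in> null_sets lborel"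
begin

abbreviation "X \<equiv> \<Omega> \<times> \<Omega>"
abbreviation "U \<equiv> interior (\<Omega> \<times> \<Omega>)"
abbreviation "smd d \<mu> \<equiv> smooth_density \<Omega> d (pos_part \<mu>)"
abbreviation "dens f \<equiv> density lborel (\<lambda>z. ennreal (f z))"

lemma p_gt: "2 < p" "0 < p" "1 \<le> p"
proof -
 have "1 \<le> DIM('a)" by (simp add: Suc_leI)
 then have "2 \<le> real (DIM('a) + DIM('a))" by linarith
 then show "2 < p" "0 < p" "1 \<le> p" using p by linarith+
qed

lemma upperD:
 assumes "\<mu> \<in> upper_level_set \<Omega> \<rho>"
 shows "\<mu> \<in> prob_measures \<Omega>" "\<mu> \<in> signed_measures \<Omega>" "nonneg_smeas \<mu>" "prob_space (pos_part \<mu>)" "sets (pos_part \<mu>) = sets borel"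
  "AE x in pos_part \<mu>. x \<in> deep_set \<Omega> \<rho>" "smeas_of (pos_part \<mu>) = \<mu>"
proof -
 show m: "\<mu> \<in> prob_measures \<Omega>" and "AE x in pos_part \<mu>. x \<in> deep_set \<Omega> \<rho>" using assms upper_level_iff[OF \<Omega> \<rho>] by auto
 show s: "\<mu> \<in> signed_measures \<Omega>" "nonneg_smeas \<mu>" using m unfolding prob_measures_def by auto
 show "prob_space (pos_part \<mu>)" by (rule coupling_dictionary(4)[OF \<Omega>(1) \<Omega>(1) m \<mu>2])
 show "sets (pos_part \<mu>) = sets borel" "smeas_of (pos_part \<mu>) = \<mu>" using pos_part_eq[OF s \<Omega>_borel(1)] by auto
qed

lemma \<mu>2_upper: "\<mu>2 \<in> upper_level_set \<Omega> \<rho>" using upper_level_iff[OF \<Omega> \<rho>] \<mu>2 B(3) by auto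

lemma smoothing_eq:
 assumes \<mu>: "\<mu> \<in> upper_level_set \<Omega> \<rho>" and d: "0 < d" and x: "x \<in> \<Omega>"
 shows "smoothing \<Omega> d \<mu> x = smd d \<mu> x"
proof -
 note u = upperD[OF \<mu>]
 have mm: "(\<lambda>y. mollifier d (x - y)) \<in> borel_measurable borel"
  by (rule measurable_compose[OF _ mollifier_props(1)[OF d]]) simp
 have "(\<integral>y. indicator \<Omega> y * mollifier d (x - y) \<partial>pos_part \<mu>) = (\<integral>y. mollifier d (x - y) \<partial>pos_part \<mu>)"
 proof (rule integral_cong_AE)
  show "(\<lambda>y. indicator \<Omega> y * mollifier d (x - y)) \<in> borel_measurable (pos_part \<mu>)" "(\<lambda>y. mollifier d (x - y)) \<in> borel_measurable (pos_part \<mu>)"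
   by (intro measurable_borel_sets[OF u(5)] borel_measurable_times borel_measurable_indicator \<Omega>_borel mm)+
 qed (use deep_in[OF u(6)] in \<open>auto elim!: eventually_mono\<close>)
 then show ?thesis unfolding smoothing_def smooth_density_def using sm_integral_eq[OF u(2,3) \<Omega>_borel(1)] x by simp
qed

lemma deep: "\<mu> \<in> upper_level_set \<Omega> \<rho> ==> 0 < d ==> d \<le> \<rho> ==> deep_measure \<Omega> \<rho> d (pos_part \<mu>)"
 using upperD by (intro deep_measureI)

lemmas marg = smooth_density_marginal[OF deep]

lemma energy_borel:
 assumes b: "b \<in> borel_measurable borel" "AE z in lborel. z \<in> X \<longrightarrow> c' z = b z"
  and f: "bcoup \<Omega> m1 m2 f" "AE z in lborel. z \<in> X \<longrightarrow> \<pi> z = f z"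
 shows "(LINT z|lebesgue_on X. c' z * \<pi> z) = (LBINT z. b z * f z)" "(LINT z|lebesgue_on X. (\<pi> z)\<^sup>2) = (LBINT z. (f z)\<^sup>2)"
proof -
 note fD = bcoupD[OF f(1)]
 show "(LINT z|lebesgue_on X. c' z * \<pi> z) = (LBINT z. b z * f z)"
 proof (rule lebesgue_on_integral_AE[OF \<Omega>_borel(2)])
  show "AE z in lborel. z \<in> X \<longrightarrow> c' z * \<pi> z = b z * f z" using b(2) f(2) by eventually_elim auto
 qed (use b(1) fD(1,3) in auto)
 show "(LINT z|lebesgue_on X. (\<pi> z)\<^sup>2) = (LBINT z. (f z)\<^sup>2)"
 proof (rule lebesgue_on_integral_AE[OF \<Omega>_borel(2)])
  show "AE z in lborel. z \<in> X \<longrightarrow> (\<pi> z)\<^sup>2 = (f z)\<^sup>2" using f(2) by eventually_elim auto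
 qed (use fD(1,3) in auto)
qed

text \<open>
 The cost \<open>c'\<close> is written as \<open>c + e\<close> with a Borel representative
 \<open>e\<close> of its deviation from the target cost, which inherits the integral and the
 interior bounds.
\<close>

lemma regularized_solution_borel:
 assumes \<gamma>: "0 < \<gamma>" and d: "0 < d" "d \<le> \<rho>" and \<mu>: "\<mu> \<in> upper_level_set \<Omega> \<rho>" and c': "sobolev_W1 p U c'"
  and \<pi>: "reg_kantorovich_solution \<Omega> \<Omega> \<gamma> c' (smoothing \<Omega> d \<mu>) (smoothing \<Omega> d \<mu>2) \<pi>"
  and C0: "\<And>u. sobolev_W1 p U u ==> AE z in lebesgue. z \<in> deep_set \<Omega> (\<rho> / 2) \<times> deep_set \<Omega> (\<rho> / 2) \<longrightarrow> \<bar>u z\<bar> \<le> C0 * W1_norm p U u"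
 obtains f e where "bcoup \<Omega> (smd d \<mu>) (smd d \<mu>2) f" "density_smeas X \<pi> = smeas_of (dens f)"
  "e \<in> borel_measurable borel" "integrable lborel (\<lambda>z. \<bar>e z\<bar> powr p)" "(LBINT z. \<bar>e z\<bar> powr p) \<le> W1_norm p U (\<lambda>z. c' z - cd z) powr p"
  "AE z in lborel. z \<in> deep_set \<Omega> (\<rho> / 2) \<times> deep_set \<Omega> (\<rho> / 2) \<longrightarrow> \<bar>e z\<bar> \<le> C0 * W1_norm p U (\<lambda>z. c' z - cd z)"
  "\<And>g. bcoup \<Omega> (smd d \<mu>) (smd d \<mu>2) g ==>
   (LBINT z. c z * f z) + (LBINT z. e z * f z) + \<gamma> / 2 * (LBINT z. (f z)\<^sup>2)
   \<le> (LBINT z. c z * g z) + (LBINT z. e z * g z) + \<gamma> / 2 * (LBINT z. (g z)\<^sup>2)"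
proof -
 let ?w = "\<lambda>z. c' z - cd z"
 have w: "sobolev_W1 p U ?w" by (rule sobolev_W1_diff[OF open_interior p_gt(3) c' cd(1)])
 obtain e where e: "e \<in> borel_measurable borel" "\<And>z. z \<notin> U ==> e z = 0" "AE z in lborel. z \<in> U \<longrightarrow> ?w z = e z"
  "integrable lborel (\<lambda>z. \<bar>e z\<bar> powr p)" "(LBINT z. \<bar>e z\<bar> powr p) \<le> W1_norm p U ?w powr p"
  by (rule sobolev_borel_representative[OF open_interior p_gt(2) w]) (rule that; assumption)
 have cX: "AE z in lborel. z \<in> X \<longrightarrow> c' z = c z + e z"
  using e(3) AE_not_in[OF boundary_null]
 proof eventually_elim
  case (elim z)
  then show ?case using cd(2)[of z] by force
 qed
 have dU: "deep_set \<Omega> (\<rho> / 2) \<times> deep_set \<Omega> (\<rho> / 2) \<subseteq> U"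
  unfolding interior_Times using deep_set_interior[OF compact_imp_closed[OF \<Omega>(1)], of "\<rho> / 2"] \<rho> by auto
 have bound: "AE z in lborel. z \<in> deep_set \<Omega> (\<rho> / 2) \<times> deep_set \<Omega> (\<rho> / 2) \<longrightarrow> \<bar>e z\<bar> \<le> C0 * W1_norm p U ?w"
  using C0[OF w, unfolded AE_completion_iff] e(3) by eventually_elim (use dU in force)
 have sm: "\<And>x. x \<in> \<Omega> ==> smoothing \<Omega> d \<mu> x = smd d \<mu> x" "\<And>x. x \<in> \<Omega> ==> smoothing \<Omega> d \<mu>2 x = smd d \<mu>2 x"
  using smoothing_eq[OF \<mu> d(1)] smoothing_eq[OF \<mu>2_upper d(1)] by auto
 note mg = marg[OF \<mu> d] marg[OF \<mu>2_upper d]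
 have \<pi>L: "\<pi> \<in> L2_couplings \<Omega> \<Omega> (smoothing \<Omega> d \<mu>) (smoothing \<Omega> d \<mu>2)" using \<pi> unfolding reg_kantorovich_solution_def is_arg_min_def by simp
 obtain f where f: "bcoup \<Omega> (smd d \<mu>) (smd d \<mu>2) f" and "AE z in lebesgue_on X. \<pi> z = f z"
  by (rule L2_coupling_bcoup[OF \<Omega>(1) mg \<pi>L sm]) (assumption | rule that)+
 then have \<pi>f: "AE z in lborel. z \<in> X \<longrightarrow> \<pi> z = f z" unfolding AE_lborel_lebesgue_on[OF \<Omega>_borel(2)] by simp
 have bm: "(\<lambda>z. c z + e z) \<in> borel_measurable borel" using c_borel e(1) by measurable
 have split: "(LBINT z. (c z + e z) * g z) = (LBINT z. c z * g z) + (LBINT z. e z * g z)" if g: "bcoup \<Omega> (smd d \<mu>) (smd d \<mu>2) g" for g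
 proof -
  note gD = bcoupD[OF g]
  have "integrable lborel (\<lambda>z. c z * g z)" by (rule integrable_mult_bounded[OF gD(4) _ c(2)]) (use c_borel in simp)
  moreover have "integrable lborel (\<lambda>z. e z * g z)"
  proof (rule Bochner_Integration.integrable_bound)
   show "integrable lborel (\<lambda>z. \<bar>e z\<bar> powr p + (g z)\<^sup>2 + g z)" using e(4) gD(4,5) by simp
   have "\<bar>e z\<bar> * g z \<le> \<bar>e z\<bar> powr p + (g z)\<^sup>2 + g z" for z
    using error_young[of p 1 1 1 "\<bar>e z\<bar>" "g z"] p_gt(1) gD(2)[of z] by simp
   then show "AE z in lborel. norm (e z * g z) \<le> norm (\<bar>e z\<bar> powr p + (g z)\<^sup>2 + g z)"
    using gD(2) by (intro AE_I2) (simp add: abs_mult)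
  qed (use e(1) gD(1) in simp)
  ultimately show ?thesis by (simp add: distrib_right)
 qed
 have opt: "(LBINT z. c z * f z) + (LBINT z. e z * f z) + \<gamma> / 2 * (LBINT z. (f z)\<^sup>2)
   \<le> (LBINT z. c z * g z) + (LBINT z. e z * g z) + \<gamma> / 2 * (LBINT z. (g z)\<^sup>2)" if g: "bcoup \<Omega> (smd d \<mu>) (smd d \<mu>2) g" for g
 proof -
  have "g \<in> L2_couplings \<Omega> \<Omega> (smoothing \<Omega> d \<mu>) (smoothing \<Omega> d \<mu>2)" by (rule bcoup_L2_coupling[OF \<Omega>(1) mg g sm])
  then have "(LINT z|lebesgue_on X. c' z * \<pi> z) + \<gamma> / 2 * (LINT z|lebesgue_on X. (\<pi> z)\<^sup>2)
    \<le> (LINT z|lebesgue_on X. c' z * g z) + \<gamma> / 2 * (LINT z|lebesgue_on X. (g z)\<^sup>2)"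
   using \<pi> unfolding reg_kantorovich_solution_def is_arg_min_def by force
  then show ?thesis unfolding energy_borel[OF bm cX f \<pi>f] energy_borel[OF bm cX g, of g, simplified] split[OF f] split[OF g] .
 qed
 have "density_smeas X \<pi> = smeas_of (dens f)" by (rule density_smeas_eq[OF \<Omega>_borel(2) bcoupD(1-4)[OF f] \<pi>f])
 then show ?thesis using that[of f e] f e bound opt by blast
qed

text \<open>
 For the target cost itself the penalty vanishes; this triple is the competitor in the bilevel
 problem.
\<close>

lemma regularized_target_solution:
 assumes \<gamma>: "0 < \<gamma>" and d: "0 < d" "d \<le> \<rho>" and \<mu>: "\<mu> \<in> upper_level_set \<Omega> \<rho>"
  and \<Phi>: "is_coupling \<Phi> (pos_part \<mu>) (pos_part \<mu>2)"
 obtains f where "bcoup \<Omega> (smd d \<mu>) (smd d \<mu>2) f" "density_smeas X f = smeas_of (dens f)"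
  "BK_reg_feasible \<Omega> \<Omega> \<rho> p \<mu>2 \<gamma> d (f, \<mu>, cd)"
  "\<And>g. bcoup \<Omega> (smd d \<mu>) (smd d \<mu>2) g ==>
   (LBINT z. c z * f z) + \<gamma> / 2 * (LBINT z. (f z)\<^sup>2) \<le> (LBINT z. c z * g z) + \<gamma> / 2 * (LBINT z. (g z)\<^sup>2)"
proof -
 have sm: "\<And>x. x \<in> \<Omega> ==> smoothing \<Omega> d \<mu> x = smd d \<mu> x" "\<And>x. x \<in> \<Omega> ==> smoothing \<Omega> d \<mu>2 x = smd d \<mu>2 x"
  using smoothing_eq[OF \<mu> d(1)] smoothing_eq[OF \<mu>2_upper d(1)] by auto
 note mg = marg[OF \<mu> d] marg[OF \<mu>2_upper d]
 obtain f0 where f0: "bcoup \<Omega> (smd d \<mu>) (smd d \<mu>2) f0"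
  by (rule bcoup_exists[OF deep[OF \<mu> d] deep[OF \<mu>2_upper d] \<Phi> coupling_props(3)[OF \<Phi> upperD(4)[OF \<mu>] deep_in[OF upperD(6)[OF \<mu>]]]])
 obtain f where f: "bcoup \<Omega> (smd d \<mu>) (smd d \<mu>2) f"
  and opt: "\<And>g. bcoup \<Omega> (smd d \<mu>) (smd d \<mu>2) g ==>
   (LBINT z. c z * f z) + \<gamma> / 2 * (LBINT z. (f z)\<^sup>2) \<le> (LBINT z. c z * g z) + \<gamma> / 2 * (LBINT z. (g z)\<^sup>2)"
  by (rule regularized_minimizer_exists[OF \<Omega>(1) mg \<gamma> c_borel c(2) f0]) (rule that; assumption)
 have cX: "AE z in lborel. z \<in> X \<longrightarrow> cd z = c z" using cd(2) by auto
 have "reg_kantorovich_solution \<Omega> \<Omega> \<gamma> cd (smoothing \<Omega> d \<mu>) (smoothing \<Omega> d \<mu>2) f"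
  unfolding reg_kantorovich_solution_def is_arg_min_linorder
 proof (intro conjI allI impI)
  show "f \<in> L2_couplings \<Omega> \<Omega> (smoothing \<Omega> d \<mu>) (smoothing \<Omega> d \<mu>2)" by (rule bcoup_L2_coupling[OF \<Omega>(1) mg f sm])
  fix \<pi> assume \<pi>L: "\<pi> \<in> L2_couplings \<Omega> \<Omega> (smoothing \<Omega> d \<mu>) (smoothing \<Omega> d \<mu>2)"
  obtain g where g: "bcoup \<Omega> (smd d \<mu>) (smd d \<mu>2) g" and "AE z in lebesgue_on X. \<pi> z = g z"
   by (rule L2_coupling_bcoup[OF \<Omega>(1) mg \<pi>L sm]) (assumption | rule that)+
  then have \<pi>g: "AE z in lborel. z \<in> X \<longrightarrow> \<pi> z = g z" unfolding AE_lborel_lebesgue_on[OF \<Omega>_borel(2)] by simp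
  show "(LINT z|lebesgue_on X. cd z * f z) + \<gamma> / 2 * (LINT z|lebesgue_on X. (f z)\<^sup>2)
    \<le> (LINT z|lebesgue_on X. cd z * \<pi> z) + \<gamma> / 2 * (LINT z|lebesgue_on X. (\<pi> z)\<^sup>2)"
   unfolding energy_borel[OF c_borel cX g \<pi>g] energy_borel[OF c_borel cX f, of f, simplified] by (rule opt[OF g])
 qed
 then have "BK_reg_feasible \<Omega> \<Omega> \<rho> p \<mu>2 \<gamma> d (f, \<mu>, cd)" unfolding BK_reg_feasible_def using cd(1) \<mu> by simp
 moreover have "density_smeas X f = smeas_of (dens f)" by (rule density_smeas_eq[OF \<Omega>_borel(2) bcoupD(1-4)[OF f]]) (assumption, rule AE_I2, simp)
 ultimately show ?thesis using that[of f] f opt by blast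
qed

lemma dens_smeas:
 assumes \<mu>: "\<mu> \<in> upper_level_set \<Omega> \<rho>" and d: "0 < d" "d \<le> \<rho>" and f: "bcoup \<Omega> (smd d \<mu>) (smd d \<mu>2) f"
 shows "smeas_of (dens f) \<in> signed_measures X" "variation (smeas_of (dens f)) X + variation \<mu> \<Omega> \<le> ennreal (\<rho> + 2)"
proof -
 note D = density_props[OF f] and u = upperD[OF \<mu>]
 show "smeas_of (dens f) \<in> signed_measures X" by (rule smeas_of(1)[OF D(1,2) \<Omega>_borel(2) D(3)])
 have "emeasure (dens f) X \<le> emeasure (dens f) UNIV" by (intro emeasure_mono) auto
 also have "\<dots> = (\<integral>\<^sup>+z. ennreal (f z) \<partial>lborel)" using bcoupD(1)[OF f] by (simp add: emeasure_density)
 also have "\<dots> = ennreal (1 + d)"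
  using nn_integral_eq_integral[OF bcoupD(4)[OF f]] bcoupD(2)[OF f] smooth_coupling_mass[OF deep[OF \<mu> d] deep[OF \<mu>2_upper d] f] by simp
 finally have 1: "variation (smeas_of (dens f)) X \<le> ennreal (1 + d)" using smeas_of(4)[OF D(1,2) \<Omega>_borel(2) D(3) \<Omega>_borel(2)] by simp
 interpret P: prob_space "pos_part \<mu>" by (rule u)
 have "variation \<mu> \<Omega> = emeasure (pos_part \<mu>) \<Omega>"
  using smeas_of(4)[OF P.finite_measure_axioms u(5) \<Omega>_borel(1) deep_in[OF u(6)] \<Omega>_borel(1)] unfolding u(7) .
 then have 2: "variation \<mu> \<Omega> \<le> ennreal 1" using P.emeasure_le_1 by simp
 have "variation (smeas_of (dens f)) X + variation \<mu> \<Omega> \<le> ennreal (1 + d) + ennreal 1" by (rule add_mono[OF 1 2])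
 also have "\<dots> = ennreal (d + 2)" using d by (subst ennreal_plus[symmetric]) (auto simp: add.commute)
 also have "\<dots> \<le> ennreal (\<rho> + 2)" using d by (intro ennreal_leI) simp
 finally show "variation (smeas_of (dens f)) X + variation \<mu> \<Omega> \<le> ennreal (\<rho> + 2)" .
qed

end

section \<open>Convergence of optimal solutions\<close>

context bilevel
begin

lemma kantorovich_iff:
 assumes "\<mu> \<in> upper_level_set \<Omega> \<rho>"
 shows "kantorovich_solution \<Omega> \<Omega> cd \<mu> \<mu>2 \<pi> \<longleftrightarrow> (\<exists>M. \<pi> = smeas_of M \<and> optimal_coupling c M (pos_part \<mu>) (pos_part \<mu>2))"
 by (rule kantorovich_dictionary[OF \<Omega>(1) \<Omega>(1) upperD(1)[OF assms] \<mu>2 c_borel]) (simp add: cd(2))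

text \<open>
 Uniqueness of optimal couplings is used only to identify the limit of the competitors, and
 enters as a hypothesis.
\<close>

theorem solutions_converge:
 fixes \<gamma> \<delta> :: "nat => real"
 assumes J: "weak_star_lsc X \<Omega> J" "weak_star_usc_fst X \<Omega> J" "bounded_on_bounded X \<Omega> J"
  and feas: "BK_feasible \<Omega> \<Omega> \<rho> cd \<mu>2 (\<pi>0, \<mu>0)"
  and unique: "\<And>\<mu> M N. \<mu> \<in> upper_level_set \<Omega> \<rho> ==> optimal_coupling c M (pos_part \<mu>) (pos_part \<mu>2) ==>
    optimal_coupling c N (pos_part \<mu>) (pos_part \<mu>2) ==> M = N"
  and \<gamma>: "\<And>n. 0 < \<gamma> n" "\<gamma> \<longlonglongrightarrow> 0" "(\<lambda>n. \<gamma> n / \<delta> n ^ (DIM('a) + DIM('a))) \<longlonglongrightarrow> 0"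
  and \<delta>: "\<And>n. 0 < \<delta> n" "\<And>n. \<delta> n \<le> \<rho>" "\<delta> \<longlonglongrightarrow> 0"
  and sol: "\<And>n. BK_reg_solution J \<Omega> \<Omega> \<rho> p cd \<mu>2 (\<gamma> n) (\<delta> n) (\<pi>n n, \<mu>n n, cn n)"
 shows "\<exists>(r :: nat => nat) \<pi> \<mu>1. strict_mono r \<and> BK_solution J \<Omega> \<Omega> \<rho> cd \<mu>2 (\<pi>, \<mu>1) \<and>
      weak_star_tendsto X (\<lambda>n. density_smeas X (\<pi>n (r n))) \<pi> \<and> weak_star_tendsto \<Omega> (\<lambda>n. \<mu>n (r n)) \<mu>1 \<and>
      (\<lambda>n. W1_norm p U (\<lambda>z. cn (r n) z - cd z)) \<longlonglongrightarrow> 0"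
proof -
 define W where "W n = W1_norm p U (\<lambda>z. cn n z - cd z)" for n
 have W0: "0 \<le> W n" for n unfolding W_def by (rule W1_norm_nonneg)
 have fe: "BK_reg_feasible \<Omega> \<Omega> \<rho> p \<mu>2 (\<gamma> n) (\<delta> n) (\<pi>n n, \<mu>n n, cn n)"
  and opt: "BK_reg_feasible \<Omega> \<Omega> \<rho> p \<mu>2 (\<gamma> n) (\<delta> n) (\<pi>, \<mu>, c') ==>
   J (density_smeas X (\<pi>n n)) (\<mu>n n) + 1 / (p * \<gamma> n) * W n powr p \<le> J (density_smeas X \<pi>) \<mu> + 1 / (p * \<gamma> n) * W1_norm p U (\<lambda>z. c' z - cd z) powr p" for n \<pi> \<mu> c'
  using sol[of n] unfolding BK_reg_solution_def is_arg_min_linorder W_def by force+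
 have \<mu>n: "\<mu>n n \<in> upper_level_set \<Omega> \<rho>" and cn: "sobolev_W1 p U (cn n)"
  and reg: "reg_kantorovich_solution \<Omega> \<Omega> (\<gamma> n) (cn n) (smoothing \<Omega> (\<delta> n) (\<mu>n n)) (smoothing \<Omega> (\<delta> n) \<mu>2) (\<pi>n n)" for n
  using fe[of n] unfolding BK_reg_feasible_def by auto
 have K: "compact (deep_set \<Omega> (\<rho> / 2) \<times> deep_set \<Omega> (\<rho> / 2))" "deep_set \<Omega> (\<rho> / 2) \<times> deep_set \<Omega> (\<rho> / 2) \<subseteq> U"
  unfolding interior_Times using deep_set_compact[OF \<Omega>(1)] deep_set_interior[OF compact_imp_closed[OF \<Omega>(1)], of "\<rho> / 2"] \<rho> by (auto intro: compact_Times)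
 have pD: "real DIM('a \<times> 'a) < p" using p by simp
 obtain C0 where C0: "0 \<le> C0" "\<And>u. sobolev_W1 p U u ==> AE z in lebesgue. z \<in> deep_set \<Omega> (\<rho> / 2) \<times> deep_set \<Omega> (\<rho> / 2) \<longrightarrow> \<bar>u z\<bar> \<le> C0 * W1_norm p U u"
  by (rule interior_sobolev_bound[OF pD open_interior K]) (rule that; assumption)
 have "\<exists>f e. bcoup \<Omega> (smd (\<delta> n) (\<mu>n n)) (smd (\<delta> n) \<mu>2) f \<and> density_smeas X (\<pi>n n) = smeas_of (dens f) \<and>
  e \<in> borel_measurable borel \<and> integrable lborel (\<lambda>z. \<bar>e z\<bar> powr p) \<and> (LBINT z. \<bar>e z\<bar> powr p) \<le> W n powr p \<and>
  (AE z in lborel. z \<in> deep_set \<Omega> (\<rho> / 2) \<times> deep_set \<Omega> (\<rho> / 2) \<longrightarrow> \<bar>e z\<bar> \<le> C0 * W n) \<and>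
  (\<forall>g. bcoup \<Omega> (smd (\<delta> n) (\<mu>n n)) (smd (\<delta> n) \<mu>2) g \<longrightarrow>
   (LBINT z. c z * f z) + (LBINT z. e z * f z) + \<gamma> n / 2 * (LBINT z. (f z)\<^sup>2)
   \<le> (LBINT z. c z * g z) + (LBINT z. e z * g z) + \<gamma> n / 2 * (LBINT z. (g z)\<^sup>2))" (is "\<exists>f e. ?P n f e") for n
  unfolding W_def by (rule regularized_solution_borel[OF \<gamma>(1) \<delta>(1,2) \<mu>n cn reg C0(2)], assumption) blast
 note ex = this
 obtain f where f1: "\<forall>n. \<exists>e. ?P n (f n) e" using choice[OF allI[OF ex]] by (rule exE) (rule that)
 obtain e where fe': "\<forall>n. ?P n (f n) (e n)" using choice[OF f1] by (rule exE) (rule that)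
 have f: "bcoup \<Omega> (smd (\<delta> n) (\<mu>n n)) (smd (\<delta> n) \<mu>2) (f n)" "density_smeas X (\<pi>n n) = smeas_of (dens (f n))"
  and e: "e n \<in> borel_measurable borel" "integrable lborel (\<lambda>z. \<bar>e n z\<bar> powr p)" "(LBINT z. \<bar>e n z\<bar> powr p) \<le> W n powr p"
   "AE z in lborel. z \<in> deep_set \<Omega> (\<rho> / 2) \<times> deep_set \<Omega> (\<rho> / 2) \<longrightarrow> \<bar>e n z\<bar> \<le> C0 * W n"
  and fopt: "\<And>g. bcoup \<Omega> (smd (\<delta> n) (\<mu>n n)) (smd (\<delta> n) \<mu>2) g ==>
   (LBINT z. c z * f n z) + (LBINT z. e n z * f n z) + \<gamma> n / 2 * (LBINT z. (f n z)\<^sup>2)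
   \<le> (LBINT z. c z * g z) + (LBINT z. e n z * g z) + \<gamma> n / 2 * (LBINT z. (g z)\<^sup>2)" for n
  using spec[OF fe', of n] by blast+
 \<comment> \<open>the regularized plans of a fixed feasible point that compete with the given solutions\<close>
 define good where "good n \<mu>' k \<longleftrightarrow> bcoup \<Omega> (smd (\<delta> n) \<mu>') (smd (\<delta> n) \<mu>2) k \<and>
   J (smeas_of (dens (f n))) (\<mu>n n) + 1 / (p * \<gamma> n) * W n powr p \<le> J (smeas_of (dens k)) \<mu>' \<and>
   (\<forall>g. bcoup \<Omega> (smd (\<delta> n) \<mu>') (smd (\<delta> n) \<mu>2) g \<longrightarrow>
    (LBINT z. c z * k z) + \<gamma> n / 2 * (LBINT z. (k z)\<^sup>2) \<le> (LBINT z. c z * g z) + \<gamma> n / 2 * (LBINT z. (g z)\<^sup>2))" for n \<mu>' k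
 have comp: "\<exists>k. \<forall>n. good n \<mu>' (k n)"
  if fs: "BK_feasible \<Omega> \<Omega> \<rho> cd \<mu>2 (\<pi>', \<mu>')" for \<pi>' \<mu>'
 proof (intro choice allI)
  fix n
  have \<mu>': "\<mu>' \<in> upper_level_set \<Omega> \<rho>" and "kantorovich_solution \<Omega> \<Omega> cd \<mu>' \<mu>2 \<pi>'" using fs unfolding BK_feasible_def by auto
  then obtain M where M: "is_coupling M (pos_part \<mu>') (pos_part \<mu>2)" unfolding kantorovich_iff[OF \<mu>'] optimal_coupling_def by blast
  obtain k where k: "bcoup \<Omega> (smd (\<delta> n) \<mu>') (smd (\<delta> n) \<mu>2) k" "density_smeas X k = smeas_of (dens k)"
   "BK_reg_feasible \<Omega> \<Omega> \<rho> p \<mu>2 (\<gamma> n) (\<delta> n) (k, \<mu>', cd)"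
   "\<And>g. bcoup \<Omega> (smd (\<delta> n) \<mu>') (smd (\<delta> n) \<mu>2) g ==>
    (LBINT z. c z * k z) + \<gamma> n / 2 * (LBINT z. (k z)\<^sup>2) \<le> (LBINT z. c z * g z) + \<gamma> n / 2 * (LBINT z. (g z)\<^sup>2)"
   by (rule regularized_target_solution[OF \<gamma>(1) \<delta>(1,2) \<mu>' M]) (rule that; assumption)
  have "J (smeas_of (dens (f n))) (\<mu>n n) + 1 / (p * \<gamma> n) * W n powr p \<le> J (smeas_of (dens k)) \<mu>'"
   using opt[OF k(3)] unfolding f(2) k(2) by (simp add: W1_norm_zero[OF open_interior p_gt(2)])
  then show "\<exists>k. good n \<mu>' k" unfolding good_def using k(1,4) by blast
 qed
 have \<rho>2: "0 < \<rho> + 2" using \<rho> by simp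
 obtain Bd where Bd: "\<And>\<pi> \<mu>. \<pi> \<in> signed_measures X ==> \<mu> \<in> signed_measures \<Omega> ==> variation \<pi> X + variation \<mu> \<Omega> \<le> ennreal (\<rho> + 2) ==> \<bar>J \<pi> \<mu>\<bar> \<le> Bd"
  using J(3)[unfolded bounded_on_bounded_def, rule_format, OF \<rho>2] by (elim exE) (rule that; blast)
 have Jb: "\<bar>J (smeas_of (dens g)) \<mu>\<bar> \<le> Bd" if "\<mu> \<in> upper_level_set \<Omega> \<rho>" "bcoup \<Omega> (smd (\<delta> n) \<mu>) (smd (\<delta> n) \<mu>2) g" for g \<mu> n
  by (rule Bd[OF dens_smeas(1)[OF that(1) \<delta>(1,2) that(2)] upperD(2)[OF that(1)] dens_smeas(2)[OF that(1) \<delta>(1,2) that(2)]])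
 have \<mu>0: "\<mu>0 \<in> upper_level_set \<Omega> \<rho>" using feas unfolding BK_feasible_def by simp
 have Wp: "W n powr p \<le> (2 * Bd * p) * \<gamma> n" for n
 proof -
  obtain k where k: "bcoup \<Omega> (smd (\<delta> n) \<mu>0) (smd (\<delta> n) \<mu>2) k" "J (smeas_of (dens (f n))) (\<mu>n n) + 1 / (p * \<gamma> n) * W n powr p \<le> J (smeas_of (dens k)) \<mu>0"
   using comp[OF feas] unfolding good_def by blast
  have "1 / (p * \<gamma> n) * W n powr p \<le> 2 * Bd" using k(2) Jb[OF \<mu>0 k(1)] Jb[OF \<mu>n[of n] f(1)[of n]] by linarith
  then show ?thesis using p_gt \<gamma>(1)[of n] by (simp add: field_simps)
 qed
 have Wlim: "W \<longlonglongrightarrow> 0"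
 proof -
  have "(\<lambda>n. W n powr p) \<longlonglongrightarrow> 0"
   by (rule tendsto_sandwich[OF _ _ tendsto_const tendsto_mult_right_zero[OF \<gamma>(2), where c="2 * Bd * p"]]) (use Wp in auto)
  then have "(\<lambda>n. (W n powr p) powr (1 / p)) \<longlonglongrightarrow> 0 powr (1 / p)" using p_gt by (intro tendsto_powr2 tendsto_intros) auto
  then show ?thesis using W0 p_gt by (simp add: powr_powr)
 qed
 have \<epsilon>: "0 \<le> C0 * W n" "(\<lambda>n. C0 * W n) \<longlonglongrightarrow> 0" for n
  using C0(1) W0 tendsto_mult_right_zero[OF Wlim] by auto
 obtain r A N where r: "strict_mono (r :: nat => nat)" and A: "prob_space A" "sets A = sets borel" "AE x in A. x \<in> deep_set \<Omega> \<rho>"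
  and limA: "\<And>g :: 'a => real. continuous_on \<Omega> g ==> (\<lambda>n. \<integral>x. indicator \<Omega> x * g x \<partial>pos_part (\<mu>n (r n))) \<longlonglongrightarrow> (\<integral>x. indicator \<Omega> x * g x \<partial>A)"
  and N: "optimal_coupling c N A (pos_part \<mu>2)"
  and limN: "\<And>g :: 'a \<times> 'a => real. continuous_on X g ==>
    (\<lambda>n. \<integral>z. indicator X z * g z \<partial>dens (f (r n))) \<longlonglongrightarrow> (\<integral>z. indicator X z * g z \<partial>N)"
  by (rule minimizers_subsequence[where An="\<lambda>n. pos_part (\<mu>n n)" and e=e and f=f and \<epsilon>="\<lambda>n. C0 * W n",
     OF upperD(4,5,6)[OF \<mu>n] \<delta> \<gamma>(1,3) p_gt(1) f(1) e(1,2) order_trans[OF e(3) Wp] \<epsilon> e(4) fopt]) (assumption | rule that; assumption)+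
 have finA: "finite_measure A" using A(1) by (rule prob_space.finite_measure)
 have A\<Omega>: "AE x in A. x \<in> \<Omega>" by (rule deep_in[OF A(3)])
 define \<mu> where "\<mu> = smeas_of A"
 note sA = smeas_of[OF finA A(2) \<Omega>_borel(1) A\<Omega>, folded \<mu>_def]
 have "\<mu> \<Omega> = 1"
  using prob_space.prob_eq_1[OF A(1), of \<Omega>] A(2) A\<Omega> \<Omega>_borel(1) unfolding \<mu>_def smeas_of_def by simp
 then have \<mu>: "\<mu> \<in> upper_level_set \<Omega> \<rho>" unfolding upper_level_iff[OF \<Omega> \<rho>] prob_measures_def sA(3) using sA(1,2) A(3) by simp
 have kN: "BK_feasible \<Omega> \<Omega> \<rho> cd \<mu>2 (smeas_of N, \<mu>)" unfolding BK_feasible_def using \<mu> N kantorovich_iff[OF \<mu>] sA(3) by auto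
 have coupN: "is_coupling N A (pos_part \<mu>2)" using N unfolding optimal_coupling_def by simp
 note pN = coupling_props[OF coupN A(1) A\<Omega>]
 have finN: "finite_measure N" using pN(1) by (rule prob_space.finite_measure)
 have w1: "weak_star_tendsto X (\<lambda>n. smeas_of (dens (f (r n)))) (smeas_of N)"
  by (rule weak_star_smeas_of[OF \<Omega>_borel(2) density_props[OF f(1)] finN pN(2,3) limN])
 have w2: "weak_star_tendsto \<Omega> (\<lambda>n. \<mu>n (r n)) \<mu>"
  using weak_star_smeas_of[OF \<Omega>_borel(1) prob_space.finite_measure[OF upperD(4)[OF \<mu>n]] upperD(5)[OF \<mu>n] deep_in[OF upperD(6)[OF \<mu>n]] finA A(2) A\<Omega> limA]
  unfolding upperD(7)[OF \<mu>n] \<mu>_def .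
 have best: "J (smeas_of N) \<mu> \<le> J \<pi>' \<mu>'" if fs: "BK_feasible \<Omega> \<Omega> \<rho> cd \<mu>2 (\<pi>', \<mu>')" for \<pi>' \<mu>'
 proof -
  have \<mu>': "\<mu>' \<in> upper_level_set \<Omega> \<rho>" and "kantorovich_solution \<Omega> \<Omega> cd \<mu>' \<mu>2 \<pi>'" using fs unfolding BK_feasible_def by auto
  then obtain M where M: "\<pi>' = smeas_of M" "optimal_coupling c M (pos_part \<mu>') (pos_part \<mu>2)" unfolding kantorovich_iff[OF \<mu>'] by blast
  note u' = upperD[OF \<mu>']
  obtain k where kg: "\<forall>n. good n \<mu>' (k n)" using comp[OF fs] by (rule exE) (rule that)
  have k: "bcoup \<Omega> (smd (\<delta> n) \<mu>') (smd (\<delta> n) \<mu>2) (k n)"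
   and kJ: "J (smeas_of (dens (f n))) (\<mu>n n) + 1 / (p * \<gamma> n) * W n powr p \<le> J (smeas_of (dens (k n))) \<mu>'"
   and kopt: "bcoup \<Omega> (smd (\<delta> n) \<mu>') (smd (\<delta> n) \<mu>2) g ==>
    (LBINT z. c z * k n z) + \<gamma> n / 2 * (LBINT z. (k n z)\<^sup>2) \<le> (LBINT z. c z * g z) + \<gamma> n / 2 * (LBINT z. (g z)\<^sup>2)" for n g
   using spec[OF kg, of n] unfolding good_def by blast+
  have \<gamma>r: "(\<lambda>n. \<gamma> (r n) / \<delta> (r n) ^ (DIM('a) + DIM('a))) \<longlonglongrightarrow> 0" and \<delta>r: "(\<lambda>n. \<delta> (r n)) \<longlonglongrightarrow> 0"
   using LIMSEQ_subseq_LIMSEQ[OF \<gamma>(3) r] LIMSEQ_subseq_LIMSEQ[OF \<delta>(3) r] by (simp_all add: o_def)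
  obtain r' A' N' where r': "strict_mono (r' :: nat => nat)" and A': "prob_space A'" "sets A' = sets borel" "AE x in A'. x \<in> deep_set \<Omega> \<rho>"
   and limA': "\<And>g :: 'a => real. continuous_on \<Omega> g ==> (\<lambda>n::nat. \<integral>x. indicator \<Omega> x * g x \<partial>pos_part \<mu>') \<longlonglongrightarrow> (\<integral>x. indicator \<Omega> x * g x \<partial>A')"
   and N': "optimal_coupling c N' A' (pos_part \<mu>2)"
   and limN': "\<And>g :: 'a \<times> 'a => real. continuous_on X g ==>
     (\<lambda>n. \<integral>z. indicator X z * g z \<partial>dens (k (r (r' n)))) \<longlonglongrightarrow> (\<integral>z. indicator X z * g z \<partial>N')"
  proof (rule minimizers_subsequence[where An="\<lambda>n. pos_part \<mu>'" and e="\<lambda>n z. 0" and f="\<lambda>n. k (r n)" and \<epsilon>="\<lambda>n. 0" and M=0,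
     OF u'(4,5,6) \<delta>(1,2) \<delta>r \<gamma>(1) \<gamma>r p_gt(1) k])
   fix n g assume g: "bcoup \<Omega> (smd (\<delta> (r n)) \<mu>') (smd (\<delta> (r n)) \<mu>2) g"
   show "(LBINT z. c z * k (r n) z) + (LBINT z. 0 * k (r n) z) + \<gamma> (r n) / 2 * (LBINT z. (k (r n) z)\<^sup>2)
    \<le> (LBINT z. c z * g z) + (LBINT z. 0 * g z) + \<gamma> (r n) / 2 * (LBINT z. (g z)\<^sup>2)" using kopt[OF g] by simp
  qed (rule that; assumption | simp add: p_gt)+
  have "A' = pos_part \<mu>'"
  proof (rule measure_eq_continuous)
   fix g :: "'a => real" and b assume g: "continuous_on UNIV g" "\<And>x. \<bar>g x\<bar> \<le> b"
   have gm: "g \<in> borel_measurable borel" using g(1) by (rule borel_measurable_continuous_onI)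
   have i: "(\<integral>x. indicator \<Omega> x * g x \<partial>Q) = (\<integral>x. g x \<partial>Q)" if "sets Q = sets borel" "AE x in Q. x \<in> deep_set \<Omega> \<rho>" for Q
   proof (rule integral_cong_AE)
    show "(\<lambda>x. indicator \<Omega> x * g x) \<in> borel_measurable Q" "g \<in> borel_measurable Q"
     by (intro measurable_borel_sets[OF that(1)] borel_measurable_times borel_measurable_indicator \<Omega>_borel gm)+
   qed (use deep_in[OF that(2)] in \<open>auto elim!: eventually_mono\<close>)
   show "(\<integral>x. g x \<partial>A') = (\<integral>x. g x \<partial>pos_part \<mu>')"
    using LIMSEQ_unique[OF limA'[OF continuous_on_subset[OF g(1) subset_UNIV]] tendsto_const] unfolding i[OF A'(2,3)] i[OF u'(5,6)] .
  qed (use A' u' in \<open>auto intro: prob_space.finite_measure\<close>)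
  then have "N' = M" using unique[OF \<mu>' _ M(2)] N' by simp
  have coupM: "is_coupling M (pos_part \<mu>') (pos_part \<mu>2)" using M(2) unfolding optimal_coupling_def by simp
  note pM = coupling_props[OF coupM u'(4) deep_in[OF u'(6)]]
  have finM: "finite_measure M" using pM(1) by (rule prob_space.finite_measure)
  have w3: "weak_star_tendsto X (\<lambda>n. smeas_of (dens (k (r (r' n))))) \<pi>'"
   unfolding M(1) by (rule weak_star_smeas_of[OF \<Omega>_borel(2) density_props[OF k] finM pM(2,3) limN'[unfolded \<open>N' = M\<close>]])
  have usc: "limsup (\<lambda>n. ereal (J (smeas_of (dens (k (r (r' n))))) \<mu>')) \<le> ereal (J \<pi>' \<mu>')"
  proof (rule J(2)[unfolded weak_star_usc_fst_def, rule_format, OF _ _ u'(2) w3])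
   show "range (\<lambda>n. smeas_of (dens (k (r (r' n))))) \<subseteq> signed_measures X" using dens_smeas(1)[OF \<mu>' \<delta>(1,2) k] by auto
   show "\<pi>' \<in> signed_measures X" unfolding M(1) by (rule smeas_of(1)[OF finM pM(2) \<Omega>_borel(2) pM(3)])
  qed
  have sub: "weak_star_tendsto Y (\<lambda>n. \<nu> (r (r' n))) l" if "weak_star_tendsto Y (\<lambda>n. \<nu> (r n)) l" for Y :: "'t::topological_space set" and \<nu> l
   using that LIMSEQ_subseq_LIMSEQ[OF _ r'] unfolding weak_star_tendsto_def by (fastforce simp: o_def)
  have "ereal (J (smeas_of N) \<mu>) \<le> liminf (\<lambda>n. ereal (J (smeas_of (dens (f (r (r' n))))) (\<mu>n (r (r' n)))))"
  proof (rule J(1)[unfolded weak_star_lsc_def, rule_format])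
   show "weak_star_tendsto X (\<lambda>n. smeas_of (dens (f (r (r' n))))) (smeas_of N)" by (rule sub[OF w1])
   show "weak_star_tendsto \<Omega> (\<lambda>n. \<mu>n (r (r' n))) \<mu>" by (rule sub[OF w2])
   show "range (\<lambda>n. smeas_of (dens (f (r (r' n))))) \<subseteq> signed_measures X" using dens_smeas(1)[OF \<mu>n \<delta>(1,2) f(1)] by auto
   show "range (\<lambda>n. \<mu>n (r (r' n))) \<subseteq> signed_measures \<Omega>" using upperD(2)[OF \<mu>n] by auto
   show "smeas_of N \<in> signed_measures X" by (rule smeas_of(1)[OF finN pN(2) \<Omega>_borel(2) pN(3)])
   show "\<mu> \<in> signed_measures \<Omega>" by (rule sA(1))
  qed
  also have "\<dots> \<le> liminf (\<lambda>n. ereal (J (smeas_of (dens (k (r (r' n))))) \<mu>'))"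
  proof (rule Liminf_mono, intro always_eventually allI)
   fix n
   have "0 \<le> 1 / (p * \<gamma> m) * W m powr p" for m using p_gt \<gamma>(1)[of m] by simp
   then show "ereal (J (smeas_of (dens (f (r (r' n))))) (\<mu>n (r (r' n)))) \<le> ereal (J (smeas_of (dens (k (r (r' n))))) \<mu>')"
    using kJ[of "r (r' n)"] by (simp add: add_increasing2 order_trans[rotated])
  qed
  also have "\<dots> \<le> limsup (\<lambda>n. ereal (J (smeas_of (dens (k (r (r' n))))) \<mu>'))" by (rule Liminf_le_Limsup) simp
  also note usc
  finally show ?thesis by simp
 qed
 have "BK_solution J \<Omega> \<Omega> \<rho> cd \<mu>2 (smeas_of N, \<mu>)"
  unfolding BK_solution_def is_arg_min_linorder using kN best by auto
 moreover have "(\<lambda>n. W1_norm p U (\<lambda>z. cn (r n) z - cd z)) \<longlonglongrightarrow> 0"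
  using LIMSEQ_subseq_LIMSEQ[OF Wlim r] unfolding W_def by (simp add: o_def)
 ultimately show ?thesis using r w1 w2 unfolding f(2)[symmetric] by blast
qed

end

theorem theorem3p5:
 fixes \<Omega>1 \<Omega>2 :: "'a::euclidean_space set"
  and \<rho> p :: real
  and \<mu>2d :: "'a smeas"
  and cd :: "'a \<times> 'a \<Rightarrow> real"
  and J :: "('a \<times> 'a) smeas \<Rightarrow> 'a smeas \<Rightarrow> real"
  and h :: "'a \<Rightarrow> real"
  and \<gamma> \<delta> :: "nat \<Rightarrow> real"
  and \<pi>n cn :: "nat \<Rightarrow> 'a \<times> 'a \<Rightarrow> real"
  and \<mu>n :: "nat \<Rightarrow> 'a smeas"
 assumes "compact \<Omega>1" "interior \<Omega>1 \<noteq> {}" "compact \<Omega>2" "interior \<Omega>2 \<noteq> {}"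
  and "\<Omega>1 \<times> \<Omega>2 = closure (interior (\<Omega>1 \<times> \<Omega>2))" "lipschitz_boundary (\<Omega>1 \<times> \<Omega>2)"
  and "0 < \<rho>"
  and "\<mu>2d \<in> prob_measures \<Omega>2" "\<rho> \<le> setdist (supp \<mu>2d) (frontier \<Omega>2)"
  and "real (DIM('a) + DIM('a)) < p"
  and "sobolev_W1 p (interior (\<Omega>1 \<times> \<Omega>2)) cd" "continuous_on (\<Omega>1 \<times> \<Omega>2) cd"
  and "weak_star_lsc (\<Omega>1 \<times> \<Omega>2) \<Omega>1 J" "bounded_on_bounded (\<Omega>1 \<times> \<Omega>2) \<Omega>1 J"
  and "\<exists>\<pi> \<mu>1. BK_feasible \<Omega>1 \<Omega>2 \<rho> cd \<mu>2d (\<pi>, \<mu>1)"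
  and "\<Omega>1 = \<Omega>2"
  and "abs_cont_lebesgue \<Omega>2 \<mu>2d"
  and "\<forall>x1\<in>\<Omega>1. \<forall>x2\<in>\<Omega>2. cd (x1, x2) = h (x1 - x2)"
  and "strictly_convex h" "\<forall>\<xi>. h (- \<xi>) = h \<xi>"
  and "weak_star_usc_fst (\<Omega>1 \<times> \<Omega>2) \<Omega>1 J"
  and "\<forall>n. 0 < \<gamma> n" "decseq \<gamma>" "\<gamma> \<longlonglongrightarrow> 0"
  and "\<forall>n. 0 < \<delta> n \<and> \<delta> n \<le> \<rho>" "decseq \<delta>" "\<delta> \<longlonglongrightarrow> 0"
  and "(\<lambda>n. \<gamma> n / \<delta> n ^ (DIM('a) + DIM('a))) \<longlonglongrightarrow> 0"
  and "\<forall>n. BK_reg_solution J \<Omega>1 \<Omega>2 \<rho> p cd \<mu>2d (\<gamma> n) (\<delta> n) (\<pi>n n, \<mu>n n, cn n)"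
 shows "\<exists>(r :: nat \<Rightarrow> nat) \<pi> \<mu>1. strict_mono r \<and>
      BK_solution J \<Omega>1 \<Omega>2 \<rho> cd \<mu>2d (\<pi>, \<mu>1) \<and>
      weak_star_tendsto (\<Omega>1 \<times> \<Omega>2) (\<lambda>n. density_smeas (\<Omega>1 \<times> \<Omega>2) (\<pi>n (r n))) \<pi> \<and>
      weak_star_tendsto \<Omega>1 (\<lambda>n. \<mu>n (r n)) \<mu>1 \<and>
      (\<lambda>n. W1_norm p (interior (\<Omega>1 \<times> \<Omega>2)) (\<lambda>z. cn (r n) z - cd z)) \<longlonglongrightarrow> 0"
proof -
 define \<Omega> where "\<Omega> = \<Omega>1"
 have eq: "\<Omega>1 = \<Omega>" "\<Omega>2 = \<Omega>" using assms(16) unfolding \<Omega>_def by simp_all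
 note a = assms[unfolded eq]
 have X: "compact (\<Omega> \<times> \<Omega>)" by (intro compact_Times a)
 obtain C where C: "0 < C" "\<And>z. z \<in> \<Omega> \<times> \<Omega> \<Longrightarrow> norm (cd z) \<le> C"
  using compact_imp_bounded[OF compact_continuous_image[OF a(12) X]] unfolding bounded_pos by auto
 have cl: "closedin (top_of_set UNIV) (\<Omega> \<times> \<Omega>)" using compact_imp_closed[OF X] by simp
 obtain c where c: "continuous_on UNIV c" "\<And>z. z \<in> \<Omega> \<times> \<Omega> \<Longrightarrow> c z = cd z" "\<And>z. norm (c z) \<le> C"
  by (rule Tietze[OF a(12) cl less_imp_le[OF C(1)] C(2)]) auto
 have up: "\<mu>2d \<in> upper_level_set \<Omega> \<rho>" unfolding upper_level_set_def using a(8,9) by simp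
 have \<mu>s: "\<mu>2d \<in> signed_measures \<Omega>" "nonneg_smeas \<mu>2d" using a(8) unfolding prob_measures_def by auto
 have \<Omega>b: "\<Omega> \<in> sets borel" using a(1) by (simp add: borel_compact)
 note pp = pos_part_eq[OF \<mu>s \<Omega>b]
 have fn: "\<Omega> \<times> \<Omega> - interior (\<Omega> \<times> \<Omega>) \<in> null_sets lborel"
  using lipschitz_frontier_null[OF X a(6)] compact_imp_closed[OF X] unfolding frontier_def by (simp add: closure_closed)
 have ch: "c (x, y) = h (x - y)" if "x \<in> \<Omega>" "y \<in> \<Omega>" for x y using c(2)[of "(x, y)"] a(18) that by simp
 have cb: "\<bar>c z\<bar> \<le> C" for z using c(3)[of z] by simp
 interpret bilevel \<Omega> \<rho> \<mu>2d c C p cd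
 proof (intro bilevel.intro fixed_target.intro bilevel_axioms.intro)
  show "prob_space (pos_part \<mu>2d)" by (rule coupling_dictionary(4)[OF a(1) a(1) a(8) a(8)])
  show "AE x in pos_part \<mu>2d. x \<in> deep_set \<Omega> \<rho>" using up upper_level_iff[OF a(1,2) a(7)] by simp
 qed (use a(1,2,7,8,10,11) pp(1) c(1) cb c(2) fn in simp_all)
 have ac: "emeasure (pos_part \<mu>2d) S = 0" if S: "S \<in> null_sets lborel" for S
 proof -
  have Sb: "S \<in> sets borel" "S \<inter> \<Omega> \<in> sets borel" using S \<Omega>b by auto
  have "S \<inter> \<Omega> \<in> null_sets lborel" using S \<Omega>b by (intro null_set_Int2) auto
  then have "emeasure (lebesgue_on \<Omega>) (S \<inter> \<Omega>) = 0"
   using \<Omega>b Sb by (subst emeasure_restrict_space) (auto simp: emeasure_completion)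
  then have "\<mu>2d (S \<inter> \<Omega>) = 0" by (rule a(17)[unfolded abs_cont_lebesgue_def, rule_format, OF Sb(2) Int_lower2])
  then show ?thesis using pp(2)[OF Sb(1)] signed_measuresD(2)[OF \<mu>s(1) Sb(1)] by simp
 qed
 obtain \<pi>0 \<mu>0 where feas: "BK_feasible \<Omega> \<Omega> \<rho> cd \<mu>2d (\<pi>0, \<mu>0)" using a(15) by blast
 show ?thesis unfolding eq
 proof (rule solutions_converge[where \<gamma>=\<gamma> and \<delta>=\<delta>, OF a(13,21,14) feas])
  fix \<mu> M N assume \<mu>: "\<mu> \<in> upper_level_set \<Omega> \<rho>" and o: "optimal_coupling c M (pos_part \<mu>) (pos_part \<mu>2d)" "optimal_coupling c N (pos_part \<mu>) (pos_part \<mu>2d)"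
  show "M = N"
   by (rule optimal_coupling_unique[OF a(1) a(1) upperD(4)[OF \<mu>] deep_in[OF upperD(6)[OF \<mu>]] B(1) deep_in[OF B(3)] c(1) cb ch a(19) ac o])
 qed (use a(22,24,25,27,28,29) in blast)+
qed

end
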